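(* Let $(R,\mathfrak m,k)$ be a Noetherian local ring of positive dimension $d$ with infinite residue field. Let $M_1\subseteq F_1,\dots,M_q\subseteq F_q$ be $R$-submodules of finite colength in free $R$-modules $F_1,\dots,F_q$ of finite ranks $r_1,\dots,r_q\ge1$, and let $I_i=I(M_i)$ be the $0$th Fitting ideal of $F_i/M_i$. (a) Suppose $q=d$ and $M_i\subsetneq F_i$ for all $i$, and let $(B_1,\dots,B_d)$ be a joint reduction of $(M_1,\dots,M_d)$. Then each $\det(B_i)$ is part of a minimal generating set of $I_i$, and every minimal generating set of $B_i$ can be extended to a minimal generating set of $M_i$. (b) If $q\ge d$ and $R$ has positive depth, then there is a joint reduction $(B_1,\dots,B_q)$ of $(M_1,\dots,M_q)$ in which each $B_i$ is a free submodule of $F_i$.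
   Context: Finite colength of $M_i$ in $F_i$ means $F_i/M_i$ has finite length. $S(F)$ denotes the symmetric algebra of $F=F_1\oplus\cdots\oplus F_q$, $S_n(M_i)$ denotes the image in $S_n(F_i)$ of the $n$th symmetric power of $M_i$, and products of such modules are taken in $S(F)$. Joint reduction: submodules $B_i\subseteq M_i$ form a joint reduction $(B_1,\dots,B_q)$ of $(M_1,\dots,M_q)$ if each $B_i$ can be generated by $r_i=\operatorname{rank}F_i$ elements and, for some integer $n\ge0$, $$\prod_{j=1}^q S_{n+1}(M_j)=\sum_{i=1}^q B_i\,S_n(M_i)\prod_{j\ne i}S_{n+1}(M_j).$$ $\det(B_i)$ is the determinant of an $r_i\times r_i$ matrix whose columns express a system of $r_i$ generators of $B_i$ in terms of a basis of $F_i$ (well defined up to a unit). $I(M_i)$ is the ideal of $r_i\times r_i$ minors of a matrix whose columns express generators of $M_i$ in a basis of $F_i$. *)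

theory Defs
  imports
    "HOL-Library.Extended_Nat"
    "HOL-Library.Poly_Mapping"
    "Jordan_Normal_Form.Determinant"
    "Jordan_Normal_Form.DL_Submatrix"
begin

section \<open>Commutative rings\<close>

text \<open>
  A commutative ring is a type of class \<^class>\<open>comm_ring_1\<close>, regarded as a module over itself;
  its ideals are the submodules for the scalar multiplication \<^term>\<open>(*)\<close>. Submodules, spans and
  linear independence are those of \<^theory>\<open>HOL.Modules\<close>.
\<close>

abbreviation is_ideal :: "'a::comm_ring_1 set \<Rightarrow> bool" where
  "is_ideal \<equiv> module.subspace (*)"

abbreviation ideal_generated :: "'a::comm_ring_1 set \<Rightarrow> 'a set" where
  "ideal_generated \<equiv> module.span (*)"

definition is_noetherian :: "'a::comm_ring_1 itself \<Rightarrow> bool" where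
  "is_noetherian _ \<longleftrightarrow> (\<forall>I :: 'a set. is_ideal I \<longrightarrow> (\<exists>S. finite S \<and> ideal_generated S = I))"

definition is_maximal_ideal :: "'a::comm_ring_1 set \<Rightarrow> bool" where
  "is_maximal_ideal I \<longleftrightarrow>
     is_ideal I \<and> I \<noteq> UNIV \<and> (\<forall>J. is_ideal J \<longrightarrow> I \<subseteq> J \<longrightarrow> J = I \<or> J = UNIV)"

definition is_prime_ideal :: "'a::comm_ring_1 set \<Rightarrow> bool" where
  "is_prime_ideal P \<longleftrightarrow>
     is_ideal P \<and> P \<noteq> UNIV \<and> (\<forall>a b. a * b \<in> P \<longrightarrow> a \<in> P \<or> b \<in> P)"

definition is_noetherian_local :: "'a::comm_ring_1 set \<Rightarrow> bool" where
  "is_noetherian_local \<mm> \<longleftrightarrow>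
     is_noetherian TYPE('a) \<and> is_maximal_ideal \<mm> \<and> (\<forall>J. is_maximal_ideal J \<longrightarrow> J = \<mm>)"

definition residue_classes :: "'a::comm_ring_1 set \<Rightarrow> 'a set set" where
  "residue_classes I = UNIV // {(x, y). x - y \<in> I}"

definition krull_dim :: "'a::comm_ring_1 itself \<Rightarrow> enat" where
  "krull_dim _ = Sup {enat n | n. \<exists>P :: nat \<Rightarrow> 'a set.
     (\<forall>k\<le>n. is_prime_ideal (P k)) \<and> (\<forall>k<n. P k \<subset> P (Suc k))}"

definition is_regular_sequence :: "'a::comm_ring_1 list \<Rightarrow> bool" where
  "is_regular_sequence xs \<longleftrightarrow>
     (\<forall>k<length xs. \<forall>a. xs ! k * a \<in> ideal_generated (set (take k xs))
        \<longrightarrow> a \<in> ideal_generated (set (take k xs))) \<and>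
     ideal_generated (set xs) \<noteq> UNIV"

text \<open>The depth of a local ring, given through its maximal ideal.\<close>

definition depth :: "'a::comm_ring_1 set \<Rightarrow> enat" where
  "depth \<mm> = Sup {enat (length xs) | xs. set xs \<subseteq> \<mm> \<and> is_regular_sequence xs}"


section \<open>Modules\<close>

definition is_basis :: "('a::comm_ring_1 \<Rightarrow> 'b::ab_group_add \<Rightarrow> 'b) \<Rightarrow> 'b list \<Rightarrow> 'b set \<Rightarrow> bool" where
  "is_basis scale e F \<longleftrightarrow>
     distinct e \<and> \<not> module.dependent scale (set e) \<and> module.span scale (set e) = F"

text \<open>
  The length of \<open>F / M\<close>: chains of submodules of the quotient are written as chains of
  submodules between \<open>M\<close> and \<open>F\<close>.
\<close>

definition colength :: "('a::comm_ring_1 \<Rightarrow> 'b::ab_group_add \<Rightarrow> 'b) \<Rightarrow> 'b set \<Rightarrow> 'b set \<Rightarrow> enat" where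
  "colength scale F M = Sup {enat n | n. \<exists>N :: nat \<Rightarrow> 'b set.
     (\<forall>k\<le>n. module.subspace scale (N k) \<and> M \<subseteq> N k \<and> N k \<subseteq> F) \<and> (\<forall>k<n. N k \<subset> N (Suc k))}"

definition is_min_generating_set ::
    "('a::comm_ring_1 \<Rightarrow> 'b::ab_group_add \<Rightarrow> 'b) \<Rightarrow> 'b set \<Rightarrow> 'b set \<Rightarrow> bool" where
  "is_min_generating_set scale N S \<longleftrightarrow>
     module.span scale S = N \<and> (\<forall>T. T \<subset> S \<longrightarrow> module.span scale T \<noteq> N)"

text \<open>The matrix whose columns are the coordinates of the vectors \<open>bs\<close> in the ordered basis \<open>e\<close>.\<close>

definition coord_mat ::
    "('a::comm_ring_1 \<Rightarrow> 'b::ab_group_add \<Rightarrow> 'b) \<Rightarrow> 'b list \<Rightarrow> 'b list \<Rightarrow> 'a mat" where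
  "coord_mat scale e bs =
     mat (length e) (length bs) (\<lambda>(k, l). module.representation scale (set e) (bs ! l) (e ! k))"

definition maximal_minors_ideal :: "'a::comm_ring_1 mat \<Rightarrow> 'a set" where
  "maximal_minors_ideal A =
     ideal_generated {det (submatrix A UNIV J) | J. J \<subseteq> {..<dim_col A} \<and> card J = dim_row A}"


section \<open>The symmetric algebra and joint reductions\<close>

text \<open>
  Let \<open>e i\<close> be an ordered basis of \<open>F i\<close> for \<open>i < q\<close>. The symmetric algebra of the free module
  \<open>F = F 0 \<oplus> \<dots> \<oplus> F (q - 1)\<close> is the polynomial ring on the basis of \<open>F\<close> formed by all \<open>e i ! k\<close>;
  this basis vector is the variable with index \<open>(i, k)\<close>. The direct sum is external: the \<open>F i\<close> may
  overlap, or coincide, as subsets of the type \<open>'b\<close>. The type contains polynomials in further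
  variables, which occur in none of the submodules below.
\<close>

type_synonym 'a sym_alg = "((nat \<times> nat) \<Rightarrow>\<^sub>0 nat) \<Rightarrow>\<^sub>0 'a"

definition sym_scale :: "'a::comm_ring_1 \<Rightarrow> 'a sym_alg \<Rightarrow> 'a sym_alg" where
  "sym_scale c p = Poly_Mapping.single 0 c * p"

abbreviation sym_span :: "'a::comm_ring_1 sym_alg set \<Rightarrow> 'a sym_alg set" where
  "sym_span \<equiv> module.span sym_scale"

text \<open>The canonical map from \<open>F i\<close> to the degree one part of the symmetric algebra.\<close>

definition lin_form ::
    "('a::comm_ring_1 \<Rightarrow> 'b::ab_group_add \<Rightarrow> 'b) \<Rightarrow> (nat \<Rightarrow> 'b list) \<Rightarrow> nat \<Rightarrow> 'b \<Rightarrow> 'a sym_alg" where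
  "lin_form scale e i v =
     (\<Sum>k<length (e i). Poly_Mapping.single (Poly_Mapping.single (i, k) 1)
        (module.representation scale (set (e i)) v (e i ! k)))"

definition sym_power_image ::
    "('a::comm_ring_1 \<Rightarrow> 'b::ab_group_add \<Rightarrow> 'b) \<Rightarrow> (nat \<Rightarrow> 'b list) \<Rightarrow> nat \<Rightarrow> nat \<Rightarrow> 'b set
      \<Rightarrow> 'a sym_alg set" where
  "sym_power_image scale e i n M =
     sym_span {(\<Prod>k<n. lin_form scale e i (v k)) | v. \<forall>k<n. v k \<in> M}"

definition sym_mult ::
    "'a::comm_ring_1 sym_alg set \<Rightarrow> 'a sym_alg set \<Rightarrow> 'a sym_alg set" where
  "sym_mult U V = sym_span {u * v | u v. u \<in> U \<and> v \<in> V}"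

definition sym_prod :: "(nat \<Rightarrow> 'a::comm_ring_1 sym_alg set) \<Rightarrow> nat set \<Rightarrow> 'a sym_alg set" where
  "sym_prod U J = sym_span {(\<Prod>j\<in>J. u j) | u. \<forall>j\<in>J. u j \<in> U j}"

text \<open>The sum of the submodules in the last line is the span of their union.\<close>

definition is_joint_reduction ::
    "('a::comm_ring_1 \<Rightarrow> 'b::ab_group_add \<Rightarrow> 'b) \<Rightarrow> (nat \<Rightarrow> 'b list) \<Rightarrow> nat
      \<Rightarrow> (nat \<Rightarrow> 'b set) \<Rightarrow> (nat \<Rightarrow> 'b set) \<Rightarrow> bool" where
  "is_joint_reduction scale e q M B \<longleftrightarrow>
     (\<forall>i<q. module.subspace scale (B i) \<and> B i \<subseteq> M i \<and>
        (\<exists>bs. length bs = length (e i) \<and> module.span scale (set bs) = B i)) \<and>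
     (\<exists>n. sym_prod (\<lambda>j. sym_power_image scale e j (n + 1) (M j)) {..<q} =
        sym_span (\<Union>i<q.
          sym_mult (lin_form scale e i ` B i)
            (sym_mult (sym_power_image scale e i n (M i))
              (sym_prod (\<lambda>j. sym_power_image scale e j (n + 1) (M j)) ({..<q} - {i})))))"

end

theory Submission
  imports Defs
    "HOL-Computational_Algebra.Polynomial"
    "HOL-Library.FuncSet"
begin

text \<open>
  (a) Suppose that \<open>\<delta> = det (B i)\<close> lies in \<open>\<mm> I\<close> for the ideal \<open>I\<close> of \<open>M i\<close>. By Krull's height theorem the
  determinants of the other \<open>q - 1\<close> modules \<open>B j\<close> lie in a prime ideal \<open>Q \<noteq> \<mm>\<close>. Modulo \<open>Q\<close>, each of these \<open>B j\<close> is
  killed by a linear functional on \<open>F j\<close> which does not kill \<open>M j\<close>, and evaluating the symmetric algebra at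
  these functionals turns the joint reduction into a statement about \<open>B i\<close> alone. If \<open>\<delta> \<in> Q\<close>, then \<open>B i\<close> is
  killed as well, which is absurd. Otherwise take as functionals on \<open>F i\<close> the rows of the adjugate of \<open>B i\<close>;
  with the hypothesis on \<open>\<delta>\<close> the resulting relations contradict Nakayama's lemma. If a minimal generating set
  of \<open>B i\<close> were dependent modulo \<open>\<mm> M i\<close>, then some choice of generators would have its determinant in \<open>\<mm> I\<close>.

  (b) In the Rees algebra \<open>R\<close> of the family, choose successively \<open>r i\<close> elements of each \<open>M i\<close> which are filter-regular
  modulo the preceding ones and \<open>\<mm> R\<close>. If they generated no ideal containing high powers modulo \<open>\<mm> R\<close>, the
  lengths of the multigraded pieces of \<open>R / \<mm> R\<close> would grow at least like a polynomial of degree \<open>\<Sum>i<q. r i\<close>.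
  Artin-Rees for a regular element of \<open>\<mm>\<close> and a system of parameters bounds the degree of growth by
  \<open>(\<Sum>i<q. r i - 1) + d - 1\<close>, which is smaller as \<open>d \<le> q\<close>. So the chosen elements generate a joint reduction, and this
  remains true when they are changed modulo \<open>\<mm> M i\<close>; this freedom makes the determinants regular, hence the
  \<open>B i\<close> free.
\<close>

section \<open>Lengths of modules\<close>

text \<open>In (a), evaluation keeps enough information because \<open>M i\<close> contains a power
  of \<open>\<mm>\<close> times \<open>F i\<close>: a functional that is nonzero modulo
  \<open>Q\<close> cannot kill it when \<open>Q\<close> is not \<open>\<mm>\<close>. The adjugate
  enters because each of its rows sends all of \<open>B i\<close> into the ideal of \<delta>, while
  the determinant of adjugate times matrix is \<delta>^r. So \<delta> in \<open>\<mm>\<close> I puts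
  \<delta>^r into \<open>\<mm>\<close> times the ideal generated by products of values of the rows
  on \<open>M i\<close>. In (b) the difficulty is a sharp upper bound for lengths. In multidegree
  (n,...,n) there are about n^(sum of r i - 1) monomials; for each of them a layer J^t/J^(t+1), with
  t linear in n and J generated by d elements, contributes about n^(d-1). Artin-Rees is what makes
  the number of layers independent of n. Lengths are suprema of chains of submodules, and growth is
  compared through explicit binomial and power inequalities instead of Hilbert polynomials. The
  infinite residue field serves to avoid finitely many proper submodules at once.\<close>

lemma enat_add_leI:
  assumes "\<And>a b. enat a \<le> x \<Longrightarrow> enat b \<le> y \<Longrightarrow> enat (a + b) \<le> z"
  shows "x + y \<le> z"
proof (cases z)
  case (enat c)
  \<comment> \<open>Were \<open>x\<close> infinite, the pair \<open>Suc c\<close>, 0 would satisfy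
    the premises and give \<open>Suc c\<close> \<le> \<open>c\<close>; likewise for
    \<open>y\<close>.\<close>
  have "x \<noteq> \<infinity>"
    using assms[of "Suc c" 0] enat by (metis add_0_right enat_ord_code(3) enat_ord_simps(1) i0_lb not_less_eq_eq order_refl zero_enat_def)
  moreover have "y \<noteq> \<infinity>"
    using assms[of 0 "Suc c"] enat by (metis add_0_left enat_ord_code(3) enat_ord_simps(1) i0_lb not_less_eq_eq order_refl zero_enat_def)
  ultimately show ?thesis
    using assms by auto
qed auto

definition submodule_chain ::
    "('a::comm_ring_1 \<Rightarrow> 'b::ab_group_add \<Rightarrow> 'b) \<Rightarrow> 'b set \<Rightarrow> 'b set \<Rightarrow> nat \<Rightarrow> (nat \<Rightarrow> 'b set) \<Rightarrow> bool" where
  "submodule_chain scale V U n N \<longleftrightarrow>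
     (\<forall>k\<le>n. module.subspace scale (N k) \<and> U \<subseteq> N k \<and> N k \<subseteq> V) \<and> (\<forall>k<n. N k \<subset> N (Suc k))"

context Modules.module
begin

lemma colength_eq: "colength scale V U = Sup {enat n | n. \<exists>N. submodule_chain scale V U n N}"
  by (simp add: colength_def submodule_chain_def)

lemma colength_ge: "submodule_chain scale V U n N \<Longrightarrow> enat n \<le> colength scale V U"
  unfolding colength_eq by (rule Sup_upper) auto

lemma colength_leI:
  "(\<And>n N. submodule_chain scale V U n N \<Longrightarrow> enat n \<le> c) \<Longrightarrow> colength scale V U \<le> c"
  unfolding colength_eq by (rule Sup_least) auto

text \<open>A supremum in \<open>enat\<close> need not be attained, but the predecessor of
  \<open>n\<close> lies strictly below it, so some chain has at least \<open>n\<close> steps and can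
  be truncated to exactly \<open>n\<close>.\<close>

lemma submodule_chain_exists:
  assumes "subspace U" "U \<subseteq> V" "enat n \<le> colength scale V U"
  obtains N where "submodule_chain scale V U n N"
proof (cases n)
  case 0
  have "submodule_chain scale V U 0 (\<lambda>_. U)"
    using assms by (auto simp: submodule_chain_def)
  then show ?thesis using that 0 by blast
next
  case (Suc n')
  have "enat n' < colength scale V U"
    using assms(3) Suc by (simp add: Suc_ile_eq)
  then obtain m N where mN: "enat n' < enat m" "submodule_chain scale V U m N"
    unfolding colength_eq less_Sup_iff by blast
  then have "n \<le> m" using Suc by simp
  then have "submodule_chain scale V U n N"
    using mN(2) unfolding submodule_chain_def by (meson le_trans less_le_trans)
  then show ?thesis by (rule that)
qed

lemma colength_mono:
  "U' \<subseteq> U \<Longrightarrow> V \<subseteq> V' \<Longrightarrow> colength scale V U \<le> colength scale V' U'"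
proof (rule colength_leI, rule colength_ge)
  fix n N assume "U' \<subseteq> U" "V \<subseteq> V'" "submodule_chain scale V U n N"
  then show "submodule_chain scale V' U' n N"
    unfolding submodule_chain_def by (meson subset_trans)
qed

text \<open>Deleting the repetitions of a weakly ascending chain leaves one strict step for each
  proper inclusion. The induction also records that the strict chain ends in \<open>N n\<close>,
  since the next term is attached there.\<close>

lemma weak_chain_colength:
  assumes "\<And>k. k \<le> n \<Longrightarrow> subspace (N k) \<and> U \<subseteq> N k \<and> N k \<subseteq> V"
    and "\<And>k. k < n \<Longrightarrow> N k \<subseteq> N (Suc k)"
  shows "enat (card {k. k < n \<and> N k \<noteq> N (Suc k)}) \<le> colength scale V U"
proof -
  have "\<exists>N'. submodule_chain scale V U (card {k. k < n \<and> N k \<noteq> N (Suc k)}) N' \<and>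
      N' (card {k. k < n \<and> N k \<noteq> N (Suc k)}) = N n"
    using assms
  proof (induction n)
    case 0
    then show ?case by (intro exI[of _ N]) (auto simp: submodule_chain_def)
  next
    case (Suc n)
    let ?c = "card {k. k < n \<and> N k \<noteq> N (Suc k)}"
    have "\<exists>N'. submodule_chain scale V U ?c N' \<and> N' ?c = N n"
      by (rule Suc.IH) (use Suc.prems in auto)
    then obtain N' where N': "submodule_chain scale V U ?c N'" "N' ?c = N n" by blast
    show ?case
    proof (cases "N n = N (Suc n)")
      case True
      then have "{k. k < Suc n \<and> N k \<noteq> N (Suc k)} = {k. k < n \<and> N k \<noteq> N (Suc k)}"
        by (auto simp: less_Suc_eq)
      then show ?thesis using N' True by auto
    next
      case False
      then have "{k. k < Suc n \<and> N k \<noteq> N (Suc k)} = insert n {k. k < n \<and> N k \<noteq> N (Suc k)}"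
        by (auto simp: less_Suc_eq)
      then have c: "card {k. k < Suc n \<and> N k \<noteq> N (Suc k)} = Suc ?c"
        by simp
      have "N n \<subset> N (Suc n)" using False Suc.prems(2)[of n] by auto
      then have "submodule_chain scale V U (Suc ?c) (N'(Suc ?c := N (Suc n)))"
        using N' Suc.prems(1)[of "Suc n"] unfolding submodule_chain_def
        by (simp add: le_Suc_eq less_Suc_eq)
      moreover have "(N'(Suc ?c := N (Suc n))) (Suc ?c) = N (Suc n)" by simp
      ultimately show ?thesis unfolding c by blast
    qed
  qed
  then show ?thesis using colength_ge by blast
qed

lemma subspace_sum_set: "subspace A \<Longrightarrow> subspace B \<Longrightarrow> subspace {x + y | x y. x \<in> A \<and> y \<in> B}"
  using subspace_span[of "A \<union> B"] by (simp add: span_Un span_eq_iff[THEN iffD2])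

text \<open>By the modular law, every strict step of a chain is strict after intersecting with \<open>W\<close> or
  after adding \<open>W\<close>.\<close>
lemma colength_additive:
  assumes W: "subspace W" and U: "subspace U" "U \<subseteq> W" and "W \<subseteq> V" "subspace V"
  shows "colength scale V U = colength scale V W + colength scale W U"
proof (rule antisym)
  show "colength scale V U \<le> colength scale V W + colength scale W U"
  proof (rule colength_leI)
    fix n N assume ch: "submodule_chain scale V U n N"
    let ?P = "\<lambda>k. {x + y | x y. x \<in> N k \<and> y \<in> W}" and ?I = "\<lambda>k. N k \<inter> W"
    have N: "subspace (N k)" "U \<subseteq> N k" "N k \<subseteq> V" if "k \<le> n" for k
      using ch that by (auto simp: submodule_chain_def)
    have NS: "N k \<subset> N (Suc k)" if "k < n" for k
      using ch that by (auto simp: submodule_chain_def)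
    have 1: "enat (card {k. k < n \<and> ?P k \<noteq> ?P (Suc k)}) \<le> colength scale V W"
    proof (rule weak_chain_colength)
      fix k assume k: "k \<le> n"
      have "W \<subseteq> ?P k"
      proof
        fix y assume "y \<in> W"
        then have "y = 0 + y" "0 \<in> N k" using subspace_0[OF N(1)[OF k]] by auto
        then show "y \<in> ?P k" using \<open>y \<in> W\<close> by blast
      qed
      moreover have "?P k \<subseteq> V" using N(3)[OF k] assms(4) subspace_add[OF assms(5)] by blast
      ultimately show "subspace (?P k) \<and> W \<subseteq> ?P k \<and> ?P k \<subseteq> V"
        using subspace_sum_set[OF N(1)[OF k] W] by auto
    next
      fix k assume "k < n"
      then show "?P k \<subseteq> ?P (Suc k)" using NS by blast
    qed
    have 2: "enat (card {k. k < n \<and> ?I k \<noteq> ?I (Suc k)}) \<le> colength scale W U"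
    proof (rule weak_chain_colength)
      fix k assume k: "k \<le> n"
      show "subspace (N k \<inter> W) \<and> U \<subseteq> N k \<inter> W \<and> N k \<inter> W \<subseteq> W"
        using subspace_inter[OF N(1)[OF k] W] N(2)[OF k] U(2) by blast
    next
      fix k assume "k < n"
      then show "N k \<inter> W \<subseteq> N (Suc k) \<inter> W" using NS[of k] by blast
    qed
    have "{..<n} \<subseteq> {k. k < n \<and> ?P k \<noteq> ?P (Suc k)} \<union> {k. k < n \<and> ?I k \<noteq> ?I (Suc k)}"
    proof (rule ccontr)
      assume "\<not> ?thesis"
      then obtain k where k: "k < n" "?P k = ?P (Suc k)" "?I k = ?I (Suc k)" by blast
      have "N (Suc k) \<subseteq> N k"
      proof
        fix z assume z: "z \<in> N (Suc k)"
        then have "z + 0 \<in> ?P (Suc k)" using subspace_0[OF W] by blast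
        then have "z \<in> ?P (Suc k)" by simp
        then obtain x y where xy: "z = x + y" "x \<in> N k" "y \<in> W" unfolding k(2)[symmetric] by blast
        have "x \<in> N (Suc k)" using xy(2) NS[OF k(1)] by blast
        then have "z - x \<in> N (Suc k)" using subspace_diff[OF N(1)[of "Suc k"] z] k(1) by simp
        then have "y \<in> ?I k" unfolding k(3) using xy by simp
        then show "z \<in> N k" using xy N(1)[of k] k(1) subspace_add by simp
      qed
      then show False using NS[OF k(1)] by blast
    qed
    from card_mono[OF _ this]
    have "n \<le> card ({k. k < n \<and> ?P k \<noteq> ?P (Suc k)} \<union> {k. k < n \<and> ?I k \<noteq> ?I (Suc k)})"
      by simp
    also have "\<dots> \<le> card {k. k < n \<and> ?P k \<noteq> ?P (Suc k)} + card {k. k < n \<and> ?I k \<noteq> ?I (Suc k)}"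
      by (rule card_Un_le)
    finally have "enat n \<le> enat (card {k. k < n \<and> ?P k \<noteq> ?P (Suc k)}) +
        enat (card {k. k < n \<and> ?I k \<noteq> ?I (Suc k)})"
      by simp
    also have "\<dots> \<le> colength scale V W + colength scale W U"
      using 1 2 by (rule add_mono)
    finally show "enat n \<le> colength scale V W + colength scale W U" .
  qed
next
  show "colength scale V W + colength scale W U \<le> colength scale V U"
  proof (rule enat_add_leI)
    fix a b assume ab: "enat a \<le> colength scale V W" "enat b \<le> colength scale W U"
    obtain N2 where N2: "submodule_chain scale V W a N2"
      using submodule_chain_exists[OF W \<open>W \<subseteq> V\<close> ab(1)] .
    obtain N1 where N1: "submodule_chain scale W U b N1"
      using submodule_chain_exists[OF U ab(2)] .
    \<comment> \<open>The chain below \<open>W\<close> is followed by the one above \<open>W\<close>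
      without its term \<open>N2 0\<close>. At the junction \<open>N1 b\<close> \<subseteq>
      \<open>W\<close> \<subseteq> \<open>N2 0\<close> \<subset> \<open>N2 1\<close>, so exactly
      \<open>a + b\<close> strict steps remain.\<close>
    define N where "N k = (if k \<le> b then N1 k else N2 (k - b))" for k
    have "N k \<subset> N (Suc k)" if "k < a + b" for k
    proof -
      consider "k < b" | "k = b" | "k > b" by linarith
      then show ?thesis
      proof cases
        case 2
        then have "a > 0" using that by simp
        then have "N1 b \<subseteq> W" "W \<subseteq> N2 0" "N2 0 \<subset> N2 (Suc 0)"
          using N1 N2 unfolding submodule_chain_def by simp_all
        then have "N1 b \<subset> N2 (Suc 0)" by (meson subset_psubset_trans)
        then show ?thesis using 2 by (simp add: N_def)
      qed (use that N1 N2 in \<open>auto simp: N_def submodule_chain_def Suc_diff_le\<close>)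
    qed
    moreover have "subspace (N k) \<and> U \<subseteq> N k \<and> N k \<subseteq> V" if "k \<le> a + b" for k
    proof (cases "k \<le> b")
      case True
      then show ?thesis using N1 \<open>W \<subseteq> V\<close> by (auto simp: N_def submodule_chain_def)
    next
      case False
      then have "subspace (N2 (k - b)) \<and> W \<subseteq> N2 (k - b) \<and> N2 (k - b) \<subseteq> V"
        using N2 that unfolding submodule_chain_def by simp
      then show ?thesis using False \<open>U \<subseteq> W\<close> by (simp add: N_def subset_trans[of U W])
    qed
    ultimately have "submodule_chain scale V U (a + b) N"
      unfolding submodule_chain_def by blast
    then show "enat (a + b) \<le> colength scale V U" by (rule colength_ge)
  qed
qed

lemma colength_pos:
  assumes "subspace U" "subspace V" "U \<subset> V"
  shows "1 \<le> colength scale V U"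
proof -
  have "submodule_chain scale V U 1 (\<lambda>k. if k = 0 then U else V)"
    using assms by (auto simp: submodule_chain_def)
  then show ?thesis using colength_ge by (fastforce simp: one_enat_def)
qed

lemma colength_self: "colength scale V V = 0"
proof -
  have "colength scale V V \<le> 0"
  proof (rule colength_leI)
    fix n N assume "submodule_chain scale V V n N"
    then show "enat n \<le> 0"
      unfolding submodule_chain_def
      by (metis gr0I i0_lb less_eq_nat.simps(1) psubsetE subset_antisym Suc_leI zero_enat_def order_refl)
  qed
  then show ?thesis by simp
qed

text \<open>Among the finite subsets \<open>S\<close> of \<open>V\<close> one can maximise the
  length of \<open>span (U \<union> S)\<close> over \<open>U\<close>, as these lengths are bounded
  by that of \<open>V\<close>. A vector of \<open>V\<close> outside the span would raise the maximum
  by at least one.\<close>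

lemma span_finite_or_colength:
  assumes "subspace U" "subspace V" "U \<subseteq> V" "colength scale V U < \<infinity>"
  obtains S where "finite S" "S \<subseteq> V" "V = span (U \<union> S)"
proof -
  let ?X = "{n. \<exists>S. finite S \<and> S \<subseteq> V \<and> colength scale (span (U \<union> S)) U = enat n}"
  obtain c where c: "colength scale V U = enat c" using assms(4) by (cases "colength scale V U") auto
  have sub: "span (U \<union> S) \<subseteq> V" if "S \<subseteq> V" for S
    using that assms span_minimal by blast
  have le: "colength scale (span (U \<union> S)) U \<le> enat c" if "S \<subseteq> V" for S
    using colength_mono[OF order_refl sub[OF that], of U] c by simp
  have bd: "n \<le> c" if n: "n \<in> ?X" for n
  proof -
    obtain S where "S \<subseteq> V" "colength scale (span (U \<union> S)) U = enat n"
      using n by blast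
    then show ?thesis using le[of S] by simp
  qed
  have "colength scale (span (U \<union> {})) U = enat 0"
    using assms(1) colength_self[of U] by (simp add: zero_enat_def span_eq_iff[THEN iffD2])
  then have ne: "0 \<in> ?X" by blast
  have "finite ?X" using bd by (meson finite_nat_set_iff_bounded_le)
  then have "Max ?X \<in> ?X" using ne Max_in by blast
  then obtain S where S: "finite S" "S \<subseteq> V" "colength scale (span (U \<union> S)) U = enat (Max ?X)" by blast
  have "V \<subseteq> span (U \<union> S)"
  proof (rule ccontr)
    assume "\<not> ?thesis"
    then obtain v where v: "v \<in> V" "v \<notin> span (U \<union> S)" by blast
    let ?S = "insert v S"
    have "span (U \<union> S) \<subset> span (U \<union> ?S)"
      using v(2) span_mono[of "U \<union> S" "U \<union> ?S"] span_base[of v "U \<union> ?S"] by auto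
    then have "1 \<le> colength scale (span (U \<union> ?S)) (span (U \<union> S))"
      by (intro colength_pos) auto
    then have "1 + colength scale (span (U \<union> S)) U \<le> colength scale (span (U \<union> ?S)) U"
      using colength_additive[of "span (U \<union> S)" U "span (U \<union> ?S)"] assms(1)
        span_mono[of "U \<union> S" "U \<union> ?S"] span_superset[of "U \<union> S"]
      by (simp add: subset_insertI add_right_mono subset_insertI2)
    moreover obtain k where k: "colength scale (span (U \<union> ?S)) U = enat k"
      using le[of ?S] v S by (metis enat_ile insert_subset)
    ultimately have "Suc (Max ?X) \<le> k" using S(3) by (simp add: one_enat_def)
    moreover have "k \<in> ?X" using k v S by blast
    ultimately show False using Max_ge[OF \<open>finite ?X\<close>, of k] by simp
  qed
  then show ?thesis using that S sub by blast
qed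

end

text \<open>For a linear map \<open>f\<close>, the quotient of \<open>V\<close> by the preimage of \<open>W\<close> embeds into \<open>V' / W\<close>.\<close>
lemma colength_preimage_le:
  assumes f: "module_hom s1 s2 f"
    and V: "module.subspace s1 V" and W: "module.subspace s2 W"
    and "f ` V \<subseteq> V'" "W \<subseteq> V'" and V': "module.subspace s2 V'"
  shows "colength s1 V {v \<in> V. f v \<in> W} \<le> colength s2 V' W"
proof -
  interpret module_hom s1 s2 f by fact
  let ?K = "{v \<in> V. f v \<in> W}"
  show ?thesis
  proof (rule m1.colength_leI, rule m2.colength_ge)
    fix n N assume "submodule_chain s1 V ?K n N"
    note ch = this
    have N: "m1.subspace (N k)" "?K \<subseteq> N k" "N k \<subseteq> V" if "k \<le> n" for k
      using ch that by (auto simp: submodule_chain_def)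
    have NS: "N k \<subset> N (Suc k)" if "k < n" for k
      using ch that by (auto simp: submodule_chain_def)
    \<comment> \<open>\<open>W\<close> is added to the images to obtain submodules above
      \<open>W\<close>. Strictness persists: if \<open>f z\<close> = \<open>f x\<close> +
      \<open>y\<close> with \<open>y\<close> in \<open>W\<close>, then \<open>z - x\<close> lies in
      the preimage of \<open>W\<close>, which every \<open>N k\<close> contains.\<close>
    let ?P = "\<lambda>k. {x + y | x y. x \<in> f ` N k \<and> y \<in> W}"
    have P: "m2.subspace (?P k) \<and> W \<subseteq> ?P k \<and> ?P k \<subseteq> V'" if "k \<le> n" for k
    proof -
      have "m2.subspace (f ` N k)" using N(1)[OF that] subspace_image by blast
      then have "m2.subspace (?P k)" using W m2.subspace_sum_set by blast
      moreover have "W \<subseteq> ?P k"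
      proof
        fix y assume "y \<in> W"
        then have "0 + y \<in> ?P k" using m2.subspace_0[OF \<open>m2.subspace (f ` N k)\<close>] by blast
        then show "y \<in> ?P k" by simp
      qed
      moreover have "?P k \<subseteq> V'"
        using N(3)[OF that] assms(4,5) m2.subspace_add[OF V'] by blast
      ultimately show ?thesis by blast
    qed
    have "?P k \<subset> ?P (Suc k)" if k: "k < n" for k
    proof -
      have "?P k \<subseteq> ?P (Suc k)" using NS[OF k] by blast
      moreover obtain z where z: "z \<in> N (Suc k)" "z \<notin> N k" using NS[OF k] by blast
      have "f z + 0 \<in> ?P (Suc k)" using z m2.subspace_0[OF W] by blast
      then have "f z \<in> ?P (Suc k)" by simp
      moreover have "f z \<notin> ?P k"
      proof
        assume "f z \<in> ?P k"
        then obtain x y where xy: "f z = f x + y" "x \<in> N k" "y \<in> W" by blast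
        then have "f (z - x) \<in> W" by (simp add: diff)
        moreover have "z - x \<in> V"
          using z xy N(3)[of "Suc k"] N(3)[of k] k m1.subspace_diff[OF V] by auto
        ultimately have "z - x \<in> N k" using N(2)[of k] k by auto
        then have "(z - x) + x \<in> N k" using N(1)[of k] k xy(2) m1.subspace_add by (meson less_imp_le)
        then show False using z by simp
      qed
      ultimately show ?thesis by blast
    qed
    then show "submodule_chain s2 V' W n ?P"
      using P unfolding submodule_chain_def by blast
  qed
qed

interpretation ring_module: Modules.module "(*) :: 'a::comm_ring_1 \<Rightarrow> 'a \<Rightarrow> 'a"
  by standard (auto simp: algebra_simps)

declare ring_module.scale_scale [simp del]

context Modules.module
begin

text \<open>The quotient of \<open>U\<close> + R t by \<open>U\<close> is cyclic and killed by
  \<open>J\<close>. A submodule in between is recovered from the ideal of all \<open>c\<close> with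
  \<open>c *s t\<close> in it, because each of its elements differs from a multiple of
  \<open>t\<close> by an element of \<open>U\<close>.\<close>

lemma colength_insert_le:
  assumes "subspace U" "is_ideal J" "\<And>c. c \<in> J \<Longrightarrow> c *s t \<in> U"
  shows "colength scale (span (insert t U)) U \<le> colength (*) UNIV J"
proof (rule colength_leI)
  fix n N assume "submodule_chain scale (span (insert t U)) U n N"
  note ch = this
  have N: "subspace (N k)" "U \<subseteq> N k" "N k \<subseteq> span (insert t U)" if "k \<le> n" for k
    using ch that by (auto simp: submodule_chain_def)
  have NS: "N k \<subset> N (Suc k)" if "k < n" for k
    using ch that by (auto simp: submodule_chain_def)
  let ?Q = "\<lambda>k. {c. c *s t \<in> N k}"
  have "submodule_chain (*) UNIV J n ?Q"
    unfolding submodule_chain_def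
  proof (intro conjI allI impI)
    fix k assume k: "k \<le> n"
    show "is_ideal (?Q k)"
      using N(1)[OF k]
      by (auto simp: ring_module.subspace_def subspace_0 scale_left_distrib subspace_add
          simp flip: scale_scale intro: subspace_scale)
    show "J \<subseteq> ?Q k" using assms(3) N(2)[OF k] by blast
  next
    fix k assume k: "k < n"
    obtain z where z: "z \<in> N (Suc k)" "z \<notin> N k" using NS[OF k] by blast
    then obtain c where "z - c *s t \<in> span U"
      using N(3)[of "Suc k"] k span_breakdown_eq[of z t U] by auto
    then have c: "z - c *s t \<in> U" using span_minimal[OF order_refl assms(1)] by blast
    have "z - (z - c *s t) \<in> N (Suc k)"
      using z c N(2)[of "Suc k"] N(1)[of "Suc k"] k subspace_diff
      by (meson Suc_leI subsetD)
    moreover have "c *s t \<notin> N k"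
    proof
      assume "c *s t \<in> N k"
      then have "(z - c *s t) + c *s t \<in> N k"
        using c N(2)[of k] N(1)[of k] k subspace_add by (meson less_imp_le subsetD)
      then show False using z by simp
    qed
    ultimately show "?Q k \<subset> ?Q (Suc k)" using NS[OF k] by auto
  qed auto
  then show "enat n \<le> colength (*) UNIV J" by (rule ring_module.colength_ge)
qed

lemma colength_span_le:
  assumes "subspace U" "finite T" "is_ideal J" "\<And>c t. c \<in> J \<Longrightarrow> t \<in> T \<Longrightarrow> c *s t \<in> U"
  shows "colength scale (span (U \<union> T)) U \<le> enat (card T) * colength (*) UNIV J"
  using assms(2,4)
proof (induction T)
  case empty
  then show ?case using assms(1) colength_self[of U] by (simp add: span_eq_iff[THEN iffD2])
next
  case (insert t T)
  let ?V = "span (U \<union> T)"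
  have eq: "span (insert t ?V) = span (U \<union> insert t T)"
    by (metis Un_insert_right span_insert span_span)
  have "colength scale (span (U \<union> insert t T)) U
      = colength scale (span (U \<union> insert t T)) ?V + colength scale ?V U"
    using assms(1) span_superset[of "U \<union> T"] span_mono[of "U \<union> T" "U \<union> insert t T"]
    by (intro colength_additive) auto
  also have "\<dots> \<le> colength (*) UNIV J + enat (card T) * colength (*) UNIV J"
  proof (rule add_mono)
    show "colength scale (span (U \<union> insert t T)) ?V \<le> colength (*) UNIV J"
      unfolding eq[symmetric] using insert.prems assms span_base
      by (intro colength_insert_le) auto
  qed (use insert in auto)
  also have "\<dots> = (1 + enat (card T)) * colength (*) UNIV J"
    by (simp add: algebra_simps)
  also have "1 + enat (card T) = enat (card (insert t T))"
    using insert.hyps by (simp add: one_enat_def)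
  finally show ?case .
qed

end

section \<open>Local rings\<close>

locale noetherian_local =
  fixes \<mm> :: "'a::comm_ring_1 set"
  assumes noetherian_local: "is_noetherian_local \<mm>"

lemma ideal_acc:
  fixes I :: "nat \<Rightarrow> 'a::comm_ring_1 set"
  assumes "is_noetherian TYPE('a)" and I: "\<And>n. is_ideal (I n)" and mono: "\<And>n. I n \<subseteq> I (Suc n)"
  shows "\<exists>n. \<forall>k\<ge>n. I k = I n"
proof -
  have le: "I m \<subseteq> I n" if "m \<le> n" for m n
    using lift_Suc_mono_le[of I, OF mono that] .
  have "is_ideal (\<Union>n. I n)"
    unfolding ring_module.subspace_def
  proof (intro conjI ballI allI)
    show "0 \<in> (\<Union>n. I n)" using ring_module.subspace_0[OF I[of 0]] by blast
  next
    fix x y assume "x \<in> (\<Union>n. I n)" "y \<in> (\<Union>n. I n)"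
    then obtain m n where "x \<in> I m" "y \<in> I n" by blast
    then have "x \<in> I (max m n)" "y \<in> I (max m n)" using le[of m "max m n"] le[of n "max m n"] by auto
    then have "x + y \<in> I (max m n)" by (rule ring_module.subspace_add[OF I])
    then show "x + y \<in> (\<Union>n. I n)" by blast
  next
    fix c x assume "x \<in> (\<Union>n. I n)"
    then show "c * x \<in> (\<Union>n. I n)" using ring_module.subspace_scale[OF I] by blast
  qed
  then have "\<exists>S. finite S \<and> ideal_generated S = (\<Union>n. I n)"
    using assms(1) unfolding is_noetherian_def by (elim allE impE)
  then obtain S where S: "finite S" "ideal_generated S = (\<Union>n. I n)" by (elim exE conjE)
  have "\<exists>n. S \<subseteq> I n" if "finite S" "S \<subseteq> (\<Union>n. I n)" for S
    using that
  proof (induction S)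
    case (insert x S)
    then obtain m n where "S \<subseteq> I n" "x \<in> I m" by blast
    then have "insert x S \<subseteq> I (max m n)" using le[of m "max m n"] le[of n "max m n"] by auto
    then show ?case by blast
  qed auto
  moreover have "S \<subseteq> (\<Union>n. I n)" using S(2) ring_module.span_superset by blast
  ultimately obtain n where n: "S \<subseteq> I n" using S(1) by blast
  then have "(\<Union>n. I n) \<subseteq> I n" using ring_module.span_minimal[OF n I] S(2) by simp
  then have "I k = I n" if "k \<ge> n" for k using le[OF that] by blast
  then show ?thesis by blast
qed

context noetherian_local
begin

lemma noeth: "is_noetherian TYPE('a)"
  and ideal_m: "is_ideal \<mm>"
  and m_neq_UNIV: "\<mm> \<noteq> UNIV"
  using noetherian_local unfolding is_noetherian_local_def is_maximal_ideal_def by simp_all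

lemma one_notin_m: "1 \<notin> \<mm>"
proof
  assume "1 \<in> \<mm>"
  then have "c * 1 \<in> \<mm>" for c using ring_module.subspace_scale[OF ideal_m] by blast
  then show False using m_neq_UNIV by auto
qed

text \<open>A maximal ideal above \<open>I\<close> is found by Noetherian induction: a proper ideal
  that is not maximal lies in a strictly larger proper one, ascending chains stop, and the only
  ideal at which they can stop is \<open>\<mm>\<close>.\<close>

lemma ideal_le_m:
  assumes "is_ideal I" "I \<noteq> UNIV"
  shows "I \<subseteq> \<mm>"
proof (rule ccontr)
  assume nI: "\<not> I \<subseteq> \<mm>"
  define R where "R = {(K, J). is_ideal J \<and> is_ideal K \<and> K \<noteq> UNIV \<and> J \<subset> (K :: 'a set)}"
  have "wf R"
    unfolding wf_iff_no_infinite_down_chain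
  proof
    assume "\<exists>f. \<forall>i. (f (Suc i), f i) \<in> R"
    then obtain f where "\<forall>i. (f (Suc i), f i) \<in> R" by blast
    then have f: "is_ideal (f i)" "f i \<subset> f (Suc i)" for i unfolding R_def by auto
    have "f i \<subseteq> f (Suc i)" for i by (rule psubset_imp_subset[OF f(2)])
    from ideal_acc[of f, OF noeth f(1) this] obtain n where "\<forall>k\<ge>n. f k = f n" by (elim exE)
    then have "f (Suc n) = f n" by (meson le_Suc_eq order_refl)
    then show False using f(2)[of n] by simp
  qed
  then have "I \<subseteq> \<mm>" using assms
  proof (induction I rule: wf_induct_rule)
    case (less J)
    show ?case
    proof (cases "is_maximal_ideal J")
      case True
      then show ?thesis using noetherian_local unfolding is_noetherian_local_def by blast
    next
      case False
      then obtain K where "is_ideal K" "J \<subseteq> K" "K \<noteq> J" "K \<noteq> UNIV"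
        using less.prems unfolding is_maximal_ideal_def by blast
      then have "(K, J) \<in> R" using less.prems unfolding R_def by auto
      then have "K \<subseteq> \<mm>" using less.IH \<open>is_ideal K\<close> \<open>K \<noteq> UNIV\<close> by blast
      then show ?thesis using \<open>J \<subseteq> K\<close> by blast
    qed
  qed
  then show False using nI by blast
qed

lemma unit_notin_m:
  assumes "x \<notin> \<mm>"
  obtains y where "y * x = 1"
proof -
  let ?I = "range (\<lambda>y. y * x)"
  have "is_ideal ?I"
    using ring_module.subspace_span[of "{x}"] by (simp add: ring_module.span_singleton)
  moreover have "1 * x \<in> ?I" by blast
  then have "\<not> ?I \<subseteq> \<mm>" using assms by auto
  ultimately have "?I = UNIV" using ideal_le_m by blast
  then have "1 \<in> ?I" by simp
  then show ?thesis using that by (metis imageE)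
qed

lemma prime_m: "is_prime_ideal \<mm>"
  unfolding is_prime_ideal_def
proof (intro conjI allI impI)
  fix a b assume ab: "a * b \<in> \<mm>"
  show "a \<in> \<mm> \<or> b \<in> \<mm>"
  proof (rule disjCI)
    assume "b \<notin> \<mm>"
    then obtain c where c: "c * b = 1" by (rule unit_notin_m)
    have "c * (a * b) = (c * b) * a" by (simp add: ac_simps)
    then have "a = c * (a * b)" using c by simp
    then show "a \<in> \<mm>" using ab ring_module.subspace_scale[OF ideal_m, of "a * b" c] by simp
  qed
qed (fact ideal_m m_neq_UNIV)+

text \<open>In a chain with two strict steps above \<open>\<mm>\<close> the middle ideal would be
  proper without being contained in \<open>\<mm>\<close>.\<close>

lemma colength_m: "colength (*) UNIV \<mm> \<le> 1"
proof (rule ring_module.colength_leI)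
  fix n N assume "submodule_chain (*) UNIV \<mm> n N"
  note ch = this[unfolded submodule_chain_def]
  show "enat n \<le> 1"
  proof (rule ccontr)
    assume "\<not> enat n \<le> 1"
    then have n: "2 \<le> n" by (simp add: one_enat_def)
    have "N 0 \<subset> N (Suc 0)" "N (Suc 0) \<subset> N (Suc (Suc 0))" using ch n by simp_all
    moreover have "\<mm> \<subseteq> N 0" "is_ideal (N (Suc 0))" using ch n by simp_all
    ultimately have "\<mm> \<subset> N (Suc 0)" "N (Suc 0) \<noteq> UNIV" by blast+
    then show False using ideal_le_m[OF \<open>is_ideal (N (Suc 0))\<close>] by blast
  qed
qed

end

definition ideal_mult ::
    "('a::comm_ring_1 \<Rightarrow> 'b::ab_group_add \<Rightarrow> 'b) \<Rightarrow> 'a set \<Rightarrow> 'b set \<Rightarrow> 'b set" where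
  "ideal_mult scale I M = module.span scale {scale c x | c x. c \<in> I \<and> x \<in> M}"

context Modules.module
begin

lemma subspace_ideal_mult: "subspace (ideal_mult scale I M)"
  unfolding ideal_mult_def by (rule subspace_span)

lemma ideal_mult_base: "c \<in> I \<Longrightarrow> x \<in> M \<Longrightarrow> c *s x \<in> ideal_mult scale I M"
  unfolding ideal_mult_def by (rule span_base) blast

lemma ideal_mult_le:
  "subspace N \<Longrightarrow> (\<And>c x. c \<in> I \<Longrightarrow> x \<in> M \<Longrightarrow> c *s x \<in> N) \<Longrightarrow> ideal_mult scale I M \<subseteq> N"
  unfolding ideal_mult_def by (rule span_minimal) auto

lemma ideal_mult_mono: "I \<subseteq> I' \<Longrightarrow> M \<subseteq> M' \<Longrightarrow> ideal_mult scale I M \<subseteq> ideal_mult scale I' M'"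
  unfolding ideal_mult_def by (rule span_mono) auto

lemma ideal_mult_le_self: "subspace M \<Longrightarrow> ideal_mult scale I M \<subseteq> M"
  by (rule ideal_mult_le) (auto intro: subspace_scale)

lemma ideal_mult_span:
  assumes "is_ideal I" "x \<in> ideal_mult scale I (span S)"
  shows "x \<in> span {c *s x | c x. c \<in> I \<and> x \<in> S}"
proof -
  let ?N = "span {c *s x | c x. c \<in> I \<and> x \<in> S}"
  have "c *s x \<in> ?N" if c: "c \<in> I" and "x \<in> span S" for c x
    using that(2)
  proof (induction rule: span_induct_alt)
    case base
    then show ?case by (simp add: span_zero)
  next
    case (step d x y)
    have "(c * d) *s x \<in> ?N"
      using ring_module.subspace_scale[OF assms(1) c, of d] step(1)
      by (intro span_base) (auto simp: mult.commute)
    then show ?case using step span_add by (simp add: scale_right_distrib)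
  qed
  then have "ideal_mult scale I (span S) \<subseteq> ?N" by (intro ideal_mult_le) auto
  then show ?thesis using assms(2) by blast
qed

text \<open>Splits off a single generator, with its coefficient still in \<open>I\<close>; this is
  the elimination step of Nakayama's lemma.\<close>

lemma ideal_mult_insert_span:
  assumes "is_ideal I" "x \<in> ideal_mult scale I (span (insert t T))"
  obtains c z where "c \<in> I" "z \<in> ideal_mult scale I (span T)" "x = c *s t + z"
proof -
  have "x \<in> span {c *s x | c x. c \<in> I \<and> x \<in> insert t T}"
    using assms ideal_mult_span by blast
  then have "\<exists>c z. c \<in> I \<and> z \<in> ideal_mult scale I (span T) \<and> x = c *s t + z"
  proof (induction rule: span_induct_alt)
    case base
    have "0 = 0 *s t + 0" by simp
    then show ?case
      using ring_module.subspace_0[OF assms(1)] subspace_0[OF subspace_ideal_mult] by blast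
  next
    case (step d x y)
    obtain c z where cz: "c \<in> I" "z \<in> ideal_mult scale I (span T)" "y = c *s t + z"
      using step by blast
    obtain a w where aw: "x = a *s w" "a \<in> I" "w \<in> insert t T" using step by blast
    show ?case
    proof (cases "w = t")
      case True
      have "d * a + c \<in> I"
        using aw cz assms(1) ring_module.subspace_add ring_module.subspace_scale by blast
      moreover have "d *s x + y = (d * a + c) *s t + z"
        using True aw cz by (simp add: scale_left_distrib)
      ultimately show ?thesis using cz by blast
    next
      case False
      then have "w \<in> span T" using aw span_base by blast
      then have "d *s x + z \<in> ideal_mult scale I (span T)"
        unfolding aw(1) using aw(2) cz(2) subspace_ideal_mult subspace_add subspace_scale ideal_mult_base
        by metis
      moreover have "d *s x + y = c *s t + (d *s x + z)" using cz by (simp add: algebra_simps)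
      ultimately show ?thesis using cz by blast
    qed
  qed
  then show ?thesis using that by blast
qed

end

context noetherian_local
begin

text \<open>One generator \<open>t\<close> is eliminated at a time: its coefficient \<open>c\<close>
  in its own relation lies in \<open>\<mm>\<close>, so \<open>1 - c\<close> is a unit and
  \<open>t\<close> is expressed by the remaining generators and \<open>U\<close>. Substituting this
  into the other relations keeps the form of the hypothesis. As \<open>U\<close> is an arbitrary
  submodule, the lemma also serves modulo a prime ideal.\<close>

lemma nakayama:
  assumes "Modules.module scale"
    and "finite T" "module.subspace scale U"
    and "\<And>t. t \<in> T \<Longrightarrow> \<exists>z \<in> ideal_mult scale \<mm> (module.span scale T). \<exists>u\<in>U. t = z + u"
  shows "T \<subseteq> U"
proof -
  interpret M: Modules.module scale by fact
  show ?thesis using assms(2,4)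
  proof (induction T)
    case (insert t T)
    obtain z u where zu: "z \<in> ideal_mult scale \<mm> (M.span (insert t T))" "u \<in> U" "t = z + u"
      using insert.prems by blast
    obtain c w where cw: "c \<in> \<mm>" "w \<in> ideal_mult scale \<mm> (M.span T)" "z = scale c t + w"
      using M.ideal_mult_insert_span[OF ideal_m zu(1)] by metis
    have "1 - c \<notin> \<mm>"
    proof
      assume "1 - c \<in> \<mm>"
      then have "1 - c + c \<in> \<mm>" using cw(1) ring_module.subspace_add[OF ideal_m] by blast
      then show False using one_notin_m by simp
    qed
    then obtain a where a: "a * (1 - c) = 1" by (rule unit_notin_m)
    have "scale (1 - c) t = w + u"
      using zu(3) cw(3) by (simp add: M.scale_left_diff_distrib algebra_simps)
    then have "scale (a * (1 - c)) t = scale a (w + u)" by (metis M.scale_scale)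
    then have t: "t = scale a w + scale a u" using a by (simp add: M.scale_right_distrib)
    have aw: "scale a w \<in> ideal_mult scale \<mm> (M.span T)"
      using M.subspace_scale[OF M.subspace_ideal_mult cw(2)] .
    have au: "scale a u \<in> U" using M.subspace_scale[OF assms(3) zu(2)] .
    have T: "T \<subseteq> U"
    proof (rule insert.IH)
      fix s assume s: "s \<in> T"
      then obtain z' u' where zu': "z' \<in> ideal_mult scale \<mm> (M.span (insert t T))" "u' \<in> U" "s = z' + u'"
        using insert.prems by blast
      obtain c' w' where cw': "c' \<in> \<mm>" "w' \<in> ideal_mult scale \<mm> (M.span T)" "z' = scale c' t + w'"
        using M.ideal_mult_insert_span[OF ideal_m zu'(1)] by metis
      have "s = (scale c' (scale a w) + w') + (scale c' (scale a u) + u')"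
        unfolding zu'(3) cw'(3) by (subst t) (simp add: M.scale_right_distrib algebra_simps)
      moreover have "scale c' (scale a w) + w' \<in> ideal_mult scale \<mm> (M.span T)"
        using M.subspace_add[OF M.subspace_ideal_mult M.subspace_scale[OF M.subspace_ideal_mult aw] cw'(2)] .
      moreover have "scale c' (scale a u) + u' \<in> U"
        using M.subspace_add[OF assms(3) M.subspace_scale[OF assms(3) au] zu'(2)] .
      ultimately show "\<exists>z\<in>ideal_mult scale \<mm> (M.span T). \<exists>u\<in>U. s = z + u" by blast
    qed
    then have "M.span T \<subseteq> U" using M.span_minimal assms(3) by blast
    then have "ideal_mult scale \<mm> (M.span T) \<subseteq> U"
      using M.ideal_mult_le_self[of "M.span T" \<mm>] M.subspace_span by blast
    then have "t \<in> U" using t aw au M.subspace_add[OF assms(3)] by auto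
    then show ?case using T by blast
  qed auto
qed

lemma nakayama_span:
  assumes "Modules.module scale" "finite T" "module.subspace scale U"
    and "\<And>x. x \<in> module.span scale T \<Longrightarrow>
      \<exists>z \<in> ideal_mult scale \<mm> (module.span scale T). \<exists>u\<in>U. x = z + u"
  shows "module.span scale T \<subseteq> U"
proof -
  interpret M: Modules.module scale by fact
  have "T \<subseteq> U"
    by (rule nakayama[OF assms(1-3)]) (use assms(4) M.span_base in blast)
  then show ?thesis using M.span_minimal assms(3) by blast
qed

end

section \<open>Avoiding submodules over an infinite residue field\<close>

locale noetherian_local_inf = noetherian_local +
  assumes infinite_residue: "infinite (residue_classes \<mm>)"
begin

lemma equiv_m: "equiv UNIV {(x, y). x - y \<in> \<mm>}"
proof (rule equivI)
  show "refl_on UNIV {(x, y). x - y \<in> \<mm>}"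
    using ring_module.subspace_0[OF ideal_m] by (auto simp: refl_on_def)
  show "sym {(x, y). x - y \<in> \<mm>}"
  proof (rule symI)
    fix x y assume "(x, y) \<in> {(x, y). x - y \<in> \<mm>}"
    then have "- (x - y) \<in> \<mm>" using ring_module.subspace_neg[OF ideal_m] by blast
    then show "(y, x) \<in> {(x, y). x - y \<in> \<mm>}" by simp
  qed
  show "trans {(x, y). x - y \<in> \<mm>}"
  proof (rule transI)
    fix x y z assume "(x, y) \<in> {(x, y). x - y \<in> \<mm>}" "(y, z) \<in> {(x, y). x - y \<in> \<mm>}"
    then have "(x - y) + (y - z) \<in> \<mm>" using ring_module.subspace_add[OF ideal_m] by blast
    then show "(x, z) \<in> {(x, y). x - y \<in> \<mm>}" by simp
  qed
qed auto

lemma infinite_residue_system: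
  obtains C where "infinite C" "\<And>a b. a \<in> C \<Longrightarrow> b \<in> C \<Longrightarrow> a \<noteq> b \<Longrightarrow> a - b \<notin> \<mm>"
proof -
  define f where "f X = (SOME x. x \<in> X)" for X :: "'a set"
  have f: "f X \<in> X" if "X \<in> residue_classes \<mm>" for X
    using that in_quotient_imp_non_empty[OF equiv_m] unfolding residue_classes_def f_def
    by (metis ex_in_conv someI_ex)
  have "inj_on f (residue_classes \<mm>)"
  proof (rule inj_onI)
    fix X Y assume XY: "X \<in> residue_classes \<mm>" "Y \<in> residue_classes \<mm>" "f X = f Y"
    then show "X = Y" using f[of X] f[of Y] quotient_disj[OF equiv_m, of X Y]
      unfolding residue_classes_def by auto
  qed
  then have inf: "infinite (f ` residue_classes \<mm>)" using infinite_residue finite_imageD by blast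
  have "f X - f Y \<notin> \<mm>" if XY: "X \<in> residue_classes \<mm>" "Y \<in> residue_classes \<mm>" "f X \<noteq> f Y" for X Y
  proof
    assume "f X - f Y \<in> \<mm>"
    then have "X = Y"
      using quotient_eqI[OF equiv_m, of X Y "f X" "f Y"] XY f[of X] f[of Y]
      unfolding residue_classes_def by auto
    then show False using XY by simp
  qed
  then show ?thesis using that[OF inf] by blast
qed

text \<open>On the line \<open>v + c u\<close> with \<open>u \<notin> W\<close>, a submodule \<open>W\<close> contains points of at most one residue class
  of parameters \<open>c\<close>.\<close>
lemma line_avoids:
  fixes scale :: "'a \<Rightarrow> 'b::ab_group_add \<Rightarrow> 'b"
  assumes "Modules.module scale" "finite \<W>"
    and "\<And>W. W \<in> \<W> \<Longrightarrow> module.subspace scale W" "\<And>W. W \<in> \<W> \<Longrightarrow> u \<notin> W"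
  obtains c where "\<And>W. W \<in> \<W> \<Longrightarrow> v + scale c u \<notin> W"
proof -
  interpret M: Modules.module scale by fact
  obtain C where C: "infinite C" "\<And>a b. a \<in> C \<Longrightarrow> b \<in> C \<Longrightarrow> a \<noteq> b \<Longrightarrow> a - b \<notin> \<mm>"
    using infinite_residue_system by metis
  have "\<exists>c\<in>C. \<forall>W\<in>\<W>. v + scale c u \<notin> W"
  proof (rule ccontr)
    assume "\<not> ?thesis"
    then have "C \<subseteq> (\<Union>W\<in>\<W>. {c\<in>C. v + scale c u \<in> W})" by blast
    moreover have "finite {c\<in>C. v + scale c u \<in> W}" if W: "W \<in> \<W>" for W
    proof -
      have "a = b" if ab: "a \<in> C" "b \<in> C" "v + scale a u \<in> W" "v + scale b u \<in> W" for a b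
      proof (rule ccontr)
        assume "a \<noteq> b"
        then obtain y where y: "y * (a - b) = 1" using C(2) ab unit_notin_m by metis
        have "(v + scale a u) - (v + scale b u) \<in> W"
          using ab(3,4) M.subspace_diff[OF assms(3)[OF W]] by blast
        then have "scale (a - b) u \<in> W" by (simp add: M.scale_left_diff_distrib)
        then have "scale y (scale (a - b) u) \<in> W" using M.subspace_scale[OF assms(3)[OF W]] by blast
        then have "u \<in> W" using y by simp
        then show False using assms(4)[OF W] by simp
      qed
      then show ?thesis
        by (metis (mono_tags, lifting) finite.emptyI finite_insert insertI1 mem_Collect_eq
            rev_finite_subset subsetI)
    qed
    ultimately have "finite C" using assms(2) finite_subset by blast
    then show False using C(1) by simp
  qed
  then show ?thesis using that by blast
qed

text \<open>Let \<open>u\<close> avoid the earlier submodules but lie in \<open>W\<close>, and let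
  \<open>v\<close> \<notin> \<open>W\<close>. Some point \<open>v + c u\<close> avoids the earlier
  ones by \<open>line_avoids\<close>, and it stays outside \<open>W\<close> because otherwise
  \<open>v\<close> would be in \<open>W\<close>.\<close>

lemma avoid_submodules:
  fixes scale :: "'a \<Rightarrow> 'b::ab_group_add \<Rightarrow> 'b"
  assumes "Modules.module scale" "finite \<W>" "module.subspace scale M"
    and "\<And>W. W \<in> \<W> \<Longrightarrow> module.subspace scale W" "\<And>W. W \<in> \<W> \<Longrightarrow> \<not> M \<subseteq> W"
  obtains v where "v \<in> M" "\<And>W. W \<in> \<W> \<Longrightarrow> v \<notin> W"
proof -
  interpret M: Modules.module scale by fact
  have "\<exists>v\<in>M. \<forall>W\<in>\<W>. v \<notin> W"
    using assms(2,4,5)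
  proof (induction \<W>)
    case empty
    then show ?case using M.subspace_0[OF assms(3)] by blast
  next
    case (insert W \<W>)
    then obtain u where u: "u \<in> M" "\<forall>W\<in>\<W>. u \<notin> W" by blast
    obtain v where v: "v \<in> M" "v \<notin> W" using insert.prems(2)[of W] by blast
    show ?case
    proof (cases "u \<in> W")
      case True
      obtain c where c: "\<And>W. W \<in> \<W> \<Longrightarrow> v + scale c u \<notin> W"
        using line_avoids[OF assms(1) insert.hyps(1), of u v] insert.prems u by blast
      have "v + scale c u \<notin> W"
      proof
        assume "v + scale c u \<in> W"
        then have "(v + scale c u) - scale c u \<in> W"
          using True M.subspace_diff M.subspace_scale insert.prems(1)[of W] by blast
        then show False using v by simp
      qed
      moreover have "v + scale c u \<in> M"
        using u v M.subspace_add[OF assms(3)] M.subspace_scale[OF assms(3)] by blast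
      ultimately show ?thesis using c by blast
    qed (use u in blast)
  qed
  then show ?thesis using that by blast
qed

text \<open>A line through \<open>v\<close> whose direction lies in \<open>M\<close> and avoids
  every member of \<open>\<W>\<close> meets each of them in at most one residue class of parameters.
  Applied to \<open>\<mm> M\<close> in place of \<open>M\<close>, it permits corrections of a given
  vector modulo \<open>\<mm> M\<close>.\<close>

lemma coset_avoids_submodules:
  fixes scale :: "'a \<Rightarrow> 'b::ab_group_add \<Rightarrow> 'b"
  assumes "Modules.module scale" "finite \<W>" "module.subspace scale M"
    and "\<And>W. W \<in> \<W> \<Longrightarrow> module.subspace scale W" "\<And>W. W \<in> \<W> \<Longrightarrow> \<not> M \<subseteq> W"
  obtains w where "w \<in> M" "\<And>W. W \<in> \<W> \<Longrightarrow> v + w \<notin> W"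
proof -
  interpret M: Modules.module scale by fact
  obtain u where u: "u \<in> M" "\<And>W. W \<in> \<W> \<Longrightarrow> u \<notin> W"
    using avoid_submodules[OF assms] by metis
  obtain c where "\<And>W. W \<in> \<W> \<Longrightarrow> v + scale c u \<notin> W"
    using line_avoids[OF assms(1,2,4) u(2), of v] by blast
  then show ?thesis using that[of "scale c u"] M.subspace_scale[OF assms(3) u(1)] by blast
qed

end

section \<open>Minimal generating sets\<close>

context noetherian_local
begin

text \<open>Linear independence over the residue field of the classes of \<open>G\<close> in
  \<open>M\<close> modulo \<open>\<mm> M\<close>, phrased without the quotient.\<close>

definition irredundant_mod ::
    "('a \<Rightarrow> 'b::ab_group_add \<Rightarrow> 'b) \<Rightarrow> 'b set \<Rightarrow> 'b set \<Rightarrow> bool" where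
  "irredundant_mod scale M G \<longleftrightarrow>
     (\<forall>g\<in>G. g \<notin> module.span scale (G - {g} \<union> ideal_mult scale \<mm> M))"

text \<open>The exchange argument over the residue field: in a relation for \<open>g\<close> the
  coefficient \<open>c\<close> of \<open>y\<close> is either in \<open>\<mm>\<close>, so that its
  term is absorbed by \<open>\<mm> M\<close>, or a unit, so that the relation can be solved for
  \<open>y\<close>.\<close>

lemma irredundant_mod_insert:
  assumes "Modules.module scale" "irredundant_mod scale M H"
    and "y \<notin> module.span scale (H \<union> ideal_mult scale \<mm> M)" "H \<subseteq> M" "y \<in> M"
  shows "irredundant_mod scale M (insert y H)"
  unfolding irredundant_mod_def
proof
  interpret M: Modules.module scale by fact
  let ?Z = "ideal_mult scale \<mm> M"
  fix g assume g: "g \<in> insert y H"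
  have yH: "y \<notin> H" using assms(3) M.span_base by blast
  show "g \<notin> M.span (insert y H - {g} \<union> ?Z)"
  proof (cases "g = y")
    case True
    then have "insert y H - {g} = H" using yH by blast
    then show ?thesis using assms(3) True by simp
  next
    case False
    then have gH: "g \<in> H" using g by blast
    show ?thesis
    proof
      have eq: "insert y H - {g} \<union> ?Z = insert y (H - {g} \<union> ?Z)" using False by blast
      assume "g \<in> M.span (insert y H - {g} \<union> ?Z)"
      then obtain c where c: "g - scale c y \<in> M.span (H - {g} \<union> ?Z)"
        unfolding eq M.span_breakdown_eq by blast
      have sub: "M.span (H - {g} \<union> ?Z) \<subseteq> M.span (H \<union> ?Z)" by (rule M.span_mono) blast
      show False
      proof (cases "c \<in> \<mm>")
        case True
        then have "scale c y \<in> M.span (H - {g} \<union> ?Z)"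
          using M.span_base[of "scale c y" "H - {g} \<union> ?Z"] M.ideal_mult_base[OF True assms(5)] by simp
        from M.span_add[OF c this] have "g \<in> M.span (H - {g} \<union> ?Z)" by simp
        then show False using assms(2) gH unfolding irredundant_mod_def by blast
      next
        case False
        then obtain d where d: "d * c = 1" by (rule unit_notin_m)
        have "g - (g - scale c y) \<in> M.span (H \<union> ?Z)"
          using c sub gH M.span_base[of g "H \<union> ?Z"] M.span_diff by blast
        then have "scale c y \<in> M.span (H \<union> ?Z)" by simp
        then have "scale d (scale c y) \<in> M.span (H \<union> ?Z)" by (rule M.span_scale)
        then show False using d assms(3) by simp
      qed
    qed
  qed
qed

text \<open>Elements of \<open>T\<close> are added to \<open>G\<close> only if they are new modulo
  \<open>\<mm> M\<close>. The result generates \<open>M\<close> by Nakayama's lemma; a proper subset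
  cannot generate, since this would make an omitted element redundant modulo
  \<open>\<mm> M\<close>.\<close>

lemma extend_to_min_generating_set:
  assumes "Modules.module scale" "finite T" "module.span scale T = M"
    and "finite G" "G \<subseteq> M" "irredundant_mod scale M G"
  obtains H where "G \<subseteq> H" "is_min_generating_set scale M H"
proof -
  interpret M: Modules.module scale by fact
  let ?Z = "ideal_mult scale \<mm> M"
  have TM: "T \<subseteq> M" and subM: "M.subspace M"
    using assms(3) M.span_superset M.subspace_span by auto
  have "\<exists>H. G \<subseteq> H \<and> H \<subseteq> G \<union> T' \<and> irredundant_mod scale M H \<and> T' \<subseteq> M.span (H \<union> ?Z)"
    if "finite T'" "T' \<subseteq> M" for T'
    using that
  proof (induction T')
    case empty
    then show ?case using assms(6) by blast
  next
    case (insert y T')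
    then obtain H where H: "G \<subseteq> H" "H \<subseteq> G \<union> T'" "irredundant_mod scale M H" "T' \<subseteq> M.span (H \<union> ?Z)"
      by blast
    show ?case
    proof (cases "y \<in> M.span (H \<union> ?Z)")
      case True
      then show ?thesis using H by blast
    next
      case False
      have "H \<subseteq> M" using H(2) assms(5) insert.prems by blast
      then have "irredundant_mod scale M (insert y H)"
        using irredundant_mod_insert[OF assms(1) H(3) False] insert.prems by blast
      moreover have "M.span (H \<union> ?Z) \<subseteq> M.span (insert y H \<union> ?Z)" by (rule M.span_mono) blast
      moreover have "y \<in> M.span (insert y H \<union> ?Z)" by (rule M.span_base) blast
      ultimately show ?thesis using H by blast
    qed
  qed
  from this[OF assms(2) TM] obtain H where H: "G \<subseteq> H" "H \<subseteq> G \<union> T" "irredundant_mod scale M H"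
    "T \<subseteq> M.span (H \<union> ?Z)" by blast
  have HM: "H \<subseteq> M" using H(2) TM assms(5) by blast
  have "T \<subseteq> M.span H"
  proof (rule nakayama[OF assms(1,2) M.subspace_span])
    fix t assume "t \<in> T"
    then have "t \<in> M.span (H \<union> ?Z)" using H(4) by blast
    then obtain u z where uz: "t = u + z" "u \<in> M.span H" "z \<in> M.span ?Z"
      unfolding M.span_Un by blast
    have "z \<in> ?Z" using uz(3) M.span_minimal[OF order_refl M.subspace_ideal_mult] by blast
    then show "\<exists>z\<in>ideal_mult scale \<mm> (M.span T). \<exists>u\<in>M.span H. t = z + u"
      using uz assms(3) by (metis add.commute)
  qed
  then have spanH: "M.span H = M"
    using HM subM assms(3) M.span_minimal M.subspace_span by (metis subset_antisym)
  have "M.span K \<noteq> M" if K: "K \<subset> H" for K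
  proof
    assume sp: "M.span K = M"
    obtain g where g: "g \<in> H" "g \<notin> K" using K by blast
    have "K \<subseteq> H - {g} \<union> ?Z" using K g by blast
    then have "M \<subseteq> M.span (H - {g} \<union> ?Z)" unfolding sp[symmetric] by (rule M.span_mono)
    then show False using H(3) g(1) HM unfolding irredundant_mod_def by blast
  qed
  then show ?thesis using that[OF H(1)] spanH unfolding is_min_generating_set_def by blast
qed

text \<open>By Nakayama's lemma, redundancy of \<open>g\<close> modulo \<open>\<mm> B\<close> would
  be genuine redundancy, against minimality.\<close>

lemma min_generating_set_irredundant:
  assumes "Modules.module scale" "is_min_generating_set scale B G" "finite G" "g \<in> G"
  shows "g \<notin> module.span scale (G - {g} \<union> ideal_mult scale \<mm> B)"
proof
  interpret M: Modules.module scale by fact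
  let ?Z = "ideal_mult scale \<mm> B"
  assume "g \<in> M.span (G - {g} \<union> ?Z)"
  then obtain u z where uz: "g = u + z" "u \<in> M.span (G - {g})" "z \<in> M.span ?Z"
    unfolding M.span_Un by blast
  have z: "z \<in> ?Z" using uz(3) M.span_minimal[OF order_refl M.subspace_ideal_mult] by blast
  have spG: "M.span G = B" using assms(2) unfolding is_min_generating_set_def by blast
  have "G \<subseteq> M.span (G - {g})"
  proof (rule nakayama[OF assms(1,3) M.subspace_span])
    fix t assume "t \<in> G"
    show "\<exists>z\<in>ideal_mult scale \<mm> (M.span G). \<exists>u\<in>M.span (G - {g}). t = z + u"
    proof (cases "t = g")
      case True
      then have "t = z + u" using uz(1) by (simp add: add.commute)
      then show ?thesis using z uz(2) unfolding spG by blast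
    next
      case False
      then have "t \<in> M.span (G - {g})" using \<open>t \<in> G\<close> M.span_base[of t "G - {g}"] by simp
      moreover have "t = 0 + t" by simp
      ultimately show ?thesis using M.subspace_0[OF M.subspace_ideal_mult] by blast
    qed
  qed
  then have "M.span G \<subseteq> M.span (G - {g})" using M.span_minimal M.subspace_span by blast
  moreover have "M.span (G - {g}) \<subseteq> M.span G" by (rule M.span_mono) blast
  ultimately have "M.span (G - {g}) = B" using spG by blast
  moreover have "G - {g} \<subset> G" using assms(4) by blast
  ultimately show False using assms(2) unfolding is_min_generating_set_def by blast
qed

text \<open>Each of the finitely many elements of \<open>T\<close> uses finitely many members of
  \<open>G\<close>; these members already generate \<open>B\<close>, and by minimality they are all
  of \<open>G\<close>.\<close>

lemma min_generating_set_finite: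
  assumes "Modules.module scale" "is_min_generating_set scale B G" "finite T" "module.span scale T = B"
  shows "finite G"
proof -
  interpret M: Modules.module scale by fact
  have spG: "M.span G = B" using assms(2) unfolding is_min_generating_set_def by blast
  have "\<exists>G0\<subseteq>G. finite G0 \<and> t \<in> M.span G0" if "t \<in> T" for t
  proof -
    have "t \<in> M.span G" using that assms(4) spG M.span_base by blast
    then obtain G0 c where "finite G0" "G0 \<subseteq> G" "t = (\<Sum>a\<in>G0. scale (c a) a)"
      unfolding M.span_explicit by blast
    moreover then have "t \<in> M.span G0" by (auto intro!: M.span_sum intro: M.span_scale M.span_base)
    ultimately show ?thesis by blast
  qed
  then obtain f where f: "\<And>t. t \<in> T \<Longrightarrow> f t \<subseteq> G \<and> finite (f t) \<and> t \<in> M.span (f t)" by metis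
  let ?K = "\<Union>t\<in>T. f t"
  have "T \<subseteq> M.span ?K" using f M.span_mono[of _ ?K] by blast
  then have "B \<subseteq> M.span ?K" using M.span_minimal M.subspace_span assms(4) by blast
  moreover have KG: "?K \<subseteq> G" using f by blast
  moreover have "M.span ?K \<subseteq> B" using M.span_mono[OF KG] spG by blast
  ultimately have "M.span ?K = B" by blast
  then have "?K = G" using KG assms(2) unfolding is_min_generating_set_def by blast
  moreover have "finite ?K" using assms(3) f by blast
  ultimately show ?thesis by simp
qed

end

section \<open>Noetherian subrings\<close>

text \<open>The rings to be shown Noetherian are subrings of polynomial rings, so the ring notions
  are relative to a carrier set.\<close>

definition is_subring :: "'c::comm_ring_1 set \<Rightarrow> bool" where
  "is_subring A \<longleftrightarrow> 1 \<in> A \<and> (\<forall>x\<in>A. \<forall>y\<in>A. x - y \<in> A \<and> x * y \<in> A)"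

definition ideal_in :: "'c::comm_ring_1 set \<Rightarrow> 'c set \<Rightarrow> bool" where
  "ideal_in A I \<longleftrightarrow> I \<subseteq> A \<and> 0 \<in> I \<and> (\<forall>x\<in>I. \<forall>y\<in>I. x + y \<in> I) \<and> (\<forall>a\<in>A. \<forall>x\<in>I. a * x \<in> I)"

definition prime_in :: "'c::comm_ring_1 set \<Rightarrow> 'c set \<Rightarrow> bool" where
  "prime_in A P \<longleftrightarrow> ideal_in A P \<and> P \<noteq> A \<and> (\<forall>a\<in>A. \<forall>b\<in>A. a * b \<in> P \<longrightarrow> a \<in> P \<or> b \<in> P)"

definition noetherian_subring :: "'c::comm_ring_1 set \<Rightarrow> bool" where
  "noetherian_subring A \<longleftrightarrow> is_subring A \<and>
     (\<forall>I :: nat \<Rightarrow> 'c set. (\<forall>n. ideal_in A (I n)) \<longrightarrow> (\<forall>n. I n \<subseteq> I (Suc n)) \<longrightarrow> (\<exists>n. \<forall>k\<ge>n. I k = I n))"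

lemma ideal_in_UNIV: "ideal_in UNIV I \<longleftrightarrow> is_ideal I"
  by (auto simp: ideal_in_def ring_module.subspace_def)

lemma prime_in_UNIV: "prime_in UNIV P \<longleftrightarrow> is_prime_ideal P"
  by (auto simp: prime_in_def is_prime_ideal_def ideal_in_UNIV)

lemma
  assumes "is_subring A"
  shows subring_one: "1 \<in> A" and subring_zero: "0 \<in> A"
    and subring_diff: "x \<in> A \<Longrightarrow> y \<in> A \<Longrightarrow> x - y \<in> A"
    and subring_mult: "x \<in> A \<Longrightarrow> y \<in> A \<Longrightarrow> x * y \<in> A"
    and subring_uminus: "x \<in> A \<Longrightarrow> - x \<in> A"
    and subring_add: "x \<in> A \<Longrightarrow> y \<in> A \<Longrightarrow> x + y \<in> A"
proof -
  show 1: "1 \<in> A" and d: "x \<in> A \<Longrightarrow> y \<in> A \<Longrightarrow> x - y \<in> A" "x \<in> A \<Longrightarrow> y \<in> A \<Longrightarrow> x * y \<in> A" for x y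
    using assms unfolding is_subring_def by blast+
  have "1 - 1 \<in> A" using 1 d(1) by blast
  then show 0: "0 \<in> A" by simp
  show m: "- x \<in> A" if "x \<in> A" for x using d(1)[OF 0 that] by simp
  show "x + y \<in> A" if "x \<in> A" "y \<in> A" using d(1)[OF that(1) m[OF that(2)]] by simp
qed

lemma
  assumes "ideal_in A I"
  shows ideal_in_sub: "x \<in> I \<Longrightarrow> x \<in> A" and ideal_in_zero: "0 \<in> I"
    and ideal_in_add: "x \<in> I \<Longrightarrow> y \<in> I \<Longrightarrow> x + y \<in> I"
    and ideal_in_mult: "a \<in> A \<Longrightarrow> x \<in> I \<Longrightarrow> a * x \<in> I"
  using assms unfolding ideal_in_def by blast+

lemma ideal_in_diff:
  assumes "is_subring A" "ideal_in A I" "x \<in> I" "y \<in> I"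
  shows "x - y \<in> I"
proof -
  have "- 1 \<in> A" using assms(1) subring_one subring_uminus by blast
  then have "(- 1) * y \<in> I" using ideal_in_mult[OF assms(2)] assms(4) by blast
  then show ?thesis using ideal_in_add[OF assms(2,3)] by fastforce
qed

lemma noetherian_subring_UNIV:
  assumes "is_noetherian TYPE('a::comm_ring_1)"
  shows "noetherian_subring (UNIV :: 'a set)"
  unfolding noetherian_subring_def
proof (intro conjI allI impI)
  fix I :: "nat \<Rightarrow> 'a set" assume "\<forall>n. ideal_in UNIV (I n)" "\<forall>n. I n \<subseteq> I (Suc n)"
  then show "\<exists>n. \<forall>k\<ge>n. I k = I n"
    using ideal_acc[OF assms, of I] unfolding ideal_in_UNIV by simp
qed (simp add: is_subring_def)

lemma noetherian_subringD:
  "noetherian_subring A \<Longrightarrow> (\<And>n. ideal_in A (I n)) \<Longrightarrow> (\<And>n. I n \<subseteq> I (Suc n)) \<Longrightarrow> \<exists>n. \<forall>k\<ge>n. I k = I n"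
  by (simp add: noetherian_subring_def)

text \<open>An ideal of the image is the image of its preimage, so ascending chains can be tested in
  \<open>'a\<close>. Applied to the embeddings of the constants into polynomial rings.\<close>

lemma noetherian_subring_range:
  fixes h :: "'a::comm_ring_1 \<Rightarrow> 'c::comm_ring_1"
  assumes N: "noetherian_subring (UNIV :: 'a set)"
    and h: "h 1 = 1" "\<And>x y. h (x - y) = h x - h y" "\<And>x y. h (x * y) = h x * h y"
  shows "noetherian_subring (range h)"
  unfolding noetherian_subring_def
proof (intro conjI allI impI)
  show "is_subring (range h)"
    unfolding is_subring_def using h by (auto simp flip: h)
  have h0: "h 0 = 0" using h(2)[of 0 0] by simp
  have ha: "h (x + y) = h x + h y" for x y
    using h(2)[of x "- y"] h(2)[of 0 y] h0 by simp
  fix I :: "nat \<Rightarrow> 'c set" assume I: "\<forall>n. ideal_in (range h) (I n)" "\<forall>n. I n \<subseteq> I (Suc n)"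
  have "ideal_in UNIV (h -` I n)" for n
    using I(1)[THEN spec, of n] unfolding ideal_in_def by (auto simp: h0 ha h(3))
  moreover have "h -` I n \<subseteq> h -` I (Suc n)" for n using I(2) by blast
  ultimately have "\<exists>n. \<forall>k\<ge>n. h -` I k = h -` I n" by (rule noetherian_subringD[OF N])
  then obtain n where n: "\<forall>k\<ge>n. h -` I k = h -` I n" by (elim exE)
  have "I k = h ` (h -` I k)" for k
    using I(1)[THEN spec, of k] unfolding ideal_in_def by blast
  then have "\<forall>k\<ge>n. I k = I n" using n by metis
  then show "\<exists>n. \<forall>k\<ge>n. I k = I n" by blast
qed

section \<open>Adjoining an element and the basis theorem\<close>

primrec polys_below :: "'c::comm_ring_1 set \<Rightarrow> 'c \<Rightarrow> nat \<Rightarrow> 'c set" where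
  "polys_below A x 0 = {0}"
| "polys_below A x (Suc j) = {a * x ^ j + y | a y. a \<in> A \<and> y \<in> polys_below A x j}"

definition adjoin :: "'c::comm_ring_1 set \<Rightarrow> 'c \<Rightarrow> 'c set" where
  "adjoin A x = (\<Union>j. polys_below A x j)"

context
  fixes A :: "'c::comm_ring_1 set" and x :: 'c
  assumes A: "is_subring A"
begin

lemma polys_below_zero: "0 \<in> polys_below A x j"
proof (induction j)
  case (Suc j)
  have "0 * x ^ j + 0 \<in> polys_below A x (Suc j)"
    unfolding polys_below.simps(2) using Suc subring_zero[OF A] by blast
  then show ?case by simp
qed simp

lemma polys_below_mono:
  assumes "i \<le> j"
  shows "polys_below A x i \<subseteq> polys_below A x j"
proof (rule lift_Suc_mono_le[of "polys_below A x", OF _ assms])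
  fix j show "polys_below A x j \<subseteq> polys_below A x (Suc j)"
  proof
    fix y assume y: "y \<in> polys_below A x j"
    have "0 * x ^ j + y \<in> polys_below A x (Suc j)"
      unfolding polys_below.simps(2) using y subring_zero[OF A] by blast
    then show "y \<in> polys_below A x (Suc j)" by simp
  qed
qed

lemma polys_below_diff:
  "y \<in> polys_below A x j \<Longrightarrow> z \<in> polys_below A x j \<Longrightarrow> y - z \<in> polys_below A x j"
proof (induction j arbitrary: y z)
  case (Suc j)
  obtain a u where 1: "y = a * x ^ j + u" "a \<in> A" "u \<in> polys_below A x j" using Suc.prems(1) by auto
  obtain b v where 2: "z = b * x ^ j + v" "b \<in> A" "v \<in> polys_below A x j" using Suc.prems(2) by auto
  have "y - z = (a - b) * x ^ j + (u - v)" using 1 2 by (simp add: algebra_simps)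
  moreover have "a - b \<in> A" "u - v \<in> polys_below A x j"
    using 1 2 Suc.IH subring_diff[OF A] by auto
  ultimately show ?case by auto
qed simp

lemma polys_below_add:
  assumes "y \<in> polys_below A x j" "z \<in> polys_below A x j"
  shows "y + z \<in> polys_below A x j"
  using polys_below_diff[OF assms(1) polys_below_diff[OF polys_below_zero assms(2)]] by simp

lemma polys_below_smult: "a \<in> A \<Longrightarrow> y \<in> polys_below A x j \<Longrightarrow> a * y \<in> polys_below A x j"
proof (induction j arbitrary: y)
  case (Suc j)
  obtain b u where 1: "y = b * x ^ j + u" "b \<in> A" "u \<in> polys_below A x j" using Suc.prems(2) by auto
  have "a * y = (a * b) * x ^ j + a * u" using 1 by (simp add: algebra_simps)
  moreover have "a * b \<in> A" "a * u \<in> polys_below A x j" using 1 Suc subring_mult[OF A] by auto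
  ultimately show ?case by auto
qed simp

lemma polys_below_shift: "y \<in> polys_below A x j \<Longrightarrow> x ^ i * y \<in> polys_below A x (i + j)"
proof (induction j arbitrary: y)
  case 0
  then show ?case using polys_below_zero by simp
next
  case (Suc j)
  obtain b u where 1: "y = b * x ^ j + u" "b \<in> A" "u \<in> polys_below A x j" using Suc.prems by auto
  have "x ^ i * y = b * x ^ (i + j) + x ^ i * u" using 1 by (simp add: algebra_simps power_add)
  then show ?case using 1 Suc.IH[of u] by auto
qed

lemma polys_below_mult:
  "y \<in> polys_below A x i \<Longrightarrow> z \<in> polys_below A x j \<Longrightarrow> y * z \<in> polys_below A x (i + j)"
proof (induction i arbitrary: y)
  case 0
  then show ?case using polys_below_zero by simp
next
  case (Suc i)
  obtain a u where 1: "y = a * x ^ i + u" "a \<in> A" "u \<in> polys_below A x i" using Suc.prems(1) by auto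
  have "a * (x ^ i * z) \<in> polys_below A x (i + j)"
    using polys_below_smult 1 polys_below_shift Suc.prems by blast
  moreover have "u * z \<in> polys_below A x (i + j)" using Suc 1 by blast
  ultimately have "a * (x ^ i * z) + u * z \<in> polys_below A x (i + j)" by (rule polys_below_add)
  moreover have "y * z = a * (x ^ i * z) + u * z" using 1 by (simp add: algebra_simps)
  ultimately show ?case using polys_below_mono[of "i + j" "Suc i + j"] by auto
qed

lemma subset_adjoin: "A \<subseteq> adjoin A x"
proof
  fix a assume "a \<in> A"
  then have "a * x ^ 0 + 0 \<in> polys_below A x (Suc 0)" by auto
  then have "a \<in> polys_below A x (Suc 0)" by simp
  then show "a \<in> adjoin A x" unfolding adjoin_def by blast
qed

lemma adjoin_self: "x \<in> adjoin A x"
proof -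
  have "1 * x ^ 1 + 0 \<in> polys_below A x (Suc 1)"
    using subring_one[OF A] polys_below_zero[of 1] unfolding polys_below.simps(2)[of A x 1] by blast
  then have "x \<in> polys_below A x (Suc 1)" by simp
  then show ?thesis unfolding adjoin_def by blast
qed

lemma is_subring_adjoin: "is_subring (adjoin A x)"
  unfolding is_subring_def
proof (intro conjI ballI)
  show "1 \<in> adjoin A x" using subset_adjoin subring_one[OF A] by blast
next
  fix y z assume "y \<in> adjoin A x" "z \<in> adjoin A x"
  then obtain i j where ij: "y \<in> polys_below A x i" "z \<in> polys_below A x j" unfolding adjoin_def by blast
  then have "y \<in> polys_below A x (i + j)" "z \<in> polys_below A x (i + j)"
    using polys_below_mono[of i "i + j"] polys_below_mono[of j "i + j"] by auto
  then show "y - z \<in> adjoin A x" using polys_below_diff unfolding adjoin_def by blast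
  show "y * z \<in> adjoin A x" using polys_below_mult[OF ij] unfolding adjoin_def by blast
qed

lemma adjoin_least:
  assumes "is_subring B" "A \<subseteq> B" "x \<in> B"
  shows "adjoin A x \<subseteq> B"
proof -
  have pow: "x ^ j \<in> B" for j
    by (induction j) (use assms subring_one subring_mult in auto)
  have "polys_below A x j \<subseteq> B" for j
  proof (induction j)
    case 0
    then show ?case using subring_zero[OF assms(1)] by simp
  next
    case (Suc j)
    show ?case
    proof
      fix y assume "y \<in> polys_below A x (Suc j)"
      then obtain a u where "y = a * x ^ j + u" "a \<in> A" "u \<in> polys_below A x j" by auto
      then show "y \<in> B" using Suc pow assms subring_add[OF assms(1)] subring_mult[OF assms(1)] by blast
    qed
  qed
  then show ?thesis unfolding adjoin_def by blast
qed

text \<open>Coefficients of \<open>x ^ j\<close> in representations of elements of \<open>I\<close>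
  by polynomials of degree at most \<open>j\<close>. As \<open>x\<close> may be algebraic over
  \<open>A\<close>, one element can have several representations and contribute several leading
  coefficients.\<close>

definition leading_coeffs :: "'c set \<Rightarrow> nat \<Rightarrow> 'c set" where
  "leading_coeffs I j = {a \<in> A. \<exists>y\<in>polys_below A x j. a * x ^ j + y \<in> I}"

lemma ideal_in_leading_coeffs:
  assumes I: "ideal_in (adjoin A x) I"
  shows "ideal_in A (leading_coeffs I j)"
  unfolding ideal_in_def
proof (intro conjI ballI)
  show "leading_coeffs I j \<subseteq> A" unfolding leading_coeffs_def by blast
  have "0 * x ^ j + 0 \<in> I" using ideal_in_zero[OF I] by simp
  then show "0 \<in> leading_coeffs I j"
    using subring_zero[OF A] polys_below_zero unfolding leading_coeffs_def by blast
next
  fix a b assume "a \<in> leading_coeffs I j" "b \<in> leading_coeffs I j"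
  then obtain y z where *: "a \<in> A" "b \<in> A" "y \<in> polys_below A x j" "a * x ^ j + y \<in> I"
    "z \<in> polys_below A x j" "b * x ^ j + z \<in> I" unfolding leading_coeffs_def by blast
  have "(a * x ^ j + y) + (b * x ^ j + z) \<in> I" using * ideal_in_add[OF I] by blast
  then have "(a + b) * x ^ j + (y + z) \<in> I" by (simp add: algebra_simps)
  then show "a + b \<in> leading_coeffs I j"
    using * subring_add[OF A] polys_below_add unfolding leading_coeffs_def by blast
next
  fix a b assume a: "a \<in> A" "b \<in> leading_coeffs I j"
  then obtain z where *: "b \<in> A" "z \<in> polys_below A x j" "b * x ^ j + z \<in> I"
    unfolding leading_coeffs_def by blast
  have "a * (b * x ^ j + z) \<in> I" using * a subset_adjoin ideal_in_mult[OF I] by blast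
  then have "(a * b) * x ^ j + a * z \<in> I" by (simp add: algebra_simps)
  then show "a * b \<in> leading_coeffs I j"
    using * a subring_mult[OF A] polys_below_smult unfolding leading_coeffs_def by blast
qed

lemma leading_coeffs_mono: "I \<subseteq> J \<Longrightarrow> leading_coeffs I j \<subseteq> leading_coeffs J j"
  unfolding leading_coeffs_def by blast

lemma leading_coeffs_Suc:
  assumes I: "ideal_in (adjoin A x) I"
  shows "leading_coeffs I j \<subseteq> leading_coeffs I (Suc j)"
proof
  fix a assume "a \<in> leading_coeffs I j"
  then obtain y where *: "a \<in> A" "y \<in> polys_below A x j" "a * x ^ j + y \<in> I"
    unfolding leading_coeffs_def by blast
  have "x * (a * x ^ j + y) \<in> I" using * adjoin_self ideal_in_mult[OF I] by blast
  then have "a * x ^ Suc j + x * y \<in> I" by (simp add: algebra_simps)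
  moreover have "x * y \<in> polys_below A x (Suc j)" using polys_below_shift[OF *(2), of 1] by simp
  ultimately show "a \<in> leading_coeffs I (Suc j)" using * unfolding leading_coeffs_def by blast
qed

text \<open>Hilbert's basis theorem; \<open>x\<close> need not be transcendental over \<open>A\<close>.\<close>
lemma noetherian_subring_adjoin:
  assumes N: "noetherian_subring A"
  shows "noetherian_subring (adjoin A x)"
  unfolding noetherian_subring_def
proof (intro conjI allI impI is_subring_adjoin)
  fix f :: "nat \<Rightarrow> 'c set"
  assume f0: "\<forall>n. ideal_in (adjoin A x) (f n)" "\<forall>n. f n \<subseteq> f (Suc n)"
  then have f: "ideal_in (adjoin A x) (f n)" for n by blast
  have acc: "\<exists>n. \<forall>k\<ge>n. I k = I n" if "\<And>n. ideal_in A (I n)" "\<And>n. I n \<subseteq> I (Suc n)" for I :: "nat \<Rightarrow> 'c set"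
    using noetherian_subringD[of A I, OF N that] .
  have fm: "f i \<subseteq> f j" if "i \<le> j" for i j
    using lift_Suc_mono_le[of f] f0(2) that by blast
  have Lj: "leading_coeffs (f k) i \<subseteq> leading_coeffs (f k) j" if "i \<le> j" for i j k
    using lift_Suc_mono_le[of "leading_coeffs (f k)", OF leading_coeffs_Suc[OF f] that] .
  have L: "leading_coeffs (f k) i \<subseteq> leading_coeffs (f l) j" if "k \<le> l" "i \<le> j" for i j k l
    using Lj[OF that(2), of k] leading_coeffs_mono[OF fm[OF that(1)], of j] by blast
  have "\<exists>n. \<forall>k\<ge>n. leading_coeffs (f k) k = leading_coeffs (f n) n"
    by (rule acc[of "\<lambda>k. leading_coeffs (f k) k"]) (use f ideal_in_leading_coeffs L in auto)
  then obtain k0 where k0: "\<And>k. k \<ge> k0 \<Longrightarrow> leading_coeffs (f k) k = leading_coeffs (f k0) k0" by blast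
  have "\<exists>n. \<forall>k\<ge>n. leading_coeffs (f k) j = leading_coeffs (f n) j" for j
    by (rule acc[of "\<lambda>k. leading_coeffs (f k) j"]) (use f ideal_in_leading_coeffs L in auto)
  then obtain s where s: "\<And>j k. k \<ge> s j \<Longrightarrow> leading_coeffs (f k) j = leading_coeffs (f (s j)) j" by metis
  \<comment> \<open>From \<open>k0\<close> on the diagonal chain is constant, which settles all
    degrees \<open>j\<close> \<ge> \<open>k0\<close> at once. Each of the finitely many smaller
    degrees has its own bound \<open>s j\<close>, and the sum dominates them all.\<close>
  define n where "n = k0 + (\<Sum>j<k0. s j)"
  have eq: "leading_coeffs (f k) j \<subseteq> leading_coeffs (f n) j" if k: "k \<ge> n" for k j
  proof (cases "j < k0")
    case True
    then have "s j \<le> (\<Sum>j<k0. s j)" by (intro member_le_sum) auto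
    then have "s j \<le> n" unfolding n_def by simp
    then show ?thesis using s[of j n] s[of j k] k by simp
  next
    case False
    have "leading_coeffs (f k) j \<subseteq> leading_coeffs (f (max k j)) (max k j)" by (rule L) auto
    also have "\<dots> = leading_coeffs (f k0) k0" using False by (intro k0) simp
    also have "\<dots> \<subseteq> leading_coeffs (f n) j" using False unfolding n_def by (intro L) auto
    finally show ?thesis .
  qed
  have "f k = f n" if k: "k \<ge> n" for k
  proof
    \<comment> \<open>Descent on the degree bound: subtracting an element of \<open>f n\<close> with
      the same leading coefficient leaves an element of \<open>f k\<close> with a smaller
      bound.\<close>
    have "y \<in> f n" if "y \<in> polys_below A x j" "y \<in> f k" for y j
      using that
    proof (induction j arbitrary: y)
      case 0
      then show ?case using ideal_in_zero[OF f] by simp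
    next
      case (Suc j)
      obtain a u where au: "y = a * x ^ j + u" "a \<in> A" "u \<in> polys_below A x j" using Suc.prems(1) by auto
      then have "a \<in> leading_coeffs (f n) j"
        using Suc.prems(2) eq[OF k, of j] unfolding leading_coeffs_def by blast
      then obtain v where v: "v \<in> polys_below A x j" "a * x ^ j + v \<in> f n"
        unfolding leading_coeffs_def by blast
      have "y - (a * x ^ j + v) \<in> f k"
        using ideal_in_diff[OF is_subring_adjoin f] Suc.prems(2) v(2) fm[OF k] by blast
      then have "u - v \<in> f k" using au by simp
      then have "u - v \<in> f n" using Suc.IH polys_below_diff[OF au(3) v(1)] by blast
      then have "(u - v) + (a * x ^ j + v) \<in> f n" using v ideal_in_add[OF f] by blast
      then show ?case using au by (simp add: algebra_simps)
    qed
    then show "f k \<subseteq> f n" using ideal_in_sub[OF f] unfolding adjoin_def by blast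
  qed (rule fm[OF k])
  then show "\<exists>n. \<forall>k\<ge>n. f k = f n" by blast
qed

end

text \<open>The minimality of \<open>B\<close> serves to identify it with a concretely given
  subring: for one of the two inclusions it is enough to look at the elements of \<open>A\<close>
  and of \<open>X\<close>.\<close>

lemma adjoin_finite:
  fixes A :: "'c::comm_ring_1 set"
  assumes "noetherian_subring A" "finite X"
  shows "\<exists>B. noetherian_subring B \<and> A \<subseteq> B \<and> X \<subseteq> B \<and>
    (\<forall>C. is_subring C \<longrightarrow> A \<subseteq> C \<longrightarrow> X \<subseteq> C \<longrightarrow> B \<subseteq> C)"
  using assms(2)
proof induction
  case empty
  then show ?case using assms(1) by blast
next
  case (insert x X)
  then obtain B where B: "noetherian_subring B" "A \<subseteq> B" "X \<subseteq> B"
    "\<And>C. is_subring C \<Longrightarrow> A \<subseteq> C \<Longrightarrow> X \<subseteq> C \<Longrightarrow> B \<subseteq> C" by blast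
  have sB: "is_subring B" using B(1) unfolding noetherian_subring_def by blast
  have "noetherian_subring (adjoin B x)" using noetherian_subring_adjoin[OF sB B(1)] .
  moreover have "A \<subseteq> adjoin B x" "insert x X \<subseteq> adjoin B x"
    using subset_adjoin[OF sB] adjoin_self[OF sB] B by blast+
  moreover have "adjoin B x \<subseteq> C" if "is_subring C" "A \<subseteq> C" "insert x X \<subseteq> C" for C
    using adjoin_least[OF sB that(1)] B(4)[of C] that by blast
  ultimately show ?case by blast
qed

lemma noetherian_ideal_induct [consumes 2, case_names step]:
  assumes N: "noetherian_subring A" and "ideal_in A L"
    and step: "\<And>L. ideal_in A L \<Longrightarrow> (\<And>K. ideal_in A K \<Longrightarrow> L \<subset> K \<Longrightarrow> P K) \<Longrightarrow> P L"
  shows "P L"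
proof -
  define R where "R = {(K, J). ideal_in A J \<and> ideal_in A K \<and> J \<subset> K}"
  have "wf R"
    unfolding wf_iff_no_infinite_down_chain
  proof
    assume "\<exists>f. \<forall>i. (f (Suc i), f i) \<in> R"
    then obtain f where "\<forall>i. (f (Suc i), f i) \<in> R" by blast
    then have f: "ideal_in A (f i)" "f i \<subset> f (Suc i)" for i unfolding R_def by auto
    have "f i \<subseteq> f (Suc i)" for i by (rule psubset_imp_subset[OF f(2)])
    from noetherian_subringD[of A f, OF N f(1) this] obtain n where "\<forall>k\<ge>n. f k = f n" by (elim exE)
    then have "f (Suc n) = f n" by (meson le_Suc_eq order_refl)
    then show False using f(2)[of n] by simp
  qed
  then show ?thesis using assms(2)
  proof (induction L rule: wf_induct_rule)
    case (less J)
    show ?case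
      by (rule step[OF less.prems]) (use less in \<open>auto simp: R_def\<close>)
  qed
qed

section \<open>Zero divisors modulo an ideal and products of primes\<close>

definition colon_in :: "'c::comm_ring_1 set \<Rightarrow> 'c set \<Rightarrow> 'c \<Rightarrow> 'c set" where
  "colon_in A L z = {c \<in> A. c * z \<in> L}"

definition add_principal :: "'c::comm_ring_1 set \<Rightarrow> 'c set \<Rightarrow> 'c \<Rightarrow> 'c set" where
  "add_principal A L z = {l + c * z | l c. l \<in> L \<and> c \<in> A}"

lemma ideal_in_colon:
  assumes "is_subring A" "ideal_in A L" "z \<in> A"
  shows "ideal_in A (colon_in A L z)" "L \<subseteq> colon_in A L z"
proof -
  show "ideal_in A (colon_in A L z)"
    unfolding ideal_in_def colon_in_def using assms
    by (auto simp: distrib_right mult.assoc intro: subring_zero subring_add subring_mult ideal_in_zero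
        ideal_in_add ideal_in_mult)
  show "L \<subseteq> colon_in A L z"
    unfolding colon_in_def using assms ideal_in_sub[OF assms(2)] ideal_in_mult[OF assms(2,3)]
    by (auto simp: mult.commute)
qed

lemma ideal_in_add_principal:
  assumes "is_subring A" "ideal_in A L" "z \<in> A"
  shows "ideal_in A (add_principal A L z)" "L \<subseteq> add_principal A L z" "z \<in> add_principal A L z"
proof -
  show L: "L \<subseteq> add_principal A L z"
  proof
    fix l assume "l \<in> L"
    then have "l + 0 * z \<in> add_principal A L z"
      unfolding add_principal_def using subring_zero[OF assms(1)] by blast
    then show "l \<in> add_principal A L z" by simp
  qed
  have "0 + 1 * z \<in> add_principal A L z"
    unfolding add_principal_def using subring_one[OF assms(1)] ideal_in_zero[OF assms(2)] by blast
  then show "z \<in> add_principal A L z" by simp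
  show "ideal_in A (add_principal A L z)"
    unfolding ideal_in_def
  proof (intro conjI ballI)
    show "add_principal A L z \<subseteq> A"
      unfolding add_principal_def using assms(3) ideal_in_sub[OF assms(2)] subring_add[OF assms(1)]
        subring_mult[OF assms(1)] by blast
    show "0 \<in> add_principal A L z" using L ideal_in_zero[OF assms(2)] by blast
  next
    fix x y assume "x \<in> add_principal A L z" "y \<in> add_principal A L z"
    then obtain l c l' c' where *: "x = l + c * z" "y = l' + c' * z" "l \<in> L" "l' \<in> L" "c \<in> A" "c' \<in> A"
      unfolding add_principal_def by blast
    have "x + y = (l + l') + (c + c') * z" using * by (simp add: algebra_simps)
    then show "x + y \<in> add_principal A L z"
      unfolding add_principal_def using * ideal_in_add[OF assms(2)] subring_add[OF assms(1)] by blast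
  next
    fix a x assume a: "a \<in> A" and "x \<in> add_principal A L z"
    then obtain l c where *: "x = l + c * z" "l \<in> L" "c \<in> A" unfolding add_principal_def by blast
    have "a * x = a * l + (a * c) * z" using * by (simp add: algebra_simps)
    then show "a * x \<in> add_principal A L z"
      unfolding add_principal_def using * a ideal_in_mult[OF assms(2)] subring_mult[OF assms(1)] by blast
  qed
qed

lemma not_prime_in:
  assumes "is_subring A" "ideal_in A L" "L \<noteq> A" "\<not> prime_in A L"
  obtains z w where "z \<in> A" "w \<in> A" "z \<notin> L" "w \<notin> L" "z * w \<in> L"
  using assms unfolding prime_in_def by blast

text \<open>Generators of the \<open>k\<close>-th power of the ideal generated by \<open>X\<close>:
  that \<open>s * y\<close> \<in> \<open>L\<close> for all \<open>s\<close> in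
  \<open>products X k\<close> says that \<open>y\<close> lies in the colon of \<open>L\<close> by
  this power.\<close>

primrec products :: "'c::comm_ring_1 set \<Rightarrow> nat \<Rightarrow> 'c set" where
  "products X 0 = {1}"
| "products X (Suc k) = {s * t | s t. s \<in> X \<and> t \<in> products X k}"

lemma products_add:
  "u \<in> products X (k + l) \<Longrightarrow> \<exists>s\<in>products X k. \<exists>t\<in>products X l. u = s * t"
proof (induction k arbitrary: u)
  case (Suc k)
  then obtain s v where "u = s * v" "s \<in> X" "v \<in> products X (k + l)" by auto
  moreover then obtain s' t where "s' \<in> products X k" "t \<in> products X l" "v = s' * t" using Suc.IH by blast
  ultimately have "u = (s * s') * t" "s * s' \<in> products X (Suc k)" by (auto simp: mult.assoc)
  then show ?case using \<open>t \<in> products X l\<close> by blast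
qed auto

lemma products_subring: "is_subring A \<Longrightarrow> X \<subseteq> A \<Longrightarrow> products X k \<subseteq> A"
  by (induction k) (auto intro: subring_one subring_mult)

text \<open>If \<open>zw \<in> L\<close> with \<open>z, w \<notin> L\<close>, the claim for \<open>L\<close> follows from those for the larger ideals
  \<open>L + (z)\<close> and \<open>L : z\<close>.\<close>
lemma finitely_many_primes_cover_zero_divisors:
  assumes N: "noetherian_subring A" and X: "X \<subseteq> A" and L: "ideal_in A L"
  obtains Ps k where "finite Ps" "\<And>P. P \<in> Ps \<Longrightarrow> prime_in A P \<and> \<not> X \<subseteq> P"
    "\<And>b y s. b \<in> A \<Longrightarrow> b \<notin> \<Union>Ps \<Longrightarrow> y \<in> A \<Longrightarrow> b * y \<in> L \<Longrightarrow> s \<in> products X k \<Longrightarrow> s * y \<in> L"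
proof -
  have A: "is_subring A" using N unfolding noetherian_subring_def by blast
  define Q where "Q L = (\<exists>Ps k. finite Ps \<and> (\<forall>P\<in>Ps. prime_in A P \<and> \<not> X \<subseteq> P) \<and>
    (\<forall>b y s. b \<in> A \<longrightarrow> b \<notin> \<Union>Ps \<longrightarrow> y \<in> A \<longrightarrow> b * y \<in> L \<longrightarrow> s \<in> products X k \<longrightarrow> s * y \<in> L))" for L
  have "Q L" using N L
  proof (induction rule: noetherian_ideal_induct)
    case (step L)
    show ?case
    proof (cases "L = A \<or> prime_in A L")
      case True
      then consider "L = A" | "prime_in A L" "X \<subseteq> L" | "prime_in A L" "\<not> X \<subseteq> L" by blast
      then show ?thesis
      proof cases
        case 1
        show ?thesis unfolding Q_def by (rule exI[of _ "{}"], rule exI[of _ 0]) (use 1 in simp)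
      next
        case 2
        have "s * y \<in> L" if "y \<in> A" "s \<in> products X (Suc 0)" for s y
          using that 2 ideal_in_mult[OF step(1), of y s] by (auto simp: mult.commute)
        then show ?thesis unfolding Q_def
          by (intro exI[of _ "{}"] exI[of _ "Suc 0"]) auto
      next
        case 3
        have "s * y \<in> L" if "b \<in> A" "b \<notin> \<Union>{L}" "y \<in> A" "b * y \<in> L" "s \<in> products X 0" for b y s
        proof -
          have "y \<in> L" using that(1-4) 3(1) unfolding prime_in_def by blast
          then show ?thesis using that(5) by simp
        qed
        then show ?thesis unfolding Q_def
          using 3 by (intro exI[of _ "{L}"] exI[of _ 0] conjI) (simp, simp, blast)
      qed
    next
      case False
      then obtain z w where zw: "z \<in> A" "w \<in> A" "z \<notin> L" "w \<notin> L" "z * w \<in> L"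
        using not_prime_in[OF A step(1)] by blast
      note col = ideal_in_colon[OF A step(1) zw(1)]
      note add = ideal_in_add_principal[OF A step(1) zw(1)]
      have "w \<in> colon_in A L z" using zw unfolding colon_in_def by (simp add: mult.commute)
      then have "Q (colon_in A L z)" using step(2)[OF col(1)] col(2) zw(4) by blast
      then obtain P1 k1 where 1: "finite P1" "\<forall>P\<in>P1. prime_in A P \<and> \<not> X \<subseteq> P"
        "\<And>b y s. b \<in> A \<Longrightarrow> b \<notin> \<Union>P1 \<Longrightarrow> y \<in> A \<Longrightarrow> b * y \<in> colon_in A L z \<Longrightarrow> s \<in> products X k1 \<Longrightarrow>
          s * y \<in> colon_in A L z"
        unfolding Q_def by blast
      have "Q (add_principal A L z)" using step(2)[OF add(1)] add(2,3) zw(3) by blast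
      then obtain P2 k2 where 2: "finite P2" "\<forall>P\<in>P2. prime_in A P \<and> \<not> X \<subseteq> P"
        "\<And>b y s. b \<in> A \<Longrightarrow> b \<notin> \<Union>P2 \<Longrightarrow> y \<in> A \<Longrightarrow> b * y \<in> add_principal A L z \<Longrightarrow> s \<in> products X k2 \<Longrightarrow>
          s * y \<in> add_principal A L z"
        unfolding Q_def by blast
      have "s * y \<in> L" if b: "b \<in> A" "b \<notin> \<Union>(P1 \<union> P2)" and y: "y \<in> A" "b * y \<in> L"
        and s: "s \<in> products X (k1 + k2)" for b y s
      proof -
        obtain s1 s2 where s12: "s1 \<in> products X k1" "s2 \<in> products X k2" "s = s1 * s2"
          using products_add[OF s] by blast
        have sA: "s1 \<in> A" "s2 \<in> A" using s12 products_subring[OF A X] by blast+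
        have "s2 * y \<in> add_principal A L z" using 2(3)[OF b(1) _ y(1) _ s12(2)] b(2) y(2) add(2) by blast
        then obtain l c where lc: "s2 * y = l + c * z" "l \<in> L" "c \<in> A" unfolding add_principal_def by blast
        \<comment> \<open>The relation \<open>b * y\<close> \<in> \<open>L\<close> passes to the
          coefficient \<open>c\<close> of \<open>z\<close> in \<open>s2 * y\<close>:
          \<open>b * c * z\<close> \<in> \<open>L\<close>. Hence multiplication by \<open>s1\<close>
          moves \<open>c\<close> into the colon ideal.\<close>
        have "s2 * (b * y) - b * l \<in> L"
          using ideal_in_diff[OF A step(1)] ideal_in_mult[OF step(1)] sA y b lc by blast
        moreover have "s2 * (b * y) = b * (l + c * z)" unfolding lc(1)[symmetric] by (simp add: algebra_simps)
        ultimately have "(b * c) * z \<in> L" by (simp add: algebra_simps)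
        then have "b * c \<in> colon_in A L z" using b lc subring_mult[OF A] unfolding colon_in_def by blast
        then have "s1 * c \<in> colon_in A L z" using 1(3)[OF b(1) _ lc(3) _ s12(1)] b(2) by blast
        then have "s1 * c * z \<in> L" unfolding colon_in_def by blast
        moreover have "s1 * l \<in> L" using ideal_in_mult[OF step(1)] sA lc by blast
        ultimately have "s1 * l + s1 * c * z \<in> L" using ideal_in_add[OF step(1)] by blast
        moreover have "s * y = s1 * (s2 * y)" unfolding s12(3) by (simp add: mult.assoc)
        then have "s * y = s1 * l + s1 * c * z" unfolding lc(1) by (simp add: algebra_simps)
        ultimately show ?thesis by simp
      qed
      then show ?thesis unfolding Q_def
        using 1(1,2) 2(1,2) by (intro exI[of _ "P1 \<union> P2"] exI[of _ "k1 + k2"]) blast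
    qed
  qed
  then show ?thesis using that unfolding Q_def by metis
qed

text \<open>A substitute for the finiteness of the minimal primes of \<open>L\<close>. If
  \<open>z * w\<close> \<in> \<open>L\<close> with both factors outside, then \<open>L\<close>
  contains the product of the larger ideals \<open>L\<close> + (z) and \<open>L\<close> + (w), so
  the two lists of primes can be concatenated. The product ideal appears through its elements, with
  one factor from each entry of the list.\<close>

lemma product_of_primes:
  fixes L :: "'a::comm_ring_1 set"
  assumes "is_noetherian TYPE('a)" "is_ideal L"
  shows "\<exists>ps. (\<forall>P\<in>set ps. is_prime_ideal P \<and> L \<subseteq> P) \<and> (\<forall>ys. list_all2 (\<in>) ys ps \<longrightarrow> prod_list ys \<in> L)"
proof -
  have A: "is_subring (UNIV :: 'a set)" by (simp add: is_subring_def)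
  show ?thesis
    using noetherian_subring_UNIV[OF assms(1)] assms(2)[folded ideal_in_UNIV]
  proof (induction rule: noetherian_ideal_induct)
    case (step L)
    consider "L = UNIV" | "is_prime_ideal L" | "L \<noteq> UNIV" "\<not> prime_in UNIV L"
      unfolding prime_in_UNIV by blast
    then show ?case
    proof cases
      case 1
      then show ?thesis by (intro exI[of _ "[]"]) auto
    next
      case 2
      then show ?thesis by (intro exI[of _ "[L]"]) (auto simp: list_all2_Cons2)
    next
      case 3
      then obtain z w where zw: "z \<notin> L" "w \<notin> L" "z * w \<in> L"
        by (rule not_prime_in[OF A step(1)])
      note Z = ideal_in_add_principal[OF A step(1), of z] and W = ideal_in_add_principal[OF A step(1), of w]
      have "L \<subset> add_principal UNIV L z" "L \<subset> add_principal UNIV L w"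
        using Z(2,3) W(2,3) zw(1,2) by auto
      note IH = step(2)[OF Z(1)[OF UNIV_I] this(1)] step(2)[OF W(1)[OF UNIV_I] this(2)]
      from IH(1) obtain p1 where p1: "\<forall>P\<in>set p1. is_prime_ideal P \<and> add_principal UNIV L z \<subseteq> P"
        "\<forall>ys. list_all2 (\<in>) ys p1 \<longrightarrow> prod_list ys \<in> add_principal UNIV L z" by (elim exE conjE)
      from IH(2) obtain p2 where p2: "\<forall>P\<in>set p2. is_prime_ideal P \<and> add_principal UNIV L w \<subseteq> P"
        "\<forall>ys. list_all2 (\<in>) ys p2 \<longrightarrow> prod_list ys \<in> add_principal UNIV L w" by (elim exE conjE)
      have "prod_list ys \<in> L" if "list_all2 (\<in>) ys (p1 @ p2)" for ys
      proof -
        obtain y1 y2 where y: "ys = y1 @ y2" "list_all2 (\<in>) y1 p1" "list_all2 (\<in>) y2 p2"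
          using \<open>list_all2 (\<in>) ys (p1 @ p2)\<close> unfolding list_all2_append2 by blast
        obtain l c where lc: "prod_list y1 = l + c * z" "l \<in> L"
          using p1(2) y(2) unfolding add_principal_def by blast
        obtain l' c' where lc': "prod_list y2 = l' + c' * w" "l' \<in> L"
          using p2(2) y(3) unfolding add_principal_def by blast
        have "prod_list ys = (l' + c' * w) * l + (c * z) * l' + (c * c') * (z * w)"
          unfolding y(1) prod_list.append lc lc' by (simp add: algebra_simps)
        then show ?thesis
          using ideal_in_mult[OF step(1)] ideal_in_add[OF step(1)] lc(2) lc'(2) zw(3) by simp
      qed
      moreover have "\<forall>P\<in>set (p1 @ p2). is_prime_ideal P \<and> L \<subseteq> P"
      proof
        fix P assume "P \<in> set (p1 @ p2)"
        then consider "P \<in> set p1" | "P \<in> set p2" by auto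
        then show "is_prime_ideal P \<and> L \<subseteq> P"
        proof cases
          case 1
          then show ?thesis using p1(1) Z(2)[OF UNIV_I] by (meson subset_trans)
        next
          case 2
          then show ?thesis using p2(1) W(2)[OF UNIV_I] by (meson subset_trans)
        qed
      qed
      ultimately show ?thesis by blast
    qed
  qed
qed

lemma prime_ideal_prod_list:
  "is_prime_ideal P \<Longrightarrow> prod_list ys \<in> P \<Longrightarrow> \<exists>y\<in>set ys. y \<in> P"
proof (induction ys)
  case Nil
  have "is_ideal P" using Nil(1) unfolding is_prime_ideal_def by blast
  then have "c * 1 \<in> P" for c using Nil(2) ring_module.subspace_scale[of P 1 c] by simp
  then have "P = UNIV" by auto
  then show ?case using Nil(1) unfolding is_prime_ideal_def by blast
qed (auto simp: is_prime_ideal_def)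

text \<open>Otherwise a factor outside \<open>Q\<close> could be chosen from every listed prime,
  while the product of these factors lies in \<open>Q\<close>. Thus avoiding the finitely many
  primes in \<open>ps\<close> controls all primes above \<open>L\<close>.\<close>

lemma prime_contains_factor:
  assumes "is_prime_ideal Q" "L \<subseteq> Q" "\<forall>ys. list_all2 (\<in>) ys ps \<longrightarrow> prod_list ys \<in> L"
  obtains P where "P \<in> set ps" "P \<subseteq> Q"
proof -
  have "\<exists>P\<in>set ps. P \<subseteq> Q"
  proof (rule ccontr)
    assume "\<not> ?thesis"
    then have "\<forall>P\<in>set ps. \<exists>y. y \<in> P \<and> y \<notin> Q" by blast
    then obtain f where f: "\<forall>P\<in>set ps. f P \<in> P \<and> f P \<notin> Q" by (rule bchoice[THEN exE])
    have "list_all2 (\<in>) (map f ps) ps" using f by (simp add: list_all2_conv_all_nth)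
    then have "prod_list (map f ps) \<in> Q" using assms by blast
    then show False using prime_ideal_prod_list[OF assms(1)] f by fastforce
  qed
  then show ?thesis using that by blast
qed

section \<open>Powers of ideals and the Artin-Rees lemma\<close>

lemma is_ideal_colon:
  assumes "is_ideal I"
  shows "is_ideal {a. a * e \<in> I}" "is_ideal {a. e * a \<in> I}"
proof -
  show "is_ideal {a. a * e \<in> I}"
    unfolding ring_module.subspace_def
  proof (intro conjI ballI allI CollectI)
    show "0 * e \<in> I" using ring_module.subspace_0[OF assms] by simp
    show "(x + y) * e \<in> I" if "x \<in> {a. a * e \<in> I}" "y \<in> {a. a * e \<in> I}" for x y
      using that ring_module.subspace_add[OF assms] by (simp add: distrib_right)
    show "c * x * e \<in> I" if "x \<in> {a. a * e \<in> I}" for c x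
      using that ring_module.subspace_scale[OF assms, of "x * e" c] by (simp add: mult.assoc)
  qed
  then show "is_ideal {a. e * a \<in> I}" by (simp add: mult.commute)
qed

primrec power_mult :: "'a::comm_ring_1 set \<Rightarrow> nat \<Rightarrow> 'a set \<Rightarrow> 'a set" where
  "power_mult J 0 X = X"
| "power_mult J (Suc n) X = ideal_mult (*) J (power_mult J n X)"

abbreviation ideal_power :: "'a::comm_ring_1 set \<Rightarrow> nat \<Rightarrow> 'a set" where
  "ideal_power J n \<equiv> power_mult J n UNIV"

lemma is_ideal_power_mult: "is_ideal X \<Longrightarrow> is_ideal (power_mult J n X)"
  by (cases n) (auto simp: ring_module.subspace_ideal_mult)

lemma is_ideal_power: "is_ideal (ideal_power J n)"
  by (rule is_ideal_power_mult) (rule ring_module.subspace_UNIV)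

lemma power_mult_mono: "X \<subseteq> Y \<Longrightarrow> power_mult J n X \<subseteq> power_mult J n Y"
  by (induction n) (auto intro: ring_module.ideal_mult_mono[THEN subsetD, OF order_refl])

lemma power_mult_add: "power_mult J (m + n) X = power_mult J m (power_mult J n X)"
  by (induction m) auto

lemma power_mult_le: "is_ideal X \<Longrightarrow> power_mult J n X \<subseteq> X"
proof (induction n)
  case (Suc n)
  have "ideal_mult (*) J (power_mult J n X) \<subseteq> power_mult J n X"
    by (rule ring_module.ideal_mult_le_self[OF is_ideal_power_mult[OF Suc.prems]])
  then show ?case using Suc by auto
qed simp

lemma ideal_power_antimono:
  assumes "m \<le> n"
  shows "ideal_power J n \<subseteq> ideal_power J m"
proof -
  obtain k where "n = k + m" using assms by (metis add.commute le_Suc_ex)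
  then show ?thesis using power_mult_le[OF is_ideal_power, of J k J m] by (simp add: power_mult_add)
qed

lemma power_mult_times:
  assumes X: "is_ideal X" and "a \<in> power_mult J s Y" "\<And>y. y \<in> Y \<Longrightarrow> y * e \<in> X"
  shows "a * e \<in> power_mult J s X"
  using assms(2)
proof (induction s arbitrary: a)
  case 0
  then show ?case using assms(3) by simp
next
  case (Suc s)
  let ?N = "{a. a * e \<in> power_mult J (Suc s) X}"
  note I = is_ideal_power_mult[OF X, of J "Suc s"]
  have "is_ideal ?N" by (rule is_ideal_colon(1)[OF I])
  then have "ideal_mult (*) J (power_mult J s Y) \<subseteq> ?N"
  proof (rule ring_module.ideal_mult_le)
    fix c x assume "c \<in> J" "x \<in> power_mult J s Y"
    then have "c * (x * e) \<in> power_mult J (Suc s) X"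
      using Suc.IH ring_module.ideal_mult_base[of c J] by simp
    then show "c * x \<in> ?N" by (simp only: mem_Collect_eq mult.assoc)
  qed
  then show ?case using Suc.prems by auto
qed

lemma ideal_power_times:
  assumes "a \<in> ideal_power J m" "b \<in> ideal_power J n"
  shows "a * b \<in> ideal_power J (m + n)"
  unfolding power_mult_add
  using power_mult_times[OF is_ideal_power assms(1)] assms(2) ring_module.subspace_scale[OF is_ideal_power]
  by blast

lemma ideal_power_base: "a \<in> J \<Longrightarrow> b \<in> ideal_power J n \<Longrightarrow> a * b \<in> ideal_power J (Suc n)"
  using ring_module.ideal_mult_base[of a J b] by simp

lemma ideal_power_le:
  assumes "is_ideal L" "\<And>ys. list_all2 (\<in>) ys (replicate N X) \<Longrightarrow> prod_list ys \<in> L"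
  shows "ideal_power X N \<subseteq> L"
  using assms
proof (induction N arbitrary: L)
  case 0
  have "c * 1 \<in> L" for c using 0(2)[of "[]"] ring_module.subspace_scale[OF 0(1), of 1] by simp
  then show ?case by auto
next
  case (Suc N)
  show ?case
    unfolding power_mult.simps
  proof (rule ring_module.ideal_mult_le[OF Suc.prems(1)])
    fix c x assume c: "c \<in> X" and x: "x \<in> ideal_power X N"
    have "ideal_power X N \<subseteq> {x. c * x \<in> L}"
    proof (rule Suc.IH)
      show "is_ideal {x. c * x \<in> L}" by (rule is_ideal_colon(2)[OF Suc.prems(1)])
    next
      fix ys assume "list_all2 (\<in>) ys (replicate N X)"
      then show "prod_list ys \<in> {x. c * x \<in> L}" using Suc.prems(2)[of "c # ys"] c by simp
    qed
    then show "c * x \<in> L" using x by blast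
  qed
qed

text \<open>The Rees ring of the single ideal \<open>J\<close>, the sum of the J^n t^n inside R[t].
  It serves the Artin-Rees lemma; the algebra attached to the family of modules is
  \<open>rees_algebra\<close>.\<close>

definition rees_ring :: "'a::comm_ring_1 set \<Rightarrow> 'a poly set" where
  "rees_ring J = {p. \<forall>n. coeff p n \<in> ideal_power J n}"

lemma is_subring_rees_ring: "is_subring (rees_ring J)"
  unfolding is_subring_def
proof (intro conjI ballI)
  show "1 \<in> rees_ring J"
    unfolding rees_ring_def using ring_module.subspace_0[OF is_ideal_power]
    by (auto simp: coeff_1)
  fix p q assume pq: "p \<in> rees_ring J" "q \<in> rees_ring J"
  have "coeff (p - q) n \<in> ideal_power J n" for n
    using pq ring_module.subspace_diff[OF is_ideal_power, of "coeff p n" J n "coeff q n"]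
    unfolding rees_ring_def by simp
  then show "p - q \<in> rees_ring J" unfolding rees_ring_def by blast
  have "coeff (p * q) n \<in> ideal_power J n" for n
    unfolding coeff_mult
  proof (rule ring_module.subspace_sum[OF is_ideal_power])
    fix i assume "i \<in> {..n}"
    then show "coeff p i * coeff q (n - i) \<in> ideal_power J n"
      using pq ideal_power_times[of "coeff p i" J i "coeff q (n - i)" "n - i"] unfolding rees_ring_def by simp
  qed
  then show "p * q \<in> rees_ring J" unfolding rees_ring_def by blast
qed

lemma monom_in_rees_ring: "c \<in> ideal_power J n \<Longrightarrow> monom c n \<in> rees_ring J"
  unfolding rees_ring_def using ring_module.subspace_0[OF is_ideal_power] by auto

text \<open>The ring is generated over the constants by the finitely many elements a t with a among
  generators of \<open>J\<close>; all monomials c t^n with c in J^n are built from these.\<close>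

lemma noetherian_rees_ring:
  assumes N: "is_noetherian TYPE('a::comm_ring_1)" and J: "is_ideal (J :: 'a set)"
  shows "noetherian_subring (rees_ring J)"
proof -
  obtain S where S: "finite S" "ideal_generated S = J" using N J unfolding is_noetherian_def by blast
  have base: "noetherian_subring (range (\<lambda>c :: 'a. [:c:]))"
    by (rule noetherian_subring_range[OF noetherian_subring_UNIV[OF N]]) simp_all
  obtain B where B: "noetherian_subring B" "range (\<lambda>c :: 'a. [:c:]) \<subseteq> B" "(\<lambda>a. monom a 1) ` S \<subseteq> B"
    "\<forall>C. is_subring C \<longrightarrow> range (\<lambda>c :: 'a. [:c:]) \<subseteq> C \<longrightarrow> (\<lambda>a. monom a 1) ` S \<subseteq> C \<longrightarrow> B \<subseteq> C"
    using adjoin_finite[OF base finite_imageI[OF S(1)], of "\<lambda>a. monom a 1"] by (elim exE conjE)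
  have sB: "is_subring B" using B(1) unfolding noetherian_subring_def by blast
  have "B \<subseteq> rees_ring J"
  proof (rule B(4)[rule_format, OF is_subring_rees_ring])
    show "range (\<lambda>c :: 'a. [:c:]) \<subseteq> rees_ring J"
      using monom_in_rees_ring[of _ J 0] by (auto simp: monom_0)
    have "a \<in> ideal_power J 1" if "a \<in> S" for a
      using ideal_power_base[of a J 1 0] that S(2) ring_module.span_base by auto
    then show "(\<lambda>a. monom a 1) ` S \<subseteq> rees_ring J" using monom_in_rees_ring by blast
  qed
  moreover have "rees_ring J \<subseteq> B"
  proof -
    have ideal: "is_ideal {c. monom (c * y) n \<in> B}" for y n
      unfolding ring_module.subspace_def mem_Collect_eq
    proof (intro conjI ballI allI)
      show "monom (0 * y) n \<in> B" using subring_zero[OF sB] by simp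
      show "monom ((a + b) * y) n \<in> B" if "a \<in> {c. monom (c * y) n \<in> B}" "b \<in> {c. monom (c * y) n \<in> B}" for a b
        using subring_add[OF sB, of "monom (a * y) n" "monom (b * y) n"] that by (simp add: distrib_right add_monom)
      show "monom (c * a * y) n \<in> B" if "a \<in> {c. monom (c * y) n \<in> B}" for c a
        using subring_mult[OF sB, of "[:c:]" "monom (a * y) n"] B(2) that
        by (auto simp: smult_monom mult.assoc)
    qed
    have monom: "monom c n \<in> B" if "c \<in> ideal_power J n" for c n
      using that
    proof (induction n arbitrary: c)
      case 0
      then show ?case using B(2) by (auto simp: monom_0)
    next
      case (Suc n)
      have "ideal_mult (*) J (ideal_power J n) \<subseteq> {c. monom (c * 1) (Suc n) \<in> B}"
      proof (rule ring_module.ideal_mult_le[OF ideal])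
        fix c x assume c: "c \<in> J" and x: "x \<in> ideal_power J n"
        have "ideal_generated S \<subseteq> {c. monom (c * x) (Suc n) \<in> B}"
        proof (rule ring_module.span_minimal[OF _ ideal], rule subsetI)
          fix a assume "a \<in> S"
          then have "monom a 1 * monom x n \<in> B" using B(3) Suc.IH[OF x] subring_mult[OF sB] by blast
          then show "a \<in> {c. monom (c * x) (Suc n) \<in> B}" by (simp add: mult_monom)
        qed
        then show "c * x \<in> {c. monom (c * 1) (Suc n) \<in> B}" using c S(2) by auto
      qed
      then show ?case using Suc.prems by auto
    qed
    show ?thesis
    proof
      fix p assume "p \<in> rees_ring J"
      then have c: "monom (coeff p n) n \<in> B" for n using monom unfolding rees_ring_def by blast
      have "(\<Sum>i\<in>I. monom (coeff p i) i) \<in> B" if "finite I" for I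
        using that by induction (auto intro: subring_zero[OF sB] subring_add[OF sB] c)
      then show "p \<in> B" using poly_as_sum_of_monoms[of p] by (metis finite_atMost)
    qed
  qed
  ultimately have "B = rees_ring J" by (rule subset_antisym)
  then show ?thesis using B(1) by simp
qed

text \<open>\<open>F k\<close> is the ideal of the Rees ring whose components are the intersections
  of \<open>I\<close> with J^n up to degree \<open>k\<close> and arise from degree \<open>k\<close>
  by multiplication with powers of \<open>J\<close> beyond it. These ideals ascend, and the index
  where they become constant is the number \<open>c\<close>.\<close>

lemma artin_rees:
  assumes N: "is_noetherian TYPE('a::comm_ring_1)" and J: "is_ideal (J :: 'a set)" and I: "is_ideal I"
  shows "\<exists>c. \<forall>n\<ge>c. I \<inter> ideal_power J n \<subseteq> power_mult J (n - c) (I \<inter> ideal_power J c)"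
proof -
  let ?X = "\<lambda>k. I \<inter> ideal_power J k"
  define E where "E k n = (if n \<le> k then ?X n else power_mult J (n - k) (?X k))" for k n
  define F where "F k = {p. \<forall>n. coeff p n \<in> E k n}" for k
  have X: "is_ideal (?X k)" for k using ring_module.subspace_inter[OF I is_ideal_power] .
  have E: "is_ideal (E k n)" for k n
    unfolding E_def using X is_ideal_power_mult[OF X] by auto
  have E_le: "E k n \<subseteq> ideal_power J n" for k n
  proof (cases "n \<le> k")
    case False
    have "power_mult J (n - k) (?X k) \<subseteq> power_mult J (n - k) (ideal_power J k)"
      by (rule power_mult_mono) blast
    then show ?thesis using False power_mult_add[of J "n - k" k UNIV] by (simp add: E_def)
  qed (simp add: E_def)
  have E_mult: "a * e \<in> E k (i + j)" if a: "a \<in> ideal_power J i" and e: "e \<in> E k j" for a e i j k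
  proof -
    consider "i + j \<le> k" | "k \<le> j" "i + j > k" | "j < k" "k < i + j" by linarith
    then show ?thesis
    proof cases
      case 1
      then show ?thesis using a e ideal_power_times[OF a, of e j] ring_module.subspace_scale[OF I]
        by (auto simp: E_def)
    next
      case 2
      have e': "e \<in> power_mult J (j - k) (?X k)" using e 2 by (cases "j = k") (auto simp: E_def)
      have "a * e \<in> power_mult J i (power_mult J (j - k) (?X k))"
        by (rule power_mult_times[OF is_ideal_power_mult[OF X] a])
          (rule ring_module.subspace_scale[OF is_ideal_power_mult[OF X] e'])
      then show ?thesis using 2 power_mult_add[of J i "j - k" "?X k"] by (simp add: E_def)
    next
      \<comment> \<open>The degrees straddle \<open>k\<close>: a power J^(k-j) is split off from
        \<open>a\<close> to lift \<open>e\<close> into degree \<open>k\<close>, and the remaining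
        power acts on the intersection of \<open>I\<close> with J^k.\<close>
      case 3
      have e': "e \<in> ?X j" using e 3 by (simp add: E_def)
      have a': "a \<in> power_mult J (i + j - k) (ideal_power J (k - j))"
        using a 3 power_mult_add[of J "i + j - k" "k - j" UNIV] by simp
      have "a * e \<in> power_mult J (i + j - k) (?X k)"
      proof (rule power_mult_times[OF X a'])
        fix y assume "y \<in> ideal_power J (k - j)"
        then have "y * e \<in> ideal_power J (k - j + j)" using e' ideal_power_times by blast
        then show "y * e \<in> ?X k" using 3 e' ring_module.subspace_scale[OF I] by simp
      qed
      then show ?thesis using 3 by (simp add: E_def)
    qed
  qed
  have F: "ideal_in (rees_ring J) (F k)" for k
    unfolding ideal_in_def
  proof (intro conjI ballI)
    show "F k \<subseteq> rees_ring J" unfolding F_def rees_ring_def using E_le by blast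
    show "0 \<in> F k" unfolding F_def using ring_module.subspace_0[OF E] by simp
    show "p + q \<in> F k" if "p \<in> F k" "q \<in> F k" for p q
      using that ring_module.subspace_add[OF E] unfolding F_def by simp
  next
    fix p q assume pq: "p \<in> rees_ring J" "q \<in> F k"
    have "coeff (p * q) n \<in> E k n" for n
      unfolding coeff_mult
    proof (rule ring_module.subspace_sum[OF E])
      fix i assume "i \<in> {..n}"
      then show "coeff p i * coeff q (n - i) \<in> E k n"
        using pq E_mult[of "coeff p i" i "coeff q (n - i)" k "n - i"] unfolding rees_ring_def F_def by simp
    qed
    then show "p * q \<in> F k" unfolding F_def by blast
  qed
  have "E k n \<subseteq> E (Suc k) n" for k n
  proof -
    have 1: "power_mult J 1 (?X k) \<subseteq> ?X (Suc k)"
    proof -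
      have "power_mult J 1 (?X k) \<subseteq> I" using power_mult_le[OF X, of J 1 k] by blast
      moreover have "power_mult J 1 (?X k) \<subseteq> power_mult J 1 (ideal_power J k)" by (rule power_mult_mono) blast
      ultimately show ?thesis by simp
    qed
    consider "n \<le> k" | "n = Suc k" | "n > Suc k" by linarith
    then show ?thesis
    proof cases
      case 3
      then have "E k n = power_mult J (n - Suc k) (power_mult J 1 (?X k))"
        unfolding power_mult_add[symmetric] by (simp add: E_def Suc_diff_Suc del: power_mult.simps)
      also have "\<dots> \<subseteq> power_mult J (n - Suc k) (?X (Suc k))" using 1 by (rule power_mult_mono)
      finally show ?thesis using 3 by (simp add: E_def)
    next
      case 2
      then show ?thesis using 1 by (simp add: E_def)
    qed (simp add: E_def)
  qed
  then have "F k \<subseteq> F (Suc k)" for k unfolding F_def by blast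
  from noetherian_subringD[of _ F, OF noetherian_rees_ring[OF N J] F this]
  obtain c where c: "\<forall>k\<ge>c. F k = F c" by (elim exE)
  have "I \<inter> ideal_power J n \<subseteq> power_mult J (n - c) (I \<inter> ideal_power J c)" if n: "n \<ge> c" for n
  proof
    fix z assume z: "z \<in> I \<inter> ideal_power J n"
    have "coeff (monom z n) k \<in> E n k" for k
      using z ring_module.subspace_0[OF E, of n k] by (cases "k = n") (simp_all add: E_def)
    then have "monom z n \<in> F n" unfolding F_def by blast
    moreover have "F n = F c" using c n by blast
    ultimately have "monom z n \<in> F c" by simp
    then have "coeff (monom z n) n \<in> E c n" unfolding F_def by blast
    then show "z \<in> power_mult J (n - c) (I \<inter> ideal_power J c)" using n by (cases "n = c") (auto simp: E_def)
  qed
  then show ?thesis by blast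
qed

lemma is_ideal_sum_scaled:
  assumes "is_ideal Z" "is_ideal K"
  shows "is_ideal {x * z + k | z k. z \<in> Z \<and> k \<in> K}"
proof -
  have "is_ideal ((*) x ` Z)"
    unfolding ring_module.subspace_def
  proof (intro conjI ballI allI)
    have "0 = x * 0" by simp
    then show "0 \<in> (*) x ` Z" using ring_module.subspace_0[OF assms(1)] by blast
  next
    fix u v assume "u \<in> (*) x ` Z" "v \<in> (*) x ` Z"
    then obtain z w where "u = x * z" "v = x * w" "z \<in> Z" "w \<in> Z" by blast
    then have "u + v = x * (z + w)" "z + w \<in> Z"
      using ring_module.subspace_add[OF assms(1)] by (auto simp: distrib_left)
    then show "u + v \<in> (*) x ` Z" by blast
  next
    fix c u assume "u \<in> (*) x ` Z"
    then obtain z where "u = x * z" "z \<in> Z" by blast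
    then have "c * u = x * (c * z)" "c * z \<in> Z"
      using ring_module.subspace_scale[OF assms(1)] by (auto simp: mult.left_commute)
    then show "c * u \<in> (*) x ` Z" by blast
  qed
  from ring_module.subspace_sum_set[OF this assms(2)] show ?thesis
    by (rule back_subst[of is_ideal]) blast
qed

text \<open>The Artin-Rees lemma for the ideal x R + K. It is used with \<open>K\<close> prime and
  \<open>x\<close> outside \<open>K\<close>, where it gives \<open>y\<close> in K + J^(n-c), and
  with \<open>K\<close> zero and \<open>x\<close> regular, where it gives \<open>y\<close> in
  J^(n-c).\<close>

lemma artin_rees_colon:
  assumes N: "is_noetherian TYPE('a::comm_ring_1)" and J: "is_ideal (J :: 'a set)" and K: "is_ideal K"
  shows "\<exists>c. \<forall>n\<ge>c. \<forall>y j k. x * y = j + k \<longrightarrow> j \<in> ideal_power J n \<longrightarrow> k \<in> K \<longrightarrow>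
    (\<exists>z\<in>ideal_power J (n - c). x * (y - z) \<in> K)"
proof -
  define I where "I = {x * z + k | z k. z \<in> UNIV \<and> k \<in> K}"
  have I: "is_ideal I" unfolding I_def by (rule is_ideal_sum_scaled[OF ring_module.subspace_UNIV K])
  obtain c where c: "\<And>n. n \<ge> c \<Longrightarrow> I \<inter> ideal_power J n \<subseteq> power_mult J (n - c) (I \<inter> ideal_power J c)"
    using artin_rees[OF N J I] by blast
  \<comment> \<open>A factor from \<open>J\<close> is pushed onto the multiplier of
    \<open>x\<close>, while \<open>K\<close> absorbs it.\<close>
  have pm: "power_mult J s I \<subseteq> {x * z + k | z k. z \<in> ideal_power J s \<and> k \<in> K}" for s
  proof (induction s)
    case (Suc s)
    show ?case
      unfolding power_mult.simps(2)[of J s I]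
    proof (rule ring_module.ideal_mult_le[OF is_ideal_sum_scaled[OF is_ideal_power K]])
      fix a u assume a: "a \<in> J" and "u \<in> power_mult J s I"
      then obtain z k where zk: "u = x * z + k" "z \<in> ideal_power J s" "k \<in> K" using Suc by blast
      have "a * u = x * (a * z) + a * k" unfolding zk(1) by (simp add: distrib_left mult.left_commute)
      moreover have "a * z \<in> ideal_power J (Suc s)" using ideal_power_base[OF a zk(2)] .
      moreover have "a * k \<in> K" using ring_module.subspace_scale[OF K zk(3)] .
      ultimately show "a * u \<in> {x * z + k | z k. z \<in> ideal_power J (Suc s) \<and> k \<in> K}" by blast
    qed
  qed (simp add: I_def)
  have "\<exists>z\<in>ideal_power J (n - c). x * (y - z) \<in> K"
    if n: "n \<ge> c" and eq: "x * y = j + k" and j: "j \<in> ideal_power J n" and k: "k \<in> K" for n y j k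
  proof -
    have "j = x * y + - k" using eq by simp
    then have "j \<in> I" unfolding I_def using ring_module.subspace_neg[OF K k] by blast
    then have "j \<in> power_mult J (n - c) (I \<inter> ideal_power J c)" using c[OF n] j by blast
    then have "j \<in> power_mult J (n - c) I" using power_mult_mono[of "I \<inter> ideal_power J c" I] by blast
    then obtain z k' where zk: "j = x * z + k'" "z \<in> ideal_power J (n - c)" "k' \<in> K" using pm by blast
    have "x * (y - z) = k' + k" using eq zk(1) by (simp add: right_diff_distrib)
    then show ?thesis using zk(2) ring_module.subspace_add[OF K zk(3) k] by metis
  qed
  then show ?thesis by blast
qed

section \<open>Monomials and lengths of powers\<close>

text \<open>Exponents vanish from \<open>s\<close> on, so that each formal monomial in
  \<open>s\<close> elements has exactly one exponent function and they can be counted.\<close>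

definition exponents :: "nat \<Rightarrow> nat \<Rightarrow> (nat \<Rightarrow> nat) set" where
  "exponents s j = {\<alpha>. (\<forall>i\<ge>s. \<alpha> i = 0) \<and> (\<Sum>i<s. \<alpha> i) = j}"

definition ring_monomial :: "(nat \<Rightarrow> 'a::comm_ring_1) \<Rightarrow> nat \<Rightarrow> (nat \<Rightarrow> nat) \<Rightarrow> 'a" where
  "ring_monomial a s \<alpha> = (\<Prod>i<s. a i ^ \<alpha> i)"

text \<open>The last exponent is determined by the total degree, so restriction to the first
  \<open>s\<close> of the \<open>Suc s\<close> exponents is injective. The saved variable later
  yields d - 1 in place of d.\<close>

lemma exponents_card:
  "finite (exponents (Suc s) j) \<and> card (exponents (Suc s) j) \<le> (j + 1) ^ s"
proof -
  let ?f = "\<lambda>\<alpha>. restrict \<alpha> {..<s}"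
  have "inj_on ?f (exponents (Suc s) j)"
  proof (rule inj_onI)
    fix \<alpha> \<beta> assume ab: "\<alpha> \<in> exponents (Suc s) j" "\<beta> \<in> exponents (Suc s) j" "?f \<alpha> = ?f \<beta>"
    have lt: "\<alpha> i = \<beta> i" if "i < s" for i using fun_cong[OF ab(3), of i] that by simp
    have "(\<Sum>i<s. \<alpha> i) = (\<Sum>i<s. \<beta> i)" using lt by (intro sum.cong) auto
    then have eq: "\<alpha> s = \<beta> s" using ab(1,2) unfolding exponents_def by simp
    show "\<alpha> = \<beta>"
    proof
      fix i
      consider "i < s" | "i = s" | "i \<ge> Suc s" by linarith
      then show "\<alpha> i = \<beta> i" using lt eq ab(1,2) unfolding exponents_def by cases auto
    qed
  qed
  moreover have "?f ` exponents (Suc s) j \<subseteq> {..<s} \<rightarrow>\<^sub>E {..j}"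
  proof
    fix g assume "g \<in> ?f ` exponents (Suc s) j"
    then obtain \<alpha> where a: "g = ?f \<alpha>" "\<alpha> \<in> exponents (Suc s) j" by blast
    have "\<alpha> i \<le> j" if "i < s" for i
    proof -
      have "\<alpha> i \<le> (\<Sum>i<Suc s. \<alpha> i)" using that by (intro member_le_sum) auto
      then show ?thesis using a(2) unfolding exponents_def by simp
    qed
    then show "g \<in> {..<s} \<rightarrow>\<^sub>E {..j}" unfolding a(1) by auto
  qed
  moreover have "finite ({..<s} \<rightarrow>\<^sub>E {..j})" by (rule finite_PiE) auto
  moreover have "card ({..<s} \<rightarrow>\<^sub>E {..j}) = (j + 1) ^ s" by (simp add: card_PiE)
  ultimately show ?thesis
    by (metis card_image card_mono finite_imageD finite_subset)
qed

lemma exponents_0: "exponents 0 j = (if j = 0 then {\<lambda>_. 0} else {})"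
  by (auto simp: exponents_def)

lemma finite_exponents: "finite (exponents s j)"
  using exponents_card[of "s - 1"] by (cases s) (auto simp: exponents_0)

lemma sum_card_exponents: "(\<Sum>j<Suc n. card (exponents s j)) \<le> Suc n ^ s"
proof (cases s)
  case 0
  have "(\<Sum>j<Suc n. card (exponents 0 j)) = (\<Sum>j<Suc n. if j = 0 then 1 else 0)"
    by (rule sum.cong) (auto simp: exponents_0)
  then show ?thesis using 0 by simp
next
  case (Suc t)
  have "(\<Sum>j<Suc n. card (exponents s j)) \<le> (\<Sum>j<Suc n. Suc n ^ t)"
    unfolding Suc
  proof (rule sum_mono)
    fix j assume "j \<in> {..<Suc n}"
    then have "(j + 1) ^ t \<le> Suc n ^ t" by (intro power_mono) auto
    then show "card (exponents (Suc t) j) \<le> Suc n ^ t" using exponents_card[of t j] by linarith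
  qed
  then show ?thesis using Suc by simp
qed

lemma ideal_power_generated:
  "ideal_power (ideal_generated (a ` {..<s})) j \<subseteq> ideal_generated (ring_monomial a s ` exponents s j)"
proof (induction j)
  case 0
  have "(\<lambda>_. 0) \<in> exponents s 0" by (simp add: exponents_def)
  then have "ring_monomial a s (\<lambda>_. 0) \<in> ideal_generated (ring_monomial a s ` exponents s 0)"
    by (intro ring_module.span_base) blast
  then have 1: "1 \<in> ideal_generated (ring_monomial a s ` exponents s 0)" by (simp add: ring_monomial_def)
  have "c * 1 \<in> ideal_generated (ring_monomial a s ` exponents s 0)" for c
    by (rule ring_module.span_scale[OF 1])
  then show ?case by auto
next
  case (Suc j)
  let ?G = "ideal_generated (ring_monomial a s ` exponents s (Suc j))"
  have gen: "a i * ring_monomial a s \<alpha> \<in> ?G" if "i < s" "\<alpha> \<in> exponents s j" for i \<alpha>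
  proof -
    have "\<alpha>(i := Suc (\<alpha> i)) \<in> exponents s (Suc j)"
      using that unfolding exponents_def by (auto simp: sum.remove[of "{..<s}" i])
    moreover have "ring_monomial a s (\<alpha>(i := Suc (\<alpha> i))) = a i * ring_monomial a s \<alpha>"
      using that(1) unfolding ring_monomial_def by (simp add: prod.remove[of "{..<s}" i] mult.assoc)
    ultimately show ?thesis using ring_module.span_base by (metis imageI)
  qed
  note ideal = is_ideal_colon[OF ring_module.subspace_span]
  show ?case
    unfolding power_mult.simps
  proof (rule ring_module.ideal_mult_le[OF ring_module.subspace_span])
    fix c x assume c: "c \<in> ideal_generated (a ` {..<s})" and x: "x \<in> ideal_power (ideal_generated (a ` {..<s})) j"
    have "ideal_generated (a ` {..<s}) \<subseteq> {c. c * x \<in> ?G}"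
    proof (rule ring_module.span_minimal[OF _ ideal(1)], rule subsetI)
      fix b assume "b \<in> a ` {..<s}"
      then have "ideal_generated (ring_monomial a s ` exponents s j) \<subseteq> {x. b * x \<in> ?G}"
        using gen by (intro ring_module.span_minimal[OF _ ideal(2)]) auto
      then show "b \<in> {c. c * x \<in> ?G}" using Suc x by blast
    qed
    then show "c * x \<in> ?G" using c by blast
  qed
qed

lemma power_in_ideal_power: "t \<in> J \<Longrightarrow> t ^ k \<in> ideal_power J k"
  by (induction k) (auto intro: ring_module.ideal_mult_base)

lemma ring_monomial_in_power:
  assumes a: "a ` {..<s} \<subseteq> J" and "\<beta> \<in> exponents s j"
  shows "ring_monomial a s \<beta> \<in> ideal_power J j"
proof -
  have pw: "a i ^ k \<in> ideal_power J k" if "i < s" for i k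
    by (rule power_in_ideal_power) (use a that in auto)
  have "(\<Prod>i<t. a i ^ \<beta> i) \<in> ideal_power J (\<Sum>i<t. \<beta> i)" if "t \<le> s" for t
    using that
  proof (induction t)
    case (Suc t)
    then have "(\<Prod>i<t. a i ^ \<beta> i) * a t ^ \<beta> t \<in> ideal_power J ((\<Sum>i<t. \<beta> i) + \<beta> t)"
      by (intro ideal_power_times pw) auto
    then show ?case by simp
  qed simp
  then show ?thesis using assms(2) unfolding ring_monomial_def exponents_def by auto
qed

text \<open>Modulo J^(j+1) the power J^j is generated by the monomials of degree \<open>j\<close> in
  the generators of \<open>J\<close>, and each of them is killed by \<open>J\<close>.\<close>

lemma colength_power_step:
  fixes a :: "nat \<Rightarrow> 'a::comm_ring_1" and s :: nat
  defines "J \<equiv> ideal_generated (a ` {..<s})"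
  shows "colength (*) (ideal_power J j) (ideal_power J (Suc j)) \<le>
    enat (card (exponents s j)) * colength (*) UNIV J"
proof -
  let ?T = "ring_monomial a s ` exponents s j"
  have J: "is_ideal J" unfolding J_def by (rule ring_module.subspace_span)
  have aJ: "a ` {..<s} \<subseteq> J" unfolding J_def by (rule ring_module.span_superset)
  note T = ring_monomial_in_power[OF aJ]
  have "colength (*) (ideal_power J j) (ideal_power J (Suc j)) \<le>
      colength (*) (ideal_generated (ideal_power J (Suc j) \<union> ?T)) (ideal_power J (Suc j))"
    using ideal_power_generated[of a s j] ring_module.span_mono[of ?T "ideal_power J (Suc j) \<union> ?T"]
    unfolding J_def[symmetric] by (intro ring_module.colength_mono) auto
  also have "\<dots> \<le> enat (card ?T) * colength (*) UNIV J"
  proof (rule ring_module.colength_span_le[OF is_ideal_power finite_imageI[OF finite_exponents] J])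
    fix c t assume c: "c \<in> J" and "t \<in> ?T"
    then obtain \<alpha> where "t = ring_monomial a s \<alpha>" "\<alpha> \<in> exponents s j" by blast
    then show "c * t \<in> ideal_power J (Suc j)" using ideal_power_base[OF c T] by blast
  qed
  also have "\<dots> \<le> enat (card (exponents s j)) * colength (*) UNIV J"
    by (rule mult_right_mono) (use card_image_le[OF finite_exponents] in auto)
  finally show ?thesis .
qed

lemma colength_ideal_power:
  fixes a :: "nat \<Rightarrow> 'a::comm_ring_1" and s :: nat
  defines "J \<equiv> ideal_generated (a ` {..<s})"
  shows "colength (*) UNIV (ideal_power J n) \<le> enat (\<Sum>j<n. card (exponents s j)) * colength (*) UNIV J"
proof (induction n)
  case 0
  then show ?case by (simp add: ring_module.colength_self)
next
  case (Suc n)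
  have "colength (*) UNIV (ideal_power J (Suc n)) =
      colength (*) UNIV (ideal_power J n) + colength (*) (ideal_power J n) (ideal_power J (Suc n))"
    by (rule ring_module.colength_additive[OF is_ideal_power is_ideal_power
        ideal_power_antimono[of n "Suc n"] subset_UNIV ring_module.subspace_UNIV]) simp
  also have "\<dots> \<le> enat (\<Sum>j<n. card (exponents s j)) * colength (*) UNIV J +
      enat (card (exponents s n)) * colength (*) UNIV J"
    by (rule add_mono[OF Suc.IH]) (unfold J_def, rule colength_power_step)
  also have "\<dots> = enat (\<Sum>j<Suc n. card (exponents s j)) * colength (*) UNIV J"
    by (simp flip: distrib_right)
  finally show ?case .
qed

section \<open>Dimension and systems of parameters\<close>

lemma power_growth:
  fixes D T :: real
  assumes "s < t" "0 < D" "0 < T"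
  obtains n :: nat where "n \<ge> n0" "D * real (n + 1) ^ s < (real n / T) ^ t"
proof -
  \<comment> \<open>The factor 2^s comes from n + 1 \<le> 2 n and T^t from the denominator; the
    surplus power of n, available as t \<ge> s + 1, exceeds the product.\<close>
  obtain n1 :: nat where n1: "D * 2 ^ s * T ^ t < real n1" using reals_Archimedean2 by blast
  define n where "n = max (max n0 n1) 1"
  have n: "n \<ge> n0" "n \<ge> 1" "D * 2 ^ s * T ^ t < real n" using n1 unfolding n_def by auto
  have "D * real (n + 1) ^ s \<le> D * (2 * real n) ^ s"
    using n(2) assms by (intro mult_left_mono power_mono) auto
  also have "\<dots> = D * 2 ^ s * real n ^ s" by (simp add: power_mult_distrib)
  also have "\<dots> = (D * 2 ^ s * T ^ t) * real n ^ s / T ^ t" using assms by simp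
  also have "\<dots> < real n * real n ^ s / T ^ t"
    using n assms by (intro divide_strict_right_mono mult_strict_right_mono) auto
  also have "real n * real n ^ s = real n ^ Suc s" by simp
  also have "real n ^ Suc s / T ^ t \<le> real n ^ t / T ^ t"
    using n assms by (intro divide_right_mono power_increasing) auto
  also have "\<dots> = (real n / T) ^ t" by (simp add: power_divide)
  finally show ?thesis using that n(1) by blast
qed

text \<open>The degree of growth of a binomial coefficient is read off from n choose t \<ge>
  (n/t)^t. Comparisons of this kind take the place of degrees of Hilbert polynomials.\<close>

lemma binomial_growth:
  assumes "\<And>n. real (n choose t) \<le> C * real (c * n + 1) ^ s"
  shows "t \<le> s"
proof (rule ccontr)
  assume "\<not> t \<le> s"
  then have st: "s < t" "t > 0" by auto
  define D where "D = (\<bar>C\<bar> + 1) * real (c + 1) ^ s"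
  have "D > 0" unfolding D_def by (intro mult_pos_pos) auto
  from power_growth[OF st(1) this, of "real t" t] st
  obtain n :: nat where n: "n \<ge> t" "D * real (n + 1) ^ s < (real n / real t) ^ t" by auto
  have "(real n / real t) ^ t \<le> real (n choose t)"
    using binomial_ge_n_over_k_pow_k[OF n(1), where 'a = real] by simp
  also have "\<dots> \<le> C * real (c * n + 1) ^ s" by (rule assms)
  also have "\<dots> \<le> (\<bar>C\<bar> + 1) * (real (c + 1) * real (n + 1)) ^ s"
    by (intro mult_mono power_mono) (auto simp: algebra_simps)
  also have "\<dots> = D * real (n + 1) ^ s" unfolding D_def by (simp only: power_mult_distrib mult.assoc)
  finally show False using n(2) by simp
qed

section \<open>Prime chains and the height theorem\<close>

definition prime_chain :: "nat \<Rightarrow> (nat \<Rightarrow> 'a::comm_ring_1 set) \<Rightarrow> bool" where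
  "prime_chain n P \<longleftrightarrow> (\<forall>k\<le>n. is_prime_ideal (P k)) \<and> (\<forall>k<n. P k \<subset> P (Suc k))"

lemma prime_chain_le_dim:
  fixes P :: "nat \<Rightarrow> 'a::comm_ring_1 set"
  shows "prime_chain n P \<Longrightarrow> enat n \<le> krull_dim TYPE('a)"
  unfolding krull_dim_def prime_chain_def by (rule Sup_upper) auto

lemma prime_chain_exists:
  assumes "krull_dim TYPE('a::comm_ring_1) = enat d" "d > 0"
  obtains P :: "nat \<Rightarrow> 'a::comm_ring_1 set" where "prime_chain d P"
proof -
  have "enat (d - 1) < krull_dim TYPE('a)" using assms by simp
  then obtain n and P :: "nat \<Rightarrow> 'a set" where nP: "enat (d - 1) < enat n" "prime_chain n P"
    unfolding krull_dim_def less_Sup_iff prime_chain_def by blast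
  have "d \<le> n" using nP(1) by simp
  then have "prime_chain d P" using nP(2) unfolding prime_chain_def by auto
  then show ?thesis by (rule that)
qed

definition ideal_sum :: "'a::comm_ring_1 set \<Rightarrow> 'a set \<Rightarrow> 'a set" where
  "ideal_sum P J = {x + y | x y. x \<in> P \<and> y \<in> J}"

lemma is_ideal_sum: "is_ideal P \<Longrightarrow> is_ideal J \<Longrightarrow> is_ideal (ideal_sum P J)"
  unfolding ideal_sum_def by (rule ring_module.subspace_sum_set)

lemma ideal_sum_mono: "P \<subseteq> P' \<Longrightarrow> J \<subseteq> J' \<Longrightarrow> ideal_sum P J \<subseteq> ideal_sum P' J'"
  unfolding ideal_sum_def by blast

lemma subset_ideal_sum:
  assumes "is_ideal P" "is_ideal J"
  shows "P \<subseteq> ideal_sum P J" "J \<subseteq> ideal_sum P J"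
proof -
  have "x + 0 \<in> ideal_sum P J" if "x \<in> P" for x
    unfolding ideal_sum_def using that ring_module.subspace_0[OF assms(2)] by blast
  then show "P \<subseteq> ideal_sum P J" by auto
  have "0 + x \<in> ideal_sum P J" if "x \<in> J" for x
    unfolding ideal_sum_def using that ring_module.subspace_0[OF assms(1)] by blast
  then show "J \<subseteq> ideal_sum P J" by auto
qed

lemma module_hom_times: "module_hom (*) (*) ((*) (x :: 'a::comm_ring_1))"
  by (simp add: module_hom_def module_hom_axioms_def ring_module.module_axioms distrib_left mult.left_commute)

lemma is_prime_idealD: "is_prime_ideal P \<Longrightarrow> is_ideal P"
  unfolding is_prime_ideal_def by blast

context noetherian_local
begin

lemma prime_le_m: "is_prime_ideal P \<Longrightarrow> P \<subseteq> \<mm>"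
  unfolding is_prime_ideal_def using ideal_le_m by blast

text \<open>The quotient of R by P + J^n maps onto that by P' + J^n. The kernel contains the
  multiples of some \<open>x\<close> in P' outside P, and by Artin-Rees \<open>x * y\<close> in P +
  J^n forces \<open>y\<close> into P + J^(n-c); this gives the second summand.\<close>

lemma colength_prime_step:
  fixes J P P' :: "'a set"
  assumes J: "is_ideal J" and P: "is_prime_ideal P" "is_ideal P'" "P \<subset> P'"
  shows "\<exists>c. \<forall>n\<ge>c. colength (*) UNIV (ideal_sum P' (ideal_power J n)) +
    colength (*) UNIV (ideal_sum P (ideal_power J (n - c))) \<le> colength (*) UNIV (ideal_sum P (ideal_power J n))"
proof -
  obtain x where x: "x \<in> P'" "x \<notin> P" using P(3) by blast
  have iP: "is_ideal P" using P(1) by (rule is_prime_idealD)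
  obtain c where c: "\<And>n y j k. n \<ge> c \<Longrightarrow> x * y = j + k \<Longrightarrow> j \<in> ideal_power J n \<Longrightarrow> k \<in> P \<Longrightarrow>
      \<exists>z\<in>ideal_power J (n - c). x * (y - z) \<in> P"
    using artin_rees_colon[OF noeth J iP, of x] by blast
  have "colength (*) UNIV (ideal_sum P' (ideal_power J n)) +
      colength (*) UNIV (ideal_sum P (ideal_power J (n - c))) \<le> colength (*) UNIV (ideal_sum P (ideal_power J n))"
    if n: "n \<ge> c" for n
  proof -
    let ?S = "ideal_sum P (ideal_power J n)" and ?S' = "ideal_sum P' (ideal_power J n)"
    have iS: "is_ideal ?S" "is_ideal ?S'" using iP P(2) is_ideal_power is_ideal_sum by blast+
    have SS: "?S \<subseteq> ?S'" using P(3) by (intro ideal_sum_mono) auto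
    have "{y \<in> UNIV. x * y \<in> ?S} \<subseteq> ideal_sum P (ideal_power J (n - c))"
    proof
      fix y assume "y \<in> {y \<in> UNIV. x * y \<in> ?S}"
      then obtain k j where kj: "x * y = k + j" "k \<in> P" "j \<in> ideal_power J n" unfolding ideal_sum_def by blast
      then obtain z where z: "z \<in> ideal_power J (n - c)" "x * (y - z) \<in> P"
        using c[OF n, of y j k] by (auto simp: add.commute)
      then have "y - z \<in> P" using P(1) x(2) unfolding is_prime_ideal_def by blast
      then have "(y - z) + z \<in> ideal_sum P (ideal_power J (n - c))" unfolding ideal_sum_def using z(1) by blast
      then show "y \<in> ideal_sum P (ideal_power J (n - c))" by simp
    qed
    then have "colength (*) UNIV (ideal_sum P (ideal_power J (n - c))) \<le>
        colength (*) UNIV {y \<in> UNIV. x * y \<in> ?S}"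
      by (rule ring_module.colength_mono) simp
    also have "\<dots> \<le> colength (*) ?S' ?S"
    proof (rule colength_preimage_le[OF module_hom_times ring_module.subspace_UNIV iS(1) _ SS iS(2)])
      have "x \<in> ?S'" using subset_ideal_sum(1)[OF P(2) is_ideal_power] x(1) by blast
      then show "(*) x ` UNIV \<subseteq> ?S'"
        using ring_module.subspace_scale[OF iS(2), of x] by (auto simp: mult.commute[of x])
    qed
    finally show ?thesis
      using ring_module.colength_additive[OF iS(2) iS(1) SS subset_UNIV ring_module.subspace_UNIV]
      by (simp add: add_left_mono)
  qed
  then show ?thesis by blast
qed

text \<open>Going down the chain, \<open>colength_prime_step\<close> bounds the increments of the
  lengths at one prime from below by the lengths at the next larger prime. Summation by Pascal's
  rule raises the degree of growth by one per prime; \<open>j\<close> counts the steps below the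
  top.\<close>

lemma colength_prime_chain_lower:
  fixes J :: "'a set" and P :: "nat \<Rightarrow> 'a set"
  assumes J: "is_ideal J" "J \<subseteq> \<mm>" and P: "prime_chain t P" and "j \<le> t"
  shows "\<exists>c. \<forall>n. enat (n choose j) \<le> colength (*) UNIV (ideal_sum (P (t - j)) (ideal_power J (c * n + 1)))"
  using assms(4)
proof (induction j)
  case 0
  have "enat (n choose 0) \<le> colength (*) UNIV (ideal_sum (P t) (ideal_power J (1 * n + 1)))" for n
  proof -
    have Pt: "is_prime_ideal (P t)" using P unfolding prime_chain_def by blast
    have "ideal_power J (Suc n) \<subseteq> J"
      using ideal_power_antimono[of 1 "Suc n" J] ring_module.ideal_mult_le_self[OF ring_module.subspace_UNIV, of J]
        ring_module.ideal_mult_le[OF J(1), of J UNIV] ring_module.subspace_scale[OF J(1)]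
      by (auto simp: mult.commute)
    then have "ideal_power J (Suc n) \<subseteq> \<mm>" using J(2) by blast
    then have "ideal_sum (P t) (ideal_power J (Suc n)) \<subseteq> \<mm>"
      using prime_le_m[OF Pt] ring_module.subspace_add[OF ideal_m] unfolding ideal_sum_def by blast
    then have "ideal_sum (P t) (ideal_power J (Suc n)) \<subset> UNIV" using m_neq_UNIV by blast
    then have "1 \<le> colength (*) UNIV (ideal_sum (P t) (ideal_power J (Suc n)))"
      by (rule ring_module.colength_pos[OF is_ideal_sum[OF is_prime_idealD[OF Pt] is_ideal_power]
          ring_module.subspace_UNIV])
    then show ?thesis by (simp add: one_enat_def)
  qed
  then show ?case by (intro exI[of _ 1]) simp
next
  case (Suc j)
  let ?f = "\<lambda>j n. colength (*) UNIV (ideal_sum (P (t - j)) (ideal_power J n))"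
  have mono: "?f j m \<le> ?f j n" if "m \<le> n" for j m n
    by (intro ring_module.colength_mono ideal_sum_mono ideal_power_antimono that) auto
  obtain c where c: "\<And>n. enat (n choose j) \<le> ?f j (c * n + 1)" using Suc by auto
  have tj: "t - j = Suc (t - Suc j)" using Suc.prems by simp
  have 1: "is_prime_ideal (P (t - Suc j))" "is_prime_ideal (P (t - j))"
    using P unfolding prime_chain_def by simp_all
  have 2: "P (t - Suc j) \<subset> P (t - j)" unfolding tj using P Suc.prems unfolding prime_chain_def by simp
  obtain c1 where c1: "\<And>n. n \<ge> c1 \<Longrightarrow> ?f j n + ?f (Suc j) (n - c1) \<le> ?f (Suc j) n"
    using colength_prime_step[OF J(1) 1(1) is_prime_idealD[OF 1(2)] 2] by blast
  \<comment> \<open>One more unit of \<open>n\<close> raises the exponent by \<open>c + c1\<close>: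
    \<open>c1\<close> pays for the Artin-Rees shift, \<open>c\<close> for the rate already needed at
    the larger prime.\<close>
  let ?C = "c + c1"
  have "enat (n choose Suc j) \<le> ?f (Suc j) (?C * n + 1)" for n
  proof (induction n)
    case 0
    then show ?case by (simp add: zero_enat_def[symmetric])
  next
    case (Suc n)
    have "enat (n choose j) \<le> enat (Suc n choose j)"
      by (cases j) auto
    also have "\<dots> \<le> ?f j (c * Suc n + 1)" by (rule c)
    also have "\<dots> \<le> ?f j (?C * Suc n + 1)" by (rule mono) (simp add: algebra_simps)
    finally have "enat (n choose j) \<le> ?f j (?C * Suc n + 1)" .
    moreover have "?f (Suc j) (?C * n + 1) \<le> ?f (Suc j) (?C * Suc n + 1 - c1)"
      by (rule mono) simp
    ultimately have "enat (n choose j) + enat (n choose Suc j) \<le>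
        ?f j (?C * Suc n + 1) + ?f (Suc j) (?C * Suc n + 1 - c1)"
      using Suc.IH by (intro add_mono) (auto intro: order_trans)
    also have "\<dots> \<le> ?f (Suc j) (?C * Suc n + 1)" by (rule c1) simp
    finally show ?case by simp
  qed
  then show ?case by blast
qed

lemma colength_m_power_finite: "colength (*) UNIV (ideal_power \<mm> N) < \<infinity>"
proof -
  obtain S where S: "finite S" "ideal_generated S = \<mm>" using noeth ideal_m unfolding is_noetherian_def by blast
  obtain xs where "S = set xs" using finite_list[OF S(1)] by metis
  then have "S = (\<lambda>i. xs ! i) ` {..<length xs}" by (auto simp: set_conv_nth)
  then have m: "\<mm> = ideal_generated ((\<lambda>i. xs ! i) ` {..<length xs})" using S(2) by simp
  have "colength (*) UNIV (ideal_power \<mm> N) \<le>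
      enat (\<Sum>j<N. card (exponents (length xs) j)) * colength (*) UNIV \<mm>"
    unfolding m by (rule colength_ideal_power)
  also have "\<dots> \<le> enat (\<Sum>j<N. card (exponents (length xs) j)) * 1"
    by (rule mult_left_mono[OF colength_m]) simp
  finally show ?thesis by (metis enat_ord_code(4) mult.right_neutral order_le_less_trans)
qed

lemma colength_primary_finite:
  assumes "ideal_power \<mm> N \<subseteq> J"
  obtains l where "colength (*) UNIV J = enat l"
proof -
  have "colength (*) UNIV J \<le> colength (*) UNIV (ideal_power \<mm> N)"
    using assms by (rule ring_module.colength_mono) simp
  moreover obtain k where "colength (*) UNIV (ideal_power \<mm> N) = enat k"
    using colength_m_power_finite[of N] by (cases "colength (*) UNIV (ideal_power \<mm> N)") auto
  ultimately show ?thesis using that enat_ile by metis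
qed

text \<open>The powers of an ideal with \<open>s\<close> generators and finite colength have
  colengths growing at most with degree \<open>s\<close>, while a chain of \<open>t\<close> strict
  inclusions of primes forces growth of degree at least \<open>t\<close>.\<close>

lemma krull_height:
  fixes a :: "nat \<Rightarrow> 'a" and P :: "nat \<Rightarrow> 'a set"
  assumes J: "J = ideal_generated (a ` {..<s})" "J \<subseteq> \<mm>" "ideal_power \<mm> N \<subseteq> J" and P: "prime_chain t P"
  shows "t \<le> s"
proof -
  have iJ: "is_ideal J" unfolding J(1) by (rule ring_module.subspace_span)
  obtain l where l: "colength (*) UNIV J = enat l" using colength_primary_finite[OF J(3)] .
  obtain c where c: "\<And>n. enat (n choose t) \<le> colength (*) UNIV (ideal_sum (P (t - t)) (ideal_power J (c * n + 1)))"
    using colength_prime_chain_lower[OF iJ J(2) P order_refl] by blast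
  have P0: "is_ideal (P 0)" using P is_prime_idealD unfolding prime_chain_def by blast
  have "n choose t \<le> l * (c * n + 1) ^ s" for n
  proof -
    have "enat (n choose t) \<le> colength (*) UNIV (ideal_sum (P 0) (ideal_power J (c * n + 1)))"
      using c[of n] by simp
    also have "\<dots> \<le> colength (*) UNIV (ideal_power J (c * n + 1))"
      by (rule ring_module.colength_mono[OF subset_ideal_sum(2)[OF P0 is_ideal_power]]) simp
    also have "\<dots> \<le> enat (\<Sum>j<c * n + 1. card (exponents s j)) * colength (*) UNIV J"
      unfolding J(1) by (rule colength_ideal_power)
    also have "\<dots> = enat ((\<Sum>j<Suc (c * n). card (exponents s j)) * l)" unfolding l by simp
    finally have "n choose t \<le> (\<Sum>j<Suc (c * n). card (exponents s j)) * l" by simp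
    also have "\<dots> \<le> Suc (c * n) ^ s * l" by (rule mult_right_mono[OF sum_card_exponents]) simp
    finally show ?thesis by (simp add: mult.commute)
  qed
  then have "real (n choose t) \<le> real l * real (c * n + 1) ^ s" for n
    by (metis of_nat_le_iff of_nat_mult of_nat_power)
  then show ?thesis by (rule binomial_growth)
qed

lemma power_le_of_primes:
  assumes L: "is_ideal L" "\<And>P. is_prime_ideal P \<Longrightarrow> L \<subseteq> P \<Longrightarrow> P = \<mm>"
  shows "\<exists>N. ideal_power \<mm> N \<subseteq> L"
proof -
  obtain ps where ps: "\<forall>P\<in>set ps. is_prime_ideal P \<and> L \<subseteq> P"
    "\<forall>ys. list_all2 (\<in>) ys ps \<longrightarrow> prod_list ys \<in> L"
    using product_of_primes[OF noeth L(1)] by (elim exE conjE)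
  have "ps = replicate (length ps) \<mm>" using ps(1) L(2) by (simp add: replicate_eqI)
  then have "ideal_power \<mm> (length ps) \<subseteq> L" using ps(2) ideal_power_le[OF L(1)] by metis
  then show ?thesis by blast
qed

end

section \<open>Systems of parameters\<close>

context noetherian_local_inf
begin

text \<open>The invariant says that every prime other than \<open>\<mm>\<close> above the chosen
  elements has height at least \<open>i\<close>. The new element avoids the listed primes other than
  \<open>\<mm>\<close>; a prime different from \<open>\<mm>\<close> that contains it as well
  therefore contains a listed one properly.\<close>

lemma system_of_parameters_step:
  fixes a :: "nat \<Rightarrow> 'a"
  assumes a: "\<forall>P. is_prime_ideal P \<longrightarrow> a ` {..<i} \<subseteq> P \<longrightarrow> P = \<mm> \<or> (\<exists>Q. prime_chain i Q \<and> Q i = P)"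
  obtains x where "x \<in> \<mm>" "\<forall>P. is_prime_ideal P \<longrightarrow> a ` {..<i} \<subseteq> P \<longrightarrow> x \<in> P \<longrightarrow>
    P = \<mm> \<or> (\<exists>Q. prime_chain (Suc i) Q \<and> Q (Suc i) = P)"
proof -
  let ?L = "ideal_generated (a ` {..<i})"
  obtain ps where ps: "\<forall>P\<in>set ps. is_prime_ideal P \<and> ?L \<subseteq> P"
    "\<forall>ys. list_all2 (\<in>) ys ps \<longrightarrow> prod_list ys \<in> ?L"
    using product_of_primes[OF noeth ring_module.subspace_span, of "a ` {..<i}"] by (elim exE conjE)
  obtain x where x: "x \<in> \<mm>" "\<And>W. W \<in> set ps - {\<mm>} \<Longrightarrow> x \<notin> W"
  proof (rule avoid_submodules[OF ring_module.module_axioms, of "set ps - {\<mm>}" \<mm>])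
    show "is_ideal W" if "W \<in> set ps - {\<mm>}" for W using ps(1) that is_prime_idealD by blast
    show "\<not> \<mm> \<subseteq> W" if "W \<in> set ps - {\<mm>}" for W using ps(1) that prime_le_m by blast
  qed (use ideal_m in auto)
  have "P = \<mm> \<or> (\<exists>Q. prime_chain (Suc i) Q \<and> Q (Suc i) = P)"
    if P: "is_prime_ideal P" "a ` {..<i} \<subseteq> P" "x \<in> P" for P
  proof (cases "P = \<mm>")
    case False
    have "?L \<subseteq> P" using P(2) is_prime_idealD[OF P(1)] by (rule ring_module.span_minimal)
    from prime_contains_factor[OF P(1) this ps(2)] obtain P' where P': "P' \<in> set ps" "P' \<subseteq> P" .
    have pP': "is_prime_ideal P'" "?L \<subseteq> P'" using ps(1) P'(1) by auto
    have ne: "P' \<noteq> \<mm>" using P'(2) False prime_le_m[OF P(1)] by blast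
    then have "x \<notin> P'" using x(2) P'(1) by blast
    then have sub: "P' \<subset> P" using P(3) P'(2) by blast
    have "a ` {..<i} \<subseteq> P'" by (rule subset_trans[OF ring_module.span_superset pP'(2)])
    from a[rule_format, OF pP'(1) this] ne have "\<exists>Q. prime_chain i Q \<and> Q i = P'" by blast
    then obtain Q where Q: "prime_chain i Q" "Q i = P'" by (elim exE conjE)
    have "prime_chain (Suc i) (Q(Suc i := P))"
      using Q P(1) sub unfolding prime_chain_def by (simp add: le_Suc_eq less_Suc_eq)
    then show ?thesis by (metis fun_upd_same)
  qed simp
  then show ?thesis using that[OF x(1)] by blast
qed

lemma system_of_parameters:
  assumes "krull_dim TYPE('a) = enat d"
  obtains a :: "nat \<Rightarrow> 'a" and N where "a ` {..<d} \<subseteq> \<mm>" "ideal_power \<mm> N \<subseteq> ideal_generated (a ` {..<d})"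
proof -
  have "\<exists>a :: nat \<Rightarrow> 'a. a ` {..<i} \<subseteq> \<mm> \<and> (\<forall>P. is_prime_ideal P \<longrightarrow> a ` {..<i} \<subseteq> P \<longrightarrow>
      P = \<mm> \<or> (\<exists>Q. prime_chain i Q \<and> Q i = P))" for i
  proof (induction i)
    case 0
    have "prime_chain 0 (\<lambda>_. P)" if "is_prime_ideal P" for P :: "'a set"
      using that unfolding prime_chain_def by simp
    then show ?case by auto
  next
    case (Suc i)
    then obtain a :: "nat \<Rightarrow> 'a" where a: "a ` {..<i} \<subseteq> \<mm>" "\<forall>P. is_prime_ideal P \<longrightarrow> a ` {..<i} \<subseteq> P \<longrightarrow>
      P = \<mm> \<or> (\<exists>Q. prime_chain i Q \<and> Q i = P)" by (elim exE conjE)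
    obtain x where x: "x \<in> \<mm>" "\<forall>P. is_prime_ideal P \<longrightarrow> a ` {..<i} \<subseteq> P \<longrightarrow> x \<in> P \<longrightarrow>
      P = \<mm> \<or> (\<exists>Q. prime_chain (Suc i) Q \<and> Q (Suc i) = P)"
      by (rule system_of_parameters_step[OF a(2)])
    have im: "(a(i := x)) ` {..<Suc i} = insert x (a ` {..<i})" by (auto simp: lessThan_Suc)
    show ?case
      by (rule exI[of _ "a(i := x)"]) (unfold im insert_subset, use a(1) x in simp)
  qed
  from this[of d] obtain a :: "nat \<Rightarrow> 'a" where a: "a ` {..<d} \<subseteq> \<mm>"
    "\<forall>P. is_prime_ideal P \<longrightarrow> a ` {..<d} \<subseteq> P \<longrightarrow> P = \<mm> \<or> (\<exists>Q. prime_chain d Q \<and> Q d = P)"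
    by (elim exE conjE)
  \<comment> \<open>A further prime would carry a chain of length \<open>d\<close>, and appending
    \<open>\<mm>\<close> would exceed the dimension.\<close>
  have "P = \<mm>" if P: "is_prime_ideal P" "ideal_generated (a ` {..<d}) \<subseteq> P" for P
  proof (rule ccontr)
    assume ne: "P \<noteq> \<mm>"
    have "a ` {..<d} \<subseteq> P" by (rule subset_trans[OF ring_module.span_superset P(2)])
    from a(2)[rule_format, OF P(1) this] ne have "\<exists>Q. prime_chain d Q \<and> Q d = P" by blast
    then obtain Q where Q: "prime_chain d Q" "Q d = P" by (elim exE conjE)
    have "P \<subset> \<mm>" using ne prime_le_m[OF P(1)] by blast
    then have "prime_chain (Suc d) (Q(Suc d := \<mm>))"
      using Q prime_m unfolding prime_chain_def by (simp add: le_Suc_eq less_Suc_eq)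
    then have "enat (Suc d) \<le> krull_dim TYPE('a)" by (rule prime_chain_le_dim)
    then show False using assms by simp
  qed
  then obtain N where "ideal_power \<mm> N \<subseteq> ideal_generated (a ` {..<d})"
    using power_le_of_primes[OF ring_module.subspace_span] by blast
  then show ?thesis using that a(1) by blast
qed

end

section \<open>Linear algebra modulo a prime ideal\<close>

lemma
  assumes "is_prime_ideal P"
  shows prime_ideal_one: "1 \<notin> P" and prime_ideal_zero: "0 \<in> P"
    and prime_ideal_mult: "a * b \<in> P \<longleftrightarrow> a \<in> P \<or> b \<in> P"
proof -
  have I: "is_ideal P" using assms by (rule is_prime_idealD)
  show "0 \<in> P" by (rule ring_module.subspace_0[OF I])
  show "1 \<notin> P"
  proof
    assume "1 \<in> P"
    then have "c * 1 \<in> P" for c by (rule ring_module.subspace_scale[OF I])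
    then show False using assms unfolding is_prime_ideal_def by auto
  qed
  show "a * b \<in> P \<longleftrightarrow> a \<in> P \<or> b \<in> P"
    using assms ring_module.subspace_scale[OF I, of b a] ring_module.subspace_scale[OF I, of a b]
    unfolding is_prime_ideal_def by (auto simp: mult.commute)
qed

lemma prime_ideal_prod: "finite A \<Longrightarrow> is_prime_ideal P \<Longrightarrow> prod f A \<in> P \<longleftrightarrow> (\<exists>i\<in>A. f i \<in> P)"
  by (induction A rule: finite_induct) (auto simp: prime_ideal_one prime_ideal_mult)

lemma prime_ideal_power: "is_prime_ideal P \<Longrightarrow> a ^ n \<in> P \<Longrightarrow> a \<in> P"
  by (induction n) (auto simp: prime_ideal_one prime_ideal_mult)

lemma prime_ideal_prod_list_iff: "is_prime_ideal P \<Longrightarrow> prod_list xs \<in> P \<longleftrightarrow> (\<exists>x\<in>set xs. x \<in> P)"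
  by (induction xs) (auto simp: prime_ideal_one prime_ideal_mult)

text \<open>More rows than columns give a nontrivial relation over the fraction field of the residue
  domain; here its denominators are cleared. Column \<open>j\<close> is eliminated with the pivot
  \<open>f i0 j\<close>, and the coefficient of the pivot row is chosen to cancel that column
  exactly.\<close>

lemma relation_mod_prime:
  fixes f :: "'i \<Rightarrow> 'j \<Rightarrow> 'a::comm_ring_1"
  assumes P: "is_prime_ideal P" and "finite J" "finite I" "card J < card I"
  shows "\<exists>v. (\<exists>i\<in>I. v i \<notin> P) \<and> (\<forall>j\<in>J. (\<Sum>i\<in>I. v i * f i j) \<in> P)"
  using assms(2-4)
proof (induction J arbitrary: I f)
  case empty
  then obtain i where "i \<in> I" by fastforce
  then show ?case using prime_ideal_one[OF P] by (intro exI[of _ "\<lambda>_. 1"]) auto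
next
  case (insert j J)
  note iP = is_prime_idealD[OF P]
  show ?case
  proof (cases "\<forall>i\<in>I. f i j \<in> P")
    case True
    have "card J < card I" using insert.prems insert.hyps by simp
    then obtain v where v: "\<exists>i\<in>I. v i \<notin> P" "\<forall>j\<in>J. (\<Sum>i\<in>I. v i * f i j) \<in> P"
      using insert.IH[OF insert.prems(1), of f] by blast
    have "(\<Sum>i\<in>I. v i * f i j) \<in> P"
      using True by (intro ring_module.subspace_sum[OF iP]) (auto simp: prime_ideal_mult[OF P])
    then show ?thesis using v by (intro exI[of _ v]) auto
  next
    case False
    then obtain i0 where i0: "i0 \<in> I" "f i0 j \<notin> P" by blast
    let ?I = "I - {i0}"
    have "card J < card ?I" using insert.prems insert.hyps i0 by simp
    then obtain u where u: "\<exists>i\<in>?I. u i \<notin> P"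
      "\<forall>j'\<in>J. (\<Sum>i\<in>?I. u i * (f i0 j * f i j' - f i j * f i0 j')) \<in> P"
      using insert.IH[of ?I "\<lambda>i j'. f i0 j * f i j' - f i j * f i0 j'"] insert.prems by auto
    define v where "v i = (if i = i0 then - (\<Sum>i\<in>?I. u i * f i j) else f i0 j * u i)" for i
    have sum: "(\<Sum>i\<in>I. v i * f i j') = (\<Sum>i\<in>?I. u i * (f i0 j * f i j' - f i j * f i0 j'))" for j'
    proof -
      have "(\<Sum>i\<in>I. v i * f i j') = v i0 * f i0 j' + (\<Sum>i\<in>?I. v i * f i j')"
        using i0 insert.prems(1) by (simp add: sum.remove)
      also have "(\<Sum>i\<in>?I. v i * f i j') = (\<Sum>i\<in>?I. f i0 j * u i * f i j')"
        by (rule sum.cong) (auto simp: v_def)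
      also have "v i0 * f i0 j' = - (\<Sum>i\<in>?I. u i * f i j * f i0 j')"
        by (simp add: v_def sum_distrib_right)
      finally show ?thesis by (simp add: sum_subtractf right_diff_distrib mult.assoc mult.left_commute)
    qed
    have "(\<Sum>i\<in>I. v i * f i j') \<in> P" if "j' \<in> insert j J" for j'
    proof (cases "j' = j")
      case True
      then show ?thesis unfolding sum using prime_ideal_zero[OF P] by (simp add: mult.commute)
    next
      case False
      then show ?thesis unfolding sum using u(2) that by blast
    qed
    moreover have "\<exists>i\<in>I. v i \<notin> P"
    proof -
      obtain i where i: "i \<in> ?I" "u i \<notin> P" using u(1) by blast
      then have "v i \<notin> P" using i0 by (auto simp: v_def prime_ideal_mult[OF P])
      then show ?thesis using i by blast
    qed
    ultimately show ?thesis by blast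
  qed
qed

lemma prod_cong_mod_ideal:
  assumes Q: "is_ideal Q" and "finite S" "\<And>i. i \<in> S \<Longrightarrow> f i - g i \<in> Q"
  shows "prod f S - prod g S \<in> Q"
  using assms(2,3)
proof (induction S)
  case empty
  then show ?case using ring_module.subspace_0[OF Q] by simp
next
  case (insert i S)
  have "prod f (insert i S) - prod g (insert i S) = prod f S * (f i - g i) + g i * (prod f S - prod g S)"
    using insert.hyps by (simp add: algebra_simps)
  moreover have "prod f S * (f i - g i) \<in> Q" "g i * (prod f S - prod g S) \<in> Q"
    using insert ring_module.subspace_scale[OF Q] by auto
  ultimately show ?case using ring_module.subspace_add[OF Q] by metis
qed

lemma det_cong_mod_ideal:
  assumes Q: "is_ideal Q" and A: "A \<in> carrier_mat n n" and B: "B \<in> carrier_mat n n"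
    and AB: "\<And>i j. i < n \<Longrightarrow> j < n \<Longrightarrow> A $$ (i, j) - B $$ (i, j) \<in> Q"
  shows "det A - det B \<in> Q"
proof -
  have "det A - det B = (\<Sum>p \<in> {p. p permutes {0..<n}}.
      signof p * ((\<Prod>i = 0..<n. A $$ (i, p i)) - (\<Prod>i = 0..<n. B $$ (i, p i))))"
    unfolding det_def'[OF A] det_def'[OF B] by (simp add: sum_subtractf right_diff_distrib)
  also have "\<dots> \<in> Q"
  proof (intro ring_module.subspace_sum[OF Q] ring_module.subspace_scale[OF Q] prod_cong_mod_ideal[OF Q])
    fix p i assume "p \<in> {p. p permutes {0..<n}}" "i \<in> {0..<n}"
    then show "A $$ (i, p i) - B $$ (i, p i) \<in> Q" using permutes_in_image[of p "{0..<n}" i] by (intro AB) auto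
  qed simp
  finally show ?thesis .
qed

text \<open>If the columns were independent modulo \<open>Q\<close>, each unit vector adjoined as an
  extra column would enter a relation with a coefficient outside \<open>Q\<close>. Together these
  relations form a congruence A C = D with \<open>D\<close> diagonal and its determinant outside
  \<open>Q\<close>, against det A in \<open>Q\<close>.\<close>

lemma det_null_vector_mod_prime:
  assumes Q: "is_prime_ideal Q" and A: "A \<in> carrier_mat n n" and det: "det A \<in> Q"
  obtains v where "\<exists>l<n. v l \<notin> Q" "\<And>k. k < n \<Longrightarrow> (\<Sum>l<n. A $$ (k, l) * v l) \<in> Q"
proof -
  note iQ = is_prime_idealD[OF Q]
  have "\<exists>v. (\<exists>l<n. v l \<notin> Q) \<and> (\<forall>k<n. (\<Sum>l<n. A $$ (k, l) * v l) \<in> Q)"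
  proof (rule ccontr)
    assume no: "\<not> ?thesis"
    have ex: "\<exists>c. c n \<notin> Q \<and> (\<forall>j<n. (\<Sum>l<n. A $$ (j, l) * c l) + (if j = k then c n else 0) \<in> Q)"
      if k: "k < n" for k
    proof -
      let ?f = "\<lambda>l j. if l < n then A $$ (j, l) else if j = k then 1 else 0"
      obtain c where c: "\<exists>l\<in>{..<Suc n}. c l \<notin> Q" "\<forall>j\<in>{..<n}. (\<Sum>l\<in>{..<Suc n}. c l * ?f l j) \<in> Q"
        using relation_mod_prime[OF Q, of "{..<n}" "{..<Suc n}" ?f] by auto
      have "(\<Sum>l\<in>{..<Suc n}. c l * ?f l j) = (\<Sum>l<n. A $$ (j, l) * c l) + (if j = k then c n else 0)" for j
        by (simp add: mult.commute)
      then have c2: "(\<Sum>l<n. A $$ (j, l) * c l) + (if j = k then c n else 0) \<in> Q" if "j < n" for j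
        using c(2) that by (metis lessThan_iff)
      have "c n \<notin> Q"
      proof
        assume cn: "c n \<in> Q"
        then have z: "(if j = k then c n else 0) \<in> Q" for j using prime_ideal_zero[OF Q] by simp
        have "(\<Sum>l<n. A $$ (j, l) * c l) \<in> Q" if "j < n" for j
          using ring_module.subspace_diff[OF iQ c2[OF that] z[of j]] by simp
        moreover have "\<exists>l<n. c l \<notin> Q" using c(1) cn by (auto simp: less_Suc_eq)
        ultimately show False using no by blast
      qed
      then show ?thesis using c2 by blast
    qed
    then obtain c where c: "\<And>k. k < n \<Longrightarrow> c k n \<notin> Q"
      "\<And>j k. j < n \<Longrightarrow> k < n \<Longrightarrow> (\<Sum>l<n. A $$ (j, l) * c k l) + (if j = k then c k n else 0) \<in> Q"
      by metis
    define C where "C = mat n n (\<lambda>(l, k). c k l)"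
    define D where "D = mat n n (\<lambda>(j, k). if j = k then - c k n else 0)"
    have C: "C \<in> carrier_mat n n" and D: "D \<in> carrier_mat n n" unfolding C_def D_def by auto
    have "(A * C) $$ (j, k) - D $$ (j, k) \<in> Q" if "j < n" "k < n" for j k
    proof -
      have "(A * C) $$ (j, k) = (\<Sum>l<n. A $$ (j, l) * c k l)"
        using that A by (auto simp: C_def scalar_prod_def atLeast0LessThan intro!: sum.cong)
      then show ?thesis using c(2)[OF that] that by (auto simp: D_def)
    qed
    then have "det (A * C) - det D \<in> Q" by (intro det_cong_mod_ideal[OF iQ _ D]) (use A C in auto)
    moreover have "det (A * C) \<in> Q"
      using det det_mult[OF A C] prime_ideal_mult[OF Q] by simp
    ultimately have "det (A * C) - (det (A * C) - det D) \<in> Q" by (rule ring_module.subspace_diff[OF iQ, rotated])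
    then have "det D \<in> Q" by simp
    moreover have "det D = prod_list (diag_mat D)"
      by (rule det_upper_triangular[OF _ D]) (auto simp: upper_triangular_def D_def)
    moreover have "- c k n \<notin> Q" if "k < n" for k
      using c(1)[OF that] ring_module.subspace_neg[OF iQ, of "- c k n"] by auto
    then have "x \<notin> Q" if "x \<in> set (diag_mat D)" for x
      using that D by (auto simp: diag_mat_def D_def)
    ultimately show False using prime_ideal_prod_list_iff[OF Q] by metis
  qed
  then show ?thesis using that by blast
qed

section \<open>Coordinates in a basis\<close>

definition coord :: "('a::comm_ring_1 \<Rightarrow> 'b::ab_group_add \<Rightarrow> 'b) \<Rightarrow> 'b list \<Rightarrow> 'b \<Rightarrow> nat \<Rightarrow> 'a" where
  "coord scale es v k = module.representation scale (set es) v (es ! k)"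

text \<open>The determinant as a function of its columns, which are vectors of the module, so that
  multilinearity can be used through updates \<open>ys(l := y)\<close>.\<close>

definition col_det :: "nat \<Rightarrow> ('b \<Rightarrow> nat \<Rightarrow> 'a::comm_ring_1) \<Rightarrow> (nat \<Rightarrow> 'b) \<Rightarrow> 'a" where
  "col_det n c ys = det (mat n n (\<lambda>(k, l). c (ys l) k))"

lemma col_det_cong: "(\<And>l. l < n \<Longrightarrow> ys l = zs l) \<Longrightarrow> col_det n c ys = col_det n c zs"
  unfolding col_det_def by (rule arg_cong[of _ _ det]) auto

text \<open>Laplace expansion along column \<open>l\<close>: its cofactors do not involve the vector
  at \<open>l\<close> and serve as the coefficients \<open>K\<close>.\<close>

lemma col_det_linear:
  assumes l: "l < n"
  shows "\<exists>K. \<forall>y. col_det n c (ys(l := y)) = (\<Sum>k<n. c y k * K k)"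
proof -
  let ?A = "\<lambda>y. mat n n (\<lambda>(k, j). c ((ys(l := y)) j) k)"
  have "cofactor (?A y) k l = cofactor (?A (ys l)) k l" if "k < n" for y k
  proof -
    have "mat_delete (?A y) k l = mat_delete (?A (ys l)) k l"
      unfolding mat_delete_def using l by (intro eq_matI) auto
    then show ?thesis unfolding cofactor_def by simp
  qed
  moreover have "det (?A y) = (\<Sum>k<n. ?A y $$ (k, l) * cofactor (?A y) k l)" for y
    by (rule laplace_expansion_column[OF _ l]) simp
  ultimately have "col_det n c (ys(l := y)) = (\<Sum>k<n. c y k * cofactor (?A (ys l)) k l)" for y
    unfolding col_det_def using l by simp
  then show ?thesis by (intro exI[of _ "\<lambda>k. cofactor (?A (ys l)) k l"] allI)
qed

lemma col_det_identical:
  assumes "i < n" "j < n" "i \<noteq> j" "ys i = ys j"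
  shows "col_det n c ys = 0"
  unfolding col_det_def
  by (rule det_identical_columns[of _ n i j]) (use assms in \<open>auto intro!: eq_vecI\<close>)

lemma col_det_permute:
  assumes p: "p permutes {0..<n}"
  shows "col_det n c (\<lambda>l. ys (p l)) = signof p * col_det n c ys"
proof -
  let ?A = "mat n n (\<lambda>(k, l). c (ys l) k)"
  have "col_det n c (\<lambda>l. ys (p l)) = det (mat n n (\<lambda>(k, l). c (ys (p l)) k))" by (simp add: col_det_def)
  also have "\<dots> = det ((mat n n (\<lambda>(k, l). c (ys (p l)) k))\<^sup>T)" by (rule det_transpose[of _ n, symmetric]) simp
  also have "(mat n n (\<lambda>(k, l). c (ys (p l)) k))\<^sup>T = mat n n (\<lambda>(i, j). ?A\<^sup>T $$ (p i, j))"
    using permutes_in_image[OF p] by (intro eq_matI) auto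
  also have "det \<dots> = signof p * det (?A\<^sup>T)" by (rule det_permute_rows[OF _ p]) simp
  also have "det (?A\<^sup>T) = det ?A" by (rule det_transpose[of _ n]) simp
  finally show ?thesis by (simp add: col_det_def)
qed

locale free_module = Modules.module scale
  for scale :: "'a::comm_ring_1 \<Rightarrow> 'b::ab_group_add \<Rightarrow> 'b" (infixr "*s" 75) +
  fixes es :: "'b list" and F :: "'b set"
  assumes basis: "is_basis scale es F"
begin

lemma distinct_es: "distinct es" and indep: "\<not> dependent (set es)" and span_es: "span (set es) = F"
  using basis unfolding is_basis_def by auto

lemma subspace_F: "subspace F"
  using subspace_span span_es by metis

lemma coord_add: "v \<in> F \<Longrightarrow> w \<in> F \<Longrightarrow> coord scale es (v + w) k = coord scale es v k + coord scale es w k"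
  unfolding coord_def using representation_add[OF indep, of w v] span_es by (simp add: add.commute)

lemma coord_scale: "v \<in> F \<Longrightarrow> coord scale es (c *s v) k = c * coord scale es v k"
  unfolding coord_def using representation_scale[OF indep, of v c] span_es by simp

lemma coord_zero: "coord scale es 0 k = 0"
  unfolding coord_def by (simp add: representation_zero)

lemma coord_sum: "(\<And>i. i \<in> I \<Longrightarrow> v i \<in> F) \<Longrightarrow> coord scale es (sum v I) k = (\<Sum>i\<in>I. coord scale es (v i) k)"
  unfolding coord_def using representation_sum[OF indep, of I v] span_es by simp

lemma es_in_F: "k < length es \<Longrightarrow> es ! k \<in> F"
  using span_base[of "es ! k" "set es"] span_es by simp

lemma sum_es: "(\<Sum>b\<in>set es. f b) = (\<Sum>k<length es. f (es ! k))"
proof -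
  have "bij_betw (\<lambda>k. es ! k) {..<length es} (set es)"
    by (rule bij_betw_nth[OF distinct_es]) auto
  from sum.reindex_bij_betw[OF this, of f] show ?thesis by simp
qed

lemma coord_expand: "v \<in> F \<Longrightarrow> (\<Sum>k<length es. coord scale es v k *s es ! k) = v"
  unfolding coord_def
  using sum_representation_eq[OF indep, of v "set es"] span_es sum_es[of "\<lambda>b. representation (set es) v b *s b"]
  by simp

lemma coord_basis: "k < length es \<Longrightarrow> l < length es \<Longrightarrow> coord scale es (es ! l) k = (if k = l then 1 else 0)"
  unfolding coord_def using representation_basis[OF indep, of "es ! l"] distinct_es
  by (simp add: nth_eq_iff_index_eq)

lemma coord_eqD:
  assumes "v \<in> F" "w \<in> F" "\<And>k. k < length es \<Longrightarrow> coord scale es v k = coord scale es w k"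
  shows "v = w"
proof -
  have "v = (\<Sum>k<length es. coord scale es v k *s es ! k)" using coord_expand[OF assms(1)] by simp
  also have "\<dots> = (\<Sum>k<length es. coord scale es w k *s es ! k)" using assms(3) by (intro sum.cong) auto
  also have "\<dots> = w" using coord_expand[OF assms(2)] .
  finally show ?thesis .
qed

lemma coord_mat_nth:
  "k < length es \<Longrightarrow> l < length bs \<Longrightarrow> coord_mat scale es bs $$ (k, l) = coord scale es (bs ! l) k"
  unfolding coord_mat_def coord_def by simp

lemma coord_mat_carrier: "coord_mat scale es bs \<in> carrier_mat (length es) (length bs)"
  unfolding coord_mat_def by simp

lemma det_coord_mat:
  "length bs = length es \<Longrightarrow> det (coord_mat scale es bs) = col_det (length es) (coord scale es) (\<lambda>l. bs ! l)"
  unfolding coord_mat_def col_det_def coord_def by simp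

text \<open>Linearity in one column packaged as a submodule, so that statements about a determinant
  pass from generators to their span. With the zero ideal it expresses that the determinant
  vanishes.\<close>

lemma subspace_col_det:
  assumes l: "l < length es" and I: "is_ideal I"
  shows "subspace {y \<in> F. col_det (length es) (coord scale es) (ys(l := y)) \<in> I}"
proof -
  obtain K where K: "\<And>y. col_det (length es) (coord scale es) (ys(l := y)) = (\<Sum>k<length es. coord scale es y k * K k)"
    using col_det_linear[OF l] by metis
  show ?thesis
    unfolding K subspace_def
  proof (intro conjI ballI allI CollectI)
    show "0 \<in> F" by (rule subspace_0[OF subspace_F])
    show "(\<Sum>k<length es. coord scale es 0 k * K k) \<in> I"
      using ring_module.subspace_0[OF I] by (simp add: coord_zero)
  next
    fix x y assume xy: "x \<in> {y \<in> F. (\<Sum>k<length es. coord scale es y k * K k) \<in> I}"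
      "y \<in> {y \<in> F. (\<Sum>k<length es. coord scale es y k * K k) \<in> I}"
    then show "x + y \<in> F" using subspace_add[OF subspace_F] by blast
    show "(\<Sum>k<length es. coord scale es (x + y) k * K k) \<in> I"
      using xy ring_module.subspace_add[OF I] by (simp add: coord_add distrib_right sum.distrib)
  next
    fix c x assume x: "x \<in> {y \<in> F. (\<Sum>k<length es. coord scale es y k * K k) \<in> I}"
    then show "c *s x \<in> F" using subspace_scale[OF subspace_F] by blast
    show "(\<Sum>k<length es. coord scale es (c *s x) k * K k) \<in> I"
      using x ring_module.subspace_scale[OF I, of _ c] by (simp add: coord_scale mult.assoc flip: sum_distrib_left)
  qed
qed

lemma col_det_scale:
  assumes "l < length es" "y \<in> F"
  shows "col_det (length es) (coord scale es) (ys(l := c *s y)) = c * col_det (length es) (coord scale es) (ys(l := y))"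
proof -
  obtain K where K: "\<And>y. col_det (length es) (coord scale es) (ys(l := y)) = (\<Sum>k<length es. coord scale es y k * K k)"
    using col_det_linear[OF assms(1)] by metis
  show ?thesis unfolding K using assms(2) by (simp add: coord_scale sum_distrib_left mult.assoc)
qed

lemma minor_eq_col_det:
  assumes J: "J \<subseteq> {..<length gs}" "card J = length es"
  shows "det (submatrix (coord_mat scale es gs) UNIV J) = col_det (length es) (coord scale es) (\<lambda>l. gs ! pick J l)"
    and "\<And>l. l < length es \<Longrightarrow> pick J l \<in> J"
proof -
  show pJ: "pick J l \<in> J" if "l < length es" for l
    using pick_in_set[of l J] that J by simp
  have dims: "dim_row (coord_mat scale es gs) = length es" "dim_col (coord_mat scale es gs) = length gs"
    using coord_mat_carrier by auto
  have "{j. j < length gs \<and> j \<in> J} = J" using J by auto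
  then have "submatrix (coord_mat scale es gs) UNIV J =
      mat (length es) (length es) (\<lambda>(k, l). coord scale es (gs ! pick J l) k)"
    unfolding submatrix_def dims using J pJ
    by (intro eq_matI) (auto simp: pick_UNIV coord_mat_nth subset_iff)
  then show "det (submatrix (coord_mat scale es gs) UNIV J) =
      col_det (length es) (coord scale es) (\<lambda>l. gs ! pick J l)"
    by (simp add: col_det_def)
qed

text \<open>Minors are indexed by sets, choices of columns by functions. A repeated column gives
  zero, and an injective \<open>h\<close> differs from the increasing enumeration
  \<open>pick J\<close> of its range by a permutation.\<close>

lemma col_det_in_minors_nth:
  assumes h: "\<And>l. l < length es \<Longrightarrow> h l < length gs"
  shows "col_det (length es) (coord scale es) (\<lambda>l. gs ! h l) \<in> maximal_minors_ideal (coord_mat scale es gs)"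
    (is "_ \<in> ?I")
proof -
  let ?n = "length es"
  have I: "is_ideal ?I" unfolding maximal_minors_ideal_def by (rule ring_module.subspace_span)
  show ?thesis
  proof (cases "inj_on h {0..<?n}")
    case False
    then obtain i j where "i < ?n" "j < ?n" "i \<noteq> j" "h i = h j" unfolding inj_on_def by auto
    then have "col_det ?n (coord scale es) (\<lambda>l. gs ! h l) = 0" by (intro col_det_identical[of i _ j]) auto
    then show ?thesis using ring_module.subspace_0[OF I] by simp
  next
    case True
    define J where "J = h ` {0..<?n}"
    have J: "J \<subseteq> {..<length gs}" "card J = ?n" using h card_image[OF True] unfolding J_def by auto
    have fin: "finite J" unfolding J_def by simp
    define g where "g = the_inv_into {0..<?n} h"
    have bh: "bij_betw h {0..<?n} J" using True unfolding J_def by (rule inj_on_imp_bij_betw)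
    have pinj: "inj_on (pick J) {0..<?n}"
      by (rule inj_onI) (metis J(2) atLeastLessThan_iff nat_neq_iff pick_mono)
    have "pick J ` {0..<?n} \<subseteq> J" using minor_eq_col_det(2)[OF J] by auto
    moreover have "card (pick J ` {0..<?n}) = card J" using card_image[OF pinj] J by simp
    ultimately have bp: "bij_betw (pick J) {0..<?n} J"
      using pinj card_subset_eq[OF fin] unfolding bij_betw_def by blast
    define p where "p l = (if l < ?n then the_inv_into {0..<?n} (pick J) (h l) else l)" for l
    have "bij_betw (the_inv_into {0..<?n} (pick J) \<circ> h) {0..<?n} {0..<?n}"
      using bij_betw_trans[OF bh bij_betw_the_inv_into[OF bp]] .
    then have "bij_betw p {0..<?n} {0..<?n}" by (rule bij_betw_cong[THEN iffD1, rotated]) (simp add: p_def)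
    then have p: "p permutes {0..<?n}" by (rule bij_imp_permutes) (simp add: p_def)
    have hp: "h l = pick J (p l)" if "l < ?n" for l
      using f_the_inv_into_f_bij_betw[OF bp, of "h l"] that bh unfolding p_def bij_betw_def by auto
    have "col_det ?n (coord scale es) (\<lambda>l. gs ! h l) = col_det ?n (coord scale es) (\<lambda>l. gs ! pick J (p l))"
      by (rule col_det_cong) (simp add: hp)
    also have "\<dots> = signof p * col_det ?n (coord scale es) (\<lambda>l. gs ! pick J l)"
      using col_det_permute[OF p, of "coord scale es" "\<lambda>l. gs ! pick J l"] .
    also have "col_det ?n (coord scale es) (\<lambda>l. gs ! pick J l) = det (submatrix (coord_mat scale es gs) UNIV J)"
      using minor_eq_col_det(1)[OF J] by simp
    also have "signof p * \<dots> \<in> ?I"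
    proof (rule ring_module.subspace_scale[OF I])
      show "det (submatrix (coord_mat scale es gs) UNIV J) \<in> ?I"
        unfolding maximal_minors_ideal_def using J coord_mat_carrier[of gs]
        by (intro ring_module.span_base) auto
    qed
    finally show ?thesis .
  qed
qed

text \<open>Multilinearity, one column at a time: \<open>t\<close> counts the leading columns that
  still range over the span, while the columns from \<open>t\<close> on are generators
  already.\<close>

lemma col_det_in_minors:
  assumes gs: "set gs \<subseteq> F" and ys: "\<And>l. l < length es \<Longrightarrow> ys l \<in> span (set gs)"
  shows "col_det (length es) (coord scale es) ys \<in> maximal_minors_ideal (coord_mat scale es gs)"
proof -
  let ?n = "length es" and ?I = "maximal_minors_ideal (coord_mat scale es gs)"
  have I: "is_ideal ?I" unfolding maximal_minors_ideal_def by (rule ring_module.subspace_span)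
  have "col_det ?n (coord scale es) ys \<in> ?I"
    if "t \<le> ?n" "\<And>l. l < t \<Longrightarrow> ys l \<in> span (set gs)" "\<And>l. t \<le> l \<Longrightarrow> l < ?n \<Longrightarrow> ys l \<in> set gs" for t ys
    using that
  proof (induction t arbitrary: ys)
    case 0
    have "\<forall>l. \<exists>j. l < ?n \<longrightarrow> j < length gs \<and> gs ! j = ys l" using 0(3) by (metis in_set_conv_nth zero_le)
    then obtain h where h: "\<And>l. l < ?n \<Longrightarrow> h l < length gs \<and> gs ! h l = ys l" by metis
    have "col_det ?n (coord scale es) ys = col_det ?n (coord scale es) (\<lambda>l. gs ! h l)"
      by (rule col_det_cong) (simp add: h)
    then show ?case using col_det_in_minors_nth[of h gs] h by simp
  next
    case (Suc t)
    have t: "t < ?n" using Suc.prems(1) by simp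
    let ?S = "{y \<in> F. col_det ?n (coord scale es) (ys(t := y)) \<in> ?I}"
    have "set gs \<subseteq> ?S"
    proof
      fix g assume g: "g \<in> set gs"
      have "col_det ?n (coord scale es) (ys(t := g)) \<in> ?I"
      proof (rule Suc.IH)
        show "(ys(t := g)) l \<in> span (set gs)" if "l < t" for l using Suc.prems(2)[of l] that by simp
        show "(ys(t := g)) l \<in> set gs" if "t \<le> l" "l < ?n" for l
          using Suc.prems(3)[of l] that g by (cases "l = t") auto
      qed (use t in simp)
      then show "g \<in> ?S" using g gs by blast
    qed
    then have "span (set gs) \<subseteq> ?S" by (rule span_minimal[OF _ subspace_col_det[OF t I]])
    then have "ys t \<in> ?S" using Suc.prems(2)[of t] by blast
    then show ?case by simp
  qed
  then show ?thesis using ys by (meson le_refl not_less)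
qed

text \<open>By linearity in column \<open>t\<close> the scalar from \<open>N\<close> can be pulled
  out of the determinant.\<close>

lemma col_det_in_scaled_minors:
  assumes gs: "set gs \<subseteq> F" and ys: "\<And>l. l < length es \<Longrightarrow> ys l \<in> span (set gs)"
    and t: "t < length es" "ys t \<in> ideal_mult scale N (span (set gs))"
  shows "col_det (length es) (coord scale es) ys \<in> ideal_mult (*) N (maximal_minors_ideal (coord_mat scale es gs))"
proof -
  let ?n = "length es" and ?I = "maximal_minors_ideal (coord_mat scale es gs)"
  let ?S = "{y \<in> F. col_det ?n (coord scale es) (ys(t := y)) \<in> ideal_mult (*) N ?I}"
  have sub: "span (set gs) \<subseteq> F" using gs subspace_F by (rule span_minimal)
  have "ideal_mult scale N (span (set gs)) \<subseteq> ?S"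
  proof (rule ideal_mult_le[OF subspace_col_det[OF t(1) ring_module.subspace_ideal_mult]])
    fix c x assume c: "c \<in> N" and x: "x \<in> span (set gs)"
    have "col_det ?n (coord scale es) (ys(t := x)) \<in> ?I"
      by (rule col_det_in_minors[OF gs]) (use x ys in auto)
    then have "c * col_det ?n (coord scale es) (ys(t := x)) \<in> ideal_mult (*) N ?I"
      using ring_module.ideal_mult_base[OF c] by blast
    then show "c *s x \<in> ?S"
      using x sub subspace_scale[OF subspace_F] by (auto simp: col_det_scale[OF t(1)])
  qed
  then show ?thesis using t(2) by auto
qed

end

section \<open>The symmetric algebra\<close>

interpretation sym_module: Modules.module "sym_scale :: 'a::comm_ring_1 \<Rightarrow> 'a sym_alg \<Rightarrow> 'a sym_alg"
proof
  fix a b :: 'a and x y :: "'a sym_alg"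
  show "sym_scale a (x + y) = sym_scale a x + sym_scale a y" by (simp add: sym_scale_def distrib_left)
  show "sym_scale (a + b) x = sym_scale a x + sym_scale b x"
    by (simp add: sym_scale_def distrib_right single_add)
  show "sym_scale a (sym_scale b x) = sym_scale (a * b) x"
    by (simp add: sym_scale_def mult_single flip: mult.assoc)
  show "sym_scale 1 x = x" by (simp add: sym_scale_def)
qed

lemma sym_scale_mult: "sym_scale c x * y = sym_scale c (x * y)" "x * sym_scale c y = sym_scale c (x * y)"
  by (simp_all add: sym_scale_def ac_simps)

lemma lookup_sym_scale: "Poly_Mapping.lookup (sym_scale c p) \<alpha> = c * Poly_Mapping.lookup p \<alpha>"
proof -
  have "sym_scale c p = Poly_Mapping.map ((*) c) p" by (simp add: sym_scale_def mult_map_scale_conv_mult)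
  then show ?thesis by (simp add: map.rep_eq when_def)
qed

lemma sym_span_mult:
  assumes W: "module.subspace sym_scale W" and "x \<in> sym_span U" "y \<in> sym_span V"
    and UV: "\<And>u v. u \<in> U \<Longrightarrow> v \<in> V \<Longrightarrow> u * v \<in> W"
  shows "x * y \<in> W"
proof -
  have sub: "sym_module.subspace {x. x * z \<in> W}" "sym_module.subspace {x. z * x \<in> W}" for z
    using sym_module.subspace_0[OF W] sym_module.subspace_add[OF W] sym_module.subspace_scale[OF W]
    by (auto simp: sym_module.subspace_def sym_scale_mult distrib_left distrib_right)
  have "sym_span V \<subseteq> {y. u * y \<in> W}" if "u \<in> U" for u
    using UV[OF that] by (intro sym_module.span_minimal[OF _ sub(2)]) blast
  then have "sym_span U \<subseteq> {x. x * y \<in> W}"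
    using assms(3) by (intro sym_module.span_minimal[OF _ sub(1)]) blast
  then show ?thesis using assms(2) by blast
qed

lemma sym_alg_decomp:
  fixes p :: "'a::comm_ring_1 sym_alg"
  assumes "finite A" "Poly_Mapping.keys p \<subseteq> A"
  shows "p = (\<Sum>\<alpha>\<in>A. Poly_Mapping.single \<alpha> (Poly_Mapping.lookup p \<alpha>))"
proof (rule poly_mapping_eqI)
  fix \<beta>
  have "Poly_Mapping.lookup (\<Sum>\<alpha>\<in>A. Poly_Mapping.single \<alpha> (Poly_Mapping.lookup p \<alpha>)) \<beta> =
      (\<Sum>\<alpha>\<in>A. if \<alpha> = \<beta> then Poly_Mapping.lookup p \<beta> else 0)"
    unfolding lookup_sum by (rule sum.cong) (auto simp: lookup_single when_def)
  also have "\<dots> = Poly_Mapping.lookup p \<beta>"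
    using assms by (auto simp: in_keys_iff)
  finally show "Poly_Mapping.lookup p \<beta> =
    Poly_Mapping.lookup (\<Sum>\<alpha>\<in>A. Poly_Mapping.single \<alpha> (Poly_Mapping.lookup p \<alpha>)) \<beta>" by simp
qed

section \<open>Evaluation of the symmetric algebra\<close>

definition eval_monomial :: "('x \<Rightarrow> 'a::comm_ring_1) \<Rightarrow> ('x \<Rightarrow>\<^sub>0 nat) \<Rightarrow> 'a" where
  "eval_monomial f \<alpha> = (\<Prod>x\<in>Poly_Mapping.keys \<alpha>. f x ^ Poly_Mapping.lookup \<alpha> x)"

definition sym_eval :: "(nat \<times> nat \<Rightarrow> 'a::comm_ring_1) \<Rightarrow> 'a sym_alg \<Rightarrow> 'a" where
  "sym_eval f p = (\<Sum>\<alpha>\<in>Poly_Mapping.keys p. Poly_Mapping.lookup p \<alpha> * eval_monomial f \<alpha>)"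

lemma eval_monomial_superset:
  assumes "finite X" "Poly_Mapping.keys \<alpha> \<subseteq> X"
  shows "eval_monomial f \<alpha> = (\<Prod>x\<in>X. f x ^ Poly_Mapping.lookup \<alpha> x)"
  unfolding eval_monomial_def
  by (rule prod.mono_neutral_left) (use assms in \<open>auto simp: in_keys_iff\<close>)

lemma eval_monomial_add: "eval_monomial f (\<alpha> + \<beta>) = eval_monomial f \<alpha> * eval_monomial f \<beta>"
proof -
  let ?X = "Poly_Mapping.keys \<alpha> \<union> Poly_Mapping.keys \<beta>"
  have "eval_monomial f (\<alpha> + \<beta>) = (\<Prod>x\<in>?X. f x ^ Poly_Mapping.lookup (\<alpha> + \<beta>) x)"
    using keys_add[of \<alpha> \<beta>] by (intro eval_monomial_superset) auto
  also have "\<dots> = (\<Prod>x\<in>?X. f x ^ Poly_Mapping.lookup \<alpha> x) * (\<Prod>x\<in>?X. f x ^ Poly_Mapping.lookup \<beta> x)"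
    by (simp add: lookup_add power_add prod.distrib)
  finally show ?thesis
    using eval_monomial_superset[of ?X \<alpha> f] eval_monomial_superset[of ?X \<beta> f] by simp
qed

lemma sym_eval_superset:
  assumes "finite A" "Poly_Mapping.keys p \<subseteq> A"
  shows "sym_eval f p = (\<Sum>\<alpha>\<in>A. Poly_Mapping.lookup p \<alpha> * eval_monomial f \<alpha>)"
  unfolding sym_eval_def
  by (rule sum.mono_neutral_left) (use assms in \<open>auto simp: in_keys_iff\<close>)

lemma sym_eval_add: "sym_eval f (p + q) = sym_eval f p + sym_eval f q"
proof -
  let ?A = "Poly_Mapping.keys p \<union> Poly_Mapping.keys q"
  have "sym_eval f (p + q) = (\<Sum>\<alpha>\<in>?A. Poly_Mapping.lookup (p + q) \<alpha> * eval_monomial f \<alpha>)"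
    using keys_add[of p q] by (intro sym_eval_superset) auto
  also have "\<dots> = (\<Sum>\<alpha>\<in>?A. Poly_Mapping.lookup p \<alpha> * eval_monomial f \<alpha>) +
      (\<Sum>\<alpha>\<in>?A. Poly_Mapping.lookup q \<alpha> * eval_monomial f \<alpha>)"
    by (simp add: lookup_add distrib_right sum.distrib)
  finally show ?thesis using sym_eval_superset[of ?A p f] sym_eval_superset[of ?A q f] by simp
qed

lemma sym_eval_single: "sym_eval f (Poly_Mapping.single \<alpha> c) = c * eval_monomial f \<alpha>"
  using sym_eval_superset[of "{\<alpha>}" "Poly_Mapping.single \<alpha> c" f] by simp

lemma sym_eval_zero: "sym_eval f 0 = 0"
  by (simp add: sym_eval_def)

lemma sym_eval_sum: "sym_eval f (sum g A) = (\<Sum>x\<in>A. sym_eval f (g x))"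
  by (induction A rule: infinite_finite_induct) (auto simp: sym_eval_zero sym_eval_add)

lemma sym_eval_mult: "sym_eval f (p * q) = sym_eval f p * sym_eval f q"
proof -
  let ?p = "\<lambda>\<alpha>. Poly_Mapping.single \<alpha> (Poly_Mapping.lookup p \<alpha>)"
    and ?q = "\<lambda>\<alpha>. Poly_Mapping.single \<alpha> (Poly_Mapping.lookup q \<alpha>)"
  have p: "p = (\<Sum>\<alpha>\<in>Poly_Mapping.keys p. ?p \<alpha>)" and q: "q = (\<Sum>\<beta>\<in>Poly_Mapping.keys q. ?q \<beta>)"
    by (rule sym_alg_decomp; simp)+
  have "p * q = (\<Sum>\<alpha>\<in>Poly_Mapping.keys p. ?p \<alpha>) * (\<Sum>\<beta>\<in>Poly_Mapping.keys q. ?q \<beta>)"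
    using p q by simp
  also have "\<dots> = (\<Sum>\<alpha>\<in>Poly_Mapping.keys p. \<Sum>\<beta>\<in>Poly_Mapping.keys q. ?p \<alpha> * ?q \<beta>)"
    by (simp add: sum_product)
  finally have "sym_eval f (p * q) =
      (\<Sum>\<alpha>\<in>Poly_Mapping.keys p. \<Sum>\<beta>\<in>Poly_Mapping.keys q. sym_eval f (?p \<alpha> * ?q \<beta>))"
    by (simp add: sym_eval_sum)
  also have "\<dots> = (\<Sum>\<alpha>\<in>Poly_Mapping.keys p. \<Sum>\<beta>\<in>Poly_Mapping.keys q.
      (Poly_Mapping.lookup p \<alpha> * eval_monomial f \<alpha>) * (Poly_Mapping.lookup q \<beta> * eval_monomial f \<beta>))"
    by (intro sum.cong refl) (simp add: mult_single sym_eval_single eval_monomial_add ac_simps)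
  also have "\<dots> = sym_eval f p * sym_eval f q"
    by (simp add: sym_eval_def sum_product)
  finally show ?thesis .
qed

lemma sym_eval_scale: "sym_eval f (sym_scale c p) = c * sym_eval f p"
  by (simp add: sym_scale_def sym_eval_mult sym_eval_single eval_monomial_def)

lemma sym_eval_one: "sym_eval f 1 = 1"
  using sym_eval_single[of f 0 1] by (simp add: eval_monomial_def)

lemma sym_eval_prod: "sym_eval f (prod g A) = (\<Prod>x\<in>A. sym_eval f (g x))"
  by (induction A rule: infinite_finite_induct) (auto simp: sym_eval_one sym_eval_mult)

text \<open>The functional with value \<open>c k\<close> at the \<open>k\<close>-th basis vector.
  Evaluating the variables of a block at such values restricts to it on linear forms.\<close>

definition dual_apply ::
    "('a::comm_ring_1 \<Rightarrow> 'b::ab_group_add \<Rightarrow> 'b) \<Rightarrow> 'b list \<Rightarrow> (nat \<Rightarrow> 'a) \<Rightarrow> 'b \<Rightarrow> 'a" where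
  "dual_apply scale es c v = (\<Sum>k<length es. coord scale es v k * c k)"

lemma lin_form_coord: "lin_form scale e i v =
    (\<Sum>k<length (e i). Poly_Mapping.single (Poly_Mapping.single (i, k) 1) (coord scale (e i) v k))"
  unfolding lin_form_def coord_def ..

lemma sym_eval_lin_form: "sym_eval f (lin_form scale e i v) = dual_apply scale (e i) (\<lambda>k. f (i, k)) v"
  unfolding lin_form_coord dual_apply_def
  by (simp add: sym_eval_sum sym_eval_single eval_monomial_def)

lemma (in free_module) dual_apply_linear:
  "v \<in> F \<Longrightarrow> w \<in> F \<Longrightarrow> dual_apply scale es c (v + w) = dual_apply scale es c v + dual_apply scale es c w"
  "v \<in> F \<Longrightarrow> dual_apply scale es c (x *s v) = x * dual_apply scale es c v"
  "dual_apply scale es c 0 = 0"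
  unfolding dual_apply_def
  by (simp_all add: coord_add coord_scale coord_zero distrib_right sum.distrib sum_distrib_left mult.assoc)

section \<open>Products of symmetric powers with varying exponents\<close>

definition multi_power ::
    "('a::comm_ring_1 \<Rightarrow> 'b::ab_group_add \<Rightarrow> 'b) \<Rightarrow> (nat \<Rightarrow> 'b list) \<Rightarrow> nat \<Rightarrow> (nat \<Rightarrow> 'b set)
      \<Rightarrow> (nat \<Rightarrow> nat) \<Rightarrow> 'a sym_alg set" where
  "multi_power scale e q M n = sym_prod (\<lambda>j. sym_power_image scale e j (n j) (M j)) {..<q}"

lemma subspace_multi_power: "module.subspace sym_scale (multi_power scale e q M n)"
  unfolding multi_power_def sym_prod_def by (rule sym_module.subspace_span)

lemma sym_prod_cong: "(\<And>j. j \<in> J \<Longrightarrow> U j = V j) \<Longrightarrow> sym_prod U J = sym_prod V J"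
proof -
  assume UV: "\<And>j. j \<in> J \<Longrightarrow> U j = V j"
  have "(\<forall>j\<in>J. u j \<in> U j) \<longleftrightarrow> (\<forall>j\<in>J. u j \<in> V j)" for u using UV by blast
  then show ?thesis unfolding sym_prod_def by simp
qed

lemma sym_mult_sym_prod:
  assumes "finite J" "i \<in> J"
  shows "sym_mult (U i) (sym_prod U (J - {i})) = sym_prod U J"
proof
  show "sym_mult (U i) (sym_prod U (J - {i})) \<subseteq> sym_prod U J"
    unfolding sym_mult_def
  proof (rule sym_module.span_minimal)
    show sub: "sym_module.subspace (sym_prod U J)" unfolding sym_prod_def by (rule sym_module.subspace_span)
    show "{u * v |u v. u \<in> U i \<and> v \<in> sym_prod U (J - {i})} \<subseteq> sym_prod U J"
    proof clarify
      fix u v assume u: "u \<in> U i" and v: "v \<in> sym_prod U (J - {i})"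
      show "u * v \<in> sym_prod U J"
      proof (rule sym_span_mult[OF sub sym_module.span_base[of u "{u}"] v[unfolded sym_prod_def]])
        fix u' v' assume "u' \<in> {u}" and "v' \<in> {\<Prod>j\<in>J - {i}. w j |w. \<forall>j\<in>J - {i}. w j \<in> U j}"
        then obtain w where w: "u' = u" "v' = (\<Prod>j\<in>J - {i}. w j)" "\<forall>j\<in>J - {i}. w j \<in> U j" by blast
        have "(\<Prod>j\<in>J. (w(i := u)) j) = u * (\<Prod>j\<in>J - {i}. (w(i := u)) j)"
          using prod.remove[OF assms, of "w(i := u)"] by simp
        also have "(\<Prod>j\<in>J - {i}. (w(i := u)) j) = (\<Prod>j\<in>J - {i}. w j)" by (rule prod.cong) auto
        finally have "u * (\<Prod>j\<in>J - {i}. w j) = (\<Prod>j\<in>J. (w(i := u)) j)" by simp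
        moreover have "\<forall>j\<in>J. (w(i := u)) j \<in> U j" using w(3) u by auto
        ultimately have "u * (\<Prod>j\<in>J - {i}. w j) \<in> {\<Prod>j\<in>J. w j |w. \<forall>j\<in>J. w j \<in> U j}"
          by (intro CollectI exI[of _ "w(i := u)"] conjI)
        then show "u' * v' \<in> sym_prod U J" unfolding w sym_prod_def by (rule sym_module.span_base)
      qed simp
    qed
  qed
  show "sym_prod U J \<subseteq> sym_mult (U i) (sym_prod U (J - {i}))"
    unfolding sym_prod_def[of U J]
  proof (rule sym_module.span_minimal)
    show "sym_module.subspace (sym_mult (U i) (sym_prod U (J - {i})))"
      unfolding sym_mult_def by (rule sym_module.subspace_span)
    show "{\<Prod>j\<in>J. w j |w. \<forall>j\<in>J. w j \<in> U j} \<subseteq> sym_mult (U i) (sym_prod U (J - {i}))"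
    proof clarify
      fix w assume w: "\<forall>j\<in>J. w j \<in> U j"
      have "(\<Prod>j\<in>J - {i}. w j) \<in> sym_prod U (J - {i})"
        unfolding sym_prod_def using w by (intro sym_module.span_base) auto
      then have "w i * (\<Prod>j\<in>J - {i}. w j) \<in> sym_mult (U i) (sym_prod U (J - {i}))"
        unfolding sym_mult_def using w assms(2) by (intro sym_module.span_base) auto
      then show "(\<Prod>j\<in>J. w j) \<in> sym_mult (U i) (sym_prod U (J - {i}))"
        using assms by (simp add: prod.remove[of J i])
    qed
  qed
qed

lemma sym_prod_mult:
  assumes "finite J" "\<And>j u v. j \<in> J \<Longrightarrow> u \<in> U j \<Longrightarrow> v \<in> V j \<Longrightarrow> u * v \<in> W j"
    and "x \<in> sym_prod U J" "y \<in> sym_prod V J"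
  shows "x * y \<in> sym_prod W J"
proof (rule sym_span_mult[OF _ assms(3)[unfolded sym_prod_def] assms(4)[unfolded sym_prod_def]])
  show "sym_module.subspace (sym_prod W J)" unfolding sym_prod_def by (rule sym_module.subspace_span)
  fix u v assume "u \<in> {\<Prod>j\<in>J. w j |w. \<forall>j\<in>J. w j \<in> U j}" "v \<in> {\<Prod>j\<in>J. w j |w. \<forall>j\<in>J. w j \<in> V j}"
  then obtain a b where ab: "u = (\<Prod>j\<in>J. a j)" "v = (\<Prod>j\<in>J. b j)" "\<forall>j\<in>J. a j \<in> U j" "\<forall>j\<in>J. b j \<in> V j"
    by blast
  have "u * v = (\<Prod>j\<in>J. a j * b j)" unfolding ab by (rule prod.distrib[symmetric])
  then show "u * v \<in> sym_prod W J"
    unfolding sym_prod_def using ab(3,4) assms(2)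
    by (intro sym_module.span_base CollectI exI[of _ "\<lambda>j. a j * b j"]) auto
qed

lemma sym_power_image_mult:
  assumes "x \<in> sym_power_image scale e i m M" "y \<in> sym_power_image scale e i n M"
  shows "x * y \<in> sym_power_image scale e i (m + n) M"
proof (rule sym_span_mult[OF _ assms[unfolded sym_power_image_def]])
  show "sym_module.subspace (sym_power_image scale e i (m + n) M)"
    unfolding sym_power_image_def by (rule sym_module.subspace_span)
  fix u v assume "u \<in> {\<Prod>k<m. lin_form scale e i (v k) |v. \<forall>k<m. v k \<in> M}"
    "v \<in> {\<Prod>k<n. lin_form scale e i (v k) |v. \<forall>k<n. v k \<in> M}"
  then obtain a b where ab: "u = (\<Prod>k<m. lin_form scale e i (a k))" "v = (\<Prod>k<n. lin_form scale e i (b k))"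
    "\<forall>k<m. a k \<in> M" "\<forall>k<n. b k \<in> M" by blast
  define c where "c k = (if k < m then a k else b (k - m))" for k
  have split: "(\<Prod>k<m + n. f k) = (\<Prod>k<m. f k) * (\<Prod>k<n. f (m + k))" for f :: "nat \<Rightarrow> 'a sym_alg"
    by (induction n) (auto simp: mult.assoc)
  have "(\<Prod>k<m + n. lin_form scale e i (c k)) = u * v"
    unfolding ab split by (intro arg_cong2[of _ _ _ _ "(*)"] prod.cong) (auto simp: c_def)
  moreover have "\<forall>k<m + n. c k \<in> M" using ab(3,4) by (auto simp: c_def)
  ultimately show "u * v \<in> sym_power_image scale e i (m + n) M"
    unfolding sym_power_image_def by (intro sym_module.span_base CollectI exI[of _ c]) auto
qed

lemma lin_form_in_sym_power: "z \<in> M \<Longrightarrow> lin_form scale e i z \<in> sym_power_image scale e i 1 M"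
  unfolding sym_power_image_def by (intro sym_module.span_base CollectI exI[of _ "\<lambda>_. z"]) auto

lemma one_in_sym_power: "1 \<in> sym_power_image scale e i 0 M"
  unfolding sym_power_image_def by (intro sym_module.span_base CollectI exI[of _ "\<lambda>_. undefined"]) auto

lemma one_in_multi_power: "1 \<in> multi_power scale e q M (\<lambda>_. 0)"
  unfolding multi_power_def sym_prod_def
  by (intro sym_module.span_base CollectI exI[of _ "\<lambda>_. 1"]) (auto simp: one_in_sym_power)

lemma multi_power_mult:
  assumes "x \<in> multi_power scale e q M m" "y \<in> multi_power scale e q M n"
  shows "x * y \<in> multi_power scale e q M (\<lambda>j. m j + n j)"
  unfolding multi_power_def
  by (rule sym_prod_mult[OF finite_lessThan sym_power_image_mult assms[unfolded multi_power_def]])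

lemma multi_power_cong: "(\<And>j. j < q \<Longrightarrow> m j = n j) \<Longrightarrow> multi_power scale e q M m = multi_power scale e q M n"
  unfolding multi_power_def by (rule sym_prod_cong) simp

lemma lin_form_in_multi_power:
  assumes "i < q" "z \<in> M i"
  shows "lin_form scale e i z \<in> multi_power scale e q M ((\<lambda>_. 0)(i := 1))"
proof -
  let ?w = "(\<lambda>_. 1)(i := lin_form scale e i z)"
  have "(\<Prod>j\<in>{..<q} - {i}. ?w j) = 1" by (rule prod.neutral) simp
  then have "(\<Prod>j<q. ?w j) = lin_form scale e i z"
    using assms(1) prod.remove[of "{..<q}" i ?w] by simp
  moreover have "\<forall>j\<in>{..<q}. ?w j \<in> sym_power_image scale e j (((\<lambda>_. 0)(i := 1)) j) (M j)"
    using assms(2) by (auto simp: one_in_sym_power intro: lin_form_in_sym_power[unfolded One_nat_def])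
  ultimately show ?thesis
    unfolding multi_power_def sym_prod_def by (intro sym_module.span_base CollectI exI[of _ ?w]) auto
qed

lemma lin_form_mult_multi_power:
  assumes "i < q" "z \<in> M i" "y \<in> multi_power scale e q M n"
  shows "lin_form scale e i z * y \<in> multi_power scale e q M (n(i := Suc (n i)))"
proof -
  have "lin_form scale e i z * y \<in> multi_power scale e q M (\<lambda>j. ((\<lambda>_. 0)(i := 1)) j + n j)"
    by (rule multi_power_mult[OF lin_form_in_multi_power assms(3)]) (use assms in auto)
  moreover have "(\<lambda>j. ((\<lambda>_. 0)(i := 1)) j + n j) = n(i := Suc (n i))" by auto
  ultimately show ?thesis by simp
qed

lemma sym_power_image_Suc:
  "sym_power_image scale e i (Suc n) M \<subseteq>
    sym_span {lin_form scale e i z * y | z y. z \<in> M \<and> y \<in> sym_power_image scale e i n M}"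
  unfolding sym_power_image_def[of _ _ _ "Suc n"]
proof (rule sym_module.span_minimal[OF _ sym_module.subspace_span], clarify)
  fix v assume v: "\<forall>k<Suc n. v k \<in> M"
  have "(\<Prod>k<n. lin_form scale e i (v k)) \<in> sym_power_image scale e i n M"
    unfolding sym_power_image_def using v by (intro sym_module.span_base) auto
  then have "lin_form scale e i (v n) * (\<Prod>k<n. lin_form scale e i (v k)) \<in>
      sym_span {lin_form scale e i z * y | z y. z \<in> M \<and> y \<in> sym_power_image scale e i n M}"
    using v by (intro sym_module.span_base) auto
  then show "(\<Prod>k<Suc n. lin_form scale e i (v k)) \<in>
      sym_span {lin_form scale e i z * y | z y. z \<in> M \<and> y \<in> sym_power_image scale e i n M}"
    by (simp add: mult.commute)
qed

text \<open>Every product of linear forms with a positive number of factors from \<open>M i\<close>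
  has one to split off; this is the step of the inductions over exponents.\<close>

lemma multi_power_Suc:
  assumes "i < q"
  shows "multi_power scale e q M (n(i := Suc (n i))) \<subseteq>
    sym_span {lin_form scale e i z * y | z y. z \<in> M i \<and> y \<in> multi_power scale e q M n}"
    (is "_ \<subseteq> sym_span ?G")
proof -
  let ?U = "\<lambda>j. sym_power_image scale e j ((n(i := Suc (n i))) j) (M j)"
    and ?V = "\<lambda>j. sym_power_image scale e j (n j) (M j)"
  have i: "i \<in> {..<q}" using assms by simp
  have rest: "sym_prod ?U ({..<q} - {i}) = sym_prod ?V ({..<q} - {i})" by (rule sym_prod_cong) auto
  have "multi_power scale e q M (n(i := Suc (n i))) = sym_mult (?U i) (sym_prod ?V ({..<q} - {i}))"
    unfolding multi_power_def using sym_mult_sym_prod[OF finite_lessThan i, of ?U] rest by simp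
  also have "\<dots> \<subseteq> sym_span ?G"
    unfolding sym_mult_def
  proof (rule sym_module.span_minimal[OF _ sym_module.subspace_span], clarify)
    fix u v assume u: "u \<in> ?U i" and v: "v \<in> sym_prod ?V ({..<q} - {i})"
    have "u \<in> sym_span {lin_form scale e i z * y | z y. z \<in> M i \<and> y \<in> ?V i}"
      using u sym_power_image_Suc[of scale e i "n i" "M i"] by auto
    then show "u * v \<in> sym_span ?G"
    proof (rule sym_span_mult[OF sym_module.subspace_span _ sym_module.span_base[of v "{v}"]])
      fix u' v' assume "u' \<in> {lin_form scale e i z * y | z y. z \<in> M i \<and> y \<in> ?V i}" "v' \<in> {v}"
      then obtain z y where zy: "u' = lin_form scale e i z * y" "z \<in> M i" "y \<in> ?V i" "v' = v" by blast
      have "y * v \<in> sym_mult (?V i) (sym_prod ?V ({..<q} - {i}))"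
        unfolding sym_mult_def using zy(3) v by (intro sym_module.span_base) auto
      then have "y * v \<in> multi_power scale e q M n"
        unfolding multi_power_def using sym_mult_sym_prod[OF finite_lessThan i, of ?V] by simp
      then show "u' * v' \<in> sym_span ?G"
        unfolding zy using zy(2) by (intro sym_module.span_base) (auto simp: mult.assoc)
    qed simp
  qed
  finally show ?thesis .
qed

text \<open>The factor accompanying \<open>B i\<close> in a joint reduction is a single product of
  powers, with exponent \<open>n\<close> at \<open>i\<close> and \<open>n + 1\<close>
  elsewhere.\<close>

lemma joint_reduction_term:
  assumes "i < q"
  shows "sym_mult (sym_power_image scale e i n (M i))
      (sym_prod (\<lambda>j. sym_power_image scale e j (n + 1) (M j)) ({..<q} - {i})) =
    multi_power scale e q M ((\<lambda>_. n + 1)(i := n))"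
proof -
  let ?U = "\<lambda>j. sym_power_image scale e j (((\<lambda>_. n + 1)(i := n)) j) (M j)"
  have "sym_prod ?U ({..<q} - {i}) = sym_prod (\<lambda>j. sym_power_image scale e j (n + 1) (M j)) ({..<q} - {i})"
    by (rule sym_prod_cong) auto
  then show ?thesis
    unfolding multi_power_def using sym_mult_sym_prod[OF finite_lessThan, of i q ?U] assms by simp
qed

section \<open>Submodules of finite colength\<close>

lemma (in Modules.module) is_ideal_into:
  assumes "subspace N"
  shows "is_ideal {c. c *s x \<in> N}"
  unfolding ring_module.subspace_def
proof (intro conjI ballI allI CollectI)
  show "0 *s x \<in> N" using subspace_0[OF assms] by simp
  show "(a + b) *s x \<in> N" if "a \<in> {c. c *s x \<in> N}" "b \<in> {c. c *s x \<in> N}" for a b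
    using that subspace_add[OF assms] by (simp add: scale_left_distrib)
  show "(a * b) *s x \<in> N" if "b \<in> {c. c *s x \<in> N}" for a b
    using that subspace_scale[OF assms, of "b *s x" a] by simp
qed

lemma (in Modules.module) ideal_mult_span_span:
  "ideal_mult scale (ideal_generated S) (span E) \<subseteq> span {s *s x | s x. s \<in> S \<and> x \<in> E}"
proof -
  let ?N = "span {s *s x | s x. s \<in> S \<and> x \<in> E}"
  have "ideal_mult scale (ideal_generated S) (span E) \<subseteq> span {c *s x | c x. c \<in> ideal_generated S \<and> x \<in> E}"
    using ideal_mult_span[OF ring_module.subspace_span] by blast
  also have "\<dots> \<subseteq> ?N"
  proof (rule span_minimal[OF _ subspace_span], clarify)
    fix c x assume c: "c \<in> ideal_generated S" and x: "x \<in> E"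
    have "is_ideal {c. c *s x \<in> ?N}" by (rule is_ideal_into[OF subspace_span])
    moreover have "S \<subseteq> {c. c *s x \<in> ?N}" using x by (auto intro: span_base)
    ultimately have "ideal_generated S \<subseteq> {c. c *s x \<in> ?N}" by (rule ring_module.span_minimal[rotated])
    then show "c *s x \<in> ?N" using c by blast
  qed
  finally show ?thesis .
qed

context noetherian_local
begin

lemma finite_generators_power_mult:
  fixes scale :: "'a \<Rightarrow> 'b::ab_group_add \<Rightarrow> 'b"
  assumes "free_module scale es F"
  obtains T where "finite T" "module.span scale T = ideal_mult scale (ideal_power \<mm> j) F"
proof -
  interpret free_module scale es F by fact
  obtain S where S: "finite S" "ideal_generated S = ideal_power \<mm> j"
    using noeth is_ideal_power unfolding is_noetherian_def by blast
  define T where "T = (\<lambda>(s, x). scale s x) ` (S \<times> set es)"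
  have T: "T = {scale s x | s x. s \<in> S \<and> x \<in> set es}" unfolding T_def by auto
  have "span T = ideal_mult scale (ideal_power \<mm> j) F"
  proof
    show "span T \<subseteq> ideal_mult scale (ideal_power \<mm> j) F"
      unfolding T
      by (rule span_minimal[OF _ subspace_ideal_mult])
        (use S(2) span_es ring_module.span_superset span_superset in \<open>fastforce intro: ideal_mult_base\<close>)
    show "ideal_mult scale (ideal_power \<mm> j) F \<subseteq> span T"
      using ideal_mult_span_span[of S "set es"] unfolding T S(2) span_es .
  qed
  moreover have "finite T" unfolding T_def using S(1) by simp
  ultimately show ?thesis using that by blast
qed

text \<open>The submodules \<open>\<mm>\<close>^j F + M descend between \<open>F\<close> and
  \<open>M\<close>, so finite length forces two consecutive ones to agree; Nakayama's lemma then
  puts \<open>\<mm>\<close>^j F into \<open>M\<close>.\<close>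

lemma finite_colength_contains_power:
  fixes scale :: "'a \<Rightarrow> 'b::ab_group_add \<Rightarrow> 'b"
  assumes "free_module scale es F" and M: "module.subspace scale M" "M \<subseteq> F" "colength scale F M < \<infinity>"
  shows "\<exists>c. ideal_mult scale (ideal_power \<mm> c) F \<subseteq> M"
proof -
  interpret free_module scale es F by fact
  let ?W = "\<lambda>j. ideal_mult scale (ideal_power \<mm> j) F"
  let ?V = "\<lambda>j. {x + y | x y. x \<in> ?W j \<and> y \<in> M}"
  obtain k where k: "colength scale F M = enat k" using M(3) by (cases "colength scale F M") auto
  have V: "subspace (?V j)" "M \<subseteq> ?V j" "?V j \<subseteq> F" for j
  proof -
    show "subspace (?V j)" by (rule subspace_sum_set[OF subspace_ideal_mult M(1)])
    show "M \<subseteq> ?V j"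
    proof
      fix y assume "y \<in> M"
      then have "0 + y \<in> ?V j" using subspace_0[OF subspace_ideal_mult] by blast
      then show "y \<in> ?V j" by simp
    qed
    have "?W j \<subseteq> F" by (rule ideal_mult_le_self[OF subspace_F])
    then show "?V j \<subseteq> F" using M(2) subspace_add[OF subspace_F] by blast
  qed
  have dec: "?V (Suc j) \<subseteq> ?V j" for j
  proof -
    have "?W (Suc j) \<subseteq> ?W j"
      by (rule ideal_mult_mono[OF ideal_power_antimono[of j "Suc j" \<mm>] order_refl]) simp
    then show ?thesis by blast
  qed
  have "\<exists>j. ?V j = ?V (Suc j)"
  proof (rule ccontr)
    assume no: "\<nexists>j. ?V j = ?V (Suc j)"
    then have no': "?V j \<noteq> ?V (Suc j)" for j by (rule contrapos_nn) (rule exI)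
    \<comment> \<open>Reversed, so that the chain ascends; it would have \<open>Suc k\<close> strict
      steps, one more than the length allows.\<close>
    let ?N = "\<lambda>i. ?V (Suc k - i)"
    have step: "?V (Suc k - i) \<noteq> ?V (Suc k - Suc i) \<and> ?V (Suc k - i) \<subseteq> ?V (Suc k - Suc i)" if "i < Suc k" for i
    proof -
      have eq: "Suc k - i = Suc (Suc k - Suc i)" using that by simp
      show ?thesis unfolding eq by (intro conjI not_sym[OF no'] dec)
    qed
    have "enat (card {i. i < Suc k \<and> ?N i \<noteq> ?N (Suc i)}) \<le> colength scale F M"
      by (rule weak_chain_colength) (use V step in auto)
    moreover have "{i. i < Suc k \<and> ?N i \<noteq> ?N (Suc i)} = {..<Suc k}" using step by auto
    ultimately show False using k by simp
  qed
  then obtain j where j: "?V j = ?V (Suc j)" by (elim exE)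
  obtain T where T: "finite T" "span T = ?W j" using finite_generators_power_mult[OF assms(1)] by metis
  have W: "?W (Suc j) \<subseteq> ideal_mult scale \<mm> (?W j)"
  proof (rule ideal_mult_le[OF subspace_ideal_mult])
    fix c x assume c: "c \<in> ideal_power \<mm> (Suc j)" and x: "x \<in> F"
    have "ideal_mult (*) \<mm> (ideal_power \<mm> j) \<subseteq> {c. scale c x \<in> ideal_mult scale \<mm> (?W j)}"
    proof (rule ring_module.ideal_mult_le[OF is_ideal_into[OF subspace_ideal_mult]])
      fix a b assume ab: "a \<in> \<mm>" "b \<in> ideal_power \<mm> j"
      have "scale a (scale b x) \<in> ideal_mult scale \<mm> (?W j)"
        by (rule ideal_mult_base[OF ab(1) ideal_mult_base[OF ab(2) x]])
      then show "a * b \<in> {c. scale c x \<in> ideal_mult scale \<mm> (?W j)}" by simp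
    qed
    then show "scale c x \<in> ideal_mult scale \<mm> (?W j)" using c by auto
  qed
  have "T \<subseteq> M"
  proof (rule nakayama[OF module_axioms T(1) M(1)])
    fix t assume "t \<in> T"
    then have "t \<in> ?W j" using T(2) span_base by blast
    then have "t + 0 \<in> ?V j" using subspace_0[OF M(1)] by blast
    then have "t \<in> ?V (Suc j)" using j by simp
    then obtain x y where "t = x + y" "x \<in> ?W (Suc j)" "y \<in> M" by blast
    then show "\<exists>z\<in>ideal_mult scale \<mm> (span T). \<exists>u\<in>M. t = z + u"
      unfolding T(2) using W by blast
  qed
  then have "?W j \<subseteq> M" using T(2) span_minimal[OF _ M(1)] by blast
  then show ?thesis by blast
qed

text \<open>Both layers are finitely generated: \<open>\<mm>\<close>^c F by products of generators,
  and \<open>M\<close> over it because \<open>F\<close> modulo \<open>\<mm>\<close>^c F has finite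
  length.\<close>

lemma finite_colength_finitely_generated:
  fixes scale :: "'a \<Rightarrow> 'b::ab_group_add \<Rightarrow> 'b"
  assumes "free_module scale es F" and M: "module.subspace scale M" "M \<subseteq> F" "colength scale F M < \<infinity>"
  shows "\<exists>T. finite T \<and> module.span scale T = M"
proof -
  interpret free_module scale es F by fact
  obtain c where c: "ideal_mult scale (ideal_power \<mm> c) F \<subseteq> M"
    using finite_colength_contains_power[OF assms] by blast
  let ?W = "ideal_mult scale (ideal_power \<mm> c) F"
  obtain T where T: "finite T" "span T = ?W" using finite_generators_power_mult[OF assms(1)] by metis
  obtain l where l: "colength (*) UNIV (ideal_power \<mm> c) = enat l" using colength_primary_finite[OF order_refl] .
  have "colength scale M ?W \<le> colength scale (span (?W \<union> set es)) ?W"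
    by (rule colength_mono[OF order_refl]) (use M(2) span_es span_mono[of "set es" "?W \<union> set es"] in blast)
  also have "\<dots> \<le> enat (card (set es)) * colength (*) UNIV (ideal_power \<mm> c)"
    by (rule colength_span_le[OF subspace_ideal_mult _ is_ideal_power])
      (use span_es span_base in \<open>auto intro: ideal_mult_base\<close>)
  also have "\<dots> < \<infinity>" unfolding l by simp
  finally have "colength scale M ?W < \<infinity>" .
  then obtain S where S: "finite S" "S \<subseteq> M" "M = span (?W \<union> S)"
    by (rule span_finite_or_colength[OF subspace_ideal_mult M(1) c])
  have "span (T \<union> S) = M"
  proof
    show "span (T \<union> S) \<subseteq> M"
      using S(2) T(2) c span_superset[of T] by (intro span_minimal[OF _ M(1)]) auto
    have "?W \<union> S \<subseteq> span (T \<union> S)"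
      using T(2) span_mono[of T "T \<union> S"] span_superset[of "T \<union> S"] by blast
    then show "M \<subseteq> span (T \<union> S)" unfolding S(3) by (rule span_minimal[OF _ subspace_span])
  qed
  then show ?thesis using T(1) S(1) by blast
qed

text \<open>Multiplying the relations \<open>z w \<in> \<delta> W\<^sub>k + Q\<close> over all \<open>k\<close> and inserting the hypothesis on
  \<open>\<delta>\<^sup>r\<close> gives \<open>\<delta>\<^sup>r W \<subseteq> \<mm> \<delta>\<^sup>r W + Q\<close> for the product \<open>W\<close> of the \<open>W\<^sub>k\<close>; now apply Nakayama's lemma.\<close>
lemma no_reduction_in_scaled_products:
  fixes W D :: "nat \<Rightarrow> 'a set"
  assumes Q: "is_prime_ideal Q" and d: "\<delta> \<notin> Q"
    and W: "\<And>k. k < r \<Longrightarrow> \<not> W k \<subseteq> Q"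
    and red: "\<And>k z w. k < r \<Longrightarrow> z \<in> D k \<Longrightarrow> w \<in> W k \<Longrightarrow> \<exists>w'\<in>W k. z * w - \<delta> * w' \<in> Q"
  shows "\<delta> ^ r \<notin> ideal_mult (*) \<mm> (ideal_generated {\<Prod>k<r. z k | z. \<forall>k<r. z k \<in> D k})"
proof
  let ?D = "{\<Prod>k<r. z k | z. \<forall>k<r. z k \<in> D k}" and ?W = "{\<Prod>k<r. w k | w. \<forall>k<r. w k \<in> W k}"
  assume dr: "\<delta> ^ r \<in> ideal_mult (*) \<mm> (ideal_generated ?D)"
  note iQ = is_prime_idealD[OF Q]
  define Y where "Y = ideal_generated {\<delta> ^ r * w | w. w \<in> ?W}"
  have iY: "is_ideal Y" unfolding Y_def by (rule ring_module.subspace_span)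
  have iYQ: "is_ideal (ideal_sum Y Q)" using is_ideal_sum[OF iY iQ] .
  let ?Z = "ideal_sum (ideal_mult (*) \<mm> Y) Q"
  have iZ: "is_ideal ?Z" using is_ideal_sum[OF ring_module.subspace_ideal_mult iQ] .
  have 1: "p * w \<in> ideal_sum Y Q" if p: "p \<in> ?D" and w: "w \<in> ?W" for p w
  proof -
    obtain z where z: "p = (\<Prod>k<r. z k)" "\<forall>k<r. z k \<in> D k" using p by blast
    obtain v where v: "w = (\<Prod>k<r. v k)" "\<forall>k<r. v k \<in> W k" using w by blast
    have "\<forall>k. \<exists>w'. k < r \<longrightarrow> w' \<in> W k \<and> z k * v k - \<delta> * w' \<in> Q" using red z(2) v(2) by metis
    then obtain v' where v': "\<And>k. k < r \<Longrightarrow> v' k \<in> W k \<and> z k * v k - \<delta> * v' k \<in> Q" by metis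
    have "(\<Prod>k<r. z k * v k) - (\<Prod>k<r. \<delta> * v' k) \<in> Q"
      by (rule prod_cong_mod_ideal[OF iQ]) (use v' in auto)
    then have "p * w - \<delta> ^ r * (\<Prod>k<r. v' k) \<in> Q" unfolding z(1) v(1) by (simp add: prod.distrib)
    moreover have "\<delta> ^ r * (\<Prod>k<r. v' k) \<in> Y" unfolding Y_def using v' by (intro ring_module.span_base) blast
    ultimately have "\<delta> ^ r * (\<Prod>k<r. v' k) + (p * w - \<delta> ^ r * (\<Prod>k<r. v' k)) \<in> ideal_sum Y Q"
      unfolding ideal_sum_def by blast
    then show ?thesis by simp
  qed
  have 2: "\<delta> ^ r * w \<in> ?Z" if w: "w \<in> ?W" for w
  proof -
    have D: "ideal_generated ?D \<subseteq> {p. p * w \<in> ideal_sum Y Q}"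
      by (rule ring_module.span_minimal[OF _ is_ideal_colon(1)[OF iYQ]]) (use 1[OF _ w] in blast)
    have "ideal_mult (*) \<mm> (ideal_generated ?D) \<subseteq> {p. p * w \<in> ?Z}"
    proof (rule ring_module.ideal_mult_le[OF is_ideal_colon(1)[OF iZ]])
      fix c p assume c: "c \<in> \<mm>" and "p \<in> ideal_generated ?D"
      then have "p * w \<in> ideal_sum Y Q" using D by blast
      then obtain y u where yu: "p * w = y + u" "y \<in> Y" "u \<in> Q" unfolding ideal_sum_def by blast
      have "c * p * w = c * y + c * u" using yu(1) by (simp add: mult.assoc distrib_left)
      moreover have "c * y \<in> ideal_mult (*) \<mm> Y" by (rule ring_module.ideal_mult_base[OF c yu(2)])
      moreover have "c * u \<in> Q" by (rule ring_module.subspace_scale[OF iQ yu(3)])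
      ultimately show "c * p \<in> {p. p * w \<in> ?Z}" unfolding ideal_sum_def by blast
    qed
    then show ?thesis using dr by blast
  qed
  have YZ: "Y \<subseteq> ?Z" unfolding Y_def[symmetric] by (subst Y_def, rule ring_module.span_minimal[OF _ iZ]) (use 2 in blast)
  obtain S where S: "finite S" "ideal_generated S = Y" using noeth iY unfolding is_noetherian_def by blast
  have "ideal_generated S \<subseteq> Q"
  proof (rule nakayama_span[OF ring_module.module_axioms S(1) iQ])
    fix x assume "x \<in> ideal_generated S"
    then have "x \<in> ?Z" using YZ S(2) by blast
    then show "\<exists>z\<in>ideal_mult (*) \<mm> (ideal_generated S). \<exists>u\<in>Q. x = z + u"
      unfolding S(2) ideal_sum_def by blast
  qed
  then have YQ: "Y \<subseteq> Q" using S(2) by simp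
  have "\<forall>k. \<exists>w. k < r \<longrightarrow> w \<in> W k \<and> w \<notin> Q" using W by blast
  then obtain w where w: "\<And>k. k < r \<Longrightarrow> w k \<in> W k \<and> w k \<notin> Q" by metis
  have "\<delta> ^ r * (\<Prod>k<r. w k) \<in> Y" unfolding Y_def using w by (intro ring_module.span_base) blast
  then have "\<delta> ^ r * (\<Prod>k<r. w k) \<in> Q" using YQ by blast
  then have "\<delta> ^ r \<in> Q \<or> (\<exists>k\<in>{..<r}. w k \<in> Q)"
    using prime_ideal_mult[OF Q] prime_ideal_prod[OF finite_lessThan Q] by blast
  then show False using prime_ideal_power[OF Q, of \<delta> r] d w by blast
qed

end

section \<open>Determinants of joint reductions\<close>

context free_module
begin

text \<open>The identity adj(A) A = det(A) 1, with the rows of the adjugate read as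
  functionals.\<close>

lemma dual_adjugate_basis:
  assumes bs: "length bs = length es" and k: "k < length es" and l: "l < length es"
  shows "dual_apply scale es (\<lambda>j. adj_mat (coord_mat scale es bs) $$ (k, j)) (bs ! l) =
    (if k = l then det (coord_mat scale es bs) else 0)"
proof -
  let ?A = "coord_mat scale es bs"
  have A: "?A \<in> carrier_mat (length es) (length es)" using coord_mat_carrier[of bs] bs by simp
  have "dual_apply scale es (\<lambda>j. adj_mat ?A $$ (k, j)) (bs ! l) = (adj_mat ?A * ?A) $$ (k, l)"
    using adj_mat(1)[OF A] A k l bs unfolding dual_apply_def
    by (auto simp: scalar_prod_def coord_mat_nth atLeast0LessThan mult.commute intro!: sum.cong)
  then show ?thesis using adj_mat(3)[OF A] k l by simp
qed

lemma subspace_dual_vimage: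
  assumes "is_ideal Q"
  shows "subspace {v \<in> F. dual_apply scale es c v \<in> Q}"
  unfolding subspace_def
  using subspace_0[OF subspace_F] subspace_add[OF subspace_F] subspace_scale[OF subspace_F]
    ring_module.subspace_0[OF assms] ring_module.subspace_add[OF assms] ring_module.subspace_scale[OF assms]
  by (auto simp: dual_apply_linear)

text \<open>A null vector of the transpose modulo \<open>Q\<close> is a functional that kills all
  columns modulo \<open>Q\<close>.\<close>

lemma functional_mod_prime:
  assumes Q: "is_prime_ideal Q" and bs: "length bs = length es" "set bs \<subseteq> F"
    and det: "det (coord_mat scale es bs) \<in> Q"
  shows "\<exists>c. (\<exists>k<length es. c k \<notin> Q) \<and> (\<forall>v\<in>span (set bs). dual_apply scale es c v \<in> Q)"
proof -
  let ?n = "length es"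
  let ?A = "coord_mat scale es bs"
  have A: "?A \<in> carrier_mat ?n ?n" using coord_mat_carrier[of bs] bs by simp
  have "det (?A\<^sup>T) \<in> Q" using det det_transpose[OF A] by simp
  then obtain c where c: "\<exists>l<?n. c l \<notin> Q" "\<And>k. k < ?n \<Longrightarrow> (\<Sum>l<?n. ?A\<^sup>T $$ (k, l) * c l) \<in> Q"
    using det_null_vector_mod_prime[OF Q transpose_carrier_mat[THEN iffD2, OF A]] by blast
  let ?S = "{v \<in> F. dual_apply scale es c v \<in> Q}"
  have "set bs \<subseteq> ?S"
  proof
    fix b assume "b \<in> set bs"
    then obtain l where l: "l < ?n" "b = bs ! l" using bs(1) by (metis in_set_conv_nth)
    have "dual_apply scale es c b = (\<Sum>k<?n. ?A\<^sup>T $$ (l, k) * c k)"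
      unfolding dual_apply_def l(2) using A l(1) bs(1) by (intro sum.cong) (auto simp: coord_mat_nth)
    then show "b \<in> ?S" using c(2)[OF l(1)] bs(2) \<open>b \<in> set bs\<close> by auto
  qed
  then have "span (set bs) \<subseteq> ?S" by (rule span_minimal[OF _ subspace_dual_vimage[OF is_prime_idealD[OF Q]]])
  then show ?thesis using c(1) by blast
qed

lemma span_of_unit_det:
  assumes bs: "length bs = length es" "set bs \<subseteq> F" and y: "y * det (coord_mat scale es bs) = 1"
  shows "F \<subseteq> span (set bs)"
proof -
  let ?n = "length es"
  let ?A = "coord_mat scale es bs"
  have A: "?A \<in> carrier_mat ?n ?n" using coord_mat_carrier[of bs] bs by simp
  have bF: "bs ! l \<in> F" if "l < ?n" for l using that bs by (auto simp: subset_iff)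
  have "es ! k \<in> span (set bs)" if k: "k < ?n" for k
  proof -
    let ?v = "\<Sum>l<?n. (y * adj_mat ?A $$ (l, k)) *s bs ! l"
    have vF: "?v \<in> F" by (intro subspace_sum[OF subspace_F] subspace_scale[OF subspace_F]) (use bF in auto)
    have "coord scale es ?v j = coord scale es (es ! k) j" if j: "j < ?n" for j
    proof -
      have "coord scale es ?v j = (\<Sum>l<?n. coord scale es ((y * adj_mat ?A $$ (l, k)) *s bs ! l) j)"
        by (rule coord_sum) (use bF subspace_scale[OF subspace_F] in auto)
      also have "\<dots> = (\<Sum>l<?n. y * (?A $$ (j, l) * adj_mat ?A $$ (l, k)))"
        using bF j bs by (intro sum.cong) (auto simp: coord_scale coord_mat_nth ac_simps)
      also have "\<dots> = y * (?A * adj_mat ?A) $$ (j, k)"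
        using A adj_mat(1)[OF A] j k by (auto simp: scalar_prod_def atLeast0LessThan sum_distrib_left intro!: sum.cong)
      also have "\<dots> = (if j = k then 1 else 0)" using adj_mat(2)[OF A] j k y by simp
      finally show ?thesis using coord_basis[OF j k] by simp
    qed
    then have "?v = es ! k" by (intro coord_eqD[OF vF es_in_F[OF k]])
    moreover have "?v \<in> span (set bs)" by (intro span_sum span_scale span_base) (use bs in auto)
    ultimately show ?thesis by simp
  qed
  then have "set es \<subseteq> span (set bs)" by (metis in_set_conv_nth subsetI)
  then show ?thesis using span_minimal[OF _ subspace_span] span_es by metis
qed

text \<open>The product of the adjugate with the matrix of the \<open>ys\<close> has the values of
  the row functionals as entries; every term of its Leibniz expansion takes one value from each
  functional.\<close>

lemma adjugate_minor_expansion: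
  assumes bs: "length bs = length es" and ys: "\<And>l. l < length es \<Longrightarrow> ys l \<in> M" and MF: "M \<subseteq> F"
  shows "det (adj_mat (coord_mat scale es bs)) * col_det (length es) (coord scale es) ys \<in>
    ideal_generated {\<Prod>k<length es. z k | z. \<forall>k<length es.
      z k \<in> dual_apply scale es (\<lambda>j. adj_mat (coord_mat scale es bs) $$ (k, j)) ` M}"
    (is "_ \<in> ideal_generated ?D")
proof -
  let ?n = "length es"
  let ?A = "coord_mat scale es bs"
  let ?\<phi> = "\<lambda>k. dual_apply scale es (\<lambda>j. adj_mat ?A $$ (k, j))"
  have A: "adj_mat ?A \<in> carrier_mat ?n ?n" using adj_mat(1)[of ?A ?n] coord_mat_carrier[of bs] bs by simp
  define Y where "Y = mat ?n ?n (\<lambda>(k, l). coord scale es (ys l) k)"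
  have Y: "Y \<in> carrier_mat ?n ?n" unfolding Y_def by simp
  have AY: "(adj_mat ?A * Y) $$ (k, l) = ?\<phi> k (ys l)" if "k < ?n" "l < ?n" for k l
    using that A unfolding dual_apply_def Y_def
    by (auto simp: scalar_prod_def atLeast0LessThan mult.commute intro!: sum.cong)
  have "det (adj_mat ?A) * col_det ?n (coord scale es) ys = det (adj_mat ?A * Y)"
    unfolding col_det_def Y_def[symmetric] using det_mult[OF A Y] by simp
  also have "\<dots> = (\<Sum>p \<in> {p. p permutes {0..<?n}}. signof p * (\<Prod>i = 0..<?n. (adj_mat ?A * Y) $$ (i, p i)))"
    by (rule det_def') (use A Y in simp)
  also have "\<dots> \<in> ideal_generated ?D"
  proof (rule ring_module.span_sum, rule ring_module.span_scale, rule ring_module.span_base)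
    fix p assume "p \<in> {p. p permutes {0..<?n}}"
    then have p: "p i < ?n" if "i < ?n" for i using permutes_in_image[of p "{0..<?n}" i] that by auto
    have "(\<Prod>i = 0..<?n. (adj_mat ?A * Y) $$ (i, p i)) = (\<Prod>k<?n. ?\<phi> k (ys (p k)))"
      unfolding atLeast0LessThan by (rule prod.cong) (auto simp: AY p)
    moreover have "\<forall>k<?n. ?\<phi> k (ys (p k)) \<in> ?\<phi> k ` M" using p ys by blast
    ultimately show "(\<Prod>i = 0..<?n. (adj_mat ?A * Y) $$ (i, p i)) \<in> ?D"
      by (intro CollectI exI[of _ "\<lambda>k. ?\<phi> k (ys (p k))"] conjI)
  qed
  finally show ?thesis .
qed

text \<open>By the preceding expansion det(adj A) carries every minor of \<open>gs\<close> into the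
  ideal of products, hence det A into \<open>N\<close> times that ideal. The product det(adj A) det
  A is the power in question, because adj(A) A is det A times the identity.\<close>

lemma det_power_in_scaled_products:
  assumes bs: "length bs = length es" and gs: "set gs \<subseteq> M" and MF: "M \<subseteq> F"
    and det: "det (coord_mat scale es bs) \<in> ideal_mult (*) N (maximal_minors_ideal (coord_mat scale es gs))"
  shows "det (coord_mat scale es bs) ^ length es \<in> ideal_mult (*) N (ideal_generated
    {\<Prod>k<length es. z k | z. \<forall>k<length es.
      z k \<in> dual_apply scale es (\<lambda>j. adj_mat (coord_mat scale es bs) $$ (k, j)) ` M})"
    (is "_ \<in> ideal_mult (*) N (ideal_generated ?D)")
proof -
  let ?n = "length es"
  let ?A = "coord_mat scale es bs"
  have A: "?A \<in> carrier_mat ?n ?n" using coord_mat_carrier[of bs] bs by simp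
  have "maximal_minors_ideal (coord_mat scale es gs) \<subseteq> {x. det (adj_mat ?A) * x \<in> ideal_generated ?D}"
    unfolding maximal_minors_ideal_def
  proof (rule ring_module.span_minimal[OF _ is_ideal_colon(2)[OF ring_module.subspace_span]], clarify)
    fix J assume J: "J \<subseteq> {..<dim_col (coord_mat scale es gs)}" "card J = dim_row (coord_mat scale es gs)"
    then have J': "J \<subseteq> {..<length gs}" "card J = ?n" using coord_mat_carrier[of gs] by auto
    show "det (adj_mat ?A) * det (submatrix (coord_mat scale es gs) UNIV J) \<in> ideal_generated ?D"
      unfolding minor_eq_col_det(1)[OF J']
    proof (rule adjugate_minor_expansion[OF bs _ MF])
      fix l assume "l < ?n"
      then have "pick J l < length gs" using minor_eq_col_det(2)[OF J'] J' by blast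
      then show "gs ! pick J l \<in> M" using gs by auto
    qed
  qed
  then have "ideal_mult (*) N (maximal_minors_ideal (coord_mat scale es gs)) \<subseteq>
      {x. det (adj_mat ?A) * x \<in> ideal_mult (*) N (ideal_generated ?D)}"
  proof (intro ring_module.ideal_mult_le is_ideal_colon(2)[OF ring_module.subspace_ideal_mult])
    fix c x assume sub: "maximal_minors_ideal (coord_mat scale es gs) \<subseteq> {x. det (adj_mat ?A) * x \<in> ideal_generated ?D}"
      and c: "c \<in> N" and x: "x \<in> maximal_minors_ideal (coord_mat scale es gs)"
    have "c * (det (adj_mat ?A) * x) \<in> ideal_mult (*) N (ideal_generated ?D)"
      using sub x by (intro ring_module.ideal_mult_base[OF c]) blast
    then show "c * x \<in> {x. det (adj_mat ?A) * x \<in> ideal_mult (*) N (ideal_generated ?D)}"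
      by (simp add: mult.left_commute)
  qed
  then have "det (adj_mat ?A) * det ?A \<in> ideal_mult (*) N (ideal_generated ?D)" using det by blast
  moreover have "det (adj_mat ?A) * det ?A = det (det ?A \<cdot>\<^sub>m 1\<^sub>m ?n)"
    using det_mult[OF adj_mat(1)[OF A] A] adj_mat(3)[OF A] by simp
  ultimately show ?thesis by simp
qed

end

locale finite_colength_family = noetherian_local \<mm> + Modules.module scale
  for \<mm> :: "'a::comm_ring_1 set" and scale :: "'a \<Rightarrow> 'b::ab_group_add \<Rightarrow> 'b" (infixr "*s" 75) +
  fixes q :: nat and e :: "nat \<Rightarrow> 'b list" and F M :: "nat \<Rightarrow> 'b set"
  assumes basis: "\<And>i. i < q \<Longrightarrow> is_basis scale (e i) (F i)"
    and rank_pos: "\<And>i. i < q \<Longrightarrow> length (e i) \<ge> 1"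
    and subspace_M: "\<And>i. i < q \<Longrightarrow> subspace (M i)"
    and M_le_F: "\<And>i. i < q \<Longrightarrow> M i \<subseteq> F i"
    and colength_M: "\<And>i. i < q \<Longrightarrow> colength scale (F i) (M i) < \<infinity>"
begin

lemma free: "i < q \<Longrightarrow> free_module scale (e i) (F i)"
  using basis module_axioms by (simp add: free_module_def free_module_axioms_def)

text \<open>Some power \<open>\<mm>\<close>^s F i lies in \<open>M i\<close>. For \<open>x\<close>
  in \<open>\<mm>\<close> outside \<open>Q\<close>, the vector x^s times the \<open>k\<close>-th
  basis vector belongs to it, and the functional takes the value x^s c k there.\<close>

lemma functional_not_in_prime:
  assumes i: "i < q" and Q: "is_prime_ideal Q" "Q \<noteq> \<mm>" and c: "k < length (e i)" "c k \<notin> Q"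
  shows "\<exists>v\<in>M i. dual_apply scale (e i) c v \<notin> Q"
proof -
  interpret fm: free_module scale "e i" "F i" by (rule free[OF i])
  obtain s where s: "ideal_mult scale (ideal_power \<mm> s) (F i) \<subseteq> M i"
    using finite_colength_contains_power[OF free[OF i] subspace_M[OF i] M_le_F[OF i] colength_M[OF i]] by blast
  obtain x where x: "x \<in> \<mm>" "x \<notin> Q" using prime_le_m[OF Q(1)] Q(2) by blast
  have "x ^ j \<in> ideal_power \<mm> j" for j
  proof (induction j)
    case (Suc j)
    then show ?case using ideal_power_base[OF x(1) Suc] by simp
  qed simp
  then have v: "x ^ s *s (e i ! k) \<in> M i" using s fm.es_in_F[OF c(1)] ideal_mult_base by blast
  have "dual_apply scale (e i) c (e i ! k) = c k"
  proof -
    have "dual_apply scale (e i) c (e i ! k) = (\<Sum>j<length (e i). if j = k then c k else 0)"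
      unfolding dual_apply_def using c(1) by (intro sum.cong) (auto simp: fm.coord_basis)
    then show ?thesis using c(1) by simp
  qed
  then have "dual_apply scale (e i) c (x ^ s *s (e i ! k)) = x ^ s * c k"
    using fm.dual_apply_linear(2)[OF fm.es_in_F[OF c(1)]] by simp
  moreover have "x ^ s * c k \<notin> Q" using prime_ideal_mult[OF Q(1)] prime_ideal_power[OF Q(1)] x(2) c(2) by blast
  ultimately show ?thesis using v by metis
qed

definition family_eval :: "(nat \<Rightarrow> nat \<Rightarrow> 'a) \<Rightarrow> 'a sym_alg \<Rightarrow> 'a" where
  "family_eval c = sym_eval (\<lambda>(i, k). c i k)"

lemma family_eval_lin_form: "family_eval c (lin_form scale e i v) = dual_apply scale (e i) (c i) v"
  unfolding family_eval_def sym_eval_lin_form by simp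

lemma eval_multi_power_witness:
  assumes Q: "is_prime_ideal Q" and v: "\<And>i. i < q \<Longrightarrow> v i \<in> M i \<and> dual_apply scale (e i) (c i) (v i) \<notin> Q"
  shows "\<exists>w\<in>multi_power scale e q M n. family_eval c w \<notin> Q"
proof -
  let ?w = "\<Prod>j<q. lin_form scale e j (v j) ^ n j"
  have "?w \<in> multi_power scale e q M n"
    unfolding multi_power_def sym_prod_def
  proof (intro sym_module.span_base CollectI exI conjI ballI)
    fix j assume "j \<in> {..<q}"
    then show "lin_form scale e j (v j) ^ n j \<in> sym_power_image scale e j (n j) (M j)"
      unfolding sym_power_image_def using v
      by (intro sym_module.span_base CollectI exI[of _ "\<lambda>_. v j"]) auto
  qed simp
  moreover have "family_eval c ?w = (\<Prod>j<q. dual_apply scale (e j) (c j) (v j) ^ n j)"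
  proof -
    have "sym_eval f (x ^ k) = sym_eval f x ^ k" for f :: "nat \<times> nat \<Rightarrow> 'a" and x k
      by (induction k) (auto simp: sym_eval_one sym_eval_mult)
    then show ?thesis
      using family_eval_lin_form unfolding family_eval_def by (simp add: sym_eval_prod)
  qed
  moreover have "(\<Prod>j<q. dual_apply scale (e j) (c j) (v j) ^ n j) \<notin> Q"
  proof
    assume "(\<Prod>j<q. dual_apply scale (e j) (c j) (v j) ^ n j) \<in> Q"
    then obtain j where j: "j < q" "dual_apply scale (e j) (c j) (v j) ^ n j \<in> Q"
      unfolding prime_ideal_prod[OF finite_lessThan Q] by auto
    show False using prime_ideal_power[OF Q j(2)] v[OF j(1)] by simp
  qed
  ultimately show ?thesis by (intro bexI[of _ ?w]) auto
qed

text \<open>Under the evaluation all summands with index other than \<open>i0\<close> vanish modulo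
  \<open>Q\<close>, and the remaining one becomes a multiple of \<open>\<delta>\<close>. Two values
  of \<open>\<delta>\<close> are used: zero, when the functional at \<open>i0\<close> kills
  \<open>B i0\<close> as well, and the determinant, when it is a row of the adjugate.\<close>

lemma eval_joint_reduction:
  assumes Q: "is_ideal Q" and i0: "i0 < q"
    and red: "multi_power scale e q M (\<lambda>_. n + 1) = sym_span (\<Union>i<q. sym_mult (lin_form scale e i ` B i)
        (multi_power scale e q M ((\<lambda>_. n + 1)(i := n))))"
    and c: "\<And>i b. i < q \<Longrightarrow> i \<noteq> i0 \<Longrightarrow> b \<in> B i \<Longrightarrow> dual_apply scale (e i) (c i) b \<in> Q"
    and c0: "\<And>b. b \<in> B i0 \<Longrightarrow> \<exists>x. dual_apply scale (e i0) (c i0) b - x * \<delta> \<in> Q"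
    and y: "y \<in> multi_power scale e q M (\<lambda>_. n + 1)"
  shows "\<exists>w\<in>multi_power scale e q M ((\<lambda>_. n + 1)(i0 := n)). family_eval c y - \<delta> * family_eval c w \<in> Q"
proof -
  let ?X = "multi_power scale e q M ((\<lambda>_. n + 1)(i0 := n))"
  let ?S = "{y. \<exists>w\<in>?X. family_eval c y - \<delta> * family_eval c w \<in> Q}"
  have subX: "sym_module.subspace ?X" by (rule subspace_multi_power)
  have sub: "sym_module.subspace ?S"
    unfolding sym_module.subspace_def
  proof (intro conjI ballI allI CollectI)
    show "\<exists>w\<in>?X. family_eval c 0 - \<delta> * family_eval c w \<in> Q"
      using sym_module.subspace_0[OF subX] ring_module.subspace_0[OF Q]
      by (intro bexI[of _ 0]) (auto simp: family_eval_def sym_eval_zero)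
  next
    fix x y assume "x \<in> ?S" "y \<in> ?S"
    then obtain u w where uw: "u \<in> ?X" "w \<in> ?X" "family_eval c x - \<delta> * family_eval c u \<in> Q"
      "family_eval c y - \<delta> * family_eval c w \<in> Q" by blast
    have "(family_eval c x - \<delta> * family_eval c u) + (family_eval c y - \<delta> * family_eval c w) \<in> Q"
      using uw ring_module.subspace_add[OF Q] by blast
    then have "family_eval c (x + y) - \<delta> * family_eval c (u + w) \<in> Q"
      unfolding family_eval_def sym_eval_add by (simp add: algebra_simps)
    then show "\<exists>w\<in>?X. family_eval c (x + y) - \<delta> * family_eval c w \<in> Q"
      using sym_module.subspace_add[OF subX uw(1,2)] by blast
  next
    fix a x assume "x \<in> ?S"
    then obtain u where u: "u \<in> ?X" "family_eval c x - \<delta> * family_eval c u \<in> Q" by blast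
    have "a * (family_eval c x - \<delta> * family_eval c u) \<in> Q" by (rule ring_module.subspace_scale[OF Q u(2)])
    then have "family_eval c (sym_scale a x) - \<delta> * family_eval c (sym_scale a u) \<in> Q"
      unfolding family_eval_def sym_eval_scale by (simp add: algebra_simps)
    then show "\<exists>w\<in>?X. family_eval c (sym_scale a x) - \<delta> * family_eval c w \<in> Q"
      using sym_module.subspace_scale[OF subX u(1)] by blast
  qed
  have "sym_mult (lin_form scale e i ` B i) (multi_power scale e q M ((\<lambda>_. n + 1)(i := n))) \<subseteq> ?S"
    if i: "i < q" for i
    unfolding sym_mult_def
  proof (rule sym_module.span_minimal[OF _ sub], clarify)
    fix b w assume b: "b \<in> B i" and w: "w \<in> multi_power scale e q M ((\<lambda>_. n + 1)(i := n))"
    have ev: "family_eval c (lin_form scale e i b * w) = dual_apply scale (e i) (c i) b * family_eval c w"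
      using family_eval_lin_form[of c i b] unfolding family_eval_def by (simp add: sym_eval_mult)
    show "\<exists>w'\<in>?X. family_eval c (lin_form scale e i b * w) - \<delta> * family_eval c w' \<in> Q"
    proof (cases "i = i0")
      case True
      obtain x where x: "dual_apply scale (e i0) (c i0) b - x * \<delta> \<in> Q" using c0 b True by blast
      have "family_eval c w * (dual_apply scale (e i0) (c i0) b - x * \<delta>) \<in> Q"
        by (rule ring_module.subspace_scale[OF Q x])
      then have "family_eval c (lin_form scale e i b * w) - \<delta> * family_eval c (sym_scale x w) \<in> Q"
        unfolding ev unfolding family_eval_def sym_eval_scale using True by (simp add: algebra_simps)
      moreover have "sym_scale x w \<in> ?X" using sym_module.subspace_scale[OF subX] w True by blast
      ultimately show ?thesis by blast
    next
      case False
      have "family_eval c w * dual_apply scale (e i) (c i) b \<in> Q"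
        by (rule ring_module.subspace_scale[OF Q c[OF i False b]])
      then have "family_eval c (lin_form scale e i b * w) - \<delta> * family_eval c 0 \<in> Q"
        unfolding ev unfolding family_eval_def sym_eval_zero by (simp add: mult.commute)
      then show ?thesis using sym_module.subspace_0[OF subX] by blast
    qed
  qed
  then have "sym_span (\<Union>i<q. sym_mult (lin_form scale e i ` B i) (multi_power scale e q M ((\<lambda>_. n + 1)(i := n)))) \<subseteq> ?S"
    by (intro sym_module.span_minimal[OF _ sub]) blast
  then show ?thesis using y red by blast
qed

end

context finite_colength_family
begin

lemma joint_reduction_lists:
  assumes "is_joint_reduction scale e q M B"
  shows "\<exists>bf n. (\<forall>i<q. length (bf i) = length (e i) \<and> span (set (bf i)) = B i \<and> B i \<subseteq> M i) \<and>
    multi_power scale e q M (\<lambda>_. n + 1) = sym_span (\<Union>i<q. sym_mult (lin_form scale e i ` B i)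
        (multi_power scale e q M ((\<lambda>_. n + 1)(i := n))))"
proof -
  obtain n where n: "sym_prod (\<lambda>j. sym_power_image scale e j (n + 1) (M j)) {..<q} =
        sym_span (\<Union>i<q.
          sym_mult (lin_form scale e i ` B i)
            (sym_mult (sym_power_image scale e i n (M i))
              (sym_prod (\<lambda>j. sym_power_image scale e j (n + 1) (M j)) ({..<q} - {i}))))"
    using assms unfolding is_joint_reduction_def by blast
  have "\<forall>i. \<exists>bs. i < q \<longrightarrow> length bs = length (e i) \<and> span (set bs) = B i \<and> B i \<subseteq> M i"
    using assms unfolding is_joint_reduction_def by blast
  then obtain bf where "\<forall>i. i < q \<longrightarrow> length (bf i) = length (e i) \<and> span (set (bf i)) = B i \<and> B i \<subseteq> M i"
    by (rule choice[THEN exE])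
  then have "\<forall>i<q. length (bf i) = length (e i) \<and> span (set (bf i)) = B i \<and> B i \<subseteq> M i" by simp
  moreover have "(\<Union>i<q. sym_mult (lin_form scale e i ` B i)
            (sym_mult (sym_power_image scale e i n (M i))
              (sym_prod (\<lambda>j. sym_power_image scale e j (n + 1) (M j)) ({..<q} - {i})))) =
      (\<Union>i<q. sym_mult (lin_form scale e i ` B i) (multi_power scale e q M ((\<lambda>_. n + 1)(i := n))))"
    by (rule SUP_cong[OF refl]) (simp only: joint_reduction_term lessThan_iff)
  then have "multi_power scale e q M (\<lambda>_. n + 1) = sym_span (\<Union>i<q. sym_mult (lin_form scale e i ` B i)
        (multi_power scale e q M ((\<lambda>_. n + 1)(i := n))))"
    using n unfolding multi_power_def[of _ _ _ _ "\<lambda>_. n + 1"] by simp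
  ultimately show ?thesis by (intro exI conjI)
qed

lemma joint_reduction_det:
  assumes dim: "krull_dim TYPE('a) = enat q" and proper: "\<And>i. i < q \<Longrightarrow> M i \<subset> F i"
    and red: "is_joint_reduction scale e q M B" and i0: "i0 < q"
    and bs: "length bs = length (e i0)" "span (set bs) = B i0" and gs: "span (set gs) = M i0"
  shows "det (coord_mat scale (e i0) bs) \<notin>
    ideal_mult (*) \<mm> (maximal_minors_ideal (coord_mat scale (e i0) gs))"
proof
  let ?\<delta> = "det (coord_mat scale (e i0) bs)"
  assume det: "?\<delta> \<in> ideal_mult (*) \<mm> (maximal_minors_ideal (coord_mat scale (e i0) gs))"
  obtain bf n where bf0: "\<forall>i<q. length (bf i) = length (e i) \<and> span (set (bf i)) = B i \<and> B i \<subseteq> M i"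
    and eq: "multi_power scale e q M (\<lambda>_. n + 1) = sym_span (\<Union>i<q. sym_mult (lin_form scale e i ` B i)
        (multi_power scale e q M ((\<lambda>_. n + 1)(i := n))))"
    using joint_reduction_lists[OF red] by (elim exE conjE)
  have bf: "length (bf i) = length (e i) \<and> span (set (bf i)) = B i \<and> B i \<subseteq> M i" if "i < q" for i
    using bf0 that by blast
  have bM: "set (bf i) \<subseteq> M i" "set (bf i) \<subseteq> F i" if "i < q" for i
    using bf[OF that] span_superset[of "set (bf i)"] M_le_F[OF that] by auto
  define D where "D i = det (coord_mat scale (e i) (bf i))" for i
  \<comment> \<open>A unit determinant would make \<open>B i\<close>, and hence \<open>M i\<close>,
    all of \<open>F i\<close>; here the inclusions must be proper.\<close>
  have D_m: "D i \<in> \<mm>" if i: "i < q" for i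
  proof (rule ccontr)
    assume "D i \<notin> \<mm>"
    then obtain y where y: "y * D i = 1" by (rule unit_notin_m)
    interpret fm: free_module scale "e i" "F i" by (rule free[OF i])
    have "F i \<subseteq> span (set (bf i))"
      using fm.span_of_unit_det[of "bf i" y] bf[OF i] bM(2)[OF i] y unfolding D_def by blast
    then show False using bf[OF i] proper[OF i] by auto
  qed
  \<comment> \<open>The index \<open>i0\<close> is skipped, leaving q - 1 elements. In dimension q
    these generate no ideal containing a power of \<open>\<mm>\<close>, which leaves a prime other
    than \<open>\<mm>\<close> above them.\<close>
  define a where "a l = D (if l < i0 then l else Suc l)" for l
  let ?J = "ideal_generated (a ` {..<q - 1})"
  have aq: "a ` {..<q - 1} \<subseteq> \<mm>" unfolding a_def using D_m i0 by auto
  have J_m: "?J \<subseteq> \<mm>" by (rule ring_module.span_minimal[OF aq ideal_m])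
  have "\<exists>Q. is_prime_ideal Q \<and> ?J \<subseteq> Q \<and> Q \<noteq> \<mm>"
  proof (rule ccontr)
    assume "\<not> ?thesis"
    then have "P = \<mm>" if "is_prime_ideal P" "?J \<subseteq> P" for P using that by auto
    then obtain N where N: "ideal_power \<mm> N \<subseteq> ?J"
      using power_le_of_primes[OF ring_module.subspace_span, of "a ` {..<q - 1}"] by auto
    obtain P :: "nat \<Rightarrow> 'a set" where P: "prime_chain q P" using prime_chain_exists[OF dim] i0 by auto
    have "q \<le> q - 1" by (rule krull_height[OF refl J_m N P])
    then show False using i0 by simp
  qed
  then obtain Q where Q: "is_prime_ideal Q" "?J \<subseteq> Q" "Q \<noteq> \<mm>" by (elim exE conjE)
  have DQ: "D j \<in> Q" if j: "j < q" "j \<noteq> i0" for j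
  proof -
    let ?l = "if j < i0 then j else j - 1"
    have "a ?l = D j" "?l < q - 1" unfolding a_def using j i0 by auto
    then have "D j \<in> a ` {..<q - 1}" by (metis imageI lessThan_iff)
    then have "D j \<in> ?J" by (rule ring_module.span_base)
    then show ?thesis using Q(2) by (rule rev_subsetD)
  qed
  have kill: "\<exists>c v. (\<forall>b\<in>B i. dual_apply scale (e i) c b \<in> Q) \<and> v \<in> M i \<and> dual_apply scale (e i) c v \<notin> Q"
    if i: "i < q" and cs: "length cs = length (e i)" "span (set cs) = B i" "det (coord_mat scale (e i) cs) \<in> Q" for i cs
  proof -
    interpret fm: free_module scale "e i" "F i" by (rule free[OF i])
    have "set cs \<subseteq> F i" using cs(2) span_superset[of "set cs"] bf[OF i] M_le_F[OF i] by auto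
    then obtain c where c: "\<exists>k<length (e i). c k \<notin> Q" "\<forall>v\<in>span (set cs). dual_apply scale (e i) c v \<in> Q"
      using fm.functional_mod_prime[OF Q(1) cs(1) _ cs(3)] by blast
    then obtain v where "v \<in> M i" "dual_apply scale (e i) c v \<notin> Q"
      using functional_not_in_prime[OF i Q(1) Q(3)] by blast
    then show ?thesis using c(2) cs(2) by blast
  qed
  have "\<forall>i. \<exists>c v. i < q \<longrightarrow> i \<noteq> i0 \<longrightarrow>
    (\<forall>b\<in>B i. dual_apply scale (e i) c b \<in> Q) \<and> v \<in> M i \<and> dual_apply scale (e i) c v \<notin> Q"
    using kill[of _ "bf _"] bf DQ unfolding D_def by metis
  then obtain c v where cv: "\<And>i. i < q \<Longrightarrow> i \<noteq> i0 \<Longrightarrow>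
    (\<forall>b\<in>B i. dual_apply scale (e i) (c i) b \<in> Q) \<and> v i \<in> M i \<and> dual_apply scale (e i) (c i) (v i) \<notin> Q" by metis
  note iQ = is_prime_idealD[OF Q(1)]
  interpret fm: free_module scale "e i0" "F i0" by (rule free[OF i0])
  have bsM: "set bs \<subseteq> M i0" "set bs \<subseteq> F i0"
    using bs(2) span_superset[of "set bs"] bf[OF i0] M_le_F[OF i0] by auto
  show False
  proof (cases "?\<delta> \<in> Q")
    case True
    obtain c0 v0 where cv0: "\<forall>b\<in>B i0. dual_apply scale (e i0) c0 b \<in> Q" "v0 \<in> M i0"
      "dual_apply scale (e i0) c0 v0 \<notin> Q" using kill[OF i0 bs True] by blast
    let ?c = "c(i0 := c0)" and ?v = "v(i0 := v0)"
    have "?v i \<in> M i \<and> dual_apply scale (e i) (?c i) (?v i) \<notin> Q" if "i < q" for i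
      using cv cv0 that by (cases "i = i0") auto
    then obtain y where y: "y \<in> multi_power scale e q M (\<lambda>_. n + 1)" "family_eval ?c y \<notin> Q"
      using eval_multi_power_witness[OF Q(1), of ?v ?c "\<lambda>_. n + 1"] by blast
    \<comment> \<open>With 0 in place of the determinant: every element on the right-hand side of
      the reduction evaluates into \<open>Q\<close>, but \<open>y\<close> on the left-hand side does
      not.\<close>
    have "\<exists>w\<in>multi_power scale e q M ((\<lambda>_. n + 1)(i0 := n)). family_eval ?c y - 0 * family_eval ?c w \<in> Q"
    proof (rule eval_joint_reduction[OF iQ i0 eq _ _ y(1)])
      show "dual_apply scale (e i) (?c i) b \<in> Q" if "i < q" "i \<noteq> i0" "b \<in> B i" for i b
        using cv that by simp
      show "\<exists>x. dual_apply scale (e i0) (?c i0) b - x * 0 \<in> Q" if "b \<in> B i0" for b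
        using cv0(1) that by simp
    qed
    then show False using y(2) by simp
  next
    case False
    let ?r = "length (e i0)"
    \<comment> \<open>One evaluation for each row \<open>k\<close> of the adjugate; the functionals
      at the other indices stay fixed.\<close>
    define C where "C k = c(i0 := (\<lambda>j. adj_mat (coord_mat scale (e i0) bs) $$ (k, j)))" for k
    let ?X = "multi_power scale e q M ((\<lambda>_. n + 1)(i0 := n))"
    have C0: "C k i0 = (\<lambda>j. adj_mat (coord_mat scale (e i0) bs) $$ (k, j))" for k unfolding C_def by simp
    have Ci: "C k i = c i" if "i \<noteq> i0" for k i unfolding C_def using that by simp
    have C_bs: "dual_apply scale (e i0) (C k i0) (bs ! l) = (if k = l then ?\<delta> else 0)" if "k < ?r" "l < ?r" for k l
      unfolding C0 by (rule fm.dual_adjugate_basis[OF bs(1) that])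
    have "?\<delta> ^ ?r \<notin> ideal_mult (*) \<mm> (ideal_generated {\<Prod>k<?r. z k | z. \<forall>k<?r.
        z k \<in> dual_apply scale (e i0) (C k i0) ` M i0})"
    proof (rule no_reduction_in_scaled_products[OF Q(1) False, where W = "\<lambda>k. family_eval (C k) ` ?X"])
      fix k assume k: "k < ?r"
      \<comment> \<open>The \<open>k\<close>-th generator witnesses that the \<open>k\<close>-th
        functional does not kill \<open>M i0\<close>: its value is the determinant, which lies
        outside \<open>Q\<close> in this case.\<close>
      let ?v = "v(i0 := bs ! k)"
      have "?v i \<in> M i \<and> dual_apply scale (e i) (C k i) (?v i) \<notin> Q" if "i < q" for i
      proof (cases "i = i0")
        case True
        have "bs ! k \<in> M i0" using bsM(1) k bs(1) by auto
        then show ?thesis using True C_bs[OF k k] False by simp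
      next
        case False
        then show ?thesis using cv[OF that False] Ci[OF False] by simp
      qed
      then show "\<not> family_eval (C k) ` ?X \<subseteq> Q"
        using eval_multi_power_witness[OF Q(1), of ?v "C k" "(\<lambda>_. n + 1)(i0 := n)"] by blast
    next
      fix k z w assume k: "k < ?r" and z: "z \<in> dual_apply scale (e i0) (C k i0) ` M i0"
        and w: "w \<in> family_eval (C k) ` ?X"
      obtain z' where z': "z = dual_apply scale (e i0) (C k i0) z'" "z' \<in> M i0" using z by blast
      obtain w' where w': "w = family_eval (C k) w'" "w' \<in> ?X" using w by blast
      let ?y = "lin_form scale e i0 z' * w'"
      have "((\<lambda>_. n + 1)(i0 := n))(i0 := Suc (((\<lambda>_. n + 1)(i0 := n)) i0)) = (\<lambda>_. n + 1)" by auto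
      then have y: "?y \<in> multi_power scale e q M (\<lambda>_. n + 1)"
        using lin_form_mult_multi_power[of i0 q z' M w' scale e "(\<lambda>_. n + 1)(i0 := n)", OF i0 z'(2) w'(2)] by simp
      have evy: "family_eval (C k) ?y = z * w"
        unfolding z'(1) w'(1) family_eval_lin_form[symmetric] by (simp add: family_eval_def sym_eval_mult)
      let ?I = "{?\<delta> * x + u | x u. x \<in> UNIV \<and> u \<in> Q}"
      have "\<exists>w\<in>?X. family_eval (C k) ?y - ?\<delta> * family_eval (C k) w \<in> Q"
      proof (rule eval_joint_reduction[OF iQ i0 eq _ _ y])
        show "dual_apply scale (e i) (C k i) b \<in> Q" if "i < q" "i \<noteq> i0" "b \<in> B i" for i b
          using cv that Ci by simp
        have I: "is_ideal ?I" by (rule is_ideal_sum_scaled[OF ring_module.subspace_UNIV iQ])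
        have "set bs \<subseteq> {v \<in> F i0. dual_apply scale (e i0) (C k i0) v \<in> ?I}"
        proof
          fix b assume b: "b \<in> set bs"
          then obtain l where l: "l < ?r" "b = bs ! l" using bs(1) by (metis in_set_conv_nth)
          have "dual_apply scale (e i0) (C k i0) b = ?\<delta> * (if k = l then 1 else 0) + 0"
            unfolding l(2) C_bs[OF k l(1)] by simp
          then have "dual_apply scale (e i0) (C k i0) b \<in> ?I" using ring_module.subspace_0[OF iQ] by blast
          then show "b \<in> {v \<in> F i0. dual_apply scale (e i0) (C k i0) v \<in> ?I}" using b bsM(2) by blast
        qed
        then have sp: "span (set bs) \<subseteq> {v \<in> F i0. dual_apply scale (e i0) (C k i0) v \<in> ?I}"
          by (rule span_minimal[OF _ fm.subspace_dual_vimage[OF I]])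
        show "\<exists>x. dual_apply scale (e i0) (C k i0) b - x * ?\<delta> \<in> Q" if "b \<in> B i0" for b
        proof -
          have "b \<in> {v \<in> F i0. dual_apply scale (e i0) (C k i0) v \<in> ?I}"
            using sp that unfolding bs(2) by (rule subsetD)
          then obtain x u where "dual_apply scale (e i0) (C k i0) b = ?\<delta> * x + u" "u \<in> Q"
            unfolding mem_Collect_eq by (elim conjE exE)
          then have "dual_apply scale (e i0) (C k i0) b - x * ?\<delta> \<in> Q" by (simp add: mult.commute)
          then show ?thesis by blast
        qed
      qed
      then show "\<exists>w'\<in>family_eval (C k) ` ?X. z * w - ?\<delta> * w' \<in> Q" unfolding evy by blast
    qed
    moreover have "set gs \<subseteq> M i0" using gs span_superset[of "set gs"] by blast
    ultimately show False
      using fm.det_power_in_scaled_products[OF bs(1) _ M_le_F[OF i0] det] unfolding C0 by blast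
  qed
qed

lemma joint_reduction_det_min_generator:
  assumes "krull_dim TYPE('a) = enat q" "\<And>i. i < q \<Longrightarrow> M i \<subset> F i"
    "is_joint_reduction scale e q M B" and i0: "i0 < q"
    and bs: "length bs = length (e i0)" "span (set bs) = B i0" and gs: "span (set gs) = M i0"
  shows "\<exists>S. det (coord_mat scale (e i0) bs) \<in> S \<and>
    is_min_generating_set (*) (maximal_minors_ideal (coord_mat scale (e i0) gs)) S"
proof -
  let ?\<delta> = "det (coord_mat scale (e i0) bs)" and ?I = "maximal_minors_ideal (coord_mat scale (e i0) gs)"
  interpret fm: free_module scale "e i0" "F i0" by (rule free[OF i0])
  have I: "is_ideal ?I" unfolding maximal_minors_ideal_def by (rule ring_module.subspace_span)
  have notin: "?\<delta> \<notin> ideal_mult (*) \<mm> ?I" by (rule joint_reduction_det[OF assms])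
  have "B i0 \<subseteq> M i0" using assms(3) i0 unfolding is_joint_reduction_def by blast
  then have "bs ! l \<in> span (set gs)" if "l < length (e i0)" for l
    using that bs gs span_superset[of "set bs"] nth_mem[of l bs] by (simp add: subset_iff)
  moreover have "set gs \<subseteq> F i0" using gs span_superset[of "set gs"] M_le_F[OF i0] by blast
  ultimately have "?\<delta> \<in> ?I" unfolding fm.det_coord_mat[OF bs(1)] by (intro fm.col_det_in_minors) auto
  obtain T where T: "finite T" "ideal_generated T = ?I" using noeth I unfolding is_noetherian_def by blast
  have "ring_module.span ({?\<delta>} - {?\<delta>} \<union> ideal_mult (*) \<mm> ?I) = ideal_mult (*) \<mm> ?I"
    using ring_module.span_subspace[OF order_refl ring_module.span_superset ring_module.subspace_ideal_mult] by simp
  then have "irredundant_mod (*) ?I {?\<delta>}" unfolding irredundant_mod_def using notin by (metis singletonD)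
  then obtain H where "{?\<delta>} \<subseteq> H" "is_min_generating_set (*) ?I H"
    using extend_to_min_generating_set[OF ring_module.module_axioms T, of "{?\<delta>}"] \<open>?\<delta> \<in> ?I\<close> by blast
  then show ?thesis by blast
qed

text \<open>If \<open>g\<close> in \<open>G\<close> were redundant modulo \<open>\<mm> M i0\<close>,
  the determinant of a generating list of \<open>B i0\<close> made from \<open>G\<close> would lie
  in \<open>\<mm>\<close> times the ideal of minors, against \<open>joint_reduction_det\<close>:
  either the list contains a zero column, or the column \<open>g\<close> can be replaced by an
  element of \<open>\<mm> M i0\<close>.\<close>

lemma joint_reduction_extend_generators:
  assumes "krull_dim TYPE('a) = enat q" "\<And>i. i < q \<Longrightarrow> M i \<subset> F i"
    and red: "is_joint_reduction scale e q M B" and i0: "i0 < q"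
    and G: "is_min_generating_set scale (B i0) G"
  shows "\<exists>H. G \<subseteq> H \<and> is_min_generating_set scale (M i0) H"
proof -
  interpret fm: free_module scale "e i0" "F i0" by (rule free[OF i0])
  let ?r = "length (e i0)"
  obtain bs where bs: "length bs = ?r" "span (set bs) = B i0" and BM: "B i0 \<subseteq> M i0"
    using red i0 unfolding is_joint_reduction_def by blast
  obtain T where T: "finite T" "span T = M i0"
    using finite_colength_finitely_generated[OF free[OF i0] subspace_M[OF i0] M_le_F[OF i0] colength_M[OF i0]] by blast
  obtain gs where gs: "set gs = T" using finite_list[OF T(1)] by blast
  have fG: "finite G" by (rule min_generating_set_finite[OF module_axioms G finite_set bs(2)])
  have spG: "span G = B i0" using G unfolding is_min_generating_set_def by blast
  have irr: "g \<notin> span (G - {g} \<union> ideal_mult scale \<mm> (B i0))" if "g \<in> G" for g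
    by (rule min_generating_set_irredundant[OF module_axioms G fG that])
  have card: "card G \<le> ?r"
  proof (rule ccontr)
    assume "\<not> card G \<le> ?r"
    then have "card {..<?r} < card G" by simp
    have "\<exists>f. g = (\<Sum>l<?r. f l *s bs ! l)" if "g \<in> G" for g
    proof -
      let ?Y = "{y. \<exists>f. y = (\<Sum>l<?r. f l *s bs ! l)}"
      have "subspace ?Y"
        unfolding subspace_def
      proof (intro conjI ballI allI CollectI)
        show "\<exists>f. 0 = (\<Sum>l<?r. f l *s bs ! l)" by (rule exI[of _ "\<lambda>_. 0"]) simp
        fix x y assume "x \<in> ?Y" "y \<in> ?Y"
        then obtain f h where "x = (\<Sum>l<?r. f l *s bs ! l)" "y = (\<Sum>l<?r. h l *s bs ! l)" by blast
        then show "\<exists>f. x + y = (\<Sum>l<?r. f l *s bs ! l)"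
          by (intro exI[of _ "\<lambda>l. f l + h l"]) (simp add: scale_left_distrib sum.distrib)
      next
        fix c x assume "x \<in> ?Y"
        then obtain f where "x = (\<Sum>l<?r. f l *s bs ! l)" by blast
        then show "\<exists>f. c *s x = (\<Sum>l<?r. f l *s bs ! l)"
          by (intro exI[of _ "\<lambda>l. c * f l"]) (simp add: scale_sum_right)
      qed
      moreover have "set bs \<subseteq> ?Y"
      proof
        fix b assume "b \<in> set bs"
        then obtain l where l: "l < ?r" "b = bs ! l" using bs(1) by (metis in_set_conv_nth)
        have "(\<Sum>j<?r. (if j = l then 1 else 0) *s bs ! j) = (\<Sum>j<?r. if j = l then bs ! l else 0)"
          by (rule sum.cong) auto
        then have "b = (\<Sum>j<?r. (if j = l then 1 else 0) *s bs ! j)" using l by simp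
        then show "b \<in> ?Y" by (intro CollectI exI)
      qed
      ultimately have "span (set bs) \<subseteq> ?Y" by (rule span_minimal[rotated])
      moreover have "g \<in> span (set bs)" using that spG bs(2) span_superset[of G] by blast
      ultimately show ?thesis by blast
    qed
    then obtain f where f: "\<And>g. g \<in> G \<Longrightarrow> g = (\<Sum>l<?r. f g l *s bs ! l)" by metis
    \<comment> \<open>With more elements in \<open>G\<close> than in \<open>bs\<close>, their
      coefficient vectors satisfy a relation modulo \<open>\<mm>\<close> with a unit coefficient,
      which makes some \<open>g\<close> redundant modulo \<open>\<mm> B i0\<close>.\<close>
    obtain v where v: "\<exists>g\<in>G. v g \<notin> \<mm>" "\<forall>l\<in>{..<?r}. (\<Sum>g\<in>G. v g * f g l) \<in> \<mm>"
      using relation_mod_prime[OF prime_m _ fG \<open>card {..<?r} < card G\<close>, of f] by auto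
    obtain g where g: "g \<in> G" "v g \<notin> \<mm>" using v(1) by blast
    obtain y where y: "y * v g = 1" using unit_notin_m[OF g(2)] .
    have "(\<Sum>h\<in>G. v h *s h) = (\<Sum>h\<in>G. \<Sum>l<?r. (v h * f h l) *s bs ! l)"
      by (rule sum.cong[OF refl]) (subst f, assumption, simp add: scale_sum_right)
    also have "\<dots> = (\<Sum>l<?r. \<Sum>h\<in>G. (v h * f h l) *s bs ! l)" by (rule sum.swap)
    also have "\<dots> = (\<Sum>l<?r. (\<Sum>h\<in>G. v h * f h l) *s bs ! l)" by (simp add: scale_sum_left)
    also have "\<dots> \<in> ideal_mult scale \<mm> (B i0)"
    proof (rule subspace_sum[OF subspace_ideal_mult], rule ideal_mult_base)
      fix l assume l: "l \<in> {..<?r}"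
      then show "(\<Sum>h\<in>G. v h * f h l) \<in> \<mm>" using v(2) by blast
      show "bs ! l \<in> B i0" using l bs span_superset[of "set bs"] nth_mem[of l bs] by auto
    qed
    finally have z: "(\<Sum>h\<in>G. v h *s h) \<in> ideal_mult scale \<mm> (B i0)" .
    let ?S = "span (G - {g} \<union> ideal_mult scale \<mm> (B i0))"
    have "(\<Sum>h\<in>G. v h *s h) - (\<Sum>h\<in>G - {g}. v h *s h) \<in> ?S"
    proof (rule span_diff)
      show "(\<Sum>h\<in>G. v h *s h) \<in> ?S" using z by (intro span_base) blast
      show "(\<Sum>h\<in>G - {g}. v h *s h) \<in> ?S" by (intro span_sum span_scale span_base) blast
    qed
    then have "v g *s g \<in> ?S" using sum.remove[OF fG g(1), of "\<lambda>h. v h *s h"] by simp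
    then have "y *s (v g *s g) \<in> ?S" by (rule span_scale)
    then show False using irr[OF g(1)] y by simp
  qed
  have "irredundant_mod scale (M i0) G"
    unfolding irredundant_mod_def
  proof
    fix g assume g: "g \<in> G"
    show "g \<notin> span (G - {g} \<union> ideal_mult scale \<mm> (M i0))"
    proof
      assume bad: "g \<in> span (G - {g} \<union> ideal_mult scale \<mm> (M i0))"
      obtain xs where xs: "set xs = G" "distinct xs" using finite_distinct_list[OF fG] by blast
      have lxs: "length xs = card G" using xs distinct_card by metis
      \<comment> \<open>Padding with zeros gives exactly as many columns as the rank without
        changing the span.\<close>
      define cs where "cs = xs @ replicate (?r - card G) 0"
      have lcs: "length cs = ?r" unfolding cs_def using lxs card by simp
      have scs: "set cs \<subseteq> insert 0 G" "G \<subseteq> set cs" unfolding cs_def using xs by auto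
      have "set cs \<subseteq> span G" using scs(1) span_superset[of G] span_zero[of G] by blast
      then have spcs: "span (set cs) = B i0"
        using spG span_mono[OF scs(2)] span_minimal[OF _ subspace_span] by blast
      have csM: "cs ! l \<in> span (set gs)" if "l < ?r" for l
        using that lcs \<open>set cs \<subseteq> span G\<close> spG BM T(2) gs nth_mem[of l cs] by (simp add: subset_iff)
      have gsF: "set gs \<subseteq> F i0" using gs T(2) span_superset[of T] M_le_F[OF i0] by blast
      have "det (coord_mat scale (e i0) cs) \<in> ideal_mult (*) \<mm> (maximal_minors_ideal (coord_mat scale (e i0) gs))"
        unfolding fm.det_coord_mat[OF lcs]
      proof (cases "card G = ?r")
        case False
        then have t: "card G < ?r" using card by simp
        have "cs ! card G = 0" unfolding cs_def using t lxs by (simp add: nth_append)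
        then show "col_det ?r (coord scale (e i0)) ((!) cs) \<in> ideal_mult (*) \<mm> (maximal_minors_ideal (coord_mat scale (e i0) gs))"
          by (intro fm.col_det_in_scaled_minors[OF gsF csM t]) (auto intro: subspace_0[OF subspace_ideal_mult])
      next
        case True
        then have cs: "cs = xs" unfolding cs_def by simp
        obtain t where t: "t < ?r" "xs ! t = g" using g xs(1) lxs True by (metis in_set_conv_nth)
        obtain u z where uz: "g = u + z" "u \<in> span (G - {g})" "z \<in> span (ideal_mult scale \<mm> (M i0))"
          using bad unfolding span_Un by blast
        have z: "z \<in> ideal_mult scale \<mm> (M i0)"
          using uz(3) span_minimal[OF order_refl subspace_ideal_mult] by blast
        let ?det = "\<lambda>y. col_det ?r (coord scale (e i0)) (((!) xs)(t := y))"
        \<comment> \<open>The zero ideal turns the vanishing of the determinant at the other columns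
          into vanishing on their span, in particular at \<open>u\<close>.\<close>
        have zero: "is_ideal {0 :: 'a}" by simp
        have GF: "G \<subseteq> F i0" using span_superset[of G] spG BM M_le_F[OF i0] by blast
        have "G - {g} \<subseteq> {y \<in> F i0. ?det y \<in> {0}}"
        proof
          fix h assume h: "h \<in> G - {g}"
          then obtain s where s: "s < ?r" "xs ! s = h" using xs(1) lxs True by (metis DiffD1 in_set_conv_nth)
          have "s \<noteq> t" using s t h by auto
          then have "?det h = 0" by (intro col_det_identical[of s _ t]) (use s t in auto)
          then show "h \<in> {y \<in> F i0. ?det y \<in> {0}}" using h GF by blast
        qed
        then have "span (G - {g}) \<subseteq> {y \<in> F i0. ?det y \<in> {0}}"
          by (rule span_minimal[OF _ fm.subspace_col_det[OF t(1) zero]])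
        then have u0: "?det u = 0" "u \<in> F i0" using uz(2) by auto
        have zM: "z \<in> M i0" using z ideal_mult_le_self[OF subspace_M[OF i0]] by blast
        obtain K where K: "\<And>y. ?det y = (\<Sum>k<?r. coord scale (e i0) y k * K k)"
          using col_det_linear[OF t(1), of "coord scale (e i0)" "(!) xs"] by metis
        have "?det g = ?det u + ?det z"
          unfolding K uz(1) using u0(2) zM M_le_F[OF i0] by (simp add: fm.coord_add subset_iff distrib_right sum.distrib)
        moreover have "((!) xs)(t := g) = (!) xs" using t by auto
        ultimately have "col_det ?r (coord scale (e i0)) ((!) cs) = ?det z" using u0 cs by simp
        moreover have "?det z \<in> ideal_mult (*) \<mm> (maximal_minors_ideal (coord_mat scale (e i0) gs))"
        proof (rule fm.col_det_in_scaled_minors[OF gsF _ t(1)])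
          show "(((!) xs)(t := z)) l \<in> span (set gs)" if "l < ?r" for l
            using csM[OF that] zM T(2) gs cs by auto
          show "(((!) xs)(t := z)) t \<in> ideal_mult scale \<mm> (span (set gs))" using z T(2) gs by simp
        qed
        ultimately show "col_det ?r (coord scale (e i0)) ((!) cs) \<in>
            ideal_mult (*) \<mm> (maximal_minors_ideal (coord_mat scale (e i0) gs))" by simp
      qed
      moreover have "span (set gs) = M i0" using gs T(2) by simp
      ultimately show False using joint_reduction_det[OF assms(1,2) red i0 lcs spcs] by blast
    qed
  qed
  moreover have "G \<subseteq> M i0" using span_superset[of G] spG BM by blast
  ultimately obtain H where "G \<subseteq> H" "is_min_generating_set scale (M i0) H"
    using extend_to_min_generating_set[OF module_axioms T fG] by metis
  then show ?thesis by blast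
qed

end

section \<open>The Rees algebra\<close>

lemma multi_index_induct [case_names zero Suc]:
  fixes n :: "nat \<Rightarrow> nat"
  assumes "\<And>n. (\<And>i. i < q \<Longrightarrow> n i = 0) \<Longrightarrow> P n"
    and "\<And>n i. i < q \<Longrightarrow> P n \<Longrightarrow> P (n(i := Suc (n i)))"
  shows "P n"
proof (induction "\<Sum>i<q. n i" arbitrary: n)
  case 0
  then show ?case using assms(1)[of n] by simp
next
  case (Suc s)
  then obtain i where i: "i < q" "n i \<noteq> 0" by (metis sum.neutral lessThan_iff nat.distinct(1))
  let ?n = "n(i := n i - 1)"
  have "(\<Sum>j<q. n j) = n i + (\<Sum>j\<in>{..<q} - {i}. n j)" using i(1) by (simp add: sum.remove)
  moreover have "(\<Sum>j<q. ?n j) = ?n i + (\<Sum>j\<in>{..<q} - {i}. ?n j)" using i(1) by (simp add: sum.remove)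
  moreover have "(\<Sum>j\<in>{..<q} - {i}. ?n j) = (\<Sum>j\<in>{..<q} - {i}. n j)" by (rule sum.cong) auto
  ultimately have "s = (\<Sum>j<q. ?n j)" using Suc.hyps(2) i(2) by simp
  from assms(2)[OF i(1) Suc.hyps(1)[OF this]] have "P (?n(i := Suc (?n i)))" .
  moreover have "?n(i := Suc (?n i)) = n" using i(2) by auto
  ultimately show ?case by (rule back_subst)
qed

text \<open>The converse of \<open>multi_power_mult\<close>: linear forms are split off one at a
  time, so a product of powers decomposes along any decomposition of its exponents.\<close>

lemma multi_power_factor:
  "multi_power scale e q M (\<lambda>j. m j + n j) \<subseteq>
    sym_span {x * y | x y. x \<in> multi_power scale e q M m \<and> y \<in> multi_power scale e q M n}"
proof (induction m rule: multi_index_induct[of q])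
  case (zero m)
  have "multi_power scale e q M (\<lambda>j. m j + n j) = multi_power scale e q M n"
    by (rule multi_power_cong) (simp add: zero)
  moreover have "1 \<in> multi_power scale e q M m"
    using one_in_multi_power[of scale e q M] multi_power_cong[of q m "\<lambda>_. 0" scale e M] zero by simp
  then have "1 * y \<in> sym_span {x * y | x y. x \<in> multi_power scale e q M m \<and> y \<in> multi_power scale e q M n}"
    if "y \<in> multi_power scale e q M n" for y using that by (intro sym_module.span_base) blast
  ultimately show ?case by auto
next
  case (Suc m i)
  let ?G = "{x * y | x y. x \<in> multi_power scale e q M (m(i := Suc (m i))) \<and> y \<in> multi_power scale e q M n}"
  have "(\<lambda>j. (m(i := Suc (m i))) j + n j) = (\<lambda>j. m j + n j)(i := Suc ((\<lambda>j. m j + n j) i))" by auto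
  then have "multi_power scale e q M (\<lambda>j. (m(i := Suc (m i))) j + n j) \<subseteq>
      sym_span {lin_form scale e i z * y | z y. z \<in> M i \<and> y \<in> multi_power scale e q M (\<lambda>j. m j + n j)}"
    using multi_power_Suc[OF Suc.hyps, of scale e M "\<lambda>j. m j + n j"] by simp
  also have "\<dots> \<subseteq> sym_span ?G"
  proof (rule sym_module.span_minimal[OF _ sym_module.subspace_span], clarify)
    fix z y assume z: "z \<in> M i" and "y \<in> multi_power scale e q M (\<lambda>j. m j + n j)"
    then have "y \<in> sym_span {x * y | x y. x \<in> multi_power scale e q M m \<and> y \<in> multi_power scale e q M n}"
      using Suc.IH by blast
    then show "lin_form scale e i z * y \<in> sym_span ?G"
    proof (rule sym_span_mult[OF sym_module.subspace_span
          sym_module.span_base[of _ "{lin_form scale e i z}", OF singletonI]])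
      fix u v assume "u \<in> {lin_form scale e i z}"
        "v \<in> {x * y | x y. x \<in> multi_power scale e q M m \<and> y \<in> multi_power scale e q M n}"
      then obtain x w where uv: "u = lin_form scale e i z" "v = x * w" "x \<in> multi_power scale e q M m"
        "w \<in> multi_power scale e q M n" by blast
      have "u * v = (lin_form scale e i z * x) * w" unfolding uv by (simp add: mult.assoc)
      moreover have "lin_form scale e i z * x \<in> multi_power scale e q M (m(i := Suc (m i)))"
        by (rule lin_form_mult_multi_power) (use Suc.hyps z uv in auto)
      ultimately show "u * v \<in> sym_span ?G" using uv(4) by (intro sym_module.span_base) blast
    qed
  qed
  finally show ?case .
qed

text \<open>The sum of all multigraded pieces inside the symmetric algebra itself; its multigrading
  comes from the degrees in the blocks of variables.\<close>

definition rees_algebra ::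
    "('a::comm_ring_1 \<Rightarrow> 'b::ab_group_add \<Rightarrow> 'b) \<Rightarrow> (nat \<Rightarrow> 'b list) \<Rightarrow> nat \<Rightarrow> (nat \<Rightarrow> 'b set) \<Rightarrow> 'a sym_alg set" where
  "rees_algebra scale e q M = sym_span (\<Union>n. multi_power scale e q M n)"

lemma subspace_rees_algebra: "module.subspace sym_scale (rees_algebra scale e q M)"
  unfolding rees_algebra_def by (rule sym_module.subspace_span)

lemma multi_power_subset_rees: "multi_power scale e q M n \<subseteq> rees_algebra scale e q M"
  unfolding rees_algebra_def by (rule subset_trans[OF UN_upper[OF UNIV_I] sym_module.span_superset])

lemma is_subring_rees_algebra: "is_subring (rees_algebra scale e q M)"
  unfolding is_subring_def
proof (intro conjI ballI)
  show "1 \<in> rees_algebra scale e q M" using one_in_multi_power multi_power_subset_rees by (rule rev_subsetD)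
  fix x y assume xy: "x \<in> rees_algebra scale e q M" "y \<in> rees_algebra scale e q M"
  show "x - y \<in> rees_algebra scale e q M" using sym_module.subspace_diff[OF subspace_rees_algebra xy] .
  show "x * y \<in> rees_algebra scale e q M"
  proof (rule sym_span_mult[OF subspace_rees_algebra xy[unfolded rees_algebra_def]])
    fix u v assume "u \<in> (\<Union>n. multi_power scale e q M n)" "v \<in> (\<Union>n. multi_power scale e q M n)"
    then obtain m n where "u \<in> multi_power scale e q M m" "v \<in> multi_power scale e q M n" by blast
    then show "u * v \<in> rees_algebra scale e q M" using multi_power_mult multi_power_subset_rees by blast
  qed
qed

lemma const_in_rees: "Poly_Mapping.single 0 c \<in> rees_algebra scale e q M"
proof -
  have "1 \<in> rees_algebra scale e q M" using is_subring_rees_algebra by (rule subring_one)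
  from sym_module.subspace_scale[OF subspace_rees_algebra this, of c] show ?thesis by (simp add: sym_scale_def)
qed

lemma ideal_in_rees_subspace:
  assumes "ideal_in (rees_algebra scale e q M) L"
  shows "module.subspace sym_scale L"
  unfolding sym_module.subspace_def
  using ideal_in_zero[OF assms] ideal_in_add[OF assms] ideal_in_mult[OF assms const_in_rees]
  by (auto simp: sym_scale_def)

lemma subspace_of_subring:
  assumes "is_subring B" "range (\<lambda>c. Poly_Mapping.single 0 c) \<subseteq> B"
  shows "module.subspace sym_scale B"
  unfolding sym_module.subspace_def
proof (intro conjI ballI allI)
  show "0 \<in> B" by (rule subring_zero[OF assms(1)])
  show "x + y \<in> B" if "x \<in> B" "y \<in> B" for x y by (rule subring_add[OF assms(1) that])
  show "sym_scale c x \<in> B" if "x \<in> B" for c x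
    unfolding sym_scale_def using subring_mult[OF assms(1)] assms(2) that by blast
qed

lemma prod_in_subring:
  assumes "is_subring B" "\<And>x. x \<in> A \<Longrightarrow> f x \<in> B"
  shows "prod f A \<in> B"
  using assms(2)
  by (induction A rule: infinite_finite_induct) (auto intro: subring_one[OF assms(1)] subring_mult[OF assms(1)])

lemma (in free_module) lin_form_linear:
  assumes "es = e i"
  shows "v \<in> F \<Longrightarrow> w \<in> F \<Longrightarrow> lin_form scale e i (v + w) = lin_form scale e i v + lin_form scale e i w"
    and "v \<in> F \<Longrightarrow> lin_form scale e i (c *s v) = sym_scale c (lin_form scale e i v)"
    and "lin_form scale e i 0 = 0"
proof -
  show "lin_form scale e i (v + w) = lin_form scale e i v + lin_form scale e i w" if "v \<in> F" "w \<in> F"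
    unfolding lin_form_coord using that
    by (simp add: coord_add[unfolded assms] single_add sum.distrib)
  have "sym_scale c (Poly_Mapping.single \<alpha> x) = Poly_Mapping.single \<alpha> (c * x)" for \<alpha> x
    by (simp add: sym_scale_def mult_single)
  then show "lin_form scale e i (c *s v) = sym_scale c (lin_form scale e i v)" if "v \<in> F"
    unfolding lin_form_coord using that
    by (simp add: coord_scale[unfolded assms] sym_module.scale_sum_right)
  show "lin_form scale e i 0 = 0"
    unfolding lin_form_coord by (simp add: coord_zero[unfolded assms])
qed

lemma (in free_module) subspace_lin_form_vimage:
  assumes "es = e i" "module.subspace sym_scale L"
  shows "subspace {v \<in> F. lin_form scale e i v \<in> L}"
  unfolding subspace_def
proof (intro conjI ballI allI CollectI)
  show "0 \<in> F" by (rule subspace_0[OF subspace_F])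
  show "lin_form scale e i 0 \<in> L" using lin_form_linear(3)[of e i, OF assms(1)] sym_module.subspace_0[OF assms(2)] by simp
next
  fix x y assume xy: "x \<in> {v \<in> F. lin_form scale e i v \<in> L}" "y \<in> {v \<in> F. lin_form scale e i v \<in> L}"
  show "x + y \<in> F" using xy subspace_add[OF subspace_F] by simp
  show "lin_form scale e i (x + y) \<in> L"
    using xy lin_form_linear(1)[of e i x y, OF assms(1)] sym_module.subspace_add[OF assms(2)] by simp
next
  fix c x assume x: "x \<in> {v \<in> F. lin_form scale e i v \<in> L}"
  show "c *s x \<in> F" using x subspace_scale[OF subspace_F] by simp
  show "lin_form scale e i (c *s x) \<in> L"
    using x lin_form_linear(2)[of e i x c, OF assms(1)] sym_module.subspace_scale[OF assms(2)] by simp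
qed

context finite_colength_family
begin

abbreviation "MP \<equiv> multi_power scale e q M"
abbreviation "\<R> \<equiv> rees_algebra scale e q M"

lemma lin_form_in_rees: "i < q \<Longrightarrow> z \<in> M i \<Longrightarrow> lin_form scale e i z \<in> \<R>"
  using lin_form_in_multi_power[of i q z M scale e] multi_power_subset_rees by blast

lemma finitely_generated_M: "i < q \<Longrightarrow> \<exists>T. finite T \<and> span T = M i"
  using finite_colength_finitely_generated[OF free subspace_M M_le_F colength_M] by blast

text \<open>The algebra is generated over the constants by the linear forms of finitely many
  generators of the \<open>M i\<close>.\<close>

lemma noetherian_rees_algebra: "noetherian_subring \<R>"
proof -
  have "noetherian_subring (range (\<lambda>c :: 'a. Poly_Mapping.single 0 c :: 'a sym_alg))"
    by (rule noetherian_subring_range[OF noetherian_subring_UNIV[OF noeth]])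
      (auto simp: single_diff mult_single)
  note base = this
  have "\<forall>i. \<exists>T. i < q \<longrightarrow> finite T \<and> span T = M i" using finitely_generated_M by blast
  then obtain T where T: "\<forall>i. i < q \<longrightarrow> finite (T i) \<and> span (T i) = M i" by (rule choice[THEN exE])
  let ?X = "\<Union>i<q. lin_form scale e i ` T i"
  have "finite ?X" using T by auto
  from adjoin_finite[OF base this]
  obtain B where B: "noetherian_subring B" "range (\<lambda>c. Poly_Mapping.single 0 c) \<subseteq> B" "?X \<subseteq> B"
    "\<forall>C. is_subring C \<longrightarrow> range (\<lambda>c :: 'a. Poly_Mapping.single 0 c) \<subseteq> C \<longrightarrow> ?X \<subseteq> C \<longrightarrow> B \<subseteq> C"
    by (elim exE conjE)
  have sB: "is_subring B" using B(1) unfolding noetherian_subring_def by blast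
  have subB: "sym_module.subspace B" by (rule subspace_of_subring[OF sB B(2)])
  have "B \<subseteq> \<R>"
  proof (rule B(4)[rule_format, OF is_subring_rees_algebra])
    show "range (\<lambda>c. Poly_Mapping.single 0 c) \<subseteq> \<R>" using const_in_rees by auto
    show "?X \<subseteq> \<R>"
    proof (rule UN_least, rule image_subsetI)
      fix i t assume "i \<in> {..<q}" "t \<in> T i"
      then show "lin_form scale e i t \<in> \<R>" using T lin_form_in_rees span_base[of t "T i"] by auto
    qed
  qed
  moreover have "\<R> \<subseteq> B"
  proof -
    have lin: "lin_form scale e i v \<in> B" if i: "i < q" and v: "v \<in> M i" for i v
    proof -
      interpret fm: free_module scale "e i" "F i" by (rule free[OF i])
      have "T i \<subseteq> {v \<in> F i. lin_form scale e i v \<in> B}"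
        using B(3) i T M_le_F[OF i] span_superset[of "T i"] by auto
      then have "span (T i) \<subseteq> {v \<in> F i. lin_form scale e i v \<in> B}"
        by (rule span_minimal[OF _ fm.subspace_lin_form_vimage[of e i, OF refl subB]])
      then show ?thesis using v T i by auto
    qed
    have pw: "sym_power_image scale e i k (M i) \<subseteq> B" if i: "i < q" for i k
      unfolding sym_power_image_def
    proof (rule sym_module.span_minimal[OF _ subB], clarify)
      fix v assume "\<forall>l<k. v l \<in> M i"
      then show "(\<Prod>l<k. lin_form scale e i (v l)) \<in> B" using lin[OF i] by (intro prod_in_subring[OF sB]) auto
    qed
    have "MP n \<subseteq> B" for n
      unfolding multi_power_def sym_prod_def
    proof (rule sym_module.span_minimal[OF _ subB], clarify)
      fix u assume "\<forall>j\<in>{..<q}. u j \<in> sym_power_image scale e j (n j) (M j)"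
      then show "(\<Prod>j<q. u j) \<in> B" using pw by (intro prod_in_subring[OF sB]) auto
    qed
    then show ?thesis unfolding rees_algebra_def by (intro sym_module.span_minimal[OF _ subB]) blast
  qed
  ultimately have "B = \<R>" by (rule subset_antisym)
  then show ?thesis using B(1) by simp
qed

lemma ideal_contains_larger_powers:
  assumes I: "ideal_in \<R> I" and "MP n \<subseteq> I" and mn: "\<And>j. j < q \<Longrightarrow> n j \<le> m j"
  shows "MP m \<subseteq> I"
proof -
  have "MP m = MP (\<lambda>j. (m j - n j) + n j)" by (rule multi_power_cong) (simp add: mn)
  also have "\<dots> \<subseteq> sym_span {x * y | x y. x \<in> MP (\<lambda>j. m j - n j) \<and> y \<in> MP n}" by (rule multi_power_factor)
  also have "\<dots> \<subseteq> I"
  proof (rule sym_module.span_minimal[OF _ ideal_in_rees_subspace[OF I]], clarify)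
    fix x y assume "x \<in> MP (\<lambda>j. m j - n j)" "y \<in> MP n"
    then show "x * y \<in> I" using ideal_in_mult[OF I] assms(2) multi_power_subset_rees by blast
  qed
  finally show ?thesis .
qed

text \<open>Ideals are going to be saturated with respect to the piece of degree (1,...,1). Taking
  \<open>k\<close> factors from it raises every exponent by \<open>k\<close>, which is how a
  saturation is undone later.\<close>

lemma multi_power_products:
  "MP (\<lambda>j. n j + k) \<subseteq> sym_span {s * y | s y. s \<in> products (MP (\<lambda>_. 1)) k \<and> y \<in> MP n}"
proof (induction k)
  case 0
  have "1 * y \<in> sym_span {s * y | s y. s \<in> products (MP (\<lambda>_. 1)) 0 \<and> y \<in> MP n}" if "y \<in> MP n" for y
    using that by (intro sym_module.span_base) auto
  then show ?case by auto
next
  case (Suc k)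
  let ?G = "{s * y | s y. s \<in> products (MP (\<lambda>_. 1)) (Suc k) \<and> y \<in> MP n}"
  have "(\<lambda>j. n j + Suc k) = (\<lambda>j. 1 + (n j + k))" by auto
  then have "MP (\<lambda>j. n j + Suc k) \<subseteq> sym_span {x * y | x y. x \<in> MP (\<lambda>_. 1) \<and> y \<in> MP (\<lambda>j. n j + k)}"
    using multi_power_factor[of scale e q M "\<lambda>_. 1" "\<lambda>j. n j + k"] by simp
  also have "\<dots> \<subseteq> sym_span ?G"
  proof (rule sym_module.span_minimal[OF _ sym_module.subspace_span], clarify)
    fix x y assume x: "x \<in> MP (\<lambda>_. 1)" and "y \<in> MP (\<lambda>j. n j + k)"
    then have "y \<in> sym_span {s * y | s y. s \<in> products (MP (\<lambda>_. 1)) k \<and> y \<in> MP n}" using Suc by blast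
    then show "x * y \<in> sym_span ?G"
    proof (rule sym_span_mult[OF sym_module.subspace_span sym_module.span_base[of _ "{x}", OF singletonI]])
      fix u v assume "u \<in> {x}" "v \<in> {s * y | s y. s \<in> products (MP (\<lambda>_. 1)) k \<and> y \<in> MP n}"
      then obtain s w where uv: "u = x" "v = s * w" "s \<in> products (MP (\<lambda>_. 1)) k" "w \<in> MP n" by blast
      have "u * v = (x * s) * w" unfolding uv by (simp add: mult.assoc)
      moreover have "x * s \<in> products (MP (\<lambda>_. 1)) (Suc k)" using x uv(3) by auto
      ultimately show "u * v \<in> sym_span ?G" using uv(4) by (intro sym_module.span_base) blast
    qed
  qed
  finally show ?case .
qed

text \<open>Makes a single piece accessible to Nakayama's lemma over the base ring; products of
  linear forms of generators suffice.\<close>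

lemma multi_power_finitely_generated: "\<exists>T. finite T \<and> sym_span T = MP n"
proof (induction n rule: multi_index_induct[of q])
  case (zero n)
  have "sym_power_image scale e j 0 (M j) \<subseteq> sym_span {1}" for j
    unfolding sym_power_image_def by (rule sym_module.span_mono) auto
  then have pw: "sym_power_image scale e j (n j) (M j) \<subseteq> sym_span {1}" if "j < q" for j using zero that by simp
  have "MP n \<subseteq> sym_span {1}"
    unfolding multi_power_def sym_prod_def
  proof (rule sym_module.span_minimal[OF _ sym_module.subspace_span], clarify)
    fix u assume u: "\<forall>j\<in>{..<q}. u j \<in> sym_power_image scale e j (n j) (M j)"
    have "(\<Prod>j<t. u j) \<in> sym_span {1}" if "t \<le> q" for t
      using that
    proof (induction t)
      case 0
      then show ?case by (simp add: sym_module.span_base)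
    next
      case (Suc t)
      have ut: "u t \<in> sym_span {1}" using pw[of t] u Suc.prems by auto
      have "(\<Prod>j<t. u j) * u t \<in> sym_span {1}"
        by (rule sym_span_mult[OF sym_module.subspace_span Suc.IH ut]) (use Suc.prems in \<open>auto intro: sym_module.span_base\<close>)
      then show ?case by simp
    qed
    then show "(\<Prod>j<q. u j) \<in> sym_span {1}" by simp
  qed
  moreover have "1 \<in> MP n"
    using one_in_multi_power[of scale e q M] multi_power_cong[of q n "\<lambda>_. 0" scale e M] zero by simp
  then have "sym_span {1} \<subseteq> MP n" by (intro sym_module.span_minimal subspace_multi_power) simp
  ultimately show ?case by (intro exI[of _ "{1}"]) auto
next
  case (Suc n i)
  then obtain S where S: "finite S" "sym_span S = MP n" by blast
  interpret fm: free_module scale "e i" "F i" by (rule free[OF Suc.hyps])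
  obtain T where T: "finite T" "span T = M i" using finitely_generated_M[OF Suc.hyps] by blast
  define G where "G = (\<lambda>(t, s). lin_form scale e i t * s) ` (T \<times> S)"
  have "MP (n(i := Suc (n i))) \<subseteq> sym_span {lin_form scale e i z * y | z y. z \<in> M i \<and> y \<in> MP n}"
    by (rule multi_power_Suc[OF Suc.hyps])
  also have "\<dots> \<subseteq> sym_span G"
  proof (rule sym_module.span_minimal[OF _ sym_module.subspace_span], clarify)
    fix z y assume z: "z \<in> M i" and y: "y \<in> MP n"
    have "T \<subseteq> {v \<in> F i. lin_form scale e i v \<in> sym_span (lin_form scale e i ` T)}"
      using T(2) span_superset[of T] M_le_F[OF Suc.hyps] by (auto intro: sym_module.span_base)
    then have "span T \<subseteq> {v \<in> F i. lin_form scale e i v \<in> sym_span (lin_form scale e i ` T)}"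
      by (rule span_minimal[OF _ fm.subspace_lin_form_vimage[of e i, OF refl sym_module.subspace_span]])
    then have "lin_form scale e i z \<in> sym_span (lin_form scale e i ` T)" using z T(2) by auto
    moreover have "y \<in> sym_span S" using y S(2) by simp
    ultimately show "lin_form scale e i z * y \<in> sym_span G"
      by (rule sym_span_mult[OF sym_module.subspace_span]) (auto simp: G_def intro: sym_module.span_base)
  qed
  finally have "MP (n(i := Suc (n i))) \<subseteq> sym_span G" .
  moreover have "sym_span G \<subseteq> MP (n(i := Suc (n i)))"
  proof (rule sym_module.span_minimal[OF _ subspace_multi_power], rule subsetI)
    fix g assume "g \<in> G"
    then obtain t s where ts: "g = lin_form scale e i t * s" "t \<in> T" "s \<in> S" unfolding G_def by auto
    then have "t \<in> M i" "s \<in> MP n" using T(2) S(2) span_superset[of T] sym_module.span_superset[of S] by auto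
    then show "g \<in> MP (n(i := Suc (n i)))" unfolding ts(1) by (intro lin_form_mult_multi_power Suc.hyps)
  qed
  moreover have "finite G" unfolding G_def using T(1) S(1) by simp
  ultimately show ?case by blast
qed

end

section \<open>Multidegrees\<close>

text \<open>The type has further variables; the condition on the keys restricts to the genuine ones,
  so that each multidegree contains only finitely many monomials.\<close>

definition has_degree :: "nat \<Rightarrow> (nat \<Rightarrow> nat) \<Rightarrow> (nat \<Rightarrow> nat) \<Rightarrow> ((nat \<times> nat) \<Rightarrow>\<^sub>0 nat) \<Rightarrow> bool" where
  "has_degree q r n \<alpha> \<longleftrightarrow> Poly_Mapping.keys \<alpha> \<subseteq> (SIGMA i:{..<q}. {..<r i}) \<and>
     (\<forall>i<q. (\<Sum>k<r i. Poly_Mapping.lookup \<alpha> (i, k)) = n i)"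

definition homogeneous :: "nat \<Rightarrow> (nat \<Rightarrow> nat) \<Rightarrow> (nat \<Rightarrow> nat) \<Rightarrow> 'a::comm_ring_1 sym_alg set" where
  "homogeneous q r n = {p. \<forall>\<alpha>\<in>Poly_Mapping.keys p. has_degree q r n \<alpha>}"

lemma has_degree_add:
  assumes "has_degree q r m \<alpha>" "has_degree q r n \<beta>"
  shows "has_degree q r (\<lambda>j. m j + n j) (\<alpha> + \<beta>)"
proof -
  have "Poly_Mapping.keys (\<alpha> + \<beta>) \<subseteq> (SIGMA i:{..<q}. {..<r i})"
    using assms keys_add[of \<alpha> \<beta>] unfolding has_degree_def by blast
  then show ?thesis using assms unfolding has_degree_def by (simp add: lookup_add sum.distrib)
qed

lemma has_degree_unique:
  "has_degree q r m \<alpha> \<Longrightarrow> has_degree q r n \<alpha> \<Longrightarrow> i < q \<Longrightarrow> m i = n i"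
  unfolding has_degree_def by metis

lemma subspace_homogeneous: "module.subspace sym_scale (homogeneous q r n)"
  unfolding sym_module.subspace_def homogeneous_def
proof (intro conjI ballI allI CollectI)
  show "has_degree q r n \<alpha>" if "\<alpha> \<in> Poly_Mapping.keys 0" for \<alpha> using that by simp
next
  fix x y \<alpha> assume "x \<in> {p. \<forall>\<alpha>\<in>Poly_Mapping.keys p. has_degree q r n \<alpha>}"
    "y \<in> {p. \<forall>\<alpha>\<in>Poly_Mapping.keys p. has_degree q r n \<alpha>}" "\<alpha> \<in> Poly_Mapping.keys (x + y)"
  then show "has_degree q r n \<alpha>" using keys_add[of x y] by blast
next
  fix c x \<alpha> assume x: "x \<in> {p. \<forall>\<alpha>\<in>Poly_Mapping.keys p. has_degree q r n \<alpha>}"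
    and a: "\<alpha> \<in> Poly_Mapping.keys (sym_scale c x)"
  have "Poly_Mapping.lookup x \<alpha> \<noteq> 0" using a unfolding in_keys_iff lookup_sym_scale by auto
  then show "has_degree q r n \<alpha>" using x by (auto simp: in_keys_iff)
qed

lemma homogeneous_mult:
  assumes "x \<in> homogeneous q r m" "y \<in> homogeneous q r n"
  shows "x * y \<in> homogeneous q r (\<lambda>j. m j + n j)"
  unfolding homogeneous_def
proof (intro CollectI ballI)
  fix \<alpha> assume "\<alpha> \<in> Poly_Mapping.keys (x * y)"
  then obtain a b where "\<alpha> = a + b" "a \<in> Poly_Mapping.keys x" "b \<in> Poly_Mapping.keys y"
    using keys_mult[of x y] by blast
  then show "has_degree q r (\<lambda>j. m j + n j) \<alpha>"
    using assms has_degree_add unfolding homogeneous_def by blast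
qed

lemma homogeneous_one: "1 \<in> homogeneous q r (\<lambda>_. 0)"
  unfolding homogeneous_def has_degree_def by simp

lemma homogeneous_prod:
  assumes "finite J" "\<And>j. j \<in> J \<Longrightarrow> u j \<in> homogeneous q r (n j)"
  shows "prod u J \<in> homogeneous q r (\<lambda>i. \<Sum>j\<in>J. n j i)"
  using assms
proof (induction J)
  case empty
  then show ?case using homogeneous_one by simp
next
  case (insert j J)
  then show ?case using homogeneous_mult[of "u j" q r "n j" "prod u J" "\<lambda>i. \<Sum>j\<in>J. n j i"] by simp
qed

lemma lin_form_homogeneous:
  assumes "i < q" and r: "\<And>i. i < q \<Longrightarrow> r i = length (e i)"
  shows "lin_form scale e i v \<in> homogeneous q r ((\<lambda>_. 0)(i := 1))"
  unfolding lin_form_coord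
proof (rule sym_module.subspace_sum[OF subspace_homogeneous])
  fix k assume k: "k \<in> {..<length (e i)}"
  have "has_degree q r ((\<lambda>_. 0)(i := 1)) (Poly_Mapping.single (i, k) 1)"
    unfolding has_degree_def
  proof (intro conjI allI impI)
    show "Poly_Mapping.keys (Poly_Mapping.single (i, k) (1::nat)) \<subseteq> (SIGMA i:{..<q}. {..<r i})"
      using assms k by auto
    fix j assume "j < q"
    have "(\<Sum>l<r j. Poly_Mapping.lookup (Poly_Mapping.single (i, k) (1::nat)) (j, l)) =
        (\<Sum>l<r j. if l = k then (if j = i then 1 else 0) else 0)"
      by (rule sum.cong) (auto simp: lookup_single when_def)
    then show "(\<Sum>l<r j. Poly_Mapping.lookup (Poly_Mapping.single (i, k) (1::nat)) (j, l)) = ((\<lambda>_. 0)(i := 1)) j"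
      using k r[OF assms(1)] by auto
  qed
  then show "Poly_Mapping.single (Poly_Mapping.single (i, k) 1) (coord scale (e i) v k) \<in> homogeneous q r ((\<lambda>_. 0)(i := 1))"
    unfolding homogeneous_def by (auto split: if_splits)
qed

lemma homogeneous_cong:
  assumes "\<And>i. i < q \<Longrightarrow> m i = n i"
  shows "homogeneous q r m = homogeneous q r n"
proof -
  have "has_degree q r m \<alpha> = has_degree q r n \<alpha>" for \<alpha> unfolding has_degree_def using assms by auto
  then show ?thesis unfolding homogeneous_def by simp
qed

lemma multi_power_homogeneous:
  fixes scale :: "'a::comm_ring_1 \<Rightarrow> 'b::ab_group_add \<Rightarrow> 'b"
  assumes r: "\<And>i. i < q \<Longrightarrow> r i = length (e i)"
  shows "multi_power scale e q M n \<subseteq> homogeneous q r n"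
proof -
  have pw: "sym_power_image scale e j (n j) (M j) \<subseteq> homogeneous q r ((\<lambda>_. 0)(j := n j))" if j: "j < q" for j
    unfolding sym_power_image_def
  proof (rule sym_module.span_minimal[OF _ subspace_homogeneous], clarify)
    fix v
    have "(\<Prod>k<n j. lin_form scale e j (v k)) \<in> homogeneous q r (\<lambda>i. \<Sum>k<n j. ((\<lambda>_. 0)(j := 1)) i)"
      by (rule homogeneous_prod[OF finite_lessThan lin_form_homogeneous[OF j]]) (rule r)
    moreover have "(\<lambda>i. \<Sum>k<n j. ((\<lambda>_. 0)(j := 1)) i) = (\<lambda>_. 0)(j := n j)" by auto
    ultimately show "(\<Prod>k<n j. lin_form scale e j (v k)) \<in> homogeneous q r ((\<lambda>_. 0)(j := n j))"
      by (simp only:)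
  qed
  show ?thesis
    unfolding multi_power_def sym_prod_def
  proof (rule sym_module.span_minimal[OF _ subspace_homogeneous], clarify)
    fix u assume u: "\<forall>j\<in>{..<q}. u j \<in> sym_power_image scale e j (n j) (M j)"
    have A: "(\<Prod>j<q. u j) \<in> homogeneous q r (\<lambda>i. \<Sum>j<q. ((\<lambda>_. 0)(j := n j)) i)"
    proof (rule homogeneous_prod[OF finite_lessThan])
      fix j assume "j \<in> {..<q}"
      then show "u j \<in> homogeneous q r ((\<lambda>_. 0)(j := n j))" using u pw[of j] by blast
    qed
    have "(\<Sum>j<q. ((\<lambda>_. 0)(j := n j)) i) = n i" if "i < q" for i
    proof -
      have "(\<Sum>j<q. ((\<lambda>_. 0)(j := n j)) i) = (\<Sum>j<q. if j = i then n i else 0)" by (rule sum.cong) auto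
      then show ?thesis using that by simp
    qed
    from homogeneous_cong[of q "\<lambda>i. \<Sum>j<q. ((\<lambda>_. 0)(j := n j)) i" n r, OF this]
    have "homogeneous q r (\<lambda>i. \<Sum>j<q. ((\<lambda>_. 0)(j := n j)) i) = (homogeneous q r n :: 'a sym_alg set)" .
    then show "(\<Prod>j<q. u j) \<in> homogeneous q r n" using A by (rule subst)
  qed
qed

definition hom_part :: "nat \<Rightarrow> (nat \<Rightarrow> nat) \<Rightarrow> (nat \<Rightarrow> nat) \<Rightarrow> 'a::comm_ring_1 sym_alg \<Rightarrow> 'a sym_alg" where
  "hom_part q r n p = (\<Sum>\<alpha>\<in>{\<alpha> \<in> Poly_Mapping.keys p. has_degree q r n \<alpha>}.
     Poly_Mapping.single \<alpha> (Poly_Mapping.lookup p \<alpha>))"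

lemma lookup_hom_part:
  "Poly_Mapping.lookup (hom_part q r n p) \<beta> = (if has_degree q r n \<beta> then Poly_Mapping.lookup p \<beta> else 0)"
proof -
  have "Poly_Mapping.lookup (hom_part q r n p) \<beta> =
      (\<Sum>\<alpha>\<in>{\<alpha> \<in> Poly_Mapping.keys p. has_degree q r n \<alpha>}. if \<alpha> = \<beta> then Poly_Mapping.lookup p \<beta> else 0)"
    unfolding hom_part_def lookup_sum by (rule sum.cong) (auto simp: lookup_single when_def)
  then show ?thesis by (auto simp: in_keys_iff)
qed

lemma hom_part_add: "hom_part q r n (x + y) = hom_part q r n x + hom_part q r n y"
  by (rule poly_mapping_eqI) (simp add: lookup_hom_part lookup_add)

lemma hom_part_scale: "hom_part q r n (sym_scale c x) = sym_scale c (hom_part q r n x)"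
  by (rule poly_mapping_eqI) (simp add: lookup_hom_part lookup_sym_scale)

lemma hom_part_zero: "hom_part q r n 0 = 0"
  by (rule poly_mapping_eqI) (simp add: lookup_hom_part)

lemma hom_part_same: "x \<in> homogeneous q r n \<Longrightarrow> hom_part q r n x = x"
  by (rule poly_mapping_eqI) (auto simp: lookup_hom_part homogeneous_def in_keys_iff)

lemma hom_part_other:
  assumes "x \<in> homogeneous q r m" "i < q" "m i \<noteq> n i"
  shows "hom_part q r n x = 0"
proof (rule poly_mapping_eqI)
  fix \<beta>
  have "Poly_Mapping.lookup x \<beta> = 0" if d: "has_degree q r n \<beta>"
  proof (rule ccontr)
    assume "Poly_Mapping.lookup x \<beta> \<noteq> 0"
    then have "has_degree q r m \<beta>" using assms(1) unfolding homogeneous_def by (simp add: in_keys_iff)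
    from has_degree_unique[OF this d assms(2)] show False using assms(3) by simp
  qed
  then show "Poly_Mapping.lookup (hom_part q r n x) \<beta> = Poly_Mapping.lookup 0 \<beta>"
    by (simp add: lookup_hom_part)
qed

section \<open>Growth of the fiber\<close>

lemma power_mult_span:
  assumes X: "is_ideal X"
  shows "power_mult J t X \<subseteq> ideal_generated {a * b | a b. a \<in> ideal_power J t \<and> b \<in> X}"
proof (induction t)
  case 0
  have "1 * b \<in> ideal_generated {a * b | a b. a \<in> ideal_power J 0 \<and> b \<in> X}" if "b \<in> X" for b
    by (intro ring_module.span_base CollectI exI[of _ 1] exI[of _ b] conjI) (use that in auto)
  then show ?case by auto
next
  case (Suc t)
  let ?G = "ideal_generated {a * b | a b. a \<in> ideal_power J (Suc t) \<and> b \<in> X}"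
  show ?case
    unfolding power_mult.simps(2)[of J t X]
  proof (rule ring_module.ideal_mult_le[OF ring_module.subspace_span])
    fix c x assume c: "c \<in> J" and x: "x \<in> power_mult J t X"
    have "ideal_generated {a * b | a b. a \<in> ideal_power J t \<and> b \<in> X} \<subseteq> {y. c * y \<in> ?G}"
    proof (rule ring_module.span_minimal[OF _ is_ideal_colon(2)[OF ring_module.subspace_span]], clarify)
      fix a b assume ab: "a \<in> ideal_power J t" "b \<in> X"
      have "(c * a) * b \<in> ?G"
        using ideal_power_base[OF c ab(1)] ab(2) by (intro ring_module.span_base) blast
      then show "c * (a * b) \<in> ?G" by (simp add: mult.assoc)
    qed
    then show "c * x \<in> ?G" using x Suc by blast
  qed
qed

lemma ideal_power_mono:
  assumes "J \<subseteq> K"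
  shows "ideal_power J n \<subseteq> ideal_power K n"
proof (induction n)
  case (Suc n)
  show ?case unfolding power_mult.simps by (rule ring_module.ideal_mult_mono[OF assms Suc])
qed simp

lemma sym_scale_single: "sym_scale c (Poly_Mapping.single \<alpha> x) = Poly_Mapping.single \<alpha> (c * x)"
  by (simp add: sym_scale_def mult_single)

lemma is_ideal_single:
  assumes "module.subspace sym_scale N"
  shows "is_ideal {c. Poly_Mapping.single \<alpha> c \<in> N}"
  using sym_module.is_ideal_into[OF assms, of "Poly_Mapping.single \<alpha> 1"] by (simp add: sym_scale_single)

text \<open>In each block the last exponent is determined by the degree \<open>n\<close> of the
  block; the other \<open>r i - 1\<close> exponents range over at most n + 1 values each.\<close>

lemma degree_monomials_card:
  assumes r: "\<And>i. i < q \<Longrightarrow> r i \<ge> 1"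
  shows "finite {\<alpha>. has_degree q r (\<lambda>_. n) \<alpha>}"
    and "card {\<alpha>. has_degree q r (\<lambda>_. n) \<alpha>} \<le> (n + 1) ^ (\<Sum>i<q. r i - 1)"
proof -
  let ?M = "{\<alpha>. has_degree q r (\<lambda>_. n) \<alpha>}"
  let ?V = "SIGMA i:{..<q}. {..<r i - 1}"
  let ?f = "\<lambda>\<alpha> :: (nat \<times> nat) \<Rightarrow>\<^sub>0 nat. restrict (Poly_Mapping.lookup \<alpha>) ?V"
  have inj: "inj_on ?f ?M"
  proof (rule inj_onI)
    fix \<alpha> \<beta> assume ab: "\<alpha> \<in> ?M" "\<beta> \<in> ?M" "?f \<alpha> = ?f \<beta>"
    have lt: "Poly_Mapping.lookup \<alpha> (i, k) = Poly_Mapping.lookup \<beta> (i, k)" if "i < q" "k < r i - 1" for i k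
      using fun_cong[OF ab(3), of "(i, k)"] that by simp
    show "\<alpha> = \<beta>"
    proof (rule poly_mapping_eqI)
      fix x :: "nat \<times> nat"
      obtain i k where x: "x = (i, k)" by (cases x)
      show "Poly_Mapping.lookup \<alpha> x = Poly_Mapping.lookup \<beta> x"
      proof (cases "i < q \<and> k < r i")
        case False
        then have "x \<notin> Poly_Mapping.keys \<alpha>" "x \<notin> Poly_Mapping.keys \<beta>"
          using ab(1,2) unfolding has_degree_def x by auto
        then show ?thesis by (simp add: in_keys_iff)
      next
        case True
        show ?thesis
        proof (cases "k < r i - 1")
          case True
          then show ?thesis using lt \<open>i < q \<and> k < r i\<close> x by simp
        next
          case False
          then have k: "r i = Suc k" using True by arith
          have "(\<Sum>l<k. Poly_Mapping.lookup \<alpha> (i, l)) = (\<Sum>l<k. Poly_Mapping.lookup \<beta> (i, l))"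
            using lt True k by (intro sum.cong) auto
          moreover have "(\<Sum>l<Suc k. Poly_Mapping.lookup \<alpha> (i, l)) = n" "(\<Sum>l<Suc k. Poly_Mapping.lookup \<beta> (i, l)) = n"
            using ab(1,2) True k unfolding has_degree_def by auto
          ultimately show ?thesis unfolding x by simp
        qed
      qed
    qed
  qed
  have im: "?f ` ?M \<subseteq> ?V \<rightarrow>\<^sub>E {..n}"
  proof
    fix g assume "g \<in> ?f ` ?M"
    then obtain \<alpha> where a: "g = ?f \<alpha>" "has_degree q r (\<lambda>_. n) \<alpha>" by blast
    have "Poly_Mapping.lookup \<alpha> (i, k) \<le> n" if ik: "i < q" "k < r i - 1" for i k
    proof -
      have "k < r i" using ik(2) by simp
      then have "Poly_Mapping.lookup \<alpha> (i, k) \<le> (\<Sum>l<r i. Poly_Mapping.lookup \<alpha> (i, l))"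
        by (intro member_le_sum) auto
      then show ?thesis using a(2) ik(1) unfolding has_degree_def by simp
    qed
    then show "g \<in> ?V \<rightarrow>\<^sub>E {..n}" unfolding a(1) by auto
  qed
  have fV: "finite ?V" by auto
  have finE: "finite (?V \<rightarrow>\<^sub>E {..n})" by (rule finite_PiE[OF fV]) auto
  show "finite ?M" using finite_imageD[OF finite_subset[OF im finE] inj] .
  have "card ?M = card (?f ` ?M)" using card_image[OF inj] by simp
  also have "\<dots> \<le> card (?V \<rightarrow>\<^sub>E {..n})" by (rule card_mono[OF finE im])
  also have "\<dots> = (n + 1) ^ card ?V" using fV by (simp add: card_PiE)
  also have "card ?V = (\<Sum>i<q. r i - 1)" by simp
  finally show "card ?M \<le> (n + 1) ^ (\<Sum>i<q. r i - 1)" .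
qed

text \<open>J^t times the component of multidegree \<open>n\<close>: a filtration of this component
  by powers of \<open>J\<close>.\<close>

definition coeff_power ::
    "nat \<Rightarrow> (nat \<Rightarrow> nat) \<Rightarrow> (nat \<Rightarrow> nat) \<Rightarrow> 'a::comm_ring_1 set \<Rightarrow> nat \<Rightarrow> 'a sym_alg set" where
  "coeff_power q r n J t = {p \<in> homogeneous q r n. \<forall>\<alpha>. Poly_Mapping.lookup p \<alpha> \<in> ideal_power J t}"

lemma subspace_coeff_power:
  fixes J :: "'a::comm_ring_1 set"
  shows "module.subspace sym_scale (coeff_power q r n J t)"
  unfolding sym_module.subspace_def
proof (intro conjI ballI allI)
  show "0 \<in> coeff_power q r n J t"
    unfolding coeff_power_def
    by (simp add: sym_module.subspace_0[OF subspace_homogeneous] ring_module.subspace_0[OF is_ideal_power])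
next
  fix x y :: "'a sym_alg" assume xy: "x \<in> coeff_power q r n J t" "y \<in> coeff_power q r n J t"
  have "x + y \<in> homogeneous q r n"
    using xy sym_module.subspace_add[OF subspace_homogeneous, of x q r n y] by (simp add: coeff_power_def)
  moreover have "Poly_Mapping.lookup (x + y) \<alpha> \<in> ideal_power J t" for \<alpha>
    unfolding lookup_add by (rule ring_module.subspace_add[OF is_ideal_power]) (use xy in \<open>simp_all add: coeff_power_def\<close>)
  ultimately show "x + y \<in> coeff_power q r n J t" by (simp add: coeff_power_def)
next
  fix c and x :: "'a sym_alg" assume x: "x \<in> coeff_power q r n J t"
  have "sym_scale c x \<in> homogeneous q r n"
    using x sym_module.subspace_scale[OF subspace_homogeneous, of x q r n c] by (simp add: coeff_power_def)
  moreover have "Poly_Mapping.lookup (sym_scale c x) \<alpha> \<in> ideal_power J t" for \<alpha>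
    unfolding lookup_sym_scale by (rule ring_module.subspace_scale[OF is_ideal_power]) (use x in \<open>simp add: coeff_power_def\<close>)
  ultimately show "sym_scale c x \<in> coeff_power q r n J t" by (simp add: coeff_power_def)
qed

lemma coeff_power_antimono: "s \<le> t \<Longrightarrow> coeff_power q r n J t \<subseteq> coeff_power q r n J s"
  unfolding coeff_power_def using ideal_power_antimono[of s t J] by blast

lemma coeff_power_0: "coeff_power q r n J 0 = homogeneous q r n"
  unfolding coeff_power_def by simp

lemma coeff_power_le:
  assumes N: "module.subspace sym_scale N"
    and "\<And>\<alpha> c. has_degree q r n \<alpha> \<Longrightarrow> c \<in> ideal_power J t \<Longrightarrow> Poly_Mapping.single \<alpha> c \<in> N"
  shows "coeff_power q r n J t \<subseteq> N"
proof
  fix p assume p: "p \<in> coeff_power q r n J t"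
  have "(\<Sum>\<alpha>\<in>Poly_Mapping.keys p. Poly_Mapping.single \<alpha> (Poly_Mapping.lookup p \<alpha>)) \<in> N"
    by (rule sym_module.subspace_sum[OF N], rule assms(2))
      (use p in \<open>auto simp: coeff_power_def homogeneous_def\<close>)
  then show "p \<in> N" using sym_alg_decomp[OF finite_keys order_refl, of p] by simp
qed

lemma single_in_coeff_power:
  assumes "has_degree q r n \<alpha>" "c \<in> ideal_power J t"
  shows "Poly_Mapping.single \<alpha> c \<in> coeff_power q r n J t"
proof -
  have "Poly_Mapping.lookup (Poly_Mapping.single \<alpha> c) \<beta> \<in> ideal_power J t" for \<beta>
    using assms(2) ring_module.subspace_0[OF is_ideal_power] by (auto simp: lookup_single when_def)
  then show ?thesis
    using assms(1) unfolding coeff_power_def homogeneous_def by (auto split: if_splits)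
qed

text \<open>Each layer is generated by products of a monomial in the variables with a monomial of
  degree \<open>t\<close> in the generators of \<open>J\<close>, and \<open>J\<close> carries these
  into the next layer.\<close>

lemma colength_coeff_power_step:
  fixes a :: "nat \<Rightarrow> 'a::comm_ring_1" and s :: nat
  defines "J \<equiv> ideal_generated (a ` {..<s})"
  assumes fin: "finite {\<alpha>. has_degree q r n \<alpha>}"
  shows "colength sym_scale (coeff_power q r n J t) (coeff_power q r n J (Suc t)) \<le>
    enat (card {\<alpha>. has_degree q r n \<alpha>} * card (exponents s t)) * colength (*) UNIV J"
proof -
  let ?Mon = "{\<alpha>. has_degree q r n \<alpha>}"
  let ?C = "coeff_power q r n J"
  define T where "T = (\<lambda>(\<alpha>, \<beta>). Poly_Mapping.single \<alpha> (ring_monomial a s \<beta>)) ` (?Mon \<times> exponents s t)"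
  have fT: "finite T" unfolding T_def using fin finite_exponents by blast
  have iJ: "is_ideal J" unfolding J_def by (rule ring_module.subspace_span)
  have aJ: "a ` {..<s} \<subseteq> J" unfolding J_def by (rule ring_module.span_superset)
  have "?C t \<subseteq> sym_span T"
  proof (rule coeff_power_le[OF sym_module.subspace_span])
    fix \<alpha> c assume \<alpha>: "has_degree q r n \<alpha>" and c: "c \<in> ideal_power J t"
    have "ring_monomial a s ` exponents s t \<subseteq> {c. Poly_Mapping.single \<alpha> c \<in> sym_span T}"
    proof (rule image_subsetI, rule CollectI, rule sym_module.span_base)
      fix \<beta> assume "\<beta> \<in> exponents s t"
      then show "Poly_Mapping.single \<alpha> (ring_monomial a s \<beta>) \<in> T" unfolding T_def using \<alpha> by force
    qed
    then have "ideal_generated (ring_monomial a s ` exponents s t) \<subseteq> {c. Poly_Mapping.single \<alpha> c \<in> sym_span T}"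
      by (rule ring_module.span_minimal[OF _ is_ideal_single[OF sym_module.subspace_span]])
    then show "Poly_Mapping.single \<alpha> c \<in> sym_span T"
      using c ideal_power_generated[of a s t] unfolding J_def by blast
  qed
  then have "?C t \<subseteq> sym_span (?C (Suc t) \<union> T)" using sym_module.span_mono[of T "?C (Suc t) \<union> T"] by blast
  then have "colength sym_scale (?C t) (?C (Suc t)) \<le> colength sym_scale (sym_span (?C (Suc t) \<union> T)) (?C (Suc t))"
    by (rule sym_module.colength_mono[OF order_refl])
  also have "\<dots> \<le> enat (card T) * colength (*) UNIV J"
  proof (rule sym_module.colength_span_le[OF subspace_coeff_power fT iJ])
    fix c \<tau> assume c: "c \<in> J" and "\<tau> \<in> T"
    then obtain \<alpha> \<beta> where t: "\<tau> = Poly_Mapping.single \<alpha> (ring_monomial a s \<beta>)" "has_degree q r n \<alpha>" "\<beta> \<in> exponents s t"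
      unfolding T_def by auto
    have "c * ring_monomial a s \<beta> \<in> ideal_power J (Suc t)"
      by (rule ideal_power_base[OF c ring_monomial_in_power[OF aJ t(3)]])
    then show "sym_scale c \<tau> \<in> ?C (Suc t)" unfolding t(1) sym_scale_single by (rule single_in_coeff_power[OF t(2)])
  qed
  also have "\<dots> \<le> enat (card ?Mon * card (exponents s t)) * colength (*) UNIV J"
  proof (rule mult_right_mono)
    have "card T \<le> card (?Mon \<times> exponents s t)" unfolding T_def by (rule card_image_le) (use fin finite_exponents in blast)
    then show "enat (card T) \<le> enat (card ?Mon * card (exponents s t))" by (simp add: card_cartesian_product)
  qed simp
  finally show ?thesis .
qed

lemma colength_coeff_power:
  fixes a :: "nat \<Rightarrow> 'a::comm_ring_1" and s :: nat
  defines "J \<equiv> ideal_generated (a ` {..<s})"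
  assumes fin: "finite {\<alpha>. has_degree q r n \<alpha>}" and l: "colength (*) UNIV J = enat l"
  shows "colength sym_scale (coeff_power q r n J t) (coeff_power q r n J (t + k)) \<le>
    enat (\<Sum>j<k. card {\<alpha>. has_degree q r n \<alpha>} * card (exponents s (t + j)) * l)"
proof (induction k)
  case 0
  then show ?case by (simp add: sym_module.colength_self zero_enat_def)
next
  case (Suc k)
  let ?C = "coeff_power q r n J"
  have "colength sym_scale (?C t) (?C (t + Suc k)) =
      colength sym_scale (?C t) (?C (t + k)) + colength sym_scale (?C (t + k)) (?C (t + Suc k))"
    by (rule sym_module.colength_additive[OF subspace_coeff_power subspace_coeff_power
        coeff_power_antimono coeff_power_antimono subspace_coeff_power]) simp_all
  also have "\<dots> \<le> enat (\<Sum>j<k. card {\<alpha>. has_degree q r n \<alpha>} * card (exponents s (t + j)) * l) +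
      enat (card {\<alpha>. has_degree q r n \<alpha>} * card (exponents s (t + k))) * colength (*) UNIV J"
    by (rule add_mono[OF Suc.IH]) (use colength_coeff_power_step[OF fin, of a s "t + k"] in \<open>simp add: J_def\<close>)
  finally show ?case unfolding l by simp
qed

context finite_colength_family
begin

abbreviation "rk i \<equiv> length (e i)"

lemma common_power: "\<exists>c. \<forall>i<q. ideal_mult scale (ideal_power \<mm> c) (F i) \<subseteq> M i"
proof -
  have "\<exists>c. \<forall>i<t. ideal_mult scale (ideal_power \<mm> c) (F i) \<subseteq> M i" if "t \<le> q" for t
    using that
  proof (induction t)
    case (Suc t)
    then obtain c where c: "\<forall>i<t. ideal_mult scale (ideal_power \<mm> c) (F i) \<subseteq> M i" by auto
    have t: "t < q" using Suc.prems by simp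
    obtain c' where c': "ideal_mult scale (ideal_power \<mm> c') (F t) \<subseteq> M t"
      using finite_colength_contains_power[OF free[OF t] subspace_M[OF t] M_le_F[OF t] colength_M[OF t]] by blast
    have "ideal_mult scale (ideal_power \<mm> (max c c')) (F i) \<subseteq> M i" if i: "i < Suc t" for i
    proof (cases "i = t")
      case True
      have "ideal_mult scale (ideal_power \<mm> (max c c')) (F i) \<subseteq> ideal_mult scale (ideal_power \<mm> c') (F i)"
        by (rule ideal_mult_mono[OF ideal_power_antimono order_refl]) simp
      then show ?thesis using c' True by blast
    next
      case False
      have "ideal_mult scale (ideal_power \<mm> (max c c')) (F i) \<subseteq> ideal_mult scale (ideal_power \<mm> c) (F i)"
        by (rule ideal_mult_mono[OF ideal_power_antimono order_refl]) simp
      moreover have "ideal_mult scale (ideal_power \<mm> c) (F i) \<subseteq> M i" using c i False by simp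
      ultimately show ?thesis by blast
    qed
    then show ?case by blast
  qed simp
  then show ?thesis by blast
qed

text \<open>The number of variables in a monomial of multidegree \<open>n\<close> is the sum of the
  \<open>n i\<close>. Each variable becomes the linear form of an element of \<open>M i\<close> at
  the cost of a factor from \<open>\<mm>\<close>^c, which accounts for the exponent.\<close>

lemma single_in_multi_power:
  assumes c: "\<forall>i<q. ideal_mult scale (ideal_power \<mm> c) (F i) \<subseteq> M i"
  shows "has_degree q rk n \<alpha> \<Longrightarrow> b \<in> ideal_power \<mm> (c * (\<Sum>i<q. n i)) \<Longrightarrow> Poly_Mapping.single \<alpha> b \<in> MP n"
proof (induction n arbitrary: \<alpha> b rule: multi_index_induct[of q])
  case (zero n)
  have "Poly_Mapping.lookup \<alpha> (i, k) = 0" for i k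
  proof (cases "i < q \<and> k < rk i")
    case True
    then have "(\<Sum>k<rk i. Poly_Mapping.lookup \<alpha> (i, k)) = 0" using zero unfolding has_degree_def by auto
    then show ?thesis using True by simp
  next
    case False
    then have "(i, k) \<notin> Poly_Mapping.keys \<alpha>" using zero.prems(1) unfolding has_degree_def by auto
    then show ?thesis by (simp add: in_keys_iff)
  qed
  then have "\<alpha> = 0" by (intro poly_mapping_eqI) auto
  moreover have "1 \<in> MP n"
    using one_in_multi_power[of scale e q M] multi_power_cong[of q n "\<lambda>_. 0" scale e M] zero.hyps by simp
  then have "sym_scale b 1 \<in> MP n" by (rule sym_module.subspace_scale[OF subspace_multi_power])
  ultimately show ?case by (simp add: sym_scale_def)
next
  case (Suc n i)
  let ?n = "n(i := Suc (n i))"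
  interpret fm: free_module scale "e i" "F i" by (rule free[OF Suc.hyps])
  have "(\<Sum>k<rk i. Poly_Mapping.lookup \<alpha> (i, k)) = Suc (n i)"
    using Suc.prems(1) Suc.hyps unfolding has_degree_def by auto
  then obtain k where k: "k < rk i" "Poly_Mapping.lookup \<alpha> (i, k) \<noteq> 0"
    by (metis sum.neutral lessThan_iff nat.distinct(1))
  define \<sigma> where "\<sigma> = Poly_Mapping.single (i, k) (1 :: nat)"
  define \<beta> where "\<beta> = \<alpha> - \<sigma>"
  have lb: "Poly_Mapping.lookup \<beta> x = Poly_Mapping.lookup \<alpha> x - (if x = (i, k) then 1 else 0)" for x
    unfolding \<beta>_def \<sigma>_def by (simp add: lookup_minus lookup_single when_def)
  have \<alpha>: "\<alpha> = \<sigma> + \<beta>"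
    by (rule poly_mapping_eqI) (use k in \<open>auto simp: lookup_add lb \<sigma>_def lookup_single when_def\<close>)
  have deg: "has_degree q rk n \<beta>"
    unfolding has_degree_def
  proof (intro conjI allI impI)
    have "Poly_Mapping.keys \<beta> \<subseteq> Poly_Mapping.keys \<alpha>" by (auto simp: in_keys_iff lb)
    then show "Poly_Mapping.keys \<beta> \<subseteq> (SIGMA i:{..<q}. {..<rk i})"
      using Suc.prems(1) unfolding has_degree_def by blast
    fix j assume j: "j < q"
    have "(\<Sum>l<rk j. Poly_Mapping.lookup \<alpha> (j, l)) =
        (\<Sum>l<rk j. Poly_Mapping.lookup \<sigma> (j, l)) + (\<Sum>l<rk j. Poly_Mapping.lookup \<beta> (j, l))"
      unfolding \<alpha> by (simp add: lookup_add sum.distrib)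
    moreover have "(\<Sum>l<rk j. Poly_Mapping.lookup \<sigma> (j, l)) = (\<Sum>l<rk j. if l = k then (if j = i then 1 else 0) else 0)"
      by (rule sum.cong) (auto simp: \<sigma>_def lookup_single when_def)
    then have "(\<Sum>l<rk j. Poly_Mapping.lookup \<sigma> (j, l)) = (if j = i then 1 else 0)" using k(1) by auto
    moreover have "(\<Sum>l<rk j. Poly_Mapping.lookup \<alpha> (j, l)) = ?n j"
      using Suc.prems(1) j unfolding has_degree_def by blast
    ultimately show "(\<Sum>l<rk j. Poly_Mapping.lookup \<beta> (j, l)) = n j" by (simp split: if_splits)
  qed
  have sum: "(\<Sum>j<q. ?n j) = Suc (\<Sum>j<q. n j)"
  proof -
    have "(\<Sum>j<q. ?n j) = (\<Sum>j<q. n j + (if j = i then 1 else 0))" by (rule sum.cong) auto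
    then show ?thesis using Suc.hyps by (simp add: sum.distrib)
  qed
  let ?s = "c * (\<Sum>j<q. n j)"
  have "b \<in> power_mult \<mm> c (ideal_power \<mm> ?s)"
    using Suc.prems(2) unfolding sum power_mult_add[symmetric] by simp
  then have b: "b \<in> ideal_generated {x * y | x y. x \<in> ideal_power \<mm> c \<and> y \<in> ideal_power \<mm> ?s}"
    using power_mult_span[OF is_ideal_power] by blast
  have "{x * y | x y. x \<in> ideal_power \<mm> c \<and> y \<in> ideal_power \<mm> ?s} \<subseteq> {b. Poly_Mapping.single \<alpha> b \<in> MP ?n}"
  proof clarify
    fix x y assume x: "x \<in> ideal_power \<mm> c" and y: "y \<in> ideal_power \<mm> ?s"
    have "x *s (e i ! k) \<in> ideal_mult scale (ideal_power \<mm> c) (F i)"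
      by (rule ideal_mult_base[OF x fm.es_in_F[OF k(1)]])
    then have xe: "x *s (e i ! k) \<in> M i" using c Suc.hyps by blast
    have "lin_form scale e i (x *s (e i ! k)) = (\<Sum>l<rk i. if l = k then Poly_Mapping.single \<sigma> x else 0)"
      unfolding lin_form_coord \<sigma>_def
      by (rule sum.cong) (auto simp: fm.coord_scale[OF fm.es_in_F[OF k(1)]] fm.coord_basis[OF _ k(1)])
    then have lin: "lin_form scale e i (x *s (e i ! k)) = Poly_Mapping.single \<sigma> x" using k(1) by simp
    have "lin_form scale e i (x *s (e i ! k)) * Poly_Mapping.single \<beta> y \<in> MP ?n"
      by (rule lin_form_mult_multi_power[OF Suc.hyps xe Suc.IH[OF deg y]])
    then show "Poly_Mapping.single \<alpha> (x * y) \<in> MP ?n" unfolding lin \<alpha> by (simp add: mult_single)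
  qed
  then have "ideal_generated {x * y | x y. x \<in> ideal_power \<mm> c \<and> y \<in> ideal_power \<mm> ?s} \<subseteq>
      {b. Poly_Mapping.single \<alpha> b \<in> MP ?n}"
    by (rule ring_module.span_minimal[OF _ is_ideal_single[OF subspace_multi_power]])
  then show ?case using b by blast
qed

text \<open>Modulo \<open>x\<close> a power of the variables is saved: \<open>\<ell>(N/\<mm>N) \<le> \<ell>(N/(xN + J\<^sup>K S))\<close>, and by Artin-Rees
  the latter is at most the length of \<open>J\<^bsup>K-c\<^esup> S / J\<^sup>K S\<close>.\<close>
lemma colength_fiber_bound:
  fixes a :: "nat \<Rightarrow> 'a" and s :: nat
  defines "J \<equiv> ideal_generated (a ` {..<Suc s})"
  assumes J: "J \<subseteq> \<mm>" "ideal_power \<mm> N0 \<subseteq> J" and x: "x \<in> \<mm>" "\<And>y. x * y = 0 \<Longrightarrow> y = 0"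
  shows "\<exists>C. \<forall>n. colength sym_scale (MP (\<lambda>_. n)) (ideal_mult sym_scale \<mm> (MP (\<lambda>_. n))) \<le>
    enat (C * (n + 1) ^ ((\<Sum>i<q. rk i - 1) + s))"
proof -
  have iJ: "is_ideal J" unfolding J_def by (rule ring_module.subspace_span)
  obtain l where l: "colength (*) UNIV J = enat l" using colength_primary_finite[OF J(2)] .
  obtain c0 where c0: "\<forall>i<q. ideal_mult scale (ideal_power \<mm> c0) (F i) \<subseteq> M i" using common_power by blast
  obtain c1 where c1: "\<forall>n\<ge>c1. \<forall>y j k. x * y = j + k \<longrightarrow> j \<in> ideal_power J n \<longrightarrow> k \<in> {0} \<longrightarrow>
      (\<exists>z\<in>ideal_power J (n - c1). x * (y - z) \<in> {0})"
    using artin_rees_colon[OF noeth iJ ring_module.subspace_single_0, of x] by (elim exE)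
  have AR: "y \<in> ideal_power J (n - c1)" if n: "n \<ge> c1" and y: "x * y \<in> ideal_power J n" for n y
  proof -
    have "x * y = x * y + 0" by simp
    from c1[rule_format, OF n this y singletonI] obtain z where z: "z \<in> ideal_power J (n - c1)" "x * (y - z) = 0"
      by blast
    then have "y - z = 0" using x(2) by blast
    then show ?thesis using z(1) by simp
  qed
  \<comment> \<open>There are \<open>c1\<close> layers, each weighted with the length
    \<open>l\<close> of R modulo \<open>J\<close>; the last factor bounds the rate at which the
    exponents of \<open>J\<close> in these layers grow with \<open>n\<close>.\<close>
  define C where "C = c1 * l * (c0 * q + 1 + c1) ^ s"
  have "colength sym_scale (MP (\<lambda>_. n)) (ideal_mult sym_scale \<mm> (MP (\<lambda>_. n))) \<le>
      enat (C * (n + 1) ^ ((\<Sum>i<q. rk i - 1) + s))" for n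
  proof -
    let ?N = "MP (\<lambda>_. n)"
    let ?Z = "ideal_mult sym_scale \<mm> ?N"
    let ?C = "coeff_power q rk (\<lambda>_. n) J"
    let ?Mon = "{\<alpha>. has_degree q rk (\<lambda>_. n) \<alpha>}"
    \<comment> \<open>The power of \<open>\<mm>\<close> that puts every monomial of multidegree
      (n,...,n) into the piece; one further power puts it into \<open>\<mm>\<close> times the
      piece.\<close>
    define K where "K = c0 * (q * n)"
    have fin: "finite ?Mon" by (rule degree_monomials_card(1)) (use rank_pos in auto)
    have JK: "ideal_power J t \<subseteq> ideal_power \<mm> t" for t by (rule ideal_power_mono[OF J(1)])
    have sN: "sym_module.subspace ?N" by (rule subspace_multi_power)
    have sZ: "sym_module.subspace ?Z" by (rule sym_module.subspace_ideal_mult)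
    have ZN: "?Z \<subseteq> ?N" by (rule sym_module.ideal_mult_le_self[OF sN])
    have sing: "Poly_Mapping.single \<alpha> b \<in> ?N" if "has_degree q rk (\<lambda>_. n) \<alpha>" "b \<in> ideal_power \<mm> K" for \<alpha> b
      using single_in_multi_power[OF c0 that(1)] that(2) unfolding K_def by simp
    have CZ: "?C (K + 1) \<subseteq> ?Z"
    proof (rule coeff_power_le[OF sZ])
      fix \<alpha> b assume \<alpha>: "has_degree q rk (\<lambda>_. n) \<alpha>" and b: "b \<in> ideal_power J (K + 1)"
      have "ideal_mult (*) \<mm> (ideal_power \<mm> K) \<subseteq> {b. Poly_Mapping.single \<alpha> b \<in> ?Z}"
      proof (rule ring_module.ideal_mult_le[OF is_ideal_single[OF sZ]])
        fix c y assume "c \<in> \<mm>" "y \<in> ideal_power \<mm> K"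
        then have "sym_scale c (Poly_Mapping.single \<alpha> y) \<in> ?Z"
          using sing[OF \<alpha>] by (intro sym_module.ideal_mult_base) auto
        then show "c * y \<in> {b. Poly_Mapping.single \<alpha> b \<in> ?Z}" by (simp add: sym_scale_single)
      qed
      then show "Poly_Mapping.single \<alpha> b \<in> ?Z" using b JK[of "K + 1"] by auto
    qed
    \<comment> \<open>Taken \<open>c1\<close> layers deeper, so that \<open>sym_scale x y\<close> in
      this layer forces \<open>y\<close> into the layer \<open>K + 1\<close>.\<close>
    let ?U = "?C (K + 1 + c1)"
    have UC: "?U \<subseteq> ?C (K + 1)" by (rule coeff_power_antimono) simp
    have UZ: "?U \<subseteq> ?Z" using UC CZ by blast
    have NH: "?N \<subseteq> ?C 0" unfolding coeff_power_0 by (rule multi_power_homogeneous) simp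
    have pre: "{y \<in> ?N. sym_scale x y \<in> ?U} \<subseteq> ?C (K + 1)"
    proof clarify
      fix y assume y: "y \<in> ?N" "sym_scale x y \<in> ?U"
      have "Poly_Mapping.lookup y \<alpha> \<in> ideal_power J (K + 1 + c1 - c1)" for \<alpha>
        using y(2) unfolding coeff_power_def by (intro AR) (auto simp: lookup_sym_scale)
      then show "y \<in> ?C (K + 1)" using y(1) NH unfolding coeff_power_0 unfolding coeff_power_def by auto
    qed
    have hom: "module_hom sym_scale sym_scale (sym_scale x)"
      by (simp add: module_hom_def module_hom_axioms_def sym_module.module_axioms sym_module.scale_right_distrib
          mult.commute)
    have "colength sym_scale ?N (?C (K + 1)) \<le> colength sym_scale ?N {y \<in> ?N. sym_scale x y \<in> ?U}"
      by (rule sym_module.colength_mono[OF pre order_refl])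
    also have "\<dots> \<le> colength sym_scale ?Z ?U"
      by (rule colength_preimage_le[OF hom sN subspace_coeff_power _ UZ sZ])
        (use sym_module.ideal_mult_base[OF x(1)] in blast)
    finally have 1: "colength sym_scale ?N (?C (K + 1)) \<le> colength sym_scale ?Z ?U" .
    have 2: "colength sym_scale ?N ?U = colength sym_scale ?N ?Z + colength sym_scale ?Z ?U"
      by (rule sym_module.colength_additive[OF sZ subspace_coeff_power UZ ZN sN])
    have 3: "colength sym_scale ?N ?U =
        colength sym_scale ?N (?C (K + 1)) + colength sym_scale (?C (K + 1)) ?U"
      by (rule sym_module.colength_additive[OF subspace_coeff_power subspace_coeff_power UC _ sN]) (use CZ ZN in blast)
    have "colength sym_scale ?N (?C (K + 1)) \<le> colength sym_scale (?C 0) (?C (0 + (K + 1)))"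
      using NH by (intro sym_module.colength_mono) auto
    also have "\<dots> \<le> enat (\<Sum>j<K + 1. card ?Mon * card (exponents (Suc s) (0 + j)) * l)"
      unfolding J_def by (rule colength_coeff_power[OF fin l[unfolded J_def]])
    finally obtain k where k: "colength sym_scale ?N (?C (K + 1)) = enat k" by (rule enat_ile[THEN exE])
    \<comment> \<open>The length of \<open>?N\<close> over \<open>?U\<close> is computed through
      \<open>?Z\<close> and through the layer \<open>K + 1\<close>. As \<open>k\<close> is at most
      the length of \<open>?Z\<close> over \<open>?U\<close> and is finite, it can be
      cancelled.\<close>
    have "colength sym_scale ?N ?Z + enat k \<le> enat k + colength sym_scale (?C (K + 1)) ?U"
      using 1 2 3 k by (metis add_left_mono)
    then have "colength sym_scale ?N ?Z \<le> colength sym_scale (?C (K + 1)) ?U"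
      by (cases "colength sym_scale ?N ?Z"; cases "colength sym_scale (?C (K + 1)) ?U") simp_all
    also have "\<dots> \<le> enat (\<Sum>j<c1. card ?Mon * card (exponents (Suc s) (K + 1 + j)) * l)"
      unfolding J_def by (rule colength_coeff_power[OF fin l[unfolded J_def]])
    also have "\<dots> \<le> enat (C * (n + 1) ^ ((\<Sum>i<q. rk i - 1) + s))"
    proof -
      have "(\<Sum>j<c1. card ?Mon * card (exponents (Suc s) (K + 1 + j)) * l) \<le>
          (\<Sum>j<c1. (n + 1) ^ (\<Sum>i<q. rk i - 1) * ((c0 * q + 1 + c1) * (n + 1)) ^ s * l)"
      proof (intro sum_mono mult_right_mono mult_mono)
        show "card ?Mon \<le> (n + 1) ^ (\<Sum>i<q. rk i - 1)"
          by (rule degree_monomials_card(2)) (use rank_pos in auto)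
        fix j assume j: "j \<in> {..<c1}"
        have "card (exponents (Suc s) (K + 1 + j)) \<le> (K + 1 + j + 1) ^ s" using exponents_card by blast
        also have "\<dots> \<le> ((c0 * q + 1 + c1) * (n + 1)) ^ s"
        proof (rule power_mono)
          have "K + 1 + j + 1 \<le> c0 * q * n + 1 + c1" using j unfolding K_def by simp
          also have "\<dots> \<le> (c0 * q + 1 + c1) * (n + 1)" by (simp add: algebra_simps)
          finally show "K + 1 + j + 1 \<le> (c0 * q + 1 + c1) * (n + 1)" .
        qed simp
        finally show "card (exponents (Suc s) (K + 1 + j)) \<le> ((c0 * q + 1 + c1) * (n + 1)) ^ s" .
      qed auto
      also have "\<dots> = C * (n + 1) ^ ((\<Sum>i<q. rk i - 1) + s)"
        unfolding C_def power_add power_mult_distrib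
        by (simp only: sum_constant card_lessThan of_nat_id mult.assoc mult.commute mult.left_commute)
      finally show ?thesis by simp
    qed
    finally show ?thesis .
  qed
  then show ?thesis by blast
qed

end

section \<open>Filter-regular elements\<close>

definition ideal_colon_products :: "'c::comm_ring_1 set \<Rightarrow> 'c set \<Rightarrow> 'c set \<Rightarrow> nat \<Rightarrow> 'c set" where
  "ideal_colon_products A L X k = {y \<in> A. \<forall>s\<in>products X k. s * y \<in> L}"

text \<open>Modulo \<open>L\<close> no nonzero element of \<open>A\<close> is killed by all of
  \<open>X\<close>; equivalently, the colon of \<open>L\<close> by \<open>X\<close> is
  \<open>L\<close> itself.\<close>

definition saturated_in :: "'c::comm_ring_1 set \<Rightarrow> 'c set \<Rightarrow> 'c set \<Rightarrow> bool" where
  "saturated_in A X L \<longleftrightarrow> ideal_in A L \<and> (\<forall>y\<in>A. (\<forall>s\<in>X. s * y \<in> L) \<longrightarrow> y \<in> L)"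

lemma ideal_in_colon_products:
  assumes A: "is_subring A" and X: "X \<subseteq> A" and L: "ideal_in A L"
  shows "ideal_in A (ideal_colon_products A L X k)"
proof -
  have "products X k \<subseteq> A" by (rule products_subring[OF A X])
  show ?thesis
    unfolding ideal_in_def
  proof (intro conjI ballI)
    show "ideal_colon_products A L X k \<subseteq> A" unfolding ideal_colon_products_def by blast
    show "0 \<in> ideal_colon_products A L X k"
      unfolding ideal_colon_products_def using subring_zero[OF A] ideal_in_zero[OF L] by simp
  next
    fix x y assume "x \<in> ideal_colon_products A L X k" "y \<in> ideal_colon_products A L X k"
    then show "x + y \<in> ideal_colon_products A L X k"
      unfolding ideal_colon_products_def using subring_add[OF A] ideal_in_add[OF L] by (simp add: distrib_left)
  next
    fix a x assume "a \<in> A" "x \<in> ideal_colon_products A L X k"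
    then show "a * x \<in> ideal_colon_products A L X k"
      unfolding ideal_colon_products_def using subring_mult[OF A] ideal_in_mult[OF L] by (simp add: mult.left_commute[of _ a])
  qed
qed

lemma ideal_subset_colon_products:
  assumes A: "is_subring A" and X: "X \<subseteq> A" and L: "ideal_in A L"
  shows "L \<subseteq> ideal_colon_products A L X k"
  unfolding ideal_colon_products_def
  using products_subring[OF A X, of k] ideal_in_mult[OF L] ideal_in_sub[OF L] by blast

text \<open>The colons by growing powers of \<open>X\<close> ascend; once they are constant, a
  further colon by \<open>X\<close> changes nothing.\<close>

lemma saturation_exists:
  assumes N: "noetherian_subring A" and X: "X \<subseteq> A" and L: "ideal_in A L"
  shows "\<exists>k. saturated_in A X (ideal_colon_products A L X k)"
proof -
  let ?L = "ideal_colon_products A L X"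
  have A: "is_subring A" using N unfolding noetherian_subring_def by blast
  have "?L k \<subseteq> ?L (Suc k)" for k
  proof
    fix y assume y: "y \<in> ?L k"
    have "s * t * y \<in> L" if "s \<in> X" "t \<in> products X k" for s t
      using y that X ideal_in_mult[OF L, of s "t * y"] unfolding ideal_colon_products_def by (auto simp: mult.assoc)
    then show "y \<in> ?L (Suc k)" using y unfolding ideal_colon_products_def by auto
  qed
  from noetherian_subringD[of A ?L, OF N ideal_in_colon_products[OF A X L] this]
  obtain k where k: "\<forall>j\<ge>k. ?L j = ?L k" by (elim exE)
  then have eq: "?L (Suc k) = ?L k" by (meson le_Suc_eq order_refl)
  have "y \<in> ?L k" if y: "y \<in> A" "\<forall>s\<in>X. s * y \<in> ?L k" for y
  proof -
    have "s * t * y \<in> L" if "s \<in> X" "t \<in> products X k" for s t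
    proof -
      have "t * (s * y) \<in> L" using y(2) that unfolding ideal_colon_products_def by blast
      then show ?thesis by (simp add: ac_simps)
    qed
    then have "y \<in> ?L (Suc k)" using y(1) unfolding ideal_colon_products_def by auto
    then show ?thesis using eq by simp
  qed
  then show ?thesis
    unfolding saturated_in_def using ideal_in_colon_products[OF A X L] by blast
qed

lemma saturated_products:
  assumes "is_subring A" "X \<subseteq> A" "saturated_in A X L"
  shows "y \<in> A \<Longrightarrow> (\<And>s. s \<in> products X k \<Longrightarrow> s * y \<in> L) \<Longrightarrow> y \<in> L"
proof (induction k)
  case 0
  then show ?case using 0(2)[of 1] by simp
next
  case (Suc k)
  show ?case
  proof (rule Suc.IH[OF Suc.prems(1)])
    fix t assume t: "t \<in> products X k"
    have tA: "t * y \<in> A" using t products_subring[OF assms(1,2), of k] Suc.prems(1) subring_mult[OF assms(1)] by blast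
    have "s * (t * y) \<in> L" if "s \<in> X" for s
    proof -
      have "s * t \<in> products X (Suc k)" using that t by auto
      then have "(s * t) * y \<in> L" by (rule Suc.prems(2))
      then show ?thesis by (simp add: mult.assoc)
    qed
    then show "t * y \<in> L" using assms(3) tA unfolding saturated_in_def by blast
  qed
qed

locale finite_colength_family_inf = finite_colength_family \<mm> scale q e F M + noetherian_local_inf \<mm>
  for \<mm> :: "'a::comm_ring_1 set" and scale :: "'a \<Rightarrow> 'b::ab_group_add \<Rightarrow> 'b" (infixr "*s" 75)
    and q :: nat and e :: "nat \<Rightarrow> 'b list" and F M :: "nat \<Rightarrow> 'b set"
begin

abbreviation "irr \<equiv> MP (\<lambda>_. 1)"

definition quot_length :: "'a sym_alg set \<Rightarrow> (nat \<Rightarrow> nat) \<Rightarrow> enat" where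
  "quot_length L n = colength sym_scale (MP n) (MP n \<inter> L)"

lemma irr_subset: "irr \<subseteq> \<R>"
  by (rule multi_power_subset_rees)

text \<open>Outside finitely many primes not containing \<open>irr\<close>, elements are
  filter-regular. Such a prime cannot contain all linear forms of \<open>M i\<close>, since
  \<open>irr\<close> is spanned by their multiples; so some vector of \<open>M i\<close> avoids all
  these primes, and saturation upgrades filter-regularity to regularity modulo
  \<open>L\<close>.\<close>

lemma filter_regular_element:
  assumes L: "saturated_in \<R> irr L" and i: "i < q"
  obtains b where "b \<in> M i" "\<And>y. y \<in> \<R> \<Longrightarrow> lin_form scale e i b * y \<in> L \<Longrightarrow> y \<in> L"
proof -
  interpret fm: free_module scale "e i" "F i" by (rule free[OF i])
  have iL: "ideal_in \<R> L" using L unfolding saturated_in_def by blast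
  obtain Ps k where Ps: "finite Ps" "\<And>P. P \<in> Ps \<Longrightarrow> prime_in \<R> P \<and> \<not> irr \<subseteq> P"
    "\<And>b y s. b \<in> \<R> \<Longrightarrow> b \<notin> \<Union>Ps \<Longrightarrow> y \<in> \<R> \<Longrightarrow> b * y \<in> L \<Longrightarrow> s \<in> products irr k \<Longrightarrow> s * y \<in> L"
    using finitely_many_primes_cover_zero_divisors[OF noetherian_rees_algebra irr_subset iL] by metis
  let ?W = "\<lambda>P. {v \<in> F i. lin_form scale e i v \<in> P}"
  have "\<exists>b\<in>M i. \<forall>W\<in>?W ` Ps. b \<notin> W"
  proof (rule avoid_submodules[OF module_axioms finite_imageI[OF Ps(1), of ?W] subspace_M[OF i]])
    fix W assume "W \<in> ?W ` Ps"
    then obtain P where P: "P \<in> Ps" "W = ?W P" by blast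
    have pP: "prime_in \<R> P" "\<not> irr \<subseteq> P" using Ps(2)[OF P(1)] by auto
    have iP: "ideal_in \<R> P" using pP(1) unfolding prime_in_def by blast
    note sP = ideal_in_rees_subspace[OF iP]
    show "subspace W" unfolding P(2) by (rule fm.subspace_lin_form_vimage[of e i, OF refl sP])
    show "\<not> M i \<subseteq> W"
    proof
      assume "M i \<subseteq> W"
      let ?n = "(\<lambda>_. 1 :: nat)(i := 0)"
      have "(\<lambda>_. 1 :: nat) = ?n(i := Suc (?n i))" by auto
      then have "irr \<subseteq> sym_span {lin_form scale e i z * y | z y. z \<in> M i \<and> y \<in> MP ?n}"
        using multi_power_Suc[OF i, of scale e M ?n] by simp
      also have "\<dots> \<subseteq> P"
      proof (rule sym_module.span_minimal[OF _ sP], clarify)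
        fix z y assume "z \<in> M i" "y \<in> MP ?n"
        then have "lin_form scale e i z \<in> P" "y \<in> \<R>"
          using \<open>M i \<subseteq> W\<close> P(2) multi_power_subset_rees[of scale e q M ?n] by auto
        then show "lin_form scale e i z * y \<in> P" using ideal_in_mult[OF iP] by (simp add: mult.commute)
      qed
      finally show False using pP(2) by blast
    qed
  next
    fix v assume "v \<in> M i" "\<And>W. W \<in> ?W ` Ps \<Longrightarrow> v \<notin> W"
    then show ?thesis by blast
  qed
  then obtain b where b: "b \<in> M i" "\<forall>W\<in>?W ` Ps. b \<notin> W" by blast
  have bR: "lin_form scale e i b \<in> \<R>" by (rule lin_form_in_rees[OF i b(1)])
  have bP: "lin_form scale e i b \<notin> \<Union>Ps"
  proof
    assume "lin_form scale e i b \<in> \<Union>Ps"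
    then obtain P where P: "P \<in> Ps" "lin_form scale e i b \<in> P" by (rule UnionE)
    then have "b \<in> ?W P" using rev_subsetD[OF b(1) M_le_F[OF i]] by simp
    then show False using b(2) P(1) by simp
  qed
  have reg: "\<And>y. y \<in> \<R> \<Longrightarrow> lin_form scale e i b * y \<in> L \<Longrightarrow> y \<in> L"
  proof -
    fix y assume y: "y \<in> \<R>" "lin_form scale e i b * y \<in> L"
    show "y \<in> L" by (rule saturated_products[OF is_subring_rees_algebra irr_subset L y(1)]) (rule Ps(3)[OF bR bP y])
  qed
  show ?thesis by (rule that[OF b(1) reg])
qed

text \<open>Multiplication by the linear form of \<open>b\<close> embeds the piece of degree
  \<open>n\<close> modulo \<open>L\<close> into the piece with raised exponent modulo
  \<open>L\<close>, and its image dies on passing from \<open>L\<close> to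
  \<open>L'\<close>.\<close>

lemma quot_length_step:
  assumes L: "ideal_in \<R> L" and L': "ideal_in \<R> L'" "L \<subseteq> L'" "lin_form scale e i b \<in> L'"
    and i: "i < q" and b: "b \<in> M i" "\<And>y. y \<in> \<R> \<Longrightarrow> lin_form scale e i b * y \<in> L \<Longrightarrow> y \<in> L"
  shows "quot_length L' (n(i := Suc (n i))) + quot_length L n \<le> quot_length L (n(i := Suc (n i)))"
proof -
  let ?n = "n(i := Suc (n i))" and ?b = "lin_form scale e i b"
  note sL = ideal_in_rees_subspace[OF L] ideal_in_rees_subspace[OF L'(1)]
  note sM = subspace_multi_power[of scale e q M]
  note sI = sym_module.subspace_inter[OF sM sL(1)] sym_module.subspace_inter[OF sM sL(2)]
  have add: "quot_length L ?n = quot_length L' ?n + colength sym_scale (MP ?n \<inter> L') (MP ?n \<inter> L)"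
    unfolding quot_length_def
    by (rule sym_module.colength_additive[OF sI(2) sI(1) _ _ sM]) (use L'(2) in auto)
  have hom: "module_hom sym_scale sym_scale ((*) ?b)"
    by (simp add: module_hom_def module_hom_axioms_def sym_module.module_axioms distrib_left sym_scale_mult)
  have "{y \<in> MP n. ?b * y \<in> MP ?n \<inter> L} \<subseteq> MP n \<inter> L"
    using b(2) multi_power_subset_rees[of scale e q M n] by blast
  then have "quot_length L n \<le> colength sym_scale (MP n) {y \<in> MP n. ?b * y \<in> MP ?n \<inter> L}"
    unfolding quot_length_def by (rule sym_module.colength_mono) simp
  also have "\<dots> \<le> colength sym_scale (MP ?n \<inter> L') (MP ?n \<inter> L)"
  proof (rule colength_preimage_le[OF hom sM sI(1) _ _ sI(2)])
    show "(*) ?b ` MP n \<subseteq> MP ?n \<inter> L'"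
    proof (rule image_subsetI, rule IntI)
      fix y assume y: "y \<in> MP n"
      show "?b * y \<in> MP ?n" by (rule lin_form_mult_multi_power[OF i b(1) y])
      have "y * ?b \<in> L'" using ideal_in_mult[OF L'(1) _ L'(3)] y multi_power_subset_rees by blast
      then show "?b * y \<in> L'" by (simp add: mult.commute)
    qed
    show "MP ?n \<inter> L \<subseteq> MP ?n \<inter> L'" using L'(2) by blast
  qed
  finally show ?thesis unfolding add by (rule add_left_mono)
qed

text \<open>\<open>foldr\<close> adjoins the last entry first, in accordance with the induction from
  the right end in \<open>generic_reduction_or_growth\<close>.\<close>

abbreviation extend_ideal :: "'a sym_alg list \<Rightarrow> 'a sym_alg set \<Rightarrow> 'a sym_alg set" where
  "extend_ideal xs L \<equiv> foldr (\<lambda>x K. add_principal \<R> K x) xs L"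

lemma extend_ideal_mult:
  assumes s: "s \<in> \<R>" and L: "\<And>l. l \<in> L' \<Longrightarrow> s * l \<in> L"
  shows "y \<in> extend_ideal xs L' \<Longrightarrow> s * y \<in> extend_ideal xs L"
proof (induction xs arbitrary: y)
  case Nil
  then show ?case using L by simp
next
  case (Cons x xs)
  then obtain l c where lc: "y = l + c * x" "l \<in> extend_ideal xs L'" "c \<in> \<R>"
    unfolding foldr_Cons comp_def add_principal_def[of _ "extend_ideal xs L'"] by blast
  have "s * y = s * l + (s * c) * x" unfolding lc(1) by (simp add: distrib_left mult.assoc)
  moreover have "s * c \<in> \<R>" by (rule subring_mult[OF is_subring_rees_algebra s lc(3)])
  ultimately show ?case
    unfolding foldr_Cons comp_def add_principal_def[of _ "extend_ideal xs L"] using Cons.IH[OF lc(2)] by blast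
qed

lemma ideal_in_extend_ideal:
  assumes "ideal_in \<R> L" "set xs \<subseteq> \<R>"
  shows "ideal_in \<R> (extend_ideal xs L)"
  using assms(2)
proof (induction xs)
  case (Cons x xs)
  have "ideal_in \<R> (extend_ideal xs L)" "x \<in> \<R>" using Cons by auto
  from ideal_in_add_principal(1)[OF is_subring_rees_algebra this] show ?case by simp
qed (use assms(1) in simp)

text \<open>Elements of \<open>products irr k\<close> carry the colon ideal back into
  \<open>L\<close>, and the piece with exponents raised by \<open>k\<close> is spanned by their
  multiples. Saturating thus costs only a shift of the exponents.\<close>

lemma extend_ideal_desaturate:
  assumes L: "ideal_in \<R> L" and xs: "set xs \<subseteq> \<R>"
    and sub: "MP n \<subseteq> extend_ideal xs (ideal_colon_products \<R> L irr k)"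
  shows "MP (\<lambda>j. n j + k) \<subseteq> extend_ideal xs L"
proof -
  have "MP (\<lambda>j. n j + k) \<subseteq> sym_span {s * y | s y. s \<in> products irr k \<and> y \<in> MP n}" by (rule multi_power_products)
  also have "\<dots> \<subseteq> extend_ideal xs L"
  proof (rule sym_module.span_minimal[OF _ ideal_in_rees_subspace[OF ideal_in_extend_ideal[OF L xs]]], clarify)
    fix s y assume s: "s \<in> products irr k" and y: "y \<in> MP n"
    have sR: "s \<in> \<R>" using s products_subring[OF is_subring_rees_algebra irr_subset] by blast
    have "s * l \<in> L" if "l \<in> ideal_colon_products \<R> L irr k" for l
      using that s unfolding ideal_colon_products_def by blast
    from extend_ideal_mult[OF sR this] show "s * y \<in> extend_ideal xs L" using y sub by blast
  qed
  finally show ?thesis .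
qed

abbreviation lin_forms :: "(nat \<times> 'b) list \<Rightarrow> 'a sym_alg list" where
  "lin_forms bl \<equiv> map (\<lambda>(i, b). lin_form scale e i b) bl"

lemma lin_forms_in_rees:
  assumes "set (map fst bl) \<subseteq> {..<q}" "\<forall>(i, b)\<in>set bl. b \<in> M i"
  shows "set (lin_forms bl) \<subseteq> \<R>"
proof
  fix x assume "x \<in> set (lin_forms bl)"
  then obtain j c where jc: "(j, c) \<in> set bl" "x = lin_form scale e j c" by auto
  have "j < q" using assms(1) jc(1) by force
  moreover have "c \<in> M j" using assms(2) jc(1) by blast
  ultimately show "x \<in> \<R>" unfolding jc(2) by (rule lin_form_in_rees)
qed

text \<open>Pascal's rule in factor \<open>i\<close>, relaxed by monotonicity to match
  \<open>quot_length_step\<close>, where the new quotient is measured at the raised exponent and the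
  old one at the original exponent.\<close>

lemma binomial_prod_step:
  assumes i: "i < q"
  shows "(\<Prod>j<q. (n(i := Suc (n i))) j choose (c(i := Suc (c i))) j) \<le>
    (\<Prod>j<q. (n(i := Suc (n i))) j choose c j) + (\<Prod>j<q. n j choose (c(i := Suc (c i))) j)"
proof -
  have rem: "(\<Prod>j<q. f j) = f i * (\<Prod>j\<in>{..<q} - {i}. f j)" for f :: "nat \<Rightarrow> nat"
    using i by (simp add: prod.remove)
  let ?R = "\<Prod>j\<in>{..<q} - {i}. n j choose c j"
  have R: "(\<Prod>j\<in>{..<q} - {i}. f j) = ?R" if "\<And>j. j \<noteq> i \<Longrightarrow> f j = n j choose c j" for f
    by (rule prod.cong) (use that in auto)
  have 1: "(\<Prod>j<q. (n(i := Suc (n i))) j choose (c(i := Suc (c i))) j) = (Suc (n i) choose Suc (c i)) * ?R"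
    using rem[of "\<lambda>j. (n(i := Suc (n i))) j choose (c(i := Suc (c i))) j"]
      R[of "\<lambda>j. (n(i := Suc (n i))) j choose (c(i := Suc (c i))) j"] by simp
  have 2: "(\<Prod>j<q. (n(i := Suc (n i))) j choose c j) = (Suc (n i) choose c i) * ?R"
    using rem[of "\<lambda>j. (n(i := Suc (n i))) j choose c j"] R[of "\<lambda>j. (n(i := Suc (n i))) j choose c j"] by simp
  have 3: "(\<Prod>j<q. n j choose (c(i := Suc (c i))) j) = (n i choose Suc (c i)) * ?R"
    using rem[of "\<lambda>j. n j choose (c(i := Suc (c i))) j"] R[of "\<lambda>j. n j choose (c(i := Suc (c i))) j"] by simp
  have "n i choose c i \<le> Suc (n i) choose c i" by (cases "c i") auto
  then have "Suc (n i) choose Suc (c i) \<le> (Suc (n i) choose c i) + (n i choose Suc (c i))"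
    unfolding binomial_Suc_Suc by (rule add_right_mono)
  then have "(Suc (n i) choose Suc (c i)) * ?R \<le> ((Suc (n i) choose c i) + (n i choose Suc (c i))) * ?R"
    by (rule mult_right_mono) simp
  then show ?thesis unfolding 1 2 3 by (simp only: distrib_right)
qed

text \<open>Adjoining a filter-regular element bounds the quotient length of the new ideal by a first difference
  of the old one, so that the binomial lower bound follows by summation.\<close>
lemma generic_reduction_or_growth:
  assumes "set is \<subseteq> {..<q}"
  shows "saturated_in \<R> irr L \<Longrightarrow> \<exists>bl. map fst bl = is \<and> (\<forall>(i, b)\<in>set bl. b \<in> M i) \<and>
    ((\<exists>n. MP n \<subseteq> extend_ideal (lin_forms bl) L) \<or>
     (\<forall>n. enat (\<Prod>i<q. n i choose count_list is i) \<le> quot_length L n))"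
  using assms
proof (induction "is" arbitrary: L rule: rev_induct)
  case Nil
  show ?case
  proof (cases "\<exists>n. MP n \<subseteq> L")
    case True
    then show ?thesis by (intro exI[of _ "[]"]) auto
  next
    case False
    have iL: "ideal_in \<R> L" using Nil.prems(1) unfolding saturated_in_def by blast
    have "enat (\<Prod>i<q. n i choose count_list [] i) \<le> quot_length L n" for n
    proof -
      have "MP n \<inter> L \<subset> MP n" using False by blast
      then have "1 \<le> quot_length L n"
        unfolding quot_length_def
        by (rule sym_module.colength_pos[OF sym_module.subspace_inter[OF subspace_multi_power
              ideal_in_rees_subspace[OF iL]] subspace_multi_power])
      then show ?thesis by (simp add: one_enat_def)
    qed
    then show ?thesis by (intro exI[of _ "[]"]) auto
  qed
next
  case (snoc i "is")
  have i: "i < q" and "is": "set is \<subseteq> {..<q}" using snoc.prems(2) by auto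
  have iL: "ideal_in \<R> L" using snoc.prems(1) unfolding saturated_in_def by blast
  note A = is_subring_rees_algebra[of scale e q M]
  obtain b where b: "b \<in> M i" "\<And>y. y \<in> \<R> \<Longrightarrow> lin_form scale e i b * y \<in> L \<Longrightarrow> y \<in> L"
    using filter_regular_element[OF snoc.prems(1) i] by metis
  note bR = lin_form_in_rees[OF i b(1)]
  note P = ideal_in_add_principal[OF A iL bR]
  let ?P = "add_principal \<R> L (lin_form scale e i b)"
  \<comment> \<open>The ideal with the new element adjoined may fail to be saturated; saturation is
    restored for the induction hypothesis and undone in its first alternative.\<close>
  obtain k where k: "saturated_in \<R> irr (ideal_colon_products \<R> ?P irr k)"
    using saturation_exists[OF noetherian_rees_algebra irr_subset P(1)] by blast
  let ?L' = "ideal_colon_products \<R> ?P irr k"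
  have PL': "?P \<subseteq> ?L'" by (rule ideal_subset_colon_products[OF A irr_subset P(1)])
  obtain bl where bl: "map fst bl = is" "\<forall>(i, b)\<in>set bl. b \<in> M i"
    "(\<exists>n. MP n \<subseteq> extend_ideal (lin_forms bl) ?L') \<or>
     (\<forall>n. enat (\<Prod>i<q. n i choose count_list is i) \<le> quot_length ?L' n)"
    using snoc.IH[OF k "is"] by (elim exE conjE)
  let ?bl = "bl @ [(i, b)]"
  have ext: "extend_ideal (lin_forms ?bl) L = extend_ideal (lin_forms bl) ?P" by simp
  have linR: "set (lin_forms bl) \<subseteq> \<R>" by (rule lin_forms_in_rees[OF _ bl(2)]) (use bl(1) "is" in simp)
  have "(\<exists>n. MP n \<subseteq> extend_ideal (lin_forms ?bl) L) \<or>
     (\<forall>n. enat (\<Prod>j<q. n j choose count_list (is @ [i]) j) \<le> quot_length L n)"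
    using bl(3)
  proof
    assume "\<exists>n. MP n \<subseteq> extend_ideal (lin_forms bl) ?L'"
    then obtain n where "MP n \<subseteq> extend_ideal (lin_forms bl) ?L'" by blast
    from extend_ideal_desaturate[OF P(1) linR this] show ?thesis unfolding ext by blast
  next
    assume low: "\<forall>n. enat (\<Prod>i<q. n i choose count_list is i) \<le> quot_length ?L' n"
    let ?c = "(count_list is)(i := Suc (count_list is i))"
    have cnt: "count_list (is @ [i]) = ?c" by auto
    have iL': "ideal_in \<R> ?L'" using k unfolding saturated_in_def by blast
    have step: "quot_length ?L' (n(i := Suc (n i))) + quot_length L n \<le> quot_length L (n(i := Suc (n i)))" for n
      by (rule quot_length_step[OF iL iL' _ _ i b]) (use PL' P(2,3) in blast)+
    \<comment> \<open>Summation along the \<open>i\<close>-th exponent with the others fixed; at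
      exponent zero the factor with a positive lower index vanishes.\<close>
    have main: "enat (\<Prod>j<q. (n(i := t)) j choose ?c j) \<le> quot_length L (n(i := t))" for n t
    proof (induction t)
      case 0
      have z: "(\<Prod>j<q. (n(i := 0)) j choose ?c j) = 0"
        by (rule prod_zero[OF finite_lessThan]) (use i in \<open>auto intro!: bexI[of _ i]\<close>)
      show ?case unfolding z by (simp add: zero_enat_def[symmetric])
    next
      case (Suc t)
      let ?n = "n(i := t)"
      have n: "n(i := Suc t) = ?n(i := Suc (?n i))" by auto
      have "enat (\<Prod>j<q. (?n(i := Suc (?n i))) j choose ?c j) \<le>
          enat (\<Prod>j<q. (?n(i := Suc (?n i))) j choose count_list is j) + enat (\<Prod>j<q. ?n j choose ?c j)"
        using binomial_prod_step[OF i, of ?n "count_list is"] by simp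
      also have "\<dots> \<le> quot_length ?L' (?n(i := Suc (?n i))) + quot_length L ?n"
        by (rule add_mono[OF low[rule_format] Suc.IH])
      also have "\<dots> \<le> quot_length L (?n(i := Suc (?n i)))" by (rule step)
      finally show ?case unfolding n .
    qed
    have "enat (\<Prod>j<q. n j choose ?c j) \<le> quot_length L n" for n using main[of n "n i"] by simp
    then show ?thesis unfolding cnt by blast
  qed
  moreover have "\<forall>(i, b)\<in>set ?bl. b \<in> M i" using bl(2) b(1) by auto
  ultimately show ?case using bl(1) by (intro exI[of _ ?bl]) auto
qed

end

section \<open>Reductions modulo the maximal ideal\<close>

lemma count_list_concat_replicate:
  "count_list (concat (map (\<lambda>j. replicate (r j) j) [0..<q])) i = (if i < q then r i else 0)"
proof (induction q)
  case (Suc q)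
  have "count_list (replicate t q) i = (if i = q then t else 0)" for t by (induction t) auto
  then show ?case using Suc by auto
qed simp

lemma (in noetherian_local) positive_depth_regular_element:
  assumes "0 < depth \<mm>"
  shows "\<exists>x\<in>\<mm>. \<forall>y. x * y = 0 \<longrightarrow> y = 0"
proof -
  obtain xs where xs: "0 < enat (length xs)" "set xs \<subseteq> \<mm>" "is_regular_sequence xs"
    using assms unfolding depth_def less_Sup_iff by blast
  have l: "0 < length xs" using xs(1) by (simp add: zero_enat_def)
  have "xs ! 0 * a \<in> ideal_generated {} \<Longrightarrow> a \<in> ideal_generated {}" for a
    using xs(3) l unfolding is_regular_sequence_def by force
  then have "\<forall>y. xs ! 0 * y = 0 \<longrightarrow> y = 0" by simp
  moreover have "xs ! 0 \<in> \<mm>" using xs(2) nth_mem[OF l] by blast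
  ultimately show ?thesis by blast
qed

lemma binomial_prod_lower:
  assumes r: "\<And>i. i < q \<Longrightarrow> 1 \<le> r i \<and> r i \<le> T" and n: "T \<le> n"
  shows "(real n / real T) ^ (\<Sum>i<q. r i) \<le> real (\<Prod>i<q. n choose r i)"
proof -
  have "(real n / real T) ^ r i \<le> real (n choose r i)" if "i < q" for i
  proof -
    have "(real n / real T) ^ r i \<le> (real n / real (r i)) ^ r i"
      by (rule power_mono[OF divide_left_mono]) (use r[OF that] in auto)
    also have "\<dots> \<le> real (n choose r i)"
      using binomial_ge_n_over_k_pow_k[of "r i" n, where ?'a = real] r[OF that] n by simp
    finally show ?thesis .
  qed
  then show ?thesis unfolding power_sum of_nat_prod by (intro prod_mono) auto
qed

context finite_colength_family_inf
begin

lemma ideal_in_ideal_mult_rees: "ideal_in \<R> (ideal_mult sym_scale \<mm> \<R>)"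
proof -
  let ?W = "ideal_mult sym_scale \<mm> \<R>"
  note sW = sym_module.subspace_ideal_mult[of \<mm> \<R>]
  have sub: "?W \<subseteq> \<R>" by (rule sym_module.ideal_mult_le_self[OF subspace_rees_algebra])
  have mult: "a * x \<in> ?W" if a: "a \<in> \<R>" and x: "x \<in> ?W" for a x
  proof (rule sym_span_mult[OF sW sym_module.span_base[of a "{a}"]])
    show "x \<in> sym_span {sym_scale c x | c x. c \<in> \<mm> \<and> x \<in> \<R>}" using x unfolding ideal_mult_def .
    fix u v assume "u \<in> {a}" "v \<in> {sym_scale c x | c x. c \<in> \<mm> \<and> x \<in> \<R>}"
    then obtain c y where cy: "u = a" "v = sym_scale c y" "c \<in> \<mm>" "y \<in> \<R>" by auto
    have "a * y \<in> \<R>" by (rule subring_mult[OF is_subring_rees_algebra a cy(4)])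
    then show "u * v \<in> ?W" unfolding cy(1,2) sym_scale_mult by (rule sym_module.ideal_mult_base[OF cy(3)])
  qed simp
  show ?thesis
    unfolding ideal_in_def
    using sub sym_module.subspace_0[OF sW] sym_module.subspace_add[OF sW] mult by blast
qed

lemma rank_sum: "(\<Sum>i<q. rk i - 1) + q = (\<Sum>i<q. rk i)"
proof -
  have "(\<Sum>i<q. rk i) = (\<Sum>i<q. (rk i - 1) + 1)"
    by (rule sum.cong) (use rank_pos in \<open>auto simp: Suc_le_eq\<close>)
  then show ?thesis by (simp only: sum.distrib) simp
qed

lemma no_generic_growth:
  assumes dim: "krull_dim TYPE('a) = enat d" "0 < d" "d \<le> q"
    and x: "x \<in> \<mm>" "\<And>y. x * y = 0 \<Longrightarrow> y = 0"
    and low: "\<And>n. enat (\<Prod>i<q. n choose rk i) \<le> colength sym_scale (MP (\<lambda>_. n)) (ideal_mult sym_scale \<mm> (MP (\<lambda>_. n)))"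
  shows False
proof -
  obtain s where s: "d = Suc s" using dim(2) by (cases d) auto
  obtain a :: "nat \<Rightarrow> 'a" and N where a: "a ` {..<d} \<subseteq> \<mm>" "ideal_power \<mm> N \<subseteq> ideal_generated (a ` {..<d})"
    by (rule system_of_parameters[OF dim(1)])
  have "ideal_generated (a ` {..<d}) \<subseteq> \<mm>" by (rule ring_module.span_minimal[OF a(1) ideal_m])
  from colength_fiber_bound[OF this[unfolded s] a(2)[unfolded s] x]
  obtain C where C: "\<And>n. colength sym_scale (MP (\<lambda>_. n)) (ideal_mult sym_scale \<mm> (MP (\<lambda>_. n))) \<le>
    enat (C * (n + 1) ^ ((\<Sum>i<q. rk i - 1) + s))" by blast
  let ?E = "(\<Sum>i<q. rk i - 1) + s" and ?R = "\<Sum>i<q. rk i"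
  have ER: "?E < ?R" using rank_sum dim(3) s by linarith
  have rT: "1 \<le> rk i \<and> rk i \<le> ?R" if "i < q" for i
    using rank_pos[OF that] that by (auto intro: member_le_sum simp: Suc_le_eq)
  have R: "0 < real ?R" using ER by linarith
  obtain n where n: "?R \<le> n" "(real C + 1) * real (n + 1) ^ ?E < (real n / real ?R) ^ ?R"
    by (rule power_growth[OF ER _ R, of "real C + 1" ?R]) auto
  have "enat (\<Prod>i<q. n choose rk i) \<le> enat (C * (n + 1) ^ ?E)" by (rule order_trans[OF low C])
  then have "(\<Prod>i<q. n choose rk i) \<le> C * (n + 1) ^ ?E" by simp
  then have "real (\<Prod>i<q. n choose rk i) \<le> real C * real (n + 1) ^ ?E"
    by (simp only: of_nat_le_iff[symmetric, where ?'a = real] of_nat_mult of_nat_power)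
  also have "\<dots> \<le> (real C + 1) * real (n + 1) ^ ?E" by (rule mult_right_mono) auto
  also note n(2)
  also have "(real n / real ?R) ^ ?R \<le> real (\<Prod>i<q. n choose rk i)" by (rule binomial_prod_lower[OF rT n(1)])
  finally show False by simp
qed

text \<open>The construction has to start from a saturated ideal, so \<open>\<mm>\<close> times the
  Rees algebra is replaced by its saturation. The larger ideal has shorter quotients, which keeps
  the upper bound on growth valid, and \<open>extend_ideal_desaturate\<close> returns to the
  original ideal.\<close>

lemma generic_reduction:
  assumes dim: "krull_dim TYPE('a) = enat d" "0 < d" "d \<le> q"
    and x: "x \<in> \<mm>" "\<forall>y. x * y = 0 \<longrightarrow> y = 0"
  shows "\<exists>bl N. (\<forall>i<q. count_list (map fst bl) i = rk i) \<and> set (map fst bl) \<subseteq> {..<q} \<and>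
    (\<forall>(i, b)\<in>set bl. b \<in> M i) \<and> MP (\<lambda>_. N + 1) \<subseteq> extend_ideal (lin_forms bl) (ideal_mult sym_scale \<mm> \<R>)"
proof -
  let ?K = "ideal_mult sym_scale \<mm> \<R>"
  note L0 = ideal_in_ideal_mult_rees
  obtain k where k: "saturated_in \<R> irr (ideal_colon_products \<R> ?K irr k)"
    using saturation_exists[OF noetherian_rees_algebra irr_subset L0] by blast
  let ?L = "ideal_colon_products \<R> ?K irr k"
  define js where "js = concat (map (\<lambda>j. replicate (rk j) j) [0..<q])"
  have js: "set js \<subseteq> {..<q}" "\<And>i. i < q \<Longrightarrow> count_list js i = rk i"
    unfolding js_def by (auto simp: count_list_concat_replicate)
  obtain bl where bl: "map fst bl = js" "\<forall>(i, b)\<in>set bl. b \<in> M i"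
    "(\<exists>n. MP n \<subseteq> extend_ideal (lin_forms bl) ?L) \<or>
     (\<forall>n. enat (\<Prod>i<q. n i choose count_list js i) \<le> quot_length ?L n)"
    using generic_reduction_or_growth[OF js(1) k] by (elim exE conjE)
  have "\<not> (\<forall>n. enat (\<Prod>i<q. n i choose count_list js i) \<le> quot_length ?L n)"
  proof
    assume low: "\<forall>n. enat (\<Prod>i<q. n i choose count_list js i) \<le> quot_length ?L n"
    show False
    proof (rule no_generic_growth[OF dim x(1) x(2)[rule_format]])
      fix n
      have "enat (\<Prod>i<q. n choose rk i) = enat (\<Prod>i<q. n choose count_list js i)" using js(2) by simp
      also have "\<dots> \<le> quot_length ?L (\<lambda>_. n)" by (rule low[rule_format])
      also have "\<dots> \<le> colength sym_scale (MP (\<lambda>_. n)) (ideal_mult sym_scale \<mm> (MP (\<lambda>_. n)))"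
        unfolding quot_length_def
      proof (rule sym_module.colength_mono[OF Int_greatest order_refl])
        show "ideal_mult sym_scale \<mm> (MP (\<lambda>_. n)) \<subseteq> MP (\<lambda>_. n)"
          by (rule sym_module.ideal_mult_le_self[OF subspace_multi_power])
        have "ideal_mult sym_scale \<mm> (MP (\<lambda>_. n)) \<subseteq> ?K"
          by (rule sym_module.ideal_mult_mono[OF order_refl multi_power_subset_rees])
        also have "?K \<subseteq> ?L" by (rule ideal_subset_colon_products[OF is_subring_rees_algebra irr_subset L0])
        finally show "ideal_mult sym_scale \<mm> (MP (\<lambda>_. n)) \<subseteq> ?L" .
      qed
      finally show "enat (\<Prod>i<q. n choose rk i) \<le>
        colength sym_scale (MP (\<lambda>_. n)) (ideal_mult sym_scale \<mm> (MP (\<lambda>_. n)))" .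
    qed
  qed
  then obtain n where n: "MP n \<subseteq> extend_ideal (lin_forms bl) ?L" using bl(3) by blast
  have linR: "set (lin_forms bl) \<subseteq> \<R>" by (rule lin_forms_in_rees[OF _ bl(2)]) (use bl(1) js(1) in simp)
  \<comment> \<open>One exponent that is at least every \<open>n j + k\<close>. It enters as
    \<open>N + 1\<close> because the left-hand side of a joint reduction has a successor as
    exponent.\<close>
  define N where "N = (\<Sum>j<q. n j + k)"
  have "MP (\<lambda>_. N + 1) \<subseteq> extend_ideal (lin_forms bl) ?K"
  proof (rule ideal_contains_larger_powers[OF ideal_in_extend_ideal[OF L0 linR] extend_ideal_desaturate[OF L0 linR n]])
    fix j assume "j < q"
    then have "n j + k \<le> N" unfolding N_def by (intro member_le_sum) auto
    then show "n j + k \<le> N + 1" by simp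
  qed
  then show ?thesis using bl(1,2) js by blast
qed

section \<open>Passage to a single multidegree\<close>

lemma hom_part_multi_power:
  assumes "x \<in> MP p"
  shows "hom_part q rk n x = (if \<forall>j<q. p j = n j then x else 0)"
proof -
  have x: "x \<in> homogeneous q rk p" using multi_power_homogeneous[of q rk e scale M p] assms by blast
  show ?thesis
  proof (cases "\<forall>j<q. p j = n j")
    case True
    then have "homogeneous q rk p = (homogeneous q rk n :: 'a sym_alg set)" by (intro homogeneous_cong) blast
    then have "hom_part q rk n x = x" using x by (intro hom_part_same) simp
    then show ?thesis using True by simp
  next
    case False
    then obtain j where j: "j < q" "p j \<noteq> n j" by blast
    have "hom_part q rk n x = 0" by (rule hom_part_other[where m = p and n = n and i = j, OF x j])
    then show ?thesis unfolding if_not_P[OF False] .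
  qed
qed

lemma subspace_hom_part_vimage:
  assumes S: "module.subspace sym_scale S"
  shows "module.subspace sym_scale {y. hom_part q r n y \<in> S}"
  unfolding sym_module.subspace_def
  using sym_module.subspace_0[OF S] sym_module.subspace_add[OF S] sym_module.subspace_scale[OF S]
  by (simp add: hom_part_zero hom_part_add hom_part_scale)

lemma hom_part_rees:
  assumes "x \<in> \<R>"
  shows "hom_part q rk n x \<in> MP n"
proof -
  have "\<R> \<subseteq> {x. hom_part q rk n x \<in> MP n}"
    unfolding rees_algebra_def
  proof (rule sym_module.span_minimal[OF _ subspace_hom_part_vimage[OF subspace_multi_power]], rule UN_least, rule subsetI)
    fix p x assume x: "x \<in> MP p"
    have "MP p = MP n" if "\<forall>j<q. p j = n j" by (rule multi_power_cong) (use that in blast)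
    then show "x \<in> {x. hom_part q rk n x \<in> MP n}"
      using hom_part_multi_power[OF x, of n] x sym_module.subspace_0[OF subspace_multi_power] by auto
  qed
  then show ?thesis using assms by blast
qed

text \<open>Multiplication by the linear form raises the \<open>i\<close>-th exponent by one, so
  only coefficients with \<open>i\<close>-th exponent \<open>n i - 1\<close> contribute. If
  \<open>n i\<close> is zero nothing contributes, and the truncated subtraction is harmless.\<close>

lemma hom_part_lin_form_mult:
  assumes i: "i < q" and b: "b \<in> M i" and c: "c \<in> \<R>"
  shows "hom_part q rk n (c * lin_form scale e i b) \<in>
    sym_span {lin_form scale e i b * z | z. z \<in> MP (n(i := n i - 1))}"
proof -
  let ?b = "lin_form scale e i b" and ?S = "sym_span {lin_form scale e i b * z | z. z \<in> MP (n(i := n i - 1))}"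
  let ?V = "{c. c * ?b \<in> {y. hom_part q rk n y \<in> ?S}}"
  have s0: "module.subspace sym_scale {y. hom_part q rk n y \<in> ?S}"
    by (rule subspace_hom_part_vimage[OF sym_module.subspace_span])
  have sV: "module.subspace sym_scale ?V"
    unfolding sym_module.subspace_def
  proof (intro conjI ballI allI)
    show "0 \<in> ?V" using sym_module.subspace_0[OF s0] by simp
    show "x + y \<in> ?V" if "x \<in> ?V" "y \<in> ?V" for x y
      using sym_module.subspace_add[OF s0, of "x * ?b" "y * ?b"] that by (simp only: mem_Collect_eq distrib_right)
    show "sym_scale a x \<in> ?V" if "x \<in> ?V" for a x
      using sym_module.subspace_scale[OF s0, of "x * ?b" a] that by (simp only: mem_Collect_eq sym_scale_mult)
  qed
  have "\<R> \<subseteq> ?V"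
    unfolding rees_algebra_def
  proof (rule sym_module.span_minimal[OF _ sV], rule UN_least, rule subsetI)
    fix p c assume c: "c \<in> MP p"
    let ?p = "p(i := Suc (p i))"
    have cb: "c * ?b \<in> MP ?p" using lin_form_mult_multi_power[OF i b c] by (simp add: mult.commute)
    show "c \<in> ?V"
    proof (cases "\<forall>j<q. ?p j = n j")
      case True
      have "p j = (n(i := n i - 1)) j" if "j < q" for j using True[rule_format, OF that] i by (cases "j = i") auto
      then have "MP p = MP (n(i := n i - 1))" by (rule multi_power_cong)
      then have "?b * c \<in> ?S" using c by (intro sym_module.span_base) blast
      then show ?thesis using hom_part_multi_power[OF cb, of n] True by (simp add: mult.commute)
    next
      case False
      have "hom_part q rk n (c * ?b) = 0" unfolding hom_part_multi_power[OF cb, of n] by (rule if_not_P[OF False])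
      then show ?thesis unfolding mem_Collect_eq by (simp only: sym_module.span_zero)
    qed
  qed
  then show ?thesis using c by blast
qed

text \<open>Ideal membership in the Rees algebra involves coefficients of all degrees. Taking one
  component leaves only coefficients from the pieces that occur in a joint reduction.\<close>

lemma hom_part_extend_ideal:
  assumes "set (map fst bl) \<subseteq> {..<q}" "\<forall>(i, b)\<in>set bl. b \<in> M i"
    and "y \<in> extend_ideal (lin_forms bl) (ideal_mult sym_scale \<mm> \<R>)"
  shows "hom_part q rk n y \<in> sym_span (ideal_mult sym_scale \<mm> (MP n) \<union>
    {lin_form scale e i b * z | i b z. (i, b) \<in> set bl \<and> z \<in> MP (n(i := n i - 1))})"
  using assms
proof (induction bl arbitrary: y)
  case Nil
  let ?S = "sym_span (ideal_mult sym_scale \<mm> (MP n) \<union> {})"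
  have "ideal_mult sym_scale \<mm> \<R> \<subseteq> {y. hom_part q rk n y \<in> ?S}"
  proof (rule sym_module.ideal_mult_le[OF subspace_hom_part_vimage[OF sym_module.subspace_span]])
    fix c x assume "c \<in> \<mm>" "x \<in> \<R>"
    then have "sym_scale c (hom_part q rk n x) \<in> ideal_mult sym_scale \<mm> (MP n)"
      by (intro sym_module.ideal_mult_base hom_part_rees)
    then show "sym_scale c x \<in> {y. hom_part q rk n y \<in> ?S}"
      unfolding mem_Collect_eq hom_part_scale by (intro sym_module.span_base) simp
  qed
  then show ?case using Nil.prems(3) by auto
next
  case (Cons p bl)
  obtain i b where p: "p = (i, b)" by (cases p)
  have i: "i < q" and b: "b \<in> M i" using Cons.prems(1,2) unfolding p by auto
  let ?G = "\<lambda>bl. ideal_mult sym_scale \<mm> (MP n) \<union>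
    {lin_form scale e i b * z | i b z. (i, b) \<in> set bl \<and> z \<in> MP (n(i := n i - 1))}"
  have "y \<in> add_principal \<R> (extend_ideal (lin_forms bl) (ideal_mult sym_scale \<mm> \<R>)) (lin_form scale e i b)"
    using Cons.prems(3) unfolding p by simp
  then obtain l c where lc: "y = l + c * lin_form scale e i b"
    "l \<in> extend_ideal (lin_forms bl) (ideal_mult sym_scale \<mm> \<R>)" "c \<in> \<R>"
    unfolding add_principal_def[of _ "extend_ideal (lin_forms bl) (ideal_mult sym_scale \<mm> \<R>)"] by blast
  have "hom_part q rk n l \<in> sym_span (?G bl)" by (rule Cons.IH[OF _ _ lc(2)]) (use Cons.prems(1,2) in auto)
  moreover have "?G bl \<subseteq> ?G (p # bl)" by auto
  ultimately have 1: "hom_part q rk n l \<in> sym_span (?G (p # bl))" using sym_module.span_mono by blast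
  have "{lin_form scale e i b * z | z. z \<in> MP (n(i := n i - 1))} \<subseteq> ?G (p # bl)" unfolding p by auto
  then have 2: "hom_part q rk n (c * lin_form scale e i b) \<in> sym_span (?G (p # bl))"
    using hom_part_lin_form_mult[OF i b lc(3), of n] sym_module.span_mono by blast
  show ?case unfolding lc(1) hom_part_add by (rule sym_module.span_add[OF 1 2])
qed

end

section \<open>Free joint reductions\<close>

context free_module
begin

text \<open>The vectors whose class modulo \<open>P\<close> lies, over the fraction field of the residue domain, in the span of \<open>us\<close>.\<close>
definition span_mod_prime :: "'a set \<Rightarrow> 'b list \<Rightarrow> 'b set" where
  "span_mod_prime P us = {v \<in> F. \<exists>c f. c \<notin> P \<and>
     (\<forall>k<length es. c * coord scale es v k - (\<Sum>j<length us. f j * coord scale es (us ! j) k) \<in> P)}"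

lemma span_mod_primeI:
  "v \<in> F \<Longrightarrow> c \<notin> P \<Longrightarrow>
    (\<And>k. k < length es \<Longrightarrow> c * coord scale es v k - (\<Sum>j<length us. f j * coord scale es (us ! j) k) \<in> P) \<Longrightarrow>
    v \<in> span_mod_prime P us"
  unfolding span_mod_prime_def by blast

lemma span_mod_primeD:
  "v \<in> span_mod_prime P us \<Longrightarrow> v \<in> F \<and> (\<exists>c f. c \<notin> P \<and>
    (\<forall>k<length es. c * coord scale es v k - (\<Sum>j<length us. f j * coord scale es (us ! j) k) \<in> P))"
  unfolding span_mod_prime_def by (rule CollectD)

lemma subspace_span_mod_prime:
  assumes P: "is_prime_ideal P"
  shows "subspace (span_mod_prime P us)"
proof (rule subspaceI)
  note iP = is_prime_idealD[OF P]
  have "0 \<in> P" "1 \<notin> P" using prime_ideal_zero[OF P] prime_ideal_one[OF P] by auto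
  then show "0 \<in> span_mod_prime P us"
    unfolding span_mod_prime_def
    using subspace_0[OF subspace_F] by (auto simp: coord_zero intro!: exI[of _ 1] exI[of _ "\<lambda>_. 0"])
next
  note iP = is_prime_idealD[OF P]
  let ?S = "\<lambda>f k. \<Sum>j<length us. f j * coord scale es (us ! j) k"
  fix v w assume "v \<in> span_mod_prime P us" "w \<in> span_mod_prime P us"
  note vw = this
  from span_mod_primeD[OF vw(1)] obtain c f where v: "v \<in> F" "c \<notin> P" "\<forall>k<length es. c * coord scale es v k - ?S f k \<in> P"
    by (elim conjE exE)
  from span_mod_primeD[OF vw(2)] obtain d g where w: "w \<in> F" "d \<notin> P" "\<forall>k<length es. d * coord scale es w k - ?S g k \<in> P"
    by (elim conjE exE)
  have vwP: "c * d * coord scale es (v + w) k - ?S (\<lambda>j. d * f j + c * g j) k \<in> P" if "k < length es" for k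
  proof -
    have "?S (\<lambda>j. d * f j + c * g j) k = d * ?S f k + c * ?S g k"
      by (simp add: sum_distrib_left sum.distrib distrib_right mult.assoc)
    then have "c * d * coord scale es (v + w) k - ?S (\<lambda>j. d * f j + c * g j) k =
        d * (c * coord scale es v k - ?S f k) + c * (d * coord scale es w k - ?S g k)"
      by (simp add: coord_add[OF v(1) w(1)] algebra_simps)
    then show ?thesis
      using ring_module.subspace_add[OF iP] ring_module.subspace_scale[OF iP] v(3)[rule_format, OF that] w(3)[rule_format, OF that] by simp
  qed
  have "c * d \<notin> P" using prime_ideal_mult[OF P, of c d] v(2) w(2) by simp
  from span_mod_primeI[OF subspace_add[OF subspace_F v(1) w(1)] this vwP]
  show "v + w \<in> span_mod_prime P us" .
next
  note iP = is_prime_idealD[OF P]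
  let ?S = "\<lambda>f k. \<Sum>j<length us. f j * coord scale es (us ! j) k"
  fix a v assume v': "v \<in> span_mod_prime P us"
  from span_mod_primeD[OF v'] obtain c f where v: "v \<in> F" "c \<notin> P" "\<forall>k<length es. c * coord scale es v k - ?S f k \<in> P"
    by (elim conjE exE)
  have av: "c * coord scale es (a *s v) k - ?S (\<lambda>j. a * f j) k \<in> P" if "k < length es" for k
  proof -
    have "c * coord scale es (a *s v) k - ?S (\<lambda>j. a * f j) k = a * (c * coord scale es v k - ?S f k)"
      by (simp add: coord_scale[OF v(1)] sum_distrib_left algebra_simps)
    then show ?thesis using ring_module.subspace_scale[OF iP v(3)[rule_format, OF that]] by simp
  qed
  from span_mod_primeI[OF subspace_scale[OF subspace_F v(1)] v(2) av]
  show "a *s v \<in> span_mod_prime P us" .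
qed

text \<open>A rank count: the multiples by \<open>t\<close> of all basis vectors would depend on
  fewer vectors over the fraction field, so their coefficient rows satisfy a relation. Read in
  coordinate \<open>m\<close> it puts \<open>v m * (c m * t)\<close> into \<open>P\<close>, although
  no factor lies there.\<close>

lemma not_subset_span_mod_prime:
  assumes P: "is_prime_ideal P" and us: "length us < length es" and t: "t \<notin> P"
    and N: "\<And>k. k < length es \<Longrightarrow> t *s es ! k \<in> N"
  shows "\<not> N \<subseteq> span_mod_prime P us"
proof
  note iP = is_prime_idealD[OF P]
  assume sub: "N \<subseteq> span_mod_prime P us"
  let ?r = "length es" and ?c = "\<lambda>j k. coord scale es (us ! j) k"
  have "\<exists>c f. l < ?r \<longrightarrow> c \<notin> P \<and>
      (\<forall>k<?r. c * coord scale es (t *s es ! l) k - (\<Sum>j<length us. f j * ?c j k) \<in> P)" for l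
  proof (cases "l < ?r")
    case True
    from span_mod_primeD[OF subsetD[OF sub N[OF True]]] show ?thesis using True by simp
  qed blast
  from choice[OF allI, OF this] obtain c where "\<forall>l. \<exists>f. l < ?r \<longrightarrow> c l \<notin> P \<and>
      (\<forall>k<?r. c l * coord scale es (t *s es ! l) k - (\<Sum>j<length us. f j * ?c j k) \<in> P)" by (rule exE)
  from choice[OF this] obtain f where f: "\<forall>l. l < ?r \<longrightarrow> c l \<notin> P \<and>
      (\<forall>k<?r. c l * coord scale es (t *s es ! l) k - (\<Sum>j<length us. f l j * ?c j k) \<in> P)" by (rule exE)
  have cf: "\<And>l. l < ?r \<Longrightarrow> c l \<notin> P"
    "\<And>l k. l < ?r \<Longrightarrow> k < ?r \<Longrightarrow> c l * coord scale es (t *s es ! l) k - (\<Sum>j<length us. f l j * ?c j k) \<in> P"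
    using f by simp_all
  have "\<exists>v. (\<exists>l\<in>{..<?r}. v l \<notin> P) \<and> (\<forall>j\<in>{..<length us}. (\<Sum>l\<in>{..<?r}. v l * f l j) \<in> P)"
    by (rule relation_mod_prime[OF P]) (use us in auto)
  then obtain v m where v: "m < ?r" "v m \<notin> P" "\<And>j. j < length us \<Longrightarrow> (\<Sum>l<?r. v l * f l j) \<in> P" by auto
  let ?x = "\<Sum>l<?r. v l * (c l * coord scale es (t *s es ! l) m - (\<Sum>j<length us. f l j * ?c j m))"
  let ?y = "\<Sum>j<length us. ?c j m * (\<Sum>l<?r. v l * f l j)"
  have x: "?x \<in> P"
    by (rule ring_module.subspace_sum[OF iP], rule ring_module.subspace_scale[OF iP], rule cf(2)) (use v(1) in auto)
  have y: "?y \<in> P"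
    by (rule ring_module.subspace_sum[OF iP], rule ring_module.subspace_scale[OF iP], rule v(3)) auto
  have t_coord: "coord scale es (t *s es ! l) m = (if m = l then t else 0)" if "l < ?r" for l
    using coord_scale[OF es_in_F[OF that], of t m] coord_basis[OF v(1) that] by simp
  have "(\<Sum>l<?r. v l * (c l * coord scale es (t *s es ! l) m)) = (\<Sum>l<?r. if m = l then v l * (c l * t) else 0)"
    by (rule sum.cong) (auto simp: t_coord)
  also have "\<dots> = v m * (c m * t)" using v(1) by simp
  finally have 1: "(\<Sum>l<?r. v l * (c l * coord scale es (t *s es ! l) m)) = v m * (c m * t)" .
  have "(\<Sum>l<?r. v l * (\<Sum>j<length us. f l j * ?c j m)) = (\<Sum>l<?r. \<Sum>j<length us. ?c j m * (v l * f l j))"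
    by (simp add: sum_distrib_left ac_simps)
  also have "\<dots> = ?y" by (subst sum.swap) (simp add: sum_distrib_left)
  finally have "?x = v m * (c m * t) - ?y" using 1 by (simp add: right_diff_distrib sum_subtractf)
  then have "v m * (c m * t) \<in> P" using ring_module.subspace_add[OF iP x y] by simp
  then show False using prime_ideal_mult[OF P, of "v m" "c m * t"] prime_ideal_mult[OF P, of "c m" t] v(2) cf(1)[OF v(1)] t by simp
qed

text \<open>A null vector modulo \<open>P\<close> can be solved for the last of its coordinates
  outside \<open>P\<close>; the corresponding vector then depends on the preceding ones.\<close>

lemma det_coord_mat_notin_prime:
  assumes P: "is_prime_ideal P" and ws: "length ws = length es" "set ws \<subseteq> F"
    and ind: "\<And>l. l < length es \<Longrightarrow> ws ! l \<notin> span_mod_prime P (take l ws)"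
  shows "det (coord_mat scale es ws) \<notin> P"
proof
  note iP = is_prime_idealD[OF P]
  let ?r = "length es" and ?c = "\<lambda>j k. coord scale es (ws ! j) k"
  assume det: "det (coord_mat scale es ws) \<in> P"
  obtain v where v: "\<exists>l<?r. v l \<notin> P" "\<And>k. k < ?r \<Longrightarrow> (\<Sum>l<?r. coord_mat scale es ws $$ (k, l) * v l) \<in> P"
    by (rule det_null_vector_mod_prime[OF P coord_mat_carrier[of ws, unfolded ws(1)] det]) blast
  let ?L = "{l. l < ?r \<and> v l \<notin> P}"
  define m where "m = Max ?L"
  have "finite ?L" "?L \<noteq> {}" using v(1) by auto
  then have "m \<in> ?L" unfolding m_def by (rule Max_in)
  have max: "\<And>l. l \<in> ?L \<Longrightarrow> l \<le> m" unfolding m_def by (rule Max_ge[OF \<open>finite ?L\<close>])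
  from \<open>m \<in> ?L\<close> have m: "m < ?r" "v m \<notin> P" by auto
  have rel: "v m * ?c m k - (\<Sum>j<length (take m ws). - v j * coord scale es (take m ws ! j) k) \<in> P" if k: "k < ?r" for k
  proof -
    let ?f = "\<lambda>l. v l * ?c l k"
    have "(\<Sum>l<?r. coord_mat scale es ws $$ (k, l) * v l) = (\<Sum>l<?r. ?f l)"
      by (rule sum.cong) (use k ws(1) in \<open>auto simp: coord_mat_nth\<close>)
    also have "\<dots> = sum ?f {..<Suc m} + sum ?f {m<..<?r}"
    proof -
      have "{..<?r} = {..<Suc m} \<union> {m<..<?r}" using m(1) by auto
      then have "(\<Sum>l<?r. ?f l) = sum ?f ({..<Suc m} \<union> {m<..<?r})" by (rule arg_cong[of _ _ "sum ?f"])
      also have "\<dots> = sum ?f {..<Suc m} + sum ?f {m<..<?r}"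
      proof (rule sum.union_disjoint)
        show "{..<Suc m} \<inter> {m<..<?r} = {}" by auto
      qed simp_all
      finally show ?thesis .
    qed
    finally have eq: "v m * ?c m k + (\<Sum>l<m. v l * ?c l k) =
        (\<Sum>l<?r. coord_mat scale es ws $$ (k, l) * v l) - (\<Sum>l\<in>{m<..<?r}. v l * ?c l k)"
      by (simp add: algebra_simps)
    have "(\<Sum>l\<in>{m<..<?r}. v l * ?c l k) \<in> P"
    proof (rule ring_module.subspace_sum[OF iP])
      fix l assume "l \<in> {m<..<?r}"
      then have "v l \<in> P" using max[of l] by auto
      from ring_module.subspace_scale[OF iP this, of "?c l k"] show "v l * ?c l k \<in> P" by (simp add: mult.commute)
    qed
    then have "v m * ?c m k + (\<Sum>l<m. v l * ?c l k) \<in> P"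
      unfolding eq using ring_module.subspace_diff[OF iP v(2)[OF k]] by blast
    moreover have "(\<Sum>j<length (take m ws). - v j * coord scale es (take m ws ! j) k) = - (\<Sum>l<m. v l * ?c l k)"
      using m(1) ws(1) by (simp add: sum_negf min_def)
    ultimately show ?thesis by simp
  qed
  have "ws ! m \<in> F" using ws m(1) nth_mem[of m ws] by auto
  from span_mod_primeI[OF this m(2) rel] have "ws ! m \<in> span_mod_prime P (take m ws)" .
  then show False using ind[OF m(1)] by blast
qed

text \<open>Applying the adjugate to a linear relation multiplies its coefficients by the regular
  determinant. Repetitions in \<open>ws\<close> are excluded too, as they would make the determinant
  zero.\<close>

lemma is_basis_span_regular_det:
  assumes ws: "length ws = length es" "set ws \<subseteq> F"
    and reg: "\<And>y. det (coord_mat scale es ws) * y = 0 \<Longrightarrow> y = 0"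
  shows "is_basis scale ws (span (set ws))"
proof -
  let ?r = "length es" and ?A = "coord_mat scale es ws"
  have A: "?A \<in> carrier_mat ?r ?r" using coord_mat_carrier[of ws] ws(1) by simp
  have dist: "distinct ws"
    unfolding distinct_conv_nth
  proof (intro allI impI notI)
    fix i j assume ij: "i < length ws" "j < length ws" "i \<noteq> j" "ws ! i = ws ! j"
    have "det ?A = 0"
      unfolding det_coord_mat[OF ws(1)] by (rule col_det_identical[of i _ j]) (use ij ws(1) in auto)
    then have "det ?A * 1 = 0" by simp
    then show False using reg[of 1] by simp
  qed
  have "u b = 0" if u: "(\<Sum>v\<in>set ws. u v *s v) = 0" and b: "b \<in> set ws" for u b
  proof -
    let ?u = "vec ?r (\<lambda>l. u (ws ! l))"
    have u': "?u \<in> carrier_vec ?r" by simp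
    have "bij_betw (\<lambda>l. ws ! l) {..<length ws} (set ws)" by (rule bij_betw_nth[OF dist refl refl])
    from sum.reindex_bij_betw[OF this, of "\<lambda>v. u v *s v"]
    have s: "(\<Sum>l<?r. u (ws ! l) *s ws ! l) = 0" using u ws(1) by simp
    have wF: "ws ! l \<in> F" if "l < ?r" for l using that ws nth_mem by fastforce
    have "?A *\<^sub>v ?u = 0\<^sub>v ?r"
    proof (rule eq_vecI)
      fix k assume "k < dim_vec (0\<^sub>v ?r :: 'a vec)"
      then have k: "k < ?r" by simp
      have "(?A *\<^sub>v ?u) $ k = (\<Sum>l<?r. ?A $$ (k, l) * u (ws ! l))"
        using A k by (simp add: scalar_prod_def atLeast0LessThan)
      also have "\<dots> = (\<Sum>l<?r. coord scale es (u (ws ! l) *s ws ! l) k)"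
        by (rule sum.cong) (use k ws(1) in \<open>auto simp: coord_mat_nth coord_scale[OF wF]\<close>)
      also have "\<dots> = coord scale es (\<Sum>l<?r. u (ws ! l) *s ws ! l) k"
        by (rule coord_sum[symmetric]) (use wF subspace_scale[OF subspace_F] in auto)
      also have "\<dots> = 0" unfolding s by (rule coord_zero)
      finally show "(?A *\<^sub>v ?u) $ k = 0\<^sub>v ?r $ k" using k by simp
    qed (use A in simp)
    then have "adj_mat ?A *\<^sub>v (?A *\<^sub>v ?u) = adj_mat ?A *\<^sub>v 0\<^sub>v ?r" by simp
    also have "\<dots> = 0\<^sub>v ?r" using adj_mat(1)[OF A] by (intro eq_vecI) (auto simp: scalar_prod_def)
    also have "adj_mat ?A *\<^sub>v (?A *\<^sub>v ?u) = (det ?A \<cdot>\<^sub>m 1\<^sub>m ?r) *\<^sub>v ?u"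
      unfolding assoc_mult_mat_vec[OF adj_mat(1)[OF A] A u', symmetric] adj_mat(3)[OF A] ..
    also have "\<dots> = det ?A \<cdot>\<^sub>v ?u"
      by (intro eq_vecI) (auto simp: scalar_prod_def row_def one_mat_def if_distribR if_distrib[of "(*) _"] if_distrib[of "\<lambda>c. c * _"] sum.delta cong: if_cong)
    finally have z: "det ?A \<cdot>\<^sub>v ?u = 0\<^sub>v ?r" .
    obtain l where l: "l < ?r" "b = ws ! l" using b ws(1) unfolding in_set_conv_nth by auto
    from arg_cong[OF z, of "\<lambda>x. x $ l"] l have "det ?A * u b = 0" by simp
    then show ?thesis by (rule reg)
  qed
  then have "\<not> dependent (set ws)" unfolding dependent_finite[OF finite_set] by blast
  then show ?thesis unfolding is_basis_def using dist by simp
qed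

end

lemma power_in_products: "t \<in> X \<Longrightarrow> t ^ k \<in> products X k"
  by (induction k) auto

text \<open>The zero ideal has finitely many primes outside of which an element kills only what a
  power of \<open>\<mm>\<close>, hence of the regular element \<open>x\<close>, kills. The vectors
  are corrected one at a time, each to be independent of its predecessors modulo all these primes,
  so that the determinant avoids them.\<close>

lemma (in noetherian_local_inf) perturb_to_regular_det:
  fixes scale :: "'a \<Rightarrow> 'b::ab_group_add \<Rightarrow> 'b"
  assumes fm: "free_module scale es F" and M: "module.subspace scale M" "M \<subseteq> F"
    and c: "ideal_mult scale (ideal_power \<mm> c) F \<subseteq> M"
    and x: "x \<in> \<mm>" "\<forall>y. x * y = 0 \<longrightarrow> y = 0"
    and vs: "length vs = length es" "set vs \<subseteq> M"
  shows "\<exists>ws. length ws = length es \<and> set ws \<subseteq> M \<and>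
    (\<forall>l<length es. ws ! l - vs ! l \<in> ideal_mult scale \<mm> M) \<and>
    (\<forall>y. det (coord_mat scale es ws) * y = 0 \<longrightarrow> y = 0)"
proof -
  interpret fm: free_module scale es F by (rule fm)
  have L: "ideal_in UNIV {0 :: 'a}" unfolding ideal_in_def by simp
  have N: "noetherian_subring (UNIV :: 'a set)" by (rule noetherian_subring_UNIV[OF noeth])
  obtain Ps k where Ps: "finite Ps" "\<And>P. P \<in> Ps \<Longrightarrow> prime_in UNIV P \<and> \<not> \<mm> \<subseteq> P"
    "\<And>b y s. b \<in> UNIV \<Longrightarrow> b \<notin> \<Union>Ps \<Longrightarrow> y \<in> UNIV \<Longrightarrow> b * y \<in> {0} \<Longrightarrow> s \<in> products \<mm> k \<Longrightarrow> s * y \<in> {0}"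
    using finitely_many_primes_cover_zero_divisors[OF N subset_UNIV L, of \<mm>] by metis
  have P: "is_prime_ideal P" "\<not> \<mm> \<subseteq> P" if "P \<in> Ps" for P using Ps(2)[OF that] prime_in_UNIV by auto
  let ?Z = "ideal_mult scale \<mm> M"
  have Z: "fm.subspace ?Z" by (rule fm.subspace_ideal_mult)
  have ZM: "?Z \<subseteq> M" by (rule fm.ideal_mult_le_self[OF M(1)])
  have nsub: "\<not> ?Z \<subseteq> fm.span_mod_prime P us" if "P \<in> Ps" and us: "length us < length es" for P us
  proof -
    obtain t where t: "t \<in> \<mm>" "t \<notin> P" using P(2)[OF \<open>P \<in> Ps\<close>] by blast
    show ?thesis
    proof (rule fm.not_subset_span_mod_prime[OF P(1)[OF \<open>P \<in> Ps\<close>] us])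
      \<comment> \<open>\<open>c\<close> factors bring a basis vector into \<open>M\<close>, and one
        more brings it into \<open>\<mm> M\<close>.\<close>
      show "t ^ Suc c \<notin> P" using prime_ideal_power[OF P(1)[OF \<open>P \<in> Ps\<close>]] t(2) by blast
      fix j assume j: "j < length es"
      have "scale (t ^ c) (es ! j) \<in> M"
        using c fm.ideal_mult_base[OF power_in_ideal_power[OF t(1)] fm.es_in_F[OF j]] by blast
      from fm.ideal_mult_base[OF t(1) this] show "scale (t ^ Suc c) (es ! j) \<in> ?Z" by simp
    qed
  qed
  have "\<exists>ws. length ws = l \<and> set ws \<subseteq> M \<and> (\<forall>j<l. ws ! j - vs ! j \<in> ?Z) \<and>
      (\<forall>P\<in>Ps. \<forall>j<l. ws ! j \<notin> fm.span_mod_prime P (take j ws))" if "l \<le> length es" for l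
    using that
  proof (induction l)
    case (Suc l)
    then obtain ws where ws: "length ws = l" "set ws \<subseteq> M" "\<And>j. j < l \<Longrightarrow> ws ! j - vs ! j \<in> ?Z"
      "\<And>P j. P \<in> Ps \<Longrightarrow> j < l \<Longrightarrow> ws ! j \<notin> fm.span_mod_prime P (take j ws)" by fastforce
    let ?\<W> = "(\<lambda>P. fm.span_mod_prime P ws) ` Ps"
    have sW: "fm.subspace W" if "W \<in> ?\<W>" for W using that fm.subspace_span_mod_prime[OF P(1)] by blast
    have nW: "\<not> ?Z \<subseteq> W" if W: "W \<in> ?\<W>" for W
    proof -
      obtain Q where "Q \<in> Ps" "W = fm.span_mod_prime Q ws" using W by (rule imageE)
      then show ?thesis using nsub[of Q ws] ws(1) Suc.prems by simp
    qed
    obtain w where w: "w \<in> ?Z" "\<And>W. W \<in> ?\<W> \<Longrightarrow> vs ! l + w \<notin> W"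
      by (rule coset_avoids_submodules[OF fm.module_axioms finite_imageI[OF Ps(1)] Z sW nW]) blast+
    let ?ws = "ws @ [vs ! l + w]"
    have "vs ! l \<in> M" using vs Suc.prems nth_mem by fastforce
    then have wM: "vs ! l + w \<in> M" using w(1) ZM fm.subspace_add[OF M(1)] by blast
    have "?ws ! j - vs ! j \<in> ?Z" if "j < Suc l" for j
      using that ws(3)[of j] ws(1) w(1) by (cases "j = l") (auto simp: nth_append)
    moreover have "?ws ! j \<notin> fm.span_mod_prime P (take j ?ws)" if "P \<in> Ps" "j < Suc l" for P j
      using that(2) ws(4)[OF that(1), of j] ws(1) w(2)[OF imageI[OF that(1)]]
      by (cases "j = l") (auto simp: nth_append)
    ultimately show ?case using ws(1,2) wM by (intro exI[of _ ?ws]) auto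
  qed simp
  from this[OF order_refl] obtain ws where ws: "length ws = length es" "set ws \<subseteq> M"
    "\<And>j. j < length es \<Longrightarrow> ws ! j - vs ! j \<in> ?Z"
    "\<And>P j. P \<in> Ps \<Longrightarrow> j < length es \<Longrightarrow> ws ! j \<notin> fm.span_mod_prime P (take j ws)" by blast
  have wsF: "set ws \<subseteq> F" using ws(2) M(2) by blast
  have det: "det (coord_mat scale es ws) \<notin> \<Union>Ps"
    using fm.det_coord_mat_notin_prime[OF P(1) ws(1) wsF ws(4)] by blast
  have "y = 0" if "det (coord_mat scale es ws) * y = 0" for y
  proof -
    have "x ^ k * y = 0" using Ps(3)[OF UNIV_I det UNIV_I _ power_in_products[OF x(1)], of y] that by simp
    moreover have "x ^ k * y = 0 \<Longrightarrow> y = 0" for k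
    proof (induction k)
      case (Suc k)
      then show ?case using x(2)[rule_format, of "x ^ k * y"] by (simp add: mult.assoc)
    qed simp
    ultimately show ?thesis by blast
  qed
  then show ?thesis using ws(1-3) by blast
qed

context finite_colength_family_inf
begin

text \<open>The right-hand side of the equation in \<open>is_joint_reduction\<close>, in the form
  given by \<open>joint_reduction_term\<close>.\<close>

definition joint_span :: "(nat \<Rightarrow> 'b set) \<Rightarrow> nat \<Rightarrow> 'a sym_alg set" where
  "joint_span B N = sym_span (\<Union>i<q. sym_mult (lin_form scale e i ` B i) (MP ((\<lambda>_. N + 1)(i := N))))"

lemma joint_span_base:
  assumes "i < q" "b \<in> B i" "z \<in> MP ((\<lambda>_. N + 1)(i := N))"
  shows "lin_form scale e i b * z \<in> joint_span B N"
proof -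
  have "lin_form scale e i b * z \<in> sym_mult (lin_form scale e i ` B i) (MP ((\<lambda>_. N + 1)(i := N)))"
    unfolding sym_mult_def by (rule sym_module.span_base) (use assms(2,3) in blast)
  then show ?thesis
    unfolding joint_span_def by (intro sym_module.span_base) (use assms(1) in blast)
qed

lemma joint_span_le:
  assumes B: "\<And>i. i < q \<Longrightarrow> B i \<subseteq> M i"
  shows "joint_span B N \<subseteq> MP (\<lambda>_. N + 1)"
  unfolding joint_span_def sym_mult_def
proof (rule sym_module.span_minimal[OF UN_least subspace_multi_power],
    rule sym_module.span_minimal[OF _ subspace_multi_power], clarify)
  fix i b z assume "i < q" "b \<in> B i" and z: "z \<in> MP ((\<lambda>_. N + 1)(i := N))"
  then have i: "i < q" "b \<in> M i" using B by auto
  have "((\<lambda>_. N + 1)(i := N))(i := Suc (((\<lambda>_. N + 1)(i := N)) i)) = (\<lambda>_. N + 1)" by auto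
  then show "lin_form scale e i b * z \<in> MP (\<lambda>_. N + 1)"
    using lin_form_mult_multi_power[OF i z] by simp
qed

lemma is_joint_reductionI:
  assumes B: "\<And>i. i < q \<Longrightarrow> B i = span (set (bs i)) \<and> length (bs i) = rk i \<and> B i \<subseteq> M i"
    and le: "MP (\<lambda>_. N + 1) \<subseteq> joint_span B N"
  shows "is_joint_reduction scale e q M B"
proof -
  have "MP (\<lambda>_. N + 1) = joint_span B N"
    by (rule equalityI[OF le joint_span_le]) (use B in blast)
  moreover have "(\<Union>i<q. sym_mult (lin_form scale e i ` B i)
          (sym_mult (sym_power_image scale e i N (M i))
            (sym_prod (\<lambda>j. sym_power_image scale e j (N + 1) (M j)) ({..<q} - {i})))) =
      (\<Union>i<q. sym_mult (lin_form scale e i ` B i) (MP ((\<lambda>_. N + 1)(i := N))))"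
    by (rule SUP_cong[OF refl]) (simp only: lessThan_iff joint_reduction_term)
  ultimately have "sym_prod (\<lambda>j. sym_power_image scale e j (N + 1) (M j)) {..<q} =
      sym_span (\<Union>i<q. sym_mult (lin_form scale e i ` B i)
          (sym_mult (sym_power_image scale e i N (M i))
            (sym_prod (\<lambda>j. sym_power_image scale e j (N + 1) (M j)) ({..<q} - {i}))))"
    unfolding joint_span_def multi_power_def by (simp only:)
  moreover have "subspace (B i) \<and> B i \<subseteq> M i \<and> (\<exists>bs. length bs = length (e i) \<and> span (set bs) = B i)" if "i < q" for i
    using B[OF that] subspace_span[of "set (bs i)"] by auto
  ultimately show ?thesis unfolding is_joint_reduction_def by blast
qed

lemma lin_form_mult_ideal_mult:
  assumes i: "i < q" and v: "v \<in> ideal_mult scale \<mm> (M i)" and z: "z \<in> MP ((\<lambda>_. N + 1)(i := N))"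
  shows "lin_form scale e i v * z \<in> ideal_mult sym_scale \<mm> (MP (\<lambda>_. N + 1))"
proof -
  interpret fm: free_module scale "e i" "F i" by (rule free[OF i])
  let ?Z = "ideal_mult sym_scale \<mm> (MP (\<lambda>_. N + 1))"
  note sZ = sym_module.subspace_ideal_mult[of \<mm> "MP (\<lambda>_. N + 1)"]
  have sV: "module.subspace sym_scale {p. p * z \<in> ?Z}"
    unfolding sym_module.subspace_def
    using sym_module.subspace_0[OF sZ] sym_module.subspace_add[OF sZ] sym_module.subspace_scale[OF sZ]
    by (simp add: distrib_right sym_scale_mult)
  have "ideal_mult scale \<mm> (M i) \<subseteq> {v \<in> F i. lin_form scale e i v \<in> {p. p * z \<in> ?Z}}"
  proof (rule ideal_mult_le[OF fm.subspace_lin_form_vimage[of e i, OF refl sV]])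
    fix c u assume c: "c \<in> \<mm>" and u: "u \<in> M i"
    have uF: "u \<in> F i" using u M_le_F[OF i] by blast
    have "((\<lambda>_. N + 1)(i := N))(i := Suc (((\<lambda>_. N + 1)(i := N)) i)) = (\<lambda>_. N + 1)" by auto
    then have "lin_form scale e i u * z \<in> MP (\<lambda>_. N + 1)" using lin_form_mult_multi_power[OF i u z] by simp
    then have "sym_scale c (lin_form scale e i u * z) \<in> ?Z" by (rule sym_module.ideal_mult_base[OF c])
    moreover have "lin_form scale e i (c *s u) = sym_scale c (lin_form scale e i u)"
      by (rule fm.lin_form_linear(2)[where e = e and i = i, OF refl uF])
    moreover have "c *s u \<in> F i" by (rule subspace_scale[OF fm.subspace_F uF])
    ultimately show "c *s u \<in> {v \<in> F i. lin_form scale e i v \<in> {p. p * z \<in> ?Z}}" by (simp add: sym_scale_mult)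
  qed
  then show ?thesis using v by blast
qed

lemma perturbed_family:
  assumes x: "x \<in> \<mm>" "\<forall>y. x * y = 0 \<longrightarrow> y = 0"
    and vs: "\<And>i. i < q \<Longrightarrow> length (vs i) = rk i \<and> set (vs i) \<subseteq> M i"
  shows "\<exists>ws. \<forall>i<q. length (ws i) = rk i \<and> set (ws i) \<subseteq> M i \<and>
    (\<forall>l<rk i. ws i ! l - vs i ! l \<in> ideal_mult scale \<mm> (M i)) \<and> is_basis scale (ws i) (span (set (ws i)))"
proof -
  have "\<exists>w. i < q \<longrightarrow> length w = rk i \<and> set w \<subseteq> M i \<and>
    (\<forall>l<rk i. w ! l - vs i ! l \<in> ideal_mult scale \<mm> (M i)) \<and> is_basis scale w (span (set w))" for i
  proof (cases "i < q")
    case True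
    obtain c where c: "ideal_mult scale (ideal_power \<mm> c) (F i) \<subseteq> M i" using common_power True by blast
    obtain w where w: "length w = rk i" "set w \<subseteq> M i"
      "\<forall>l<rk i. w ! l - vs i ! l \<in> ideal_mult scale \<mm> (M i)"
      "\<forall>y. det (coord_mat scale (e i) w) * y = 0 \<longrightarrow> y = 0"
      using perturb_to_regular_det[OF free[OF True] subspace_M[OF True] M_le_F[OF True] c x
        conjunct1[OF vs[OF True]] conjunct2[OF vs[OF True]]] by (elim exE conjE)
    have "set w \<subseteq> F i" using w(2) M_le_F[OF True] by (rule order_trans)
    from free_module.is_basis_span_regular_det[OF free[OF True] w(1) this] w(4)
    have "is_basis scale w (span (set w))" by simp
    then show ?thesis using w(1-3) by (intro exI[of _ w]) simp
  qed simp
  from choice[OF allI, OF this] show ?thesis .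
qed

text \<open>The generic elements are replaced by elements congruent to them modulo \<open>\<mm> M i\<close>, which by
  Nakayama still reduce the product, and which are chosen such that their determinants are regular.\<close>
lemma free_joint_reduction_exists:
  assumes dim: "krull_dim TYPE('a) = enat d" "0 < d" "d \<le> q" and depth: "0 < depth \<mm>"
  shows "\<exists>B. is_joint_reduction scale e q M B \<and> (\<forall>i<q. \<exists>b. is_basis scale b (B i))"
proof -
  obtain x where x: "x \<in> \<mm>" "\<forall>y. x * y = 0 \<longrightarrow> y = 0" using positive_depth_regular_element[OF depth] by blast
  obtain bl N where bl: "\<forall>i<q. count_list (map fst bl) i = rk i" "set (map fst bl) \<subseteq> {..<q}"
    "\<forall>(i, b)\<in>set bl. b \<in> M i" "MP (\<lambda>_. N + 1) \<subseteq> extend_ideal (lin_forms bl) (ideal_mult sym_scale \<mm> \<R>)"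
    using generic_reduction[OF dim x] by (elim exE conjE)
  \<comment> \<open>The chosen elements sorted by index; each index occurs as often as its rank, so
    \<open>vs i\<close> has the length required of generators of \<open>B i\<close>.\<close>
  define vs where "vs i = map snd (filter (\<lambda>p. fst p = i) bl)" for i
  have "count_list (map fst xs) i = length (filter (\<lambda>p. fst p = i) xs)" for i and xs :: "(nat \<times> 'b) list"
    by (induction xs) auto
  then have vs: "length (vs i) = rk i \<and> set (vs i) \<subseteq> M i" if "i < q" for i
    unfolding vs_def using bl(1,3) that by auto
  obtain ws where ws: "\<forall>i<q. length (ws i) = rk i \<and> set (ws i) \<subseteq> M i \<and>
    (\<forall>l<rk i. ws i ! l - vs i ! l \<in> ideal_mult scale \<mm> (M i)) \<and> is_basis scale (ws i) (span (set (ws i)))"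
    using perturbed_family[OF x vs] by (rule exE)
  define B where "B i = span (set (ws i))" for i
  have B: "B i = span (set (ws i)) \<and> length (ws i) = rk i \<and> B i \<subseteq> M i" if "i < q" for i
    unfolding B_def using ws that span_minimal[OF _ subspace_M[OF that], of "set (ws i)"] by simp
  let ?P = "MP (\<lambda>_. N + 1)" and ?Z = "ideal_mult sym_scale \<mm> (MP (\<lambda>_. N + 1))"
  let ?S = "{y + u | y u. y \<in> ?Z \<and> u \<in> joint_span B N}"
  note sZ = sym_module.subspace_ideal_mult[of \<mm> ?P]
  have sU: "module.subspace sym_scale (joint_span B N)" unfolding joint_span_def by (rule sym_module.subspace_span)
  have sS: "module.subspace sym_scale ?S" by (rule sym_module.subspace_sum_set[OF sZ sU])
  \<comment> \<open>The form of \<open>b\<close> differs from that of the corrected vector by the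
    form of an element of \<open>\<mm> M i\<close>, whose multiples lie in \<open>\<mm>\<close>
    times the piece.\<close>
  have gens: "lin_form scale e i b * z \<in> ?S" if ib: "(i, b) \<in> set bl" and z: "z \<in> MP ((\<lambda>_. N + 1)(i := N))" for i b z
  proof -
    have i: "i < q" using bl(2) ib by force
    interpret fm: free_module scale "e i" "F i" by (rule free[OF i])
    have "b \<in> set (vs i)" unfolding vs_def using ib by force
    then obtain l where l: "l < rk i" "vs i ! l = b" using vs[OF i] unfolding in_set_conv_nth by auto
    let ?w = "ws i ! l"
    have w: "?w \<in> B i" unfolding B_def by (rule span_base, rule nth_mem) (use ws i l(1) in simp)
    have wb: "?w - b \<in> ideal_mult scale \<mm> (M i)" using ws i l by blast
    have wF: "?w \<in> F i" "?w - b \<in> F i"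
      using w B[OF i] wb ideal_mult_le_self[OF subspace_M[OF i], of \<mm>] M_le_F[OF i] by blast+
    have "(-1) *s (?w - b) \<in> F i" by (rule subspace_scale[OF fm.subspace_F wF(2)])
    from fm.lin_form_linear(1)[where e = e and i = i, OF refl this wF(1)]
      fm.lin_form_linear(2)[where e = e and i = i and c = "-1", OF refl wF(2)]
    have "lin_form scale e i b = sym_scale (-1) (lin_form scale e i (?w - b)) + lin_form scale e i ?w" by simp
    then have "lin_form scale e i b * z =
        sym_scale (-1) (lin_form scale e i (?w - b) * z) + lin_form scale e i ?w * z"
      by (simp only: distrib_right sym_scale_mult)
    moreover have "sym_scale (-1) (lin_form scale e i (?w - b) * z) \<in> ?Z"
      by (rule sym_module.subspace_scale[OF sZ], rule lin_form_mult_ideal_mult[OF i wb z])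
    moreover have "lin_form scale e i ?w * z \<in> joint_span B N" by (rule joint_span_base) (fact i w z)+
    ultimately show ?thesis by blast
  qed
  \<comment> \<open>The exponent \<open>(N + 1) - 1\<close> is kept in the shape in which
    \<open>hom_part_extend_ideal\<close> produces it.\<close>
  have sub: "sym_span (?Z \<union> {lin_form scale e i b * z | i b z.
      (i, b) \<in> set bl \<and> z \<in> MP ((\<lambda>_. N + 1)(i := (N + 1) - 1))}) \<subseteq> ?S"
  proof (rule sym_module.span_minimal[OF Un_least sS])
    show "?Z \<subseteq> ?S" using sym_module.subspace_0[OF sU] by force
    show "{lin_form scale e i b * z | i b z. (i, b) \<in> set bl \<and> z \<in> MP ((\<lambda>_. N + 1)(i := (N + 1) - 1))} \<subseteq> ?S"
      using gens by auto
  qed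
  obtain T where T: "finite T" "sym_span T = ?P" using multi_power_finitely_generated by blast
  have "sym_span T \<subseteq> joint_span B N"
  proof (rule nakayama_span[OF sym_module.module_axioms T(1) sU])
    fix y assume "y \<in> sym_span T"
    then have y: "y \<in> ?P" using T(2) by simp
    \<comment> \<open>\<open>y\<close> is its own component of this degree, so its membership in the
      extended ideal becomes membership in \<open>?S\<close>.\<close>
    have "hom_part q rk (\<lambda>_. N + 1) y \<in> ?S"
      using hom_part_extend_ideal[OF bl(2,3) subsetD[OF bl(4) y], of "\<lambda>_. N + 1"] sub by (rule rev_subsetD)
    then have "y \<in> ?S" unfolding hom_part_multi_power[OF y] by simp
    then show "\<exists>z\<in>ideal_mult sym_scale \<mm> (sym_span T). \<exists>u\<in>joint_span B N. y = z + u" unfolding T(2) by blast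
  qed
  then have "?P \<subseteq> joint_span B N" using T(2) by simp
  from is_joint_reductionI[OF B this] have "is_joint_reduction scale e q M B" .
  moreover have "\<forall>i<q. \<exists>b. is_basis scale b (B i)" unfolding B_def using ws by blast
  ultimately show ?thesis by blast
qed

end


theorem theorem11:
  fixes scale :: "'a::comm_ring_1 \<Rightarrow> 'b::ab_group_add \<Rightarrow> 'b"
    and \<mm> :: "'a set"
    and d q :: nat
    and r :: "nat \<Rightarrow> nat"
    and e :: "nat \<Rightarrow> 'b list"
    and F M :: "nat \<Rightarrow> 'b set"
  assumes "is_noetherian_local \<mm>"
    and "infinite (residue_classes \<mm>)"
    and "krull_dim TYPE('a) = enat d" and "d > 0"
    and "Modules.module scale"
    and "\<And>i. i < q \<Longrightarrow> is_basis scale (e i) (F i)"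
    and "\<And>i. i < q \<Longrightarrow> length (e i) = r i"
    and "\<And>i. i < q \<Longrightarrow> r i \<ge> 1"
    and "\<And>i. i < q \<Longrightarrow> module.subspace scale (M i)"
    and "\<And>i. i < q \<Longrightarrow> M i \<subseteq> F i"
    and "\<And>i. i < q \<Longrightarrow> colength scale (F i) (M i) < \<infinity>"
  shows
    "(q = d \<longrightarrow> (\<forall>i<q. M i \<subset> F i) \<longrightarrow>
       (\<forall>B. is_joint_reduction scale e q M B \<longrightarrow>
         (\<forall>i<q.
           (\<forall>bs gs. length bs = r i \<longrightarrow> module.span scale (set bs) = B i \<longrightarrow>
              module.span scale (set gs) = M i \<longrightarrow>
              (\<exists>S. det (coord_mat scale (e i) bs) \<in> S \<and>
                 is_min_generating_set (*) (maximal_minors_ideal (coord_mat scale (e i) gs)) S)) \<and>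
           (\<forall>G. is_min_generating_set scale (B i) G \<longrightarrow>
              (\<exists>H. G \<subseteq> H \<and> is_min_generating_set scale (M i) H)))))
     \<and>
     (q \<ge> d \<longrightarrow> 0 < depth \<mm> \<longrightarrow>
       (\<exists>B. is_joint_reduction scale e q M B \<and>
         (\<forall>i<q. \<exists>b. is_basis scale b (B i))))"
proof -
  interpret noetherian_local_inf \<mm>
    using assms(1,2) by unfold_locales
  interpret Modules.module scale by (rule assms(5))
  interpret finite_colength_family_inf \<mm> scale q e F M
    by unfold_locales (use assms(6-11) in simp_all)
  have a: "(\<exists>S. det (coord_mat scale (e i) bs) \<in> S \<and>
        is_min_generating_set (*) (maximal_minors_ideal (coord_mat scale (e i) gs)) S)"
    if "q = d" "\<forall>i<q. M i \<subset> F i" "is_joint_reduction scale e q M B" "i < q"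
      "length bs = r i" "span (set bs) = B i" "span (set gs) = M i" for B i bs gs
    by (rule joint_reduction_det_min_generator[of B]) (use that assms(3,7) in simp_all)
  have b: "\<exists>H. G \<subseteq> H \<and> is_min_generating_set scale (M i) H"
    if "q = d" "\<forall>i<q. M i \<subset> F i" "is_joint_reduction scale e q M B" "i < q"
      "is_min_generating_set scale (B i) G" for B i G
    by (rule joint_reduction_extend_generators[of B]) (use that assms(3) in simp_all)
  show ?thesis
    using a b free_joint_reduction_exists[OF assms(3,4)] by (intro conjI impI allI) simp_all
qed

end
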